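(* For every integer $h$ with $3\le h\leq 8$, let $\widehat{ZZ}_h$ be the completion of the zigzag graph $ZZ_h$ with $h$ loops. Then $\widehat{ZZ}_h$ is semilinearly reducible, and for every prime power $q$ $$c_2(\widehat{ZZ}_h)_q\equiv -h(h+2)\mod q .$$
   Context: Graphs are finite, multiple edges allowed; $N_G$ is the number of edges $e_1,\ldots,e_{N_G}$ of $G$, $\alpha_i$ is a variable attached to $e_i$, and the loop number is $h_G=N_G-|V_G|+1$. Zigzag graphs: $\widehat{ZZ}_h$ is the $4$-regular circulant graph $C^{h+2}_{1,2}$ with vertex set $\mathbb{Z}/(h+2)$ and edges $\{i,i+1\},\{i,i+2\}$; $ZZ_h$ (with $h$ loops) is obtained from it by deleting one vertex together with its $4$ incident edges. In general, the completion of a graph $G$ obtained from a $4$-regular graph $\Gamma$ by deleting a vertex is $\widehat{G}=\Gamma$. The graph polynomial is $\Psi_G=\sum_T\prod_{e_i\notin T}\alpha_i$, the sum over spanning trees $T$ of $G$. Equivalently $\Psi_G=\det M_G$, with $M_G=\begin{pmatrix}\Delta(\alpha)&\mathcal{E}_G\\-\mathcal{E}_G^{T}&0\end{pmatrix}$, $\Delta(\alpha)=\mathrm{diag}(\alpha_1,\ldots,\alpha_{N_G})$ and $\mathcal{E}_G$ the oriented edge-vertex incidence matrix with the last column deleted; the first $N_G$ rows and columns are indexed by edges. For sets of edges $I,J,K$ with $|I|=|J|$, $K\cap(I\cup J)=\emptyset$, the Dodgson polynomial $\Psi^{I,J}_{K}=\Psi^{I,J}_{G,K}$ is the determinant (up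 to sign) of the matrix obtained from $M_G$ by removing rows $I$ and columns $J$ and putting $\alpha_t=0$ for $t\in K$. Sets of edges are written as strings of indices. $[f]_q$ denotes the number of zeros over $\mathbb{F}_q$ of $f$. For $G$ with at least $3$ vertices, $[\Psi_G]_q$ (counted in $\mathbb{A}^{N_G}$) is divisible by $q^2$ and $c_2(G)_q:=[\Psi_G]_q/q^2\bmod q$. For homogeneous polynomials $f,g$ with integer coefficients, $\deg_{tot}(f,g)$ is the total degree (sum of the degrees), $N(f,g)$ the total number of variables they depend on, and $\delta(f,g)=\deg_{tot}(f,g)-N(f,g)$; similarly $\deg_{tot}f$, $N(f)$, $\delta(f)=\deg_{tot} f-N(f)$ for a single polynomial. For $f$ linear in a variable $x_1$, write $f=f^1x_1+f_1$ with $f^1,f_1$ independent of $x_1$. The set $SLR$ of semilinearly reducible homogeneous polynomials and unordered pairs of homogeneous polynomials is defined inductively by: (1) a linear polynomial $f$ with $N(f)=1$ is in $SLR$; (2) a polynomial $f$ with $\delta(f)<0$ is in $SLR$; (3) a pair $(f,g)$ with $\delta(f,g)<0$ is in $SLR$; (4) a pair $(f,mx_1)$ with $m\in\mathbb{Z}$ and $N(f)\ge1$ is in $SLR$ if $mf_1$ is in $SLR$; (5) a polynomial $f$ with $\delta(f)\ge0$ is in $SLR$ if there is a variable $x_1$ such that $f$ is linear in $x_1$ and $f^1$ is in $SLR$; (6) a polynomial $h$ with $\delta(h)\ge0$ is in $SLR$ if there is a factorization $h=f^2g$ with $\deg_{tot} f\ge1$ and $fg\in SLR$; (7) a pair $(f,g)$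 with $\delta(f,g)\ge0$ and $N(f),N(g)>1$ is in $SLR$ if there is a variable $x_1$ such that $f$ and $g$ are both linear in $x_1$, $(f^1,g^1)\in SLR$ and $f^1g_1-f_1g^1\in SLR$; (8) a polynomial $h$ is in $SLR$ if there is a factorization $h=fg$ such that $f\in SLR$, $g\in SLR$ and $(f,g)\in SLR$. A graph $G$ is semilinearly reducible if at least one of the following holds: (a) $G$ has a $3$-valent vertex, say incident to $e_1,e_2,e_3$, such that the pair $(\Psi^{1,2}_3,\Psi^{13,23})$ is in $SLR$; (b) $G$ has a $4$-valent vertex, say incident to $e_1,\ldots,e_4$, such that the pair $(\Psi^{13,24},\Psi^{14,23})$ and the four pairs $(\Psi^{it,jt}_{k},\Psi^{ikt,jkt})$, for $(i,j,k,t)$ the cyclic permutations of $(1,2,3,4)$, are all in $SLR$. *)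

theory Defs
  imports
    "HOL-Library.Poly_Mapping"
    "HOL-Library.Uprod"
    "HOL-Library.Extended_Real"
    "HOL-Library.FuncSet"
    "HOL-Library.Cardinality"
    "HOL-Number_Theory.Cong"
    "Jordan_Normal_Form.Determinant"
    "Jordan_Normal_Form.DL_Submatrix"
begin

section \<open>Multivariate polynomials with integer coefficients\<close>

type_synonym int_mpoly = "(nat \<Rightarrow>\<^sub>0 nat) \<Rightarrow>\<^sub>0 int"

definition Var :: "nat \<Rightarrow> int_mpoly" where
  "Var x = Poly_Mapping.single (Poly_Mapping.single x 1) 1"

definition vars :: "int_mpoly \<Rightarrow> nat set" where
  "vars p = (\<Union>m\<in>Poly_Mapping.keys p. Poly_Mapping.keys m)"

definition mon_deg :: "(nat \<Rightarrow>\<^sub>0 nat) \<Rightarrow> nat" where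
  "mon_deg m = (\<Sum>i\<in>Poly_Mapping.keys m. Poly_Mapping.lookup m i)"

text \<open>
  The zero polynomial has degree \<open>-\<infinity>\<close>, so below \<open>0\<close> and every pair containing it
  have negative \<open>delta\<close>. Vanishing resultants do occur for the completed zigzag graphs.
\<close>

definition tdeg :: "int_mpoly \<Rightarrow> ereal" where
  "tdeg p = (if p = 0 then -\<infinity> else ereal (real (Max (mon_deg ` Poly_Mapping.keys p))))"

definition homogeneous :: "int_mpoly \<Rightarrow> bool" where
  "homogeneous p \<longleftrightarrow> (\<exists>d. \<forall>m\<in>Poly_Mapping.keys p. mon_deg m = d)"

definition eval_mpoly :: "(nat \<Rightarrow> 'a::comm_ring_1) \<Rightarrow> int_mpoly \<Rightarrow> 'a" where
  "eval_mpoly x p =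
     (\<Sum>m\<in>Poly_Mapping.keys p. of_int (Poly_Mapping.lookup p m) *
        (\<Prod>i\<in>Poly_Mapping.keys m. x i ^ Poly_Mapping.lookup m i))"

definition num_zeros :: "'F::{field,finite} itself \<Rightarrow> nat \<Rightarrow> int_mpoly \<Rightarrow> nat" where
  "num_zeros _ N p = card {x \<in> {..<N} \<rightarrow>\<^sub>E (UNIV :: 'F set). eval_mpoly x p = 0}"

section \<open>Multigraphs, graph polynomial and \<open>c\<^sub>2\<close>-invariant\<close>

text \<open>
  The vertices are \<open>0, \<dots>, nverts - 1\<close>, and the edges are numbered from \<open>0\<close>.
  Graphs are undirected: the order of the two ends of an edge is only an arbitrary orientation,
  used for the signs in the incidence matrix.
\<close>

record multigraph =
  nverts :: nat
  edges :: "(nat \<times> nat) list"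

abbreviation nedges :: "multigraph \<Rightarrow> nat" where
  "nedges G \<equiv> length (edges G)"

definition adj :: "multigraph \<Rightarrow> nat set \<Rightarrow> (nat \<times> nat) set" where
  "adj G T = {(u, v). \<exists>i\<in>T. edges G ! i = (u, v) \<or> edges G ! i = (v, u)}"

text \<open>
  Acyclicity of \<open>T\<close> says that no edge of \<open>T\<close> closes a cycle with other edges of \<open>T\<close>;
  this covers self-loops and multiple edges.
\<close>

definition spanning_tree :: "multigraph \<Rightarrow> nat set \<Rightarrow> bool" where
  "spanning_tree G T \<longleftrightarrow>
     T \<subseteq> {..<nedges G} \<and>
     (\<forall>u<nverts G. \<forall>v<nverts G. (u, v) \<in> (adj G T)\<^sup>*) \<and>
     (\<forall>i\<in>T. edges G ! i \<notin> (adj G (T - {i}))\<^sup>*)"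

definition graph_poly :: "multigraph \<Rightarrow> int_mpoly" where
  "graph_poly G = (\<Sum>T | spanning_tree G T. \<Prod>i\<in>{..<nedges G} - T. Var i)"

text \<open>
  For graphs with at least three vertices the number of zeros is divisible by the square of the
  field size, so that the integer division below is exact.
\<close>

definition c2 :: "'F::{field,finite} itself \<Rightarrow> multigraph \<Rightarrow> nat" where
  "c2 F G = (num_zeros F (nedges G) (graph_poly G) div CARD('F) ^ 2) mod CARD('F)"

section \<open>Dodgson polynomials\<close>

definition incidence_mat :: "multigraph \<Rightarrow> int_mpoly mat" where
  "incidence_mat G = mat (nedges G) (nverts G - 1)
     (\<lambda>(i, v). of_bool (fst (edges G ! i) = v) - of_bool (snd (edges G ! i) = v))"

definition graph_mat :: "multigraph \<Rightarrow> nat set \<Rightarrow> int_mpoly mat" where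
  "graph_mat G K = four_block_mat
     (mat (nedges G) (nedges G) (\<lambda>(i, j). if i = j \<and> i \<notin> K then Var i else 0))
     (incidence_mat G)
     (- transpose_mat (incidence_mat G))
     (0\<^sub>m (nverts G - 1) (nverts G - 1))"

text \<open>
  \<open>submatrix A R C\<close> keeps the rows in \<open>R\<close> and the columns in \<open>C\<close>. Dodgson polynomials are
  defined up to sign; here the sign is the one obtained from the given numbering and orientation.
\<close>

definition dodgson :: "multigraph \<Rightarrow> nat set \<Rightarrow> nat set \<Rightarrow> nat set \<Rightarrow> int_mpoly" where
  "dodgson G I J K = det (submatrix (graph_mat G K) (- I) (- J))"

section \<open>Semilinear reducibility\<close>

definition delta :: "int_mpoly \<Rightarrow> ereal" where
  "delta f = tdeg f - ereal (real (card (vars f)))"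

definition delta_pair :: "int_mpoly \<Rightarrow> int_mpoly \<Rightarrow> ereal" where
  "delta_pair f g = tdeg f + tdeg g - ereal (real (card (vars f \<union> vars g)))"

text \<open>
  \<open>linear_split x f f1 f0\<close>: the polynomial \<open>f\<close> is linear in the variable \<open>x\<close> (of degree
  exactly one), with coefficients \<open>f1\<close> and \<open>f0\<close>. Degree zero must be excluded: otherwise
  \<open>f1 = 0\<close>, which has \<open>delta 0 < 0\<close>, would make every homogeneous polynomial reducible.
\<close>

definition linear_split :: "nat \<Rightarrow> int_mpoly \<Rightarrow> int_mpoly \<Rightarrow> int_mpoly \<Rightarrow> bool" where
  "linear_split x f f1 f0 \<longleftrightarrow>
     f = f1 * Var x + f0 \<and> x \<notin> vars f1 \<and> x \<notin> vars f0 \<and> f1 \<noteq> 0"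

text \<open>
  In rule \<open>pair_var\<close> the polynomial \<open>f\<close> need not be linear in \<open>x\<close>; \<open>f0\<close> is \<open>f\<close> at \<open>x = 0\<close>.
\<close>

inductive slr :: "int_mpoly \<Rightarrow> bool" and slr_pair :: "int_mpoly uprod \<Rightarrow> bool" where
  single_var: "\<lbrakk>homogeneous f; tdeg f = 1; card (vars f) = 1\<rbrakk> \<Longrightarrow> slr f"
| delta_neg: "\<lbrakk>homogeneous f; delta f < 0\<rbrakk> \<Longrightarrow> slr f"
| pair_delta_neg:
    "\<lbrakk>homogeneous f; homogeneous g; delta_pair f g < 0\<rbrakk> \<Longrightarrow> slr_pair (Upair f g)"
| pair_var:
    "\<lbrakk>homogeneous f; card (vars f) \<ge> 1; f = g * Var x + f0; x \<notin> vars f0;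
      slr (of_int m * f0)\<rbrakk>
     \<Longrightarrow> slr_pair (Upair f (of_int m * Var x))"
| linear:
    "\<lbrakk>homogeneous f; delta f \<ge> 0; linear_split x f f1 f0; slr f1\<rbrakk> \<Longrightarrow> slr f"
| square_factor:
    "\<lbrakk>homogeneous h; delta h \<ge> 0; h = f\<^sup>2 * g; tdeg f \<ge> 1; slr (f * g)\<rbrakk> \<Longrightarrow> slr h"
| pair_linear:
    "\<lbrakk>homogeneous f; homogeneous g; delta_pair f g \<ge> 0; card (vars f) > 1; card (vars g) > 1;
      linear_split x f f1 f0; linear_split x g g1 g0;
      slr_pair (Upair f1 g1); slr (f1 * g0 - f0 * g1)\<rbrakk>
     \<Longrightarrow> slr_pair (Upair f g)"
| factor:
    "\<lbrakk>homogeneous h; h = f * g; slr f; slr g; slr_pair (Upair f g)\<rbrakk> \<Longrightarrow> slr h"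

definition incident_edges :: "multigraph \<Rightarrow> nat \<Rightarrow> nat set" where
  "incident_edges G v = {i. i < nedges G \<and> (fst (edges G ! i) = v \<or> snd (edges G ! i) = v)}"

definition valency :: "multigraph \<Rightarrow> nat \<Rightarrow> nat" where
  "valency G v = card {i. i < nedges G \<and> fst (edges G ! i) = v} +
                 card {i. i < nedges G \<and> snd (edges G ! i) = v}"

definition semilinearly_reducible :: "multigraph \<Rightarrow> bool" where
  "semilinearly_reducible G \<longleftrightarrow>
     (\<exists>v<nverts G. \<exists>a b c.
        valency G v = 3 \<and> distinct [a, b, c] \<and> incident_edges G v = {a, b, c} \<and>
        slr_pair (Upair (dodgson G {a} {b} {c}) (dodgson G {a, c} {b, c} {}))) \<or>
     (\<exists>v<nverts G. \<exists>a b c d.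
        valency G v = 4 \<and> distinct [a, b, c, d] \<and> incident_edges G v = {a, b, c, d} \<and>
        slr_pair (Upair (dodgson G {a, c} {b, d} {}) (dodgson G {a, d} {b, c} {})) \<and>
        (\<forall>(i, j, k, t) \<in> {(a, b, c, d), (b, c, d, a), (c, d, a, b), (d, a, b, c)}.
           slr_pair (Upair (dodgson G {i, t} {j, t} {k}) (dodgson G {i, k, t} {j, k, t} {}))))"

section \<open>Completed zigzag graphs\<close>

text \<open>
  The circulant graph on \<open>\<int>/(h + 2)\<close> with steps \<open>1\<close> and \<open>2\<close>. It is a simple \<open>4\<close>-regular graph
  for \<open>h \<ge> 3\<close>, and the zigzag graph with \<open>h\<close> loops arises by deleting any of its vertices.
\<close>

definition completed_zigzag :: "nat \<Rightarrow> multigraph" where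
  "completed_zigzag h = \<lparr>nverts = h + 2,
     edges = [(i, (i + 1) mod (h + 2)). i \<leftarrow> [0..<h + 2]] @
             [(i, (i + 2) mod (h + 2)). i \<leftarrow> [0..<h + 2]]\<rparr>"

end

theory Submission
  imports Defs "HOL-Combinatorics.List_Permutation"
begin

text \<open>
  Deleting a vertex \<open>v\<close> of the circulant graph leaves a strip of triangles whose two ends are joined by
  one more edge. All Dodgson polynomials of the four edges at \<open>v\<close> are minors of this network, and
  removing triangles from one end gives linear recursions for the minors of the strip. The
  resultants of two minors factor into minors again, by the quadratic (Dodgson) relations between
  them. This gives the chain of semilinear eliminations, for strips of any length.

  For the point count, the sum over the four edges at \<open>v\<close> is evaluated pointwise modulo \<open>q\<^sup>3\<close>: it
  only depends on which minors of the network vanish. What remains are numbers of common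
  zeros of pairs of minors modulo \<open>q\<close>; the same resultants turn them into recursions in the number
  \<open>k = h - 1\<close> of triangles, which add up to \<open>- (k + 1) (k + 3)\<close>.
\<close>

section \<open>Multivariate integer polynomials\<close>

text \<open>The deleted vertex is \<open>h + 1\<close> because its column is the one omitted from
  the incidence matrix: the rows of its four edges shrink to signed unit vectors at
  \<open>0\<close>, \<open>1\<close>, \<open>h - 1\<close>, \<open>h\<close>, so that every Dodgson
  polynomial of the star is a bordered determinant of one and the same network. Reduction works for
  all lengths by a balance of degrees. A strip of \<open>k\<close> triangles has
  \<open>2 * k + 1\<close> variables, while \<open>pP\<close> has degree \<open>k\<close> and the
  first-order minors have degree \<open>k + 1\<close>. One more variable in a pair of these makes
  \<open>delta_pair\<close> negative, so an elimination either stops or leads back to a shorter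
  strip. Products arising as resultants have to be carried along, each with the pair of its factors.
  In the count the obstacle is the locus where \<open>pP\<close> vanishes, since ratios of minors
  make no sense there; hence minors of all orders are kept, with quadratic relations that hold
  everywhere. As \<open>c2\<close> divides by the square of \<open>q\<close>, the sum over the star
  has a term of order \<open>q\<close> that must be controlled separately modulo the square of
  \<open>q\<close>.\<close>

definition hom :: "nat \<Rightarrow> int_mpoly \<Rightarrow> bool" where
  "hom d p \<longleftrightarrow> (\<forall>m\<in>Poly_Mapping.keys p. mon_deg m = d)"

lemma mon_deg_superset:
  assumes "finite A" "Poly_Mapping.keys m \<subseteq> A"
  shows "mon_deg m = (\<Sum>i\<in>A. Poly_Mapping.lookup m i)"
  unfolding mon_deg_def using assms
  by (intro sum.mono_neutral_left) (auto simp: in_keys_iff)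

lemma mon_deg_add: "mon_deg (m + m') = mon_deg m + mon_deg m'"
proof -
  let ?A = "Poly_Mapping.keys m \<union> Poly_Mapping.keys m'"
  have "Poly_Mapping.keys (m + m') \<subseteq> ?A" by (rule keys_add)
  then show ?thesis
    by (simp add: mon_deg_superset[of ?A] lookup_add sum.distrib)
qed

lemma mon_deg_0 [simp]: "mon_deg 0 = 0"
  by (simp add: mon_deg_def)

lemma mon_deg_single [simp]: "mon_deg (Poly_Mapping.single x n) = n"
  by (simp add: mon_deg_def)

lemma hom_0 [simp]: "hom d 0"
  by (simp add: hom_def)

lemma hom_add: "hom d p \<Longrightarrow> hom d q \<Longrightarrow> hom d (p + q)"
  unfolding hom_def using keys_add[of p q] by blast

lemma hom_uminus [simp]: "hom d (- p) \<longleftrightarrow> hom d p"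
  by (simp add: hom_def)

lemma hom_diff: "hom d p \<Longrightarrow> hom d q \<Longrightarrow> hom d (p - q)"
  using hom_add[of d p "- q"] by simp

lemma hom_mult: "hom d p \<Longrightarrow> hom e q \<Longrightarrow> hom (d + e) (p * q)"
  unfolding hom_def
proof
  fix m
  assume *: "\<forall>m\<in>Poly_Mapping.keys p. mon_deg m = d" "\<forall>m\<in>Poly_Mapping.keys q. mon_deg m = e"
    and "m \<in> Poly_Mapping.keys (p * q)"
  then obtain a b where "m = a + b" "a \<in> Poly_Mapping.keys p" "b \<in> Poly_Mapping.keys q"
    using keys_mult[of p q] by blast
  with * show "mon_deg m = d + e" by (simp add: mon_deg_add)
qed

lemma hom_Var [simp]: "hom (Suc 0) (Var x)"
  by (simp add: hom_def Var_def)

lemma hom_1 [simp]: "hom 0 1"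
  by (simp add: hom_def)

lemma hom_homogeneous: "hom d p \<Longrightarrow> homogeneous p"
  unfolding hom_def homogeneous_def by blast

lemma hom_tdeg: "hom d p \<Longrightarrow> p \<noteq> 0 \<Longrightarrow> tdeg p = ereal (real d)"
proof -
  assume a: "hom d p" "p \<noteq> 0"
  then have "Poly_Mapping.keys p \<noteq> {}" by simp
  moreover have "mon_deg ` Poly_Mapping.keys p = (\<lambda>_. d) ` Poly_Mapping.keys p"
    using a(1) by (intro image_cong) (auto simp: hom_def)
  ultimately have "mon_deg ` Poly_Mapping.keys p = {d}"
    by (simp add: image_constant_conv)
  with a show ?thesis by (simp add: tdeg_def)
qed

text \<open>An inequality, because zero is homogeneous of every degree in the sense of
  \<open>hom\<close> but has degree minus infinity. Vanishing coefficients and resultants then need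
  no case of their own.\<close>

lemma hom_tdeg_le: "hom d p \<Longrightarrow> tdeg p \<le> ereal (real d)"
  using hom_tdeg[of d p] by (cases "p = 0") (auto simp: tdeg_def)

lemma finite_vars [simp]: "finite (vars p)"
  by (simp add: vars_def)

lemma vars_0 [simp]: "vars 0 = {}" and vars_1 [simp]: "vars 1 = {}"
  by (simp_all add: vars_def)

lemma vars_Var [simp]: "vars (Var x) = {x}"
  by (simp add: vars_def Var_def)

lemma vars_uminus [simp]: "vars (- p) = vars p"
  by (simp add: vars_def)

lemma vars_add: "vars (p + q) \<subseteq> vars p \<union> vars q"
  unfolding vars_def using keys_add[of p q] by blast

lemma vars_diff: "vars (p - q) \<subseteq> vars p \<union> vars q"
  using vars_add[of p "- q"] by simp

lemma vars_mult: "vars (p * q) \<subseteq> vars p \<union> vars q"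
proof
  fix x assume "x \<in> vars (p * q)"
  then obtain m where m: "m \<in> Poly_Mapping.keys (p * q)" "x \<in> Poly_Mapping.keys m"
    by (auto simp: vars_def)
  then obtain a b where "m = a + b" "a \<in> Poly_Mapping.keys p" "b \<in> Poly_Mapping.keys q"
    using keys_mult[of p q] by blast
  with m(2) keys_add[of a b] show "x \<in> vars p \<union> vars q"
    by (auto simp: vars_def)
qed

lemma notin_vars_add: "x \<notin> vars p \<Longrightarrow> x \<notin> vars q \<Longrightarrow> x \<notin> vars (p + q)"
  and notin_vars_diff: "x \<notin> vars p \<Longrightarrow> x \<notin> vars q \<Longrightarrow> x \<notin> vars (p - q)"
  and notin_vars_mult: "x \<notin> vars p \<Longrightarrow> x \<notin> vars q \<Longrightarrow> x \<notin> vars (p * q)"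
  using vars_add[of p q] vars_diff[of p q] vars_mult[of p q] by blast+

lemma notin_vars_power: "x \<notin> vars p \<Longrightarrow> x \<notin> vars (p ^ n)"
  by (induction n) (auto dest: vars_mult[THEN subsetD])

lemmas notin_vars = notin_vars_add notin_vars_diff notin_vars_mult notin_vars_power

lemma hom_Suc_vars:
  assumes "hom (Suc d) p" "p \<noteq> 0"
  shows "vars p \<noteq> {}"
proof -
  from assms(2) obtain m where m: "m \<in> Poly_Mapping.keys p"
    by (metis keys_eq_empty ex_in_conv)
  with assms(1) have "mon_deg m = Suc d" by (simp add: hom_def)
  then have "Poly_Mapping.keys m \<noteq> {}" by (auto simp: mon_deg_def)
  with m show ?thesis by (auto simp: vars_def)
qed

section \<open>Splitting off a variable\<close>

lemma lookup_mult_Var: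
  "Poly_Mapping.lookup (p * Var x) (m + Poly_Mapping.single x 1) = Poly_Mapping.lookup p m"
proof -
  let ?k = "Poly_Mapping.single x 1 :: nat \<Rightarrow>\<^sub>0 nat"
  have "(Poly_Mapping.lookup (Var x) q when m + ?k = a + q) = ((1 when a = m) when q = ?k)"
    for a q by (auto simp: when_def lookup_single Var_def)
  then have "(\<Sum>q. Poly_Mapping.lookup (Var x) q when m + ?k = a + q) = (1 when a = m)" for a
    by simp
  then have "Poly_Mapping.lookup (p * Var x) (m + ?k) = (\<Sum>a. Poly_Mapping.lookup p a when a = m)"
    unfolding lookup_mult by (simp add: mult_when)
  then show ?thesis by simp
qed

lemma lookup_mult_Var_0:
  assumes "Poly_Mapping.lookup m x = 0"
  shows "Poly_Mapping.lookup (p * Var x) m = 0"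
proof (rule ccontr)
  assume "\<not> ?thesis"
  then have "m \<in> Poly_Mapping.keys (p * Var x)" by (simp add: in_keys_iff)
  then obtain a where "m = a + Poly_Mapping.single x 1"
    using keys_mult[of p "Var x"] by (auto simp: Var_def)
  with assms show False by (simp add: lookup_add)
qed

lemma lookup_notin_vars:
  "x \<notin> vars p \<Longrightarrow> Poly_Mapping.lookup m x \<noteq> 0 \<Longrightarrow> Poly_Mapping.lookup p m = 0"
  by (metis UN_iff in_keys_iff vars_def)

text \<open>No cancellation can occur: monomials of \<open>f1 * Var x\<close> contain
  \<open>x\<close> exactly once, those of \<open>f0\<close> not at all. The same reason gives
  \<open>split_eq_0\<close> and \<open>hom_split\<close>, the tools for all nonvanishing claims
  below.\<close>

lemma vars_split:
  assumes "x \<notin> vars f1" "x \<notin> vars f0"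
  shows "vars (f1 * Var x + f0) = (if f1 = 0 then {} else {x}) \<union> vars f1 \<union> vars f0"
proof -
  let ?f = "f1 * Var x + f0"
  have 1: "Poly_Mapping.lookup ?f (m + Poly_Mapping.single x 1) = Poly_Mapping.lookup f1 m" for m
    using lookup_notin_vars[OF assms(2), of "m + Poly_Mapping.single x 1"]
    by (simp add: lookup_add lookup_mult_Var[unfolded One_nat_def])
  have 0: "Poly_Mapping.lookup ?f m = Poly_Mapping.lookup f0 m" if "Poly_Mapping.lookup m x = 0" for m
    using lookup_mult_Var_0[OF that] by (simp add: lookup_add)
  have "vars f0 \<subseteq> vars ?f"
  proof
    fix y assume "y \<in> vars f0"
    then obtain m where m: "m \<in> Poly_Mapping.keys f0" "y \<in> Poly_Mapping.keys m"
      by (auto simp: vars_def)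
    with assms(2) have "Poly_Mapping.lookup m x = 0"
      by (metis UN_iff in_keys_iff vars_def)
    with 0 m have "m \<in> Poly_Mapping.keys ?f" by (simp add: in_keys_iff)
    with m show "y \<in> vars ?f" by (auto simp: vars_def)
  qed
  moreover have "insert x (vars f1) \<subseteq> vars ?f" if nz: "f1 \<noteq> 0"
  proof
    fix y assume y: "y \<in> insert x (vars f1)"
    obtain m where m: "m \<in> Poly_Mapping.keys f1" "y = x \<or> y \<in> Poly_Mapping.keys m"
      using y nz by (cases "y = x") (auto simp: vars_def dest: ex_in_conv[THEN iffD2] intro: keys_eq_empty[THEN iffD1])
    then have "m + Poly_Mapping.single x 1 \<in> Poly_Mapping.keys ?f"
      by (simp add: in_keys_iff 1[unfolded One_nat_def])
    moreover have "y \<in> Poly_Mapping.keys (m + Poly_Mapping.single x 1)"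
      using m(2) by (auto simp: in_keys_iff lookup_add)
    ultimately show "y \<in> vars ?f" by (auto simp: vars_def)
  qed
  moreover have "vars ?f \<subseteq> {x} \<union> vars f1 \<union> vars f0"
    using vars_add[of "f1 * Var x" f0] vars_mult[of f1 "Var x"] by auto
  ultimately show ?thesis by (cases "f1 = 0") auto
qed

lemma split_eq_0:
  assumes "x \<notin> vars f1" "x \<notin> vars f0"
  shows "f1 * Var x + f0 = 0 \<longleftrightarrow> f1 = 0 \<and> f0 = 0"
  using vars_split[OF assms] by (cases "f1 = 0") auto

lemma hom_split:
  assumes "hom (Suc d) (f1 * Var x + f0)" "x \<notin> vars f1" "x \<notin> vars f0"
  shows "hom d f1"
  unfolding hom_def
proof
  fix m assume m: "m \<in> Poly_Mapping.keys f1"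
  have "Poly_Mapping.lookup (f1 * Var x + f0) (m + Poly_Mapping.single x 1) = Poly_Mapping.lookup f1 m"
    using lookup_notin_vars[OF assms(3), of "m + Poly_Mapping.single x 1"]
    by (simp add: lookup_add lookup_mult_Var[unfolded One_nat_def])
  with m have "m + Poly_Mapping.single x 1 \<in> Poly_Mapping.keys (f1 * Var x + f0)"
    by (simp add: in_keys_iff)
  with assms(1) have "mon_deg (m + Poly_Mapping.single x 1) = Suc d"
    by (simp add: hom_def)
  then show "mon_deg m = d" by (simp add: mon_deg_add)
qed

section \<open>Derived rules for semilinear reducibility\<close>

lemma slr_0: "slr 0"
  by (rule delta_neg) (auto simp: homogeneous_def delta_def tdeg_def)

lemma slr_hom_neg: "hom d f \<Longrightarrow> d < card (vars f) \<Longrightarrow> slr f"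
  using hom_tdeg[of d f]
  by (intro delta_neg) (auto simp: hom_homogeneous delta_def tdeg_def)

text \<open>The degrees are upper bounds and \<open>V\<close> is a lower bound for the variables, so
  neither \<open>tdeg\<close> nor \<open>vars\<close> of a minor has to be computed exactly.\<close>

lemma slr_pair_neg:
  assumes "hom d f" "hom e g" "V \<subseteq> vars f \<union> vars g" "d + e < card V"
  shows "slr_pair (Upair f g)"
proof (rule pair_delta_neg)
  show "homogeneous f" "homogeneous g" using assms hom_homogeneous by auto
  have "card V \<le> card (vars f \<union> vars g)" using assms(3) by (intro card_mono) auto
  with assms(4) have "d + e < card (vars f \<union> vars g)" by linarith
  then have "ereal (real d) + ereal (real e) < ereal (real (card (vars f \<union> vars g)))"
    by simp
  moreover have "tdeg f + tdeg g \<le> ereal (real d) + ereal (real e)"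
    using assms(1,2) by (intro add_mono hom_tdeg_le)
  ultimately have "tdeg f + tdeg g < ereal (real (card (vars f \<union> vars g)))" by order
  then show "delta_pair f g < 0"
    unfolding delta_pair_def tdeg_def by auto
qed

lemma Var_neq_0 [simp]: "Var x \<noteq> 0"
  using vars_Var[of x] by (metis insert_not_empty vars_0)

lemma slr_Var: "slr (Var x)"
  by (rule single_var) (use hom_homogeneous[OF hom_Var] hom_tdeg[OF hom_Var] in auto)

lemma slr_pair_sym: "slr_pair (Upair f g) \<Longrightarrow> slr_pair (Upair g f)"
  by (metis Upair_inject)

lemma slr_linear:
  assumes "hom d h" "h = f1 * Var x + f0" "x \<notin> vars f1" "x \<notin> vars f0" "f1 \<noteq> 0" "slr f1"
  shows "slr h"
proof (cases "delta h < 0")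
  case True
  then show ?thesis using assms(1) by (intro delta_neg hom_homogeneous)
next
  case False
  then show ?thesis
    using assms by (intro linear[of h x f1 f0]) (auto simp: hom_homogeneous linear_split_def)
qed

lemma slr_square:
  assumes "hom d h" "h = f\<^sup>2 * g" "hom (Suc e) f" "slr (f * g)"
  shows "slr h"
proof (cases "delta h < 0 \<or> f = 0")
  case True
  then show ?thesis using assms(1,2) slr_0 by (auto intro: delta_neg hom_homogeneous)
next
  case False
  then show ?thesis
    using assms by (intro square_factor[of h f g]) (auto simp: hom_homogeneous hom_tdeg)
qed

lemma slr_factor:
  assumes "hom d h" "h = f * g" "slr f" "slr g" "slr_pair (Upair f g)"
  shows "slr h"
  using assms hom_homogeneous factor by blast

lemma slr_pair_linear:
  assumes "hom d f" "hom e g"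
    and f: "f = f1 * Var x + f0" "x \<notin> vars f1" "x \<notin> vars f0" "f1 \<noteq> 0" "vars f1 \<union> vars f0 \<noteq> {}"
    and g: "g = g1 * Var x + g0" "x \<notin> vars g1" "x \<notin> vars g0" "g1 \<noteq> 0" "vars g1 \<union> vars g0 \<noteq> {}"
    and "slr_pair (Upair f1 g1)" "slr (f1 * g0 - f0 * g1)"
  shows "slr_pair (Upair f g)"
proof (cases "delta_pair f g < 0")
  case True
  then show ?thesis using assms by (intro pair_delta_neg) (auto simp: hom_homogeneous)
next
  case False
  have card: "card (vars (p1 * Var x + p0)) > 1"
    if a: "x \<notin> vars p1" "x \<notin> vars p0" "p1 \<noteq> 0" "vars p1 \<union> vars p0 \<noteq> {}" for p1 p0
  proof -
    obtain y where "y \<in> vars p1 \<union> vars p0" using a(4) by blast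
    then have "{x, y} \<subseteq> vars (p1 * Var x + p0)" "x \<noteq> y"
      using a by (auto simp: vars_split)
    then show ?thesis using card_mono[of "vars (p1 * Var x + p0)" "{x, y}"] by simp
  qed
  show ?thesis
    using assms False card[of f1 f0] card[of g1 g0]
    by (intro pair_linear[of f g x f1 f0 g1 g0]) (auto simp: hom_homogeneous linear_split_def)
qed

text \<open>Rule \<open>factor\<close> asks for the pair of the two factors. When one factor is a
  bare variable, rule \<open>pair_var\<close> with \<open>m = 1\<close> replaces that pair by the
  single polynomial obtained at \<open>x = 0\<close>.\<close>

lemma slr_Var_mult:
  assumes "hom d B" "B = B1 * Var x + B0" "x \<notin> vars B1" "x \<notin> vars B0" "vars B \<noteq> {}" "slr B" "slr B0"
  shows "slr (Var x * B)"
proof (rule slr_factor[of "Suc d"])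
  show "hom (Suc d) (Var x * B)" using hom_mult[OF hom_Var assms(1)] by simp
  have "slr_pair (Upair B (of_int 1 * Var x))"
    using assms by (intro pair_var[of B B1 x B0 1]) (auto simp: hom_homogeneous card_gt_0_iff Suc_le_eq)
  then show "slr_pair (Upair (Var x) B)" using slr_pair_sym by simp
qed (use assms slr_Var in auto)

text \<open>Dodgson polynomials are known up to sign only and resultants occur with either sign. The
  induction is over both predicates at once; the pair part quantifies over both orders of the
  components because the pair is unordered.\<close>

lemma slr_uminus_aux:
  "(slr f \<longrightarrow> slr (- f)) \<and> (slr_pair p \<longrightarrow> (\<forall>f g. p = Upair f g \<longrightarrow> slr_pair (Upair (- f) g)))"
proof -
  have hm: "homogeneous (- f) \<longleftrightarrow> homogeneous f" for f
    by (simp add: homogeneous_def)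
  have td: "tdeg (- f) = tdeg f" for f by (simp add: tdeg_def)
  have dl: "delta (- f) = delta f" "delta_pair (- f) g = delta_pair f g" for f g
    by (simp_all add: delta_def delta_pair_def td)
  have ls: "linear_split x (- f) (- f1) (- f0) \<longleftrightarrow> linear_split x f f1 f0" for x f f1 f0
    by (auto simp: linear_split_def algebra_simps neg_eq_iff_add_eq_0)
  have "(slr f \<longrightarrow> slr (- f)) \<and> (slr_pair p \<longrightarrow> (\<forall>f g. p = Upair f g \<longrightarrow> slr_pair (Upair (- f) g)))"
    for f p
  proof (induction rule: slr_slr_pair.induct)
    case (single_var f)
    then show ?case by (intro slr_slr_pair.single_var) (auto simp: hm td)
  next
    case (delta_neg f)
    then show ?case by (intro slr_slr_pair.delta_neg) (auto simp: hm dl)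
  next
    case (pair_delta_neg f g)
    have "slr_pair (Upair (- f) g)" "slr_pair (Upair (- g) f)"
      using pair_delta_neg
      by (auto intro!: slr_slr_pair.pair_delta_neg simp: hm dl) (simp add: delta_pair_def add.commute Un_commute)
    then show ?case by (metis Upair_inject)
  next
    case (pair_var f g x f0 m)
    have "slr_pair (Upair (- f) (of_int m * Var x))"
    proof (rule slr_slr_pair.pair_var[of _ "- g" _ "- f0"])
      show "- f = - g * Var x + - f0" using pair_var.hyps by simp
      show "slr (of_int m * - f0)" using pair_var.IH by simp
    qed (use pair_var.hyps(1,2,4) in \<open>simp_all only: hm vars_uminus, simp_all\<close>)
    \<comment> \<open>The variable itself changes its sign by passing from \<open>m\<close> to
      \<open>- m\<close>.\<close>
    moreover have "slr_pair (Upair f (of_int (- m) * Var x))"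
      using pair_var by (intro slr_slr_pair.pair_var[of _ g _ f0]) auto
    then have "slr_pair (Upair (- (of_int m * Var x)) f)"
      using slr_pair_sym[of f "- (of_int m * Var x)"] by simp
    ultimately have *: "slr_pair (Upair (- f) (of_int m * Var x))"
      "slr_pair (Upair (- (of_int m * Var x)) f)" .
    show ?case
    proof (intro allI impI)
      fix p q assume "Upair f (of_int m * Var x) = Upair p q"
      then consider "p = f" "q = of_int m * Var x" | "p = of_int m * Var x" "q = f"
        by (metis Upair_inject)
      then show "slr_pair (Upair (- p) q)" by cases (simp_all only: *)
    qed
  next
    case (linear f x f1 f0)
    show ?case
      by (rule slr_slr_pair.linear[of "- f" x "- f1" "- f0"])
        (use linear in \<open>simp_all only: hm dl ls\<close>)
  next
    case (square_factor h f g)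
    show ?case
    proof (rule slr_slr_pair.square_factor[of "- h" f "- g"])
      show "- h = f\<^sup>2 * - g" using square_factor.hyps by simp
      show "slr (f * - g)" using square_factor.IH by simp
    qed (use square_factor.hyps(1,2,4) in \<open>simp_all only: hm dl\<close>)
  next
    case (pair_linear f g x f1 f0 g1 g0)
    have "slr_pair (Upair (- f) g)"
    proof (rule slr_slr_pair.pair_linear[of _ _ x "- f1" "- f0" g1 g0])
      show "slr (- f1 * g0 - - f0 * g1)" using pair_linear.IH(2) by (simp add: algebra_simps)
    qed (use pair_linear in \<open>simp_all only: hm dl ls vars_uminus\<close>)
    moreover have "slr_pair (Upair f (- g))"
    proof (rule slr_slr_pair.pair_linear[of _ _ x f1 f0 "- g1" "- g0"])
      show "slr (f1 * - g0 - f0 * - g1)" using pair_linear.IH(2) by (simp add: algebra_simps)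
      have "slr_pair (Upair (- g1) f1)" using pair_linear.IH(1) by (metis Upair_inject)
      then show "slr_pair (Upair f1 (- g1))" by (metis Upair_inject)
      show "delta_pair f (- g) \<ge> 0" using pair_linear.hyps by (simp add: delta_pair_def td)
    qed (use pair_linear in \<open>simp_all only: hm dl ls vars_uminus\<close>)
    ultimately show ?case by (metis Upair_inject)
  next
    case (factor h f g)
    show ?case
    proof (rule slr_slr_pair.factor[of "- h" "- f" g])
      show "- h = - f * g" using factor.hyps(2) by simp
    qed (use factor in \<open>simp_all only: hm\<close>)
  qed
  then show ?thesis by blast
qed

lemma slr_uminus: "slr f \<Longrightarrow> slr (- f)"
  using slr_uminus_aux[of f undefined] by blast

lemma slr_pair_uminus: "slr_pair (Upair f g) \<Longrightarrow> slr_pair (Upair (- f) g)"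
  using slr_uminus_aux[of undefined "Upair f g"] by blast

lemma slr_pair_sign:
  assumes "slr_pair (Upair f g)" "f' = f \<or> f' = - f" "g' = g \<or> g' = - g"
  shows "slr_pair (Upair f' g')"
  using assms slr_pair_uminus slr_pair_sym by metis

section \<open>Triangle strips\<close>

text \<open>
  Minors of a strip of triangles with first vertices \<open>x\<close>, \<open>y\<close> and last vertices \<open>w\<close>, \<open>r\<close>, where \<open>r\<close>
  is the ground vertex. Writing \<open>g s t\<close> for the minor with one more row \<open>s\<close> and column \<open>t\<close>,
  \<open>d1 + dm = g x x\<close>, \<open>dm = g x y\<close>, \<open>d2 + dm = g y y\<close>, \<open>t1 = g x w\<close>, \<open>t2 = g y w\<close>, \<open>om = g w w\<close>;
  \<open>ff\<close>, \<open>ch\<close>, \<open>ps\<close>, \<open>x1\<close>, \<open>x2\<close>, \<open>x3\<close> have two more rows and columns, and \<open>f4\<close> has three.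
\<close>

record 'a net =
  pP :: 'a
  d1 :: 'a
  d2 :: 'a
  dm :: 'a
  ff :: 'a
  t1 :: 'a
  t2 :: 'a
  ch :: 'a
  ps :: 'a
  om :: 'a
  x1 :: 'a
  x2 :: 'a
  x3 :: 'a
  f4 :: 'a

text \<open>A single edge \<open>c\<close> with \<open>x = w\<close> and \<open>y = r\<close>.
  Minors having the grounded vertex as a row or column vanish, as do those in which \<open>x\<close>
  and \<open>w\<close> would be two different rows.\<close>

definition strip_end :: "'a::comm_ring_1 \<Rightarrow> 'a net" where
  "strip_end c = \<lparr>pP = 1, d1 = c, d2 = 0, dm = 0, ff = 0, t1 = c, t2 = 0, ch = 0, ps = 0,
     om = c, x1 = 0, x2 = 0, x3 = 0, f4 = 0\<rparr>"

text \<open>A new first vertex is joined by \<open>a\<close> to the old \<open>x\<close> and by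
  \<open>b\<close> to the old \<open>y\<close>; the old \<open>x\<close> becomes the new
  \<open>y\<close>. In \<open>pP\<close> the factor \<open>a + b\<close> accounts for trees using
  one of the two edges, and \<open>d1 + d2\<close>, which is
  \<open>g x x - 2 * g x y + g y y\<close>, for trees using both. The formulas are justified in
  \<open>net_at_step\<close>.\<close>

definition strip_step :: "'a::comm_ring_1 \<Rightarrow> 'a \<Rightarrow> 'a net \<Rightarrow> 'a net" where
  "strip_step a b N = \<lparr>
     pP = (a + b) * pP N + d1 N + d2 N,
     d1 = a * (b * pP N + d2 N),
     d2 = a * d1 N,
     dm = a * dm N + b * (d1 N + dm N) + ff N,
     ff = a * (b * (d1 N + dm N) + ff N),
     t1 = a * t2 N + b * t1 N + ch N + ps N,
     t2 = (a + b) * t1 N + ch N + ps N,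
     ch = a * (b * t1 N + ps N),
     ps = a * ch N,
     om = (a + b) * om N + x1 N - 2 * x2 N + x3 N,
     x1 = a * b * om N + a * x3 N + b * x1 N + f4 N,
     x2 = a * x2 N + b * x1 N + f4 N,
     x3 = (a + b) * x1 N + f4 N,
     f4 = a * (b * x1 N + f4 N)\<rparr>"

fun strip :: "('a::comm_ring_1 \<times> 'a) list \<Rightarrow> 'a \<Rightarrow> 'a net" where
  "strip [] c = strip_end c"
| "strip ((a, b) # L) c = strip_step a b (strip L c)"

text \<open>Combinations that reproduce each other under a step: \<open>nS\<close> only picks up the
  factor \<open>- a\<close>, the new \<open>nU\<close> is \<open>b * nV + a * nW + nG\<close>, and
  the new \<open>nW\<close> is \<open>b * nV + a * nU + nG\<close>. So a step interchanges
  \<open>nU\<close> and \<open>nW\<close> in the term with \<open>a\<close>.\<close>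

abbreviation nF :: "'a::comm_ring_1 net \<Rightarrow> 'a" where "nF N \<equiv> d1 N + dm N"
abbreviation nS :: "'a::comm_ring_1 net \<Rightarrow> 'a" where "nS N \<equiv> t1 N - t2 N"
abbreviation nU :: "'a::comm_ring_1 net \<Rightarrow> 'a" where "nU N \<equiv> dm N - t1 N"
abbreviation nW :: "'a::comm_ring_1 net \<Rightarrow> 'a" where "nW N \<equiv> dm N - t2 N"
abbreviation nV :: "'a::comm_ring_1 net \<Rightarrow> 'a" where "nV N \<equiv> d1 N + dm N - t1 N"
abbreviation nG :: "'a::comm_ring_1 net \<Rightarrow> 'a" where "nG N \<equiv> ff N - ch N - ps N"

text \<open>These concern the two rows \<open>x, y\<close> and the three columns
  \<open>x, y, w\<close> of \<open>g\<close>: the two-by-two minors with the denominator cleared,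
  and two Cramer relations from a determinant with a repeated row. The Cramer relations are part of
  the induction because the step for \<open>ch\<close> and \<open>ps\<close> uses them.\<close>

definition net_rel :: "'a::comm_ring_1 net \<Rightarrow> bool" where
  "net_rel N \<longleftrightarrow>
     pP N * ff N = d1 N * d2 N + d1 N * dm N + d2 N * dm N \<and>
     pP N * ch N = (d1 N + dm N) * t2 N - dm N * t1 N \<and>
     pP N * ps N = (d2 N + dm N) * t1 N - dm N * t2 N \<and>
     ff N * t1 N = (d1 N + dm N) * (ch N + ps N) - d1 N * ch N \<and>
     ff N * t2 N = dm N * (ch N + ps N) + d2 N * ch N"

lemma net_rel_end: "net_rel (strip_end c)"
  by (simp add: net_rel_def strip_end_def)

text \<open>Each relation for the longer strip is an explicit combination of the old relations with
  coefficients in \<open>a\<close> and \<open>b\<close>; the five certificates are the right-hand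
  sides below.\<close>

lemma net_rel_step:
  fixes N :: "'a::idom net"
  assumes "net_rel N"
  shows "net_rel (strip_step a b N)"
proof -
  obtain P D1 D2 DM F T1 T2 X Y where N: "pP N = P" "d1 N = D1" "d2 N = D2" "dm N = DM" "ff N = F"
    "t1 N = T1" "t2 N = T2" "ch N = X" "ps N = Y" by blast
  have r: "P * F = D1 * D2 + D1 * DM + D2 * DM" "P * X = (D1 + DM) * T2 - DM * T1"
    "P * Y = (D2 + DM) * T1 - DM * T2" "F * T1 = (D1 + DM) * (X + Y) - D1 * X"
    "F * T2 = DM * (X + Y) + D2 * X"
    using assms by (simp_all add: net_rel_def N)
  have g0: "((a + b) * P + D1 + D2) * (a * (b * (D1 + DM) + F)) = ((a * (b * P + D2)) * (a * D1) + (a * (b * P + D2)) * (a * DM + b * (D1 + DM) + F) + (a * D1) * (a * DM + b * (D1 + DM) + F))"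
  proof -
    have "((a + b) * P + D1 + D2) * (a * (b * (D1 + DM) + F)) - ((a * (b * P + D2)) * (a * D1) + (a * (b * P + D2)) * (a * DM + b * (D1 + DM) + F) + (a * D1) * (a * DM + b * (D1 + DM) + F)) = a * a * (P * F - (D1 * D2 + D1 * DM + D2 * DM))"
      by (simp add: algebra_simps)
    also have "\<dots> = 0" by (simp add: r)
    finally show ?thesis by simp
  qed
  have g1: "((a + b) * P + D1 + D2) * (a * (b * T1 + Y)) = (((a * (b * P + D2)) + (a * DM + b * (D1 + DM) + F)) * ((a + b) * T1 + X + Y) - (a * DM + b * (D1 + DM) + F) * (a * T2 + b * T1 + X + Y))"
  proof -
    have "((a + b) * P + D1 + D2) * (a * (b * T1 + Y)) - (((a * (b * P + D2)) + (a * DM + b * (D1 + DM) + F)) * ((a + b) * T1 + X + Y) - (a * DM + b * (D1 + DM) + F) * (a * T2 + b * T1 + X + Y)) = a * a * (P * Y - ((D2 + DM) * T1 - DM * T2)) - a * b * (P * X - ((D1 + DM) * T2 - DM * T1)) - a * (F * T1 - ((D1 + DM) * (X + Y) - D1 * X)) + a * (F * T2 - (DM * (X + Y) + D2 * X))"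
      by (simp add: algebra_simps)
    also have "\<dots> = 0" by (simp add: r)
    finally show ?thesis by simp
  qed
  have g2: "((a + b) * P + D1 + D2) * (a * X) = (((a * D1) + (a * DM + b * (D1 + DM) + F)) * (a * T2 + b * T1 + X + Y) - (a * DM + b * (D1 + DM) + F) * ((a + b) * T1 + X + Y))"
  proof -
    have "((a + b) * P + D1 + D2) * (a * X) - (((a * D1) + (a * DM + b * (D1 + DM) + F)) * (a * T2 + b * T1 + X + Y) - (a * DM + b * (D1 + DM) + F) * ((a + b) * T1 + X + Y)) = (a * a + a * b) * (P * X - ((D1 + DM) * T2 - DM * T1)) + a * (F * T1 - ((D1 + DM) * (X + Y) - D1 * X)) - a * (F * T2 - (DM * (X + Y) + D2 * X))"
      by (simp add: algebra_simps)
    also have "\<dots> = 0" by (simp add: r)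
    finally show ?thesis by simp
  qed
  have g3: "(a * (b * (D1 + DM) + F)) * (a * T2 + b * T1 + X + Y) = (((a * (b * P + D2)) + (a * DM + b * (D1 + DM) + F)) * ((a * (b * T1 + Y)) + (a * X)) - (a * (b * P + D2)) * (a * (b * T1 + Y)))"
  proof -
    have "(a * (b * (D1 + DM) + F)) * (a * T2 + b * T1 + X + Y) - (((a * (b * P + D2)) + (a * DM + b * (D1 + DM) + F)) * ((a * (b * T1 + Y)) + (a * X)) - (a * (b * P + D2)) * (a * (b * T1 + Y))) = a * a * (F * T2 - (DM * (X + Y) + D2 * X)) - a * a * b * (P * X - ((D1 + DM) * T2 - DM * T1))"
      by (simp add: algebra_simps)
    also have "\<dots> = 0" by (simp add: r)
    finally show ?thesis by simp
  qed
  have g4: "(a * (b * (D1 + DM) + F)) * ((a + b) * T1 + X + Y) = ((a * DM + b * (D1 + DM) + F) * ((a * (b * T1 + Y)) + (a * X)) + (a * D1) * (a * (b * T1 + Y)))"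
  proof -
    have "(a * (b * (D1 + DM) + F)) * ((a + b) * T1 + X + Y) - ((a * DM + b * (D1 + DM) + F) * ((a * (b * T1 + Y)) + (a * X)) + (a * D1) * (a * (b * T1 + Y))) = a * a * (F * T1 - ((D1 + DM) * (X + Y) - D1 * X))"
      by (simp add: algebra_simps)
    also have "\<dots> = 0" by (simp add: r)
    finally show ?thesis by simp
  qed
  show ?thesis
    unfolding net_rel_def strip_step_def net.simps N
    using g0 g1 g2 g3 g4 by (intro conjI) assumption+
qed

subsection \<open>Strips with one variable per edge\<close>

fun vstrip :: "(nat \<times> nat) list \<Rightarrow> nat \<Rightarrow> int_mpoly net" where
  "vstrip [] c = strip_end (Var c)"
| "vstrip ((a, b) # L) c = strip_step (Var a) (Var b) (vstrip L c)"

fun svars :: "(nat \<times> nat) list \<Rightarrow> nat \<Rightarrow> nat set" where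
  "svars [] c = {c}"
| "svars ((a, b) # L) c = insert a (insert b (svars L c))"

fun fresh :: "(nat \<times> nat) list \<Rightarrow> nat \<Rightarrow> bool" where
  "fresh [] c = True"
| "fresh ((a, b) # L) c \<longleftrightarrow> a \<noteq> b \<and> a \<notin> svars L c \<and> b \<notin> svars L c \<and> fresh L c"

lemma net_rel_vstrip: "net_rel (vstrip L c)"
  by (induction L c rule: vstrip.induct) (auto intro: net_rel_step net_rel_end)

lemma finite_svars [simp]: "finite (svars L c)"
  by (induction L c rule: svars.induct) auto

lemma card_svars: "fresh L c \<Longrightarrow> card (svars L c) = 2 * length L + 1"
  by (induction L c rule: fresh.induct) auto

lemma hom_mult': "hom d p \<Longrightarrow> hom e q \<Longrightarrow> n = d + e \<Longrightarrow> hom n (p * q)"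
  using hom_mult by blast

lemma net_notin_vars:
  assumes "x \<notin> svars L c"
  shows "x \<notin> vars (pP (vstrip L c)) \<and>
    x \<notin> vars (d1 (vstrip L c)) \<and>
    x \<notin> vars (d2 (vstrip L c)) \<and>
    x \<notin> vars (dm (vstrip L c)) \<and>
    x \<notin> vars (ff (vstrip L c)) \<and>
    x \<notin> vars (t1 (vstrip L c)) \<and>
    x \<notin> vars (t2 (vstrip L c)) \<and>
    x \<notin> vars (ch (vstrip L c)) \<and>
    x \<notin> vars (ps (vstrip L c))"
  using assms
proof (induction L c rule: vstrip.induct)
  case (1 c)
  then show ?case by (simp add: strip_end_def)
next
  case (2 a b L c)
  then have "x \<notin> svars L c" and x: "x \<noteq> a" "x \<noteq> b" by auto
  note IH = 2(1)[OF this(1)]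
  show ?case by (simp add: strip_step_def notin_vars IH x)
qed

lemma net_hom:
  "hom (length L) (pP (vstrip L c)) \<and> hom (Suc (length L)) (d1 (vstrip L c)) \<and>
   hom (Suc (length L)) (d2 (vstrip L c)) \<and> hom (Suc (length L)) (dm (vstrip L c)) \<and>
   hom (Suc (Suc (length L))) (ff (vstrip L c)) \<and> hom (Suc (length L)) (t1 (vstrip L c)) \<and>
   hom (Suc (length L)) (t2 (vstrip L c)) \<and> hom (Suc (Suc (length L))) (ch (vstrip L c)) \<and>
   hom (Suc (Suc (length L))) (ps (vstrip L c))"
proof (induction L c rule: vstrip.induct)
  case (1 c)
  then show ?case by (simp add: strip_end_def)
next
  case (2 a b L c)
  let ?k = "length L"
  have m1: "hom (Suc ?k) p \<Longrightarrow> hom (Suc (Suc ?k)) (Var x * p)"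
    and m0: "hom ?k p \<Longrightarrow> hom (Suc ?k) (Var x * p)"
    and m2: "hom (Suc (Suc ?k)) p \<Longrightarrow> hom (Suc (Suc (Suc ?k))) (Var x * p)" for x p
    by (rule hom_mult'[OF hom_Var]; simp)+
  from 2 show ?case
    by (simp add: strip_step_def hom_add m0 m1 m2 distrib_right)
qed

lemmas net_homs = net_hom[THEN conjunct1] net_hom[THEN conjunct2, THEN conjunct1]
  net_hom[THEN conjunct2, THEN conjunct2, THEN conjunct1]
  net_hom[THEN conjunct2, THEN conjunct2, THEN conjunct2, THEN conjunct1]
  net_hom[THEN conjunct2, THEN conjunct2, THEN conjunct2, THEN conjunct2, THEN conjunct1]
  net_hom[THEN conjunct2, THEN conjunct2, THEN conjunct2, THEN conjunct2, THEN conjunct2, THEN conjunct1]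
  net_hom[THEN conjunct2, THEN conjunct2, THEN conjunct2, THEN conjunct2, THEN conjunct2, THEN conjunct2, THEN conjunct1]
  net_hom[THEN conjunct2, THEN conjunct2, THEN conjunct2, THEN conjunct2, THEN conjunct2, THEN conjunct2, THEN conjunct2, THEN conjunct1]
  net_hom[THEN conjunct2, THEN conjunct2, THEN conjunct2, THEN conjunct2, THEN conjunct2, THEN conjunct2, THEN conjunct2, THEN conjunct2]

text \<open>What the elimination of the first variables of a strip needs to know about its tail.\<close>

definition tail_net :: "nat \<Rightarrow> nat set \<Rightarrow> int_mpoly net \<Rightarrow> bool" where
  "tail_net k S N \<longleftrightarrow> net_rel N \<and> finite S \<and> card S = 2 * k + 1 \<and>
     hom k (pP N) \<and> hom (Suc k) (d1 N) \<and> hom (Suc k) (d2 N) \<and> hom (Suc k) (dm N) \<and>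
     hom (Suc (Suc k)) (ff N) \<and> hom (Suc k) (t1 N) \<and> hom (Suc k) (t2 N) \<and>
     hom (Suc (Suc k)) (ch N) \<and> hom (Suc (Suc k)) (ps N) \<and>
     (\<forall>x. x \<notin> S \<longrightarrow> x \<notin> vars (pP N) \<and> x \<notin> vars (d1 N) \<and> x \<notin> vars (d2 N) \<and> x \<notin> vars (dm N) \<and>
       x \<notin> vars (ff N) \<and> x \<notin> vars (t1 N) \<and> x \<notin> vars (t2 N) \<and> x \<notin> vars (ch N) \<and> x \<notin> vars (ps N)) \<and>
     pP N \<noteq> 0 \<and> nS N \<noteq> 0 \<and> t1 N \<noteq> 0 \<and> nF N \<noteq> 0 \<and> d1 N \<noteq> 0 \<and>
     (k = 0 \<longrightarrow> (\<exists>c. S = {c} \<and> N = strip_end (Var c))) \<and>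
     (k \<ge> 1 \<longrightarrow> vars (pP N) = S \<and> nV N \<noteq> 0 \<and> nW N \<noteq> 0 \<and> dm N \<noteq> 0 \<and> d1 N - nS N \<noteq> 0) \<and>
     (k \<ge> 2 \<longrightarrow> nU N \<noteq> 0)"

text \<open>Everything is read off from leading coefficients in \<open>a\<close> or
  \<open>b\<close>, which are nonzero polynomials of the tail. The thresholds on \<open>k\<close>
  are real: for a bare edge \<open>nV\<close>, \<open>nW\<close> and \<open>dm\<close> are zero, and
  as a consequence \<open>nU\<close> vanishes identically for exactly one triangle.\<close>

lemma tail_net_step:
  assumes N: "tail_net k S N" and ab: "a \<noteq> b" "a \<notin> S" "b \<notin> S"
    and hm: "hom (Suc k) (pP (strip_step (Var a) (Var b) N))"
  shows "vars (pP (strip_step (Var a) (Var b) N)) = insert a (insert b S)"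
    "pP (strip_step (Var a) (Var b) N) \<noteq> 0" "nS (strip_step (Var a) (Var b) N) \<noteq> 0"
    "t1 (strip_step (Var a) (Var b) N) \<noteq> 0" "nF (strip_step (Var a) (Var b) N) \<noteq> 0"
    "d1 (strip_step (Var a) (Var b) N) \<noteq> 0" "nV (strip_step (Var a) (Var b) N) \<noteq> 0"
    "nW (strip_step (Var a) (Var b) N) \<noteq> 0" "dm (strip_step (Var a) (Var b) N) \<noteq> 0"
    "d1 (strip_step (Var a) (Var b) N) - nS (strip_step (Var a) (Var b) N) \<noteq> 0"
    "k \<ge> 1 \<Longrightarrow> nU (strip_step (Var a) (Var b) N) \<noteq> 0"
proof -
  let ?N = "strip_step (Var a) (Var b) N"
  have nv: "x \<notin> vars (pP N)" "x \<notin> vars (d1 N)" "x \<notin> vars (d2 N)" "x \<notin> vars (dm N)"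
       "x \<notin> vars (ff N)" "x \<notin> vars (t1 N)" "x \<notin> vars (t2 N)" "x \<notin> vars (ch N)" "x \<notin> vars (ps N)"
    if "x \<notin> S" for x using N that unfolding tail_net_def by blast+
  note nv = notin_vars nv[OF ab(2)] nv[OF ab(3)]
  have nz: "pP N \<noteq> 0" "nS N \<noteq> 0" "t1 N \<noteq> 0" "nF N \<noteq> 0" "d1 N \<noteq> 0"
    using N unfolding tail_net_def by blast+
  note nab = ab(1) ab(1)[symmetric]
  have P: "pP ?N = pP N * Var a + (pP N * Var b + (d1 N + d2 N))"
    by (simp add: strip_step_def algebra_simps)
  show "pP ?N \<noteq> 0" unfolding P by (subst split_eq_0) (auto simp: nv nz nab)
  have "vars (pP ?N) = insert a (insert b (vars (pP N) \<union> vars (d1 N + d2 N)))"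
    unfolding P by (subst vars_split, simp add: nv nab, simp add: nv nab, subst vars_split)
      (auto simp: nv nz nab)
  also have "vars (pP N) \<union> vars (d1 N + d2 N) = S"
  proof (cases "k = 0")
    case True
    then obtain c where "S = {c}" "N = strip_end (Var c)" using N by (auto simp: tail_net_def)
    then show ?thesis by (simp add: strip_end_def)
  next
    case False
    then have "vars (pP N) = S" using N by (auto simp: tail_net_def)
    moreover have "vars (d1 N + d2 N) \<subseteq> S"
      using N vars_add[of "d1 N" "d2 N"] unfolding tail_net_def by blast
    ultimately show ?thesis by blast
  qed
  finally show "vars (pP ?N) = insert a (insert b S)" .
  have "nS ?N = Var a * - nS N" by (simp add: strip_step_def algebra_simps)
  then show "nS ?N \<noteq> 0" using nz by auto
  have "t1 ?N = t1 N * Var b + (Var a * t2 N + ch N + ps N)"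
    by (simp add: strip_step_def algebra_simps)
  then show "t1 ?N \<noteq> 0" using nz by (simp add: split_eq_0 nv nab)
  have e: "pP N * Var a + nF N \<noteq> 0" using nz by (simp add: split_eq_0 nv)
  have "nF ?N = (pP N * Var a + nF N) * Var b + (Var a * (d2 N + dm N) + ff N)"
    by (simp add: strip_step_def algebra_simps)
  then show "nF ?N \<noteq> 0" using e by (simp only:, subst split_eq_0) (auto simp: nv nab)
  have "d1 ?N = (Var a * pP N) * Var b + Var a * d2 N"
    by (simp add: strip_step_def algebra_simps)
  then show "d1 ?N \<noteq> 0" using nz by (simp add: split_eq_0 nv nab)
  have e: "pP N * Var a + nV N \<noteq> 0" using nz by (simp add: split_eq_0 nv)
  have "nV ?N = (pP N * Var a + nV N) * Var b + (Var a * (d2 N + nW N) + nG N)"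
    by (simp add: strip_step_def algebra_simps)
  then show "nV ?N \<noteq> 0" using e by (simp only:, subst split_eq_0) (auto simp: nv nab)
  have "dm ?N = nF N * Var b + (Var a * dm N + ff N)"
    by (simp add: strip_step_def algebra_simps)
  then show "dm ?N \<noteq> 0" using nz by (simp add: split_eq_0 nv nab)
  have "d1 ?N - nS ?N = (Var a * pP N) * Var b + (Var a * (d2 N + nS N))"
    by (simp add: strip_step_def algebra_simps)
  then show "d1 ?N - nS ?N \<noteq> 0" using nz by (simp add: split_eq_0 nv nab)
  have W: "nW ?N = nV N * Var b + (Var a * nU N + nG N)"
    by (simp add: strip_step_def algebra_simps)
  have U: "nU ?N = nV N * Var b + (Var a * nW N + nG N)"
    by (simp add: strip_step_def algebra_simps)
  have k1: "nV N \<noteq> 0" if "k \<ge> 1" using N that unfolding tail_net_def by blast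
  show "nU ?N \<noteq> 0" if "k \<ge> 1"
    using k1[OF that] unfolding U by (subst split_eq_0) (auto simp: nv nab)
  show "nW ?N \<noteq> 0"
  proof (cases "k = 0")
    case True
    then obtain c where "N = strip_end (Var c)" using N by (auto simp: tail_net_def)
    then show ?thesis by (simp add: strip_step_def strip_end_def)
  next
    case False
    then show ?thesis using k1 unfolding W by (subst split_eq_0) (auto simp: nv nab)
  qed
qed

lemma tail_net_vstrip: "fresh L c \<Longrightarrow> tail_net (length L) (svars L c) (vstrip L c)"
proof (induction L c rule: fresh.induct)
  case (1 c)
  then show ?case
    by (auto simp: tail_net_def strip_end_def net_rel_def)
next
  case (2 a b L c)
  then have N: "tail_net (length L) (svars L c) (vstrip L c)" by simp
  have ab: "a \<noteq> b" "a \<notin> svars L c" "b \<notin> svars L c" using 2 by auto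
  note st = tail_net_step[OF N ab net_homs(1)[of "(a, b) # L" c, simplified]]
  have nv: "\<forall>x. x \<notin> svars ((a, b) # L) c \<longrightarrow> x \<notin> vars (pP (vstrip ((a, b) # L) c)) \<and>
     x \<notin> vars (d1 (vstrip ((a, b) # L) c)) \<and> x \<notin> vars (d2 (vstrip ((a, b) # L) c)) \<and>
     x \<notin> vars (dm (vstrip ((a, b) # L) c)) \<and> x \<notin> vars (ff (vstrip ((a, b) # L) c)) \<and>
     x \<notin> vars (t1 (vstrip ((a, b) # L) c)) \<and> x \<notin> vars (t2 (vstrip ((a, b) # L) c)) \<and>
     x \<notin> vars (ch (vstrip ((a, b) # L) c)) \<and> x \<notin> vars (ps (vstrip ((a, b) # L) c))"
    using net_notin_vars[of _ "(a, b) # L" c] by blast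
  show ?case
    unfolding tail_net_def
    using st nv net_rel_vstrip[of "(a, b) # L" c] card_svars[OF 2(2)] net_hom[of "(a, b) # L" c]
    by (auto simp del: strip_step_def)
qed

lemmas asq = algebra_simps power2_eq_square

lemmas net_rels = net_rel_vstrip[unfolded net_rel_def, THEN conjunct1]
  net_rel_vstrip[unfolded net_rel_def, THEN conjunct2, THEN conjunct1]
  net_rel_vstrip[unfolded net_rel_def, THEN conjunct2, THEN conjunct2, THEN conjunct1]
  net_rel_vstrip[unfolded net_rel_def, THEN conjunct2, THEN conjunct2, THEN conjunct2, THEN conjunct1]
  net_rel_vstrip[unfolded net_rel_def, THEN conjunct2, THEN conjunct2, THEN conjunct2, THEN conjunct2]

lemma net_nz:
  assumes "fresh L c"
  shows "pP (vstrip L c) \<noteq> 0" "t1 (vstrip L c) - t2 (vstrip L c) \<noteq> 0" "t1 (vstrip L c) \<noteq> 0"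
    "d1 (vstrip L c) + dm (vstrip L c) \<noteq> 0" "d1 (vstrip L c) \<noteq> 0"
  using tail_net_vstrip[OF assms] by (auto simp: tail_net_def)

lemma net_nz1:
  assumes "fresh L c" "length L \<ge> 1"
  shows "vars (pP (vstrip L c)) = svars L c" "d1 (vstrip L c) + dm (vstrip L c) - t1 (vstrip L c) \<noteq> 0"
    "dm (vstrip L c) - t2 (vstrip L c) \<noteq> 0" "dm (vstrip L c) \<noteq> 0" "d1 (vstrip L c) - (t1 (vstrip L c) - t2 (vstrip L c)) \<noteq> 0"
  using tail_net_vstrip[OF assms(1)] assms(2) by (simp_all add: tail_net_def)

section \<open>Semilinear reducibility of the strip polynomials\<close>

lemma hom_add': "hom d p \<Longrightarrow> hom e q \<Longrightarrow> d = e \<Longrightarrow> hom d (p + q)"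
  and hom_diff': "hom d p \<Longrightarrow> hom e q \<Longrightarrow> d = e \<Longrightarrow> hom d (p - q)"
  and hom_power2: "hom d p \<Longrightarrow> hom (d + d) (p\<^sup>2)"
  and hom_minus: "hom d p \<Longrightarrow> hom d (- p)"
  and hom_cast: "hom d p \<Longrightarrow> d = n \<Longrightarrow> hom n p"
  by (simp_all add: hom_add hom_diff hom_mult power2_eq_square)

lemmas hom_rules = hom_Var hom_1 net_homs hom_add' hom_diff' hom_mult hom_power2 hom_minus

lemma slr_linear':
  assumes "h = f1 * Var x + f0" "\<exists>d. hom d h" "x \<notin> vars f1" "x \<notin> vars f0" "f1 \<noteq> 0" "slr f1"
  shows "slr h"
  using assms slr_linear by blast

lemma slr_factor':
  assumes "\<exists>d. hom d (f * g)" "slr f" "slr g" "slr_pair (Upair f g)"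
  shows "slr (f * g)"
  using assms slr_factor by blast

lemma slr_Var_mult':
  assumes "B = B1 * Var x + B0" "\<exists>d. hom (Suc d) B" "x \<notin> vars B1" "x \<notin> vars B0" "slr B" "slr B0"
  shows "slr (Var x * B)"
proof (cases "B = 0")
  case False
  with assms hom_Suc_vars have "vars B \<noteq> {}" by blast
  with assms slr_Var_mult show ?thesis by blast
qed (simp add: slr_0)

lemma slr_square':
  assumes "\<exists>d. hom (Suc d) f" "slr f"
  shows "slr (f\<^sup>2)"
proof -
  obtain d where d: "hom (Suc d) f" using assms by blast
  show ?thesis
    using slr_square[OF hom_power2[OF d], of f 1 d] d assms(2) by simp
qed

text \<open>The bounds \<open>2 \<le> d\<close> and \<open>2 \<le> e\<close> provide the side
  condition that both polynomials have more than one variable: the leading coefficients are nonzero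
  of positive degree, so they contain a variable other than \<open>x\<close>.\<close>

lemma slr_pair_linear':
  assumes "f = f1 * Var x + f0" "g = g1 * Var x + g0" "hom d f" "hom e g" "2 \<le> d" "2 \<le> e"
    and "x \<notin> vars f1" "x \<notin> vars f0" "f1 \<noteq> 0" "x \<notin> vars g1" "x \<notin> vars g0" "g1 \<noteq> 0"
    and "slr_pair (Upair f1 g1)" "f1 * g0 - f0 * g1 = r" "slr r"
  shows "slr_pair (Upair f g)"
proof -
  obtain d' e' where de: "d = Suc (Suc d')" "e = Suc (Suc e')"
    using assms(5,6) by (metis Suc_le_D numeral_2_eq_2 Suc_le_mono)
  have "vars f1 \<noteq> {}"
    using hom_Suc_vars[OF hom_split[of "Suc d'" f1 x f0]] assms de by auto
  moreover have "vars g1 \<noteq> {}"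
    using hom_Suc_vars[OF hom_split[of "Suc e'" g1 x g0]] assms de by auto
  ultimately show ?thesis
    using assms by (intro slr_pair_linear[of d f e g f1 x f0 g1 g0]) auto
qed

lemma vars_split_sub:
  assumes "x \<notin> vars f1" "x \<notin> vars f0"
  shows "vars f1 \<subseteq> vars (f1 * Var x + f0)" "vars f0 \<subseteq> vars (f1 * Var x + f0)"
    "f1 \<noteq> 0 \<Longrightarrow> x \<in> vars (f1 * Var x + f0)"
  using vars_split[OF assms] by auto

section \<open>Resultants that factor\<close>

context
  fixes P D1 D2 DM F T1 T2 X Y a b :: "'a::comm_ring_1"
  assumes r: "P * F = D1 * D2 + D1 * DM + D2 * DM" "P * X = (D1 + DM) * T2 - DM * T1"
    "P * Y = (D2 + DM) * T1 - DM * T2" "F * T1 = (D1 + DM) * (X + Y) - D1 * X"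
    "F * T2 = DM * (X + Y) + D2 * X"
begin

text \<open>The left-hand sides of \<open>strip_I1\<close> to \<open>strip_I10\<close> are
  resultants with respect to one of the variables \<open>a\<close>, \<open>b\<close> or the closing
  edge. Here \<open>a\<close> is eliminated from \<open>pP\<close> and \<open>nF\<close> of the
  longer strip, and the result is minus a square, which is what the square rule is made for.\<close>

lemma strip_I1: "P * (b * (D1 + DM) + F) - (b * P + D1 + D2) * (b * P + D2 + DM) = - ((b * P + D2)\<^sup>2)"
proof -
  have "P * (b * (D1 + DM) + F) - (b * P + D1 + D2) * (b * P + D2 + DM) - (- ((b * P + D2)\<^sup>2)) = (P * F - (D1 * D2 + D1 * DM + D2 * DM))"
    by (simp add: asq)
  also have "\<dots> = 0" by (simp add: r)
  finally show ?thesis by (rule eq_iff_diff_eq_0[THEN iffD2])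
qed

lemma strip_I2: "P * (a * DM + F) - (a * P + D1 + D2) * (D1 + DM) = - (D1 * (a * P + D1))"
proof -
  have "P * (a * DM + F) - (a * P + D1 + D2) * (D1 + DM) - (- (D1 * (a * P + D1))) = (P * F - (D1 * D2 + D1 * DM + D2 * DM))"
    by (simp add: asq)
  also have "\<dots> = 0" by (simp add: r)
  finally show ?thesis by (rule eq_iff_diff_eq_0[THEN iffD2])
qed

lemma strip_I3: "P * F - D2 * (D1 + DM) = D1 * DM"
proof -
  have "P * F - D2 * (D1 + DM) - (D1 * DM) = (P * F - (D1 * D2 + D1 * DM + D2 * DM))"
    by (simp add: asq)
  also have "\<dots> = 0" by (simp add: r)
  finally show ?thesis by (rule eq_iff_diff_eq_0[THEN iffD2])
qed

lemma strip_I4: "P * (b * (D1 + DM - T1) + (F - X - Y)) - (b * P + D1 + D2) * (b * P + D2 + (DM - T2)) = - ((b * P + D2) * (b * P + D2 + (T1 - T2)))"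
proof -
  have "P * (b * (D1 + DM - T1) + (F - X - Y)) - (b * P + D1 + D2) * (b * P + D2 + (DM - T2)) - (- ((b * P + D2) * (b * P + D2 + (T1 - T2)))) = (P * F - (D1 * D2 + D1 * DM + D2 * DM)) + - 1 * (P * X - ((D1 + DM) * T2 - DM * T1)) + - 1 * (P * Y - ((D2 + DM) * T1 - DM * T2))"
    by (simp add: asq)
  also have "\<dots> = 0" by (simp add: r)
  finally show ?thesis by (rule eq_iff_diff_eq_0[THEN iffD2])
qed

lemma strip_I5: "P * (F - X - Y) - D2 * (D1 + DM - T1) = D1 * (DM - T2)"
proof -
  have "P * (F - X - Y) - D2 * (D1 + DM - T1) - (D1 * (DM - T2)) = (P * F - (D1 * D2 + D1 * DM + D2 * DM)) + - 1 * (P * X - ((D1 + DM) * T2 - DM * T1)) + - 1 * (P * Y - ((D2 + DM) * T1 - DM * T2))"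
    by (simp add: asq)
  also have "\<dots> = 0" by (simp add: r)
  finally show ?thesis by (rule eq_iff_diff_eq_0[THEN iffD2])
qed

lemma strip_I6: "P * (a * (DM - T1) + (F - X - Y)) - (a * P + D1 + D2) * (D1 + DM - T1) = - (D1 * (a * P + D1 - (T1 - T2)))"
proof -
  have "P * (a * (DM - T1) + (F - X - Y)) - (a * P + D1 + D2) * (D1 + DM - T1) - (- (D1 * (a * P + D1 - (T1 - T2)))) = (P * F - (D1 * D2 + D1 * DM + D2 * DM)) + - 1 * (P * X - ((D1 + DM) * T2 - DM * T1)) + - 1 * (P * Y - ((D2 + DM) * T1 - DM * T2))"
    by (simp add: asq)
  also have "\<dots> = 0" by (simp add: r)
  finally show ?thesis by (rule eq_iff_diff_eq_0[THEN iffD2])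
qed

lemma strip_I7: "P * (a * (DM - T2) + (F - X - Y)) - (a * P + D1 + D2) * (D1 + DM - T1) = - ((D1 - (T1 - T2)) * (a * P + D1))"
proof -
  have "P * (a * (DM - T2) + (F - X - Y)) - (a * P + D1 + D2) * (D1 + DM - T1) - (- ((D1 - (T1 - T2)) * (a * P + D1))) = (P * F - (D1 * D2 + D1 * DM + D2 * DM)) + - 1 * (P * X - ((D1 + DM) * T2 - DM * T1)) + - 1 * (P * Y - ((D2 + DM) * T1 - DM * T2))"
    by (simp add: asq)
  also have "\<dots> = 0" by (simp add: r)
  finally show ?thesis by (rule eq_iff_diff_eq_0[THEN iffD2])
qed

lemma strip_I8: "(D1 + DM - T1) * Y - (F - X - Y) * T1 = - ((DM - T1) * X)"
proof -
  have "(D1 + DM - T1) * Y - (F - X - Y) * T1 - (- ((DM - T1) * X)) = - 1 * (F * T1 - ((D1 + DM) * (X + Y) - D1 * X))"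
    by (simp add: asq)
  also have "\<dots> = 0" by (simp add: r)
  finally show ?thesis by (rule eq_iff_diff_eq_0[THEN iffD2])
qed

lemma strip_I9: "P * (F - X) - (D1 + DM) * (D2 + (T1 - T2)) = D1 * (DM - T1)"
proof -
  have "P * (F - X) - (D1 + DM) * (D2 + (T1 - T2)) - (D1 * (DM - T1)) = (P * F - (D1 * D2 + D1 * DM + D2 * DM)) + - 1 * (P * X - ((D1 + DM) * T2 - DM * T1))"
    by (simp add: asq)
  also have "\<dots> = 0" by (simp add: r)
  finally show ?thesis by (rule eq_iff_diff_eq_0[THEN iffD2])
qed

lemma strip_I10: "(D1 + DM) * (a * D2) - (a * DM + F) * (a * P) = - (a * (DM * (a * P + D1)))"
proof -
  have "(D1 + DM) * (a * D2) - (a * DM + F) * (a * P) - (- (a * (DM * (a * P + D1)))) = - a * (P * F - (D1 * D2 + D1 * DM + D2 * DM))"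
    by (simp add: asq)
  also have "\<dots> = 0" by (simp add: r)
  finally show ?thesis by (rule eq_iff_diff_eq_0[THEN iffD2])
qed

end

section \<open>Single minors and the first products\<close>

lemma slr_P_S:
  assumes "fresh L c"
  shows "slr (pP (vstrip L c) * nS (vstrip L c))"
  using assms
proof (induction L c rule: fresh.induct)
  case (1 c)
  show ?case by (simp add: strip_end_def slr_Var)
next
  case (2 a b L c)
  have ab: "a \<noteq> b" "b \<noteq> a" "a \<notin> svars L c" "b \<notin> svars L c" "fresh L c" using 2 by auto
  let ?P = "pP (vstrip L c)" and ?D1 = "d1 (vstrip L c)" and ?D2 = "d2 (vstrip L c)" and ?DM = "dm (vstrip L c)"
  let ?F = "ff (vstrip L c)" and ?T1 = "t1 (vstrip L c)" and ?T2 = "t2 (vstrip L c)" and ?X = "ch (vstrip L c)"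
  let ?Y = "ps (vstrip L c)" and ?k = "length L" and ?A = "Var a" and ?B = "Var b"
  note rl = net_rels[of L c]
  note nv = notin_vars net_notin_vars[OF ab(3)] net_notin_vars[OF ab(4)] ab(1,2)
  note nz = net_nz[OF ab(5)]
  have cardS: "card (svars L c) = 2 * ?k + 1" using ab card_svars by auto
  have IH: "slr (?P * (?T1 - ?T2))"
    using 2 by simp
  have l1: "slr (?P * ?A * (?T1 - ?T2))"
  by (rule slr_linear'[where x = a and ?f1.0 = "?P * (?T1 - ?T2)" and ?f0.0 = "0"],
      (simp add: asq)[1], (rule exI, (rule hom_rules | simp)+)[1], (simp_all add: nv)[2], (use nz in auto)[1], (rule IH)[1])
  have l2: "slr (((?A + ?B) * ?P + ?D1 + ?D2) * ?A * (?T1 - ?T2))"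
  by (rule slr_linear'[where x = b and ?f1.0 = "?P * ?A * (?T1 - ?T2)" and ?f0.0 = "(?A * ?P + ?D1 + ?D2) * ?A * (?T1 - ?T2)"],
      (simp add: asq)[1], (rule exI, (rule hom_rules | simp)+)[1], (simp_all add: nv)[2], (use nz in auto)[1], (rule l1)[1])
  \<comment> \<open>As \<open>nS\<close> of the longer strip is \<open>- a * nS\<close> of the tail,
    the product is linear in \<open>b\<close> and its leading coefficient is linear in
    \<open>a\<close>, ending in the same product for the tail.\<close>
  have "pP (vstrip ((a, b) # L) c) * nS (vstrip ((a, b) # L) c) = - (((?A + ?B) * ?P + ?D1 + ?D2) * ?A * (?T1 - ?T2))"
    by (simp add: strip_step_def algebra_simps)
  then show ?case using slr_uminus[OF l2] by simp
qed

text \<open>Degree \<open>k\<close> against \<open>2 * k + 1\<close> variables. The bare edge is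
  excluded since there \<open>pP\<close> is the constant 1, with \<open>delta\<close> equal to
  0.\<close>

lemma slr_P:
  assumes "fresh L c" "L \<noteq> []"
  shows "slr (pP (vstrip L c))"
proof (rule slr_hom_neg)
  show "hom (length L) (pP (vstrip L c))" by (rule net_homs)
  have "length L \<ge> 1" using assms by (cases L) auto
  then show "length L < card (vars (pP (vstrip L c)))"
    using tail_net_vstrip[OF assms(1)] by (auto simp: tail_net_def)
qed

lemma slr_P_sq:
  assumes "fresh L c" "L \<noteq> []"
  shows "slr ((pP (vstrip L c))\<^sup>2)"
proof (rule slr_square'[OF _ slr_P[OF assms]])
  have "length L = Suc (length L - 1)" using assms by (cases L) auto
  then show "\<exists>d. hom (Suc d) (pP (vstrip L c))" using net_homs(1)[of L c] by metis
qed

text \<open>The total degree \<open>2 * k\<close> is one below the number of variables. This ends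
  all eliminations between two polynomials with leading coefficient \<open>pP\<close>.\<close>

lemma slr_pair_PP:
  assumes "fresh L c" "L \<noteq> []"
  shows "slr_pair (Upair (pP (vstrip L c)) (pP (vstrip L c)))"
proof (rule slr_pair_neg[OF net_homs(1) net_homs(1), where V = "svars L c"])
  have "length L \<ge> 1" using assms by (cases L) auto
  then show "svars L c \<subseteq> vars (pP (vstrip L c)) \<union> vars (pP (vstrip L c))"
    using tail_net_vstrip[OF assms(1)] by (auto simp: tail_net_def)
  show "length L + length L < card (svars L c)" using card_svars[OF assms(1)] by simp
qed

lemma slr_Var_add: "slr (Var x + Var y)" if "x \<noteq> y"
proof (rule slr_hom_neg[of 1])
  show "hom 1 (Var x + Var y)" by (simp add: hom_add)
  have "vars (1 * Var x + Var y) = {x, y}" using that by (subst vars_split) auto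
  then show "1 < card (vars (Var x + Var y))" using that by simp
qed

lemma slr_Var_Var: "slr (Var x * Var y)" if "x \<noteq> y"
  by (rule slr_linear'[where x = x and ?f1.0 = "Var y" and ?f0.0 = 0])
    (use that slr_Var hom_mult[OF hom_Var hom_Var] in auto)

text \<open>The leading coefficient in \<open>b\<close> is \<open>a * pP + nF\<close> of the tail,
  and that has leading coefficient \<open>pP\<close> in \<open>a\<close>. Only for a bare tail,
  where \<open>pP\<close> is 1, is the sum of two variables treated apart.\<close>

lemma slr_F:
  assumes "fresh L c"
  shows "slr (nF (vstrip L c))"
  using assms
proof (induction L c rule: fresh.induct)
  case (1 c)
  show ?case by (simp add: strip_end_def slr_Var)
next
  case (2 a b L c)
  have ab: "a \<noteq> b" "b \<noteq> a" "a \<notin> svars L c" "b \<notin> svars L c" "fresh L c" using 2 by auto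
  let ?P = "pP (vstrip L c)" and ?D1 = "d1 (vstrip L c)" and ?D2 = "d2 (vstrip L c)" and ?DM = "dm (vstrip L c)"
  let ?F = "ff (vstrip L c)" and ?T1 = "t1 (vstrip L c)" and ?T2 = "t2 (vstrip L c)" and ?X = "ch (vstrip L c)"
  let ?Y = "ps (vstrip L c)" and ?k = "length L" and ?A = "Var a" and ?B = "Var b"
  note rl = net_rels[of L c]
  note nv = notin_vars net_notin_vars[OF ab(3)] net_notin_vars[OF ab(4)] ab(1,2)
  note nz = net_nz[OF ab(5)]
  have cardS: "card (svars L c) = 2 * ?k + 1" using ab card_svars by auto
  have l1: "slr (?A * ?P + (?D1 + ?DM))"
  proof (cases "L = []")
    case True
    then show ?thesis using slr_Var_add[of a c] ab by (simp add: strip_end_def)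
  next
    case False
    show ?thesis
      by (rule slr_linear'[where x = a and ?f1.0 = ?P and ?f0.0 = "(?D1 + ?DM)"])
        (simp add: asq, rule exI, (rule hom_rules | simp)+, (simp_all add: nv nz slr_P ab False))
  qed
  have nz': "?A * ?P + (?D1 + ?DM) \<noteq> 0"
    using nz split_eq_0[of a ?P "(?D1 + ?DM)"] nv by (simp add: algebra_simps)
  have l2: "slr (?A * (?B * ?P + ?D2) + (?A * ?DM + ?B * (?D1 + ?DM) + ?F))"
  by (rule slr_linear'[where x = b and ?f1.0 = "?A * ?P + (?D1 + ?DM)" and ?f0.0 = "?A * (?D2 + ?DM) + ?F"],
      (simp add: asq)[1], (rule exI, (rule hom_rules | simp)+)[1], (simp_all add: nv)[2], (use nz' in auto)[1], (rule l1)[1])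
  show ?case using l2 by (simp add: strip_step_def asq)
qed

lemma slr_V:
  assumes "fresh L c" "L \<noteq> []"
  shows "slr (nV (vstrip L c))"
  using assms
proof (induction L c rule: fresh.induct)
  case (1 c)
  then show ?case by simp
next
  case (2 a b L c)
  have ab: "a \<noteq> b" "b \<noteq> a" "a \<notin> svars L c" "b \<notin> svars L c" "fresh L c" using 2 by auto
  let ?P = "pP (vstrip L c)" and ?D1 = "d1 (vstrip L c)" and ?D2 = "d2 (vstrip L c)" and ?DM = "dm (vstrip L c)"
  let ?F = "ff (vstrip L c)" and ?T1 = "t1 (vstrip L c)" and ?T2 = "t2 (vstrip L c)" and ?X = "ch (vstrip L c)"
  let ?Y = "ps (vstrip L c)" and ?k = "length L" and ?A = "Var a" and ?B = "Var b"
  note rl = net_rels[of L c]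
  note nv = notin_vars net_notin_vars[OF ab(3)] net_notin_vars[OF ab(4)] ab(1,2)
  note nz = net_nz[OF ab(5)]
  have cardS: "card (svars L c) = 2 * ?k + 1" using ab card_svars by auto
  show ?case
  proof (cases "L = []")
    case True
    have "nV (vstrip ((a, b) # L) c) = Var a * Var b" using True
      by (simp add: strip_step_def strip_end_def algebra_simps)
    then show ?thesis using slr_Var_Var ab by simp
  next
    case False
    then have kk: "?k \<ge> 1" by (cases L) auto
  note k1 = net_nz1[OF ab(5) kk]
  have l1: "slr (?A * ?P + (?D1 + ?DM - ?T1))"
      by (rule slr_linear'[where x = a and ?f1.0 = ?P and ?f0.0 = "(?D1 + ?DM - ?T1)"])
        (simp add: asq, rule exI, (rule hom_rules | simp)+, (simp_all add: nv nz slr_P ab False))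
  have nz': "?A * ?P + (?D1 + ?DM - ?T1) \<noteq> 0"
    using nz split_eq_0[of a ?P "(?D1 + ?DM - ?T1)"] nv by (simp add: algebra_simps)
  have l2: "slr (?A * (?B * ?P + ?D2) + (?A * ?DM + ?B * (?D1 + ?DM) + ?F) - (?A * ?T2 + ?B * ?T1 + ?X + ?Y))"
  by (rule slr_linear'[where x = b and ?f1.0 = "?A * ?P + (?D1 + ?DM - ?T1)" and ?f0.0 = "?A * (?D2 + (?DM - ?T2)) + (?F - ?X - ?Y)"],
      (simp add: asq)[1], (rule exI, (rule hom_rules | simp)+)[1], (simp_all add: nv)[2], (use nz' in auto)[1], (rule l1)[1])
  show ?thesis using l2 by (simp add: strip_step_def asq)
  qed
qed

lemma slr_t1:
  assumes "fresh L c"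
  shows "slr (t1 (vstrip L c))"
  using assms
proof (induction L c rule: fresh.induct)
  case (1 c)
  show ?case by (simp add: strip_end_def slr_Var)
next
  case (2 a b L c)
  have ab: "a \<noteq> b" "b \<noteq> a" "a \<notin> svars L c" "b \<notin> svars L c" "fresh L c" using 2 by auto
  let ?P = "pP (vstrip L c)" and ?D1 = "d1 (vstrip L c)" and ?D2 = "d2 (vstrip L c)" and ?DM = "dm (vstrip L c)"
  let ?F = "ff (vstrip L c)" and ?T1 = "t1 (vstrip L c)" and ?T2 = "t2 (vstrip L c)" and ?X = "ch (vstrip L c)"
  let ?Y = "ps (vstrip L c)" and ?k = "length L" and ?A = "Var a" and ?B = "Var b"
  note rl = net_rels[of L c]
  note nv = notin_vars net_notin_vars[OF ab(3)] net_notin_vars[OF ab(4)] ab(1,2)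
  note nz = net_nz[OF ab(5)]
  have cardS: "card (svars L c) = 2 * ?k + 1" using ab card_svars by auto
  have IH: "slr ?T1"
    using 2 by simp
  have l2: "slr (?A * ?T2 + ?B * ?T1 + ?X + ?Y)"
  by (rule slr_linear'[where x = b and ?f1.0 = "?T1" and ?f0.0 = "?A * ?T2 + ?X + ?Y"],
      (simp add: asq)[1], (rule exI, (rule hom_rules | simp)+)[1], (simp_all add: nv)[2], (use nz in auto)[1], (rule IH)[1])
  show ?case using l2 by (simp add: strip_step_def asq)
qed

text \<open>The polynomials that later appear as factors of resultants. Each is linear in
  \<open>b\<close>, with one of the reducible minors \<open>pP\<close>, \<open>nF\<close>,
  \<open>nV\<close>, \<open>t1\<close> of the tail as leading coefficient.\<close>

lemma slr_comps:
  assumes "fresh ((a, b) # L) c"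
  shows "slr (dm (vstrip ((a, b) # L) c))"
    "slr (Var b * (d1 (vstrip L c) + dm (vstrip L c)) + ff (vstrip L c))"
    "L \<noteq> [] \<Longrightarrow> slr (Var b * pP (vstrip L c) + d2 (vstrip L c))"
    "L \<noteq> [] \<Longrightarrow> slr (Var b * pP (vstrip L c) + d1 (vstrip L c) + d2 (vstrip L c))"
    "L \<noteq> [] \<Longrightarrow> slr (Var b * pP (vstrip L c) + d2 (vstrip L c) + nS (vstrip L c))"
    "L \<noteq> [] \<Longrightarrow> slr (Var b * nV (vstrip L c) + nG (vstrip L c))"
    "slr (Var b * t1 (vstrip L c) + ps (vstrip L c))"
    "L \<noteq> [] \<Longrightarrow> slr (nU (vstrip ((a, b) # L) c))"
    "L \<noteq> [] \<Longrightarrow> slr (nW (vstrip ((a, b) # L) c))"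
proof -
  have ab: "a \<noteq> b" "b \<noteq> a" "a \<notin> svars L c" "b \<notin> svars L c" "fresh L c" using assms by auto
  let ?P = "pP (vstrip L c)" and ?D1 = "d1 (vstrip L c)" and ?D2 = "d2 (vstrip L c)" and ?DM = "dm (vstrip L c)"
  let ?F = "ff (vstrip L c)" and ?T1 = "t1 (vstrip L c)" and ?T2 = "t2 (vstrip L c)" and ?X = "ch (vstrip L c)"
  let ?Y = "ps (vstrip L c)" and ?k = "length L" and ?A = "Var a" and ?B = "Var b"
  note rl = net_rels[of L c]
  note nv = notin_vars net_notin_vars[OF ab(3)] net_notin_vars[OF ab(4)] ab(1,2)
  note nz = net_nz[OF ab(5)]
  have cardS: "card (svars L c) = 2 * ?k + 1" using ab card_svars by auto
  have c1: "slr (?A * ?DM + ?B * (?D1 + ?DM) + ?F)"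
  by (rule slr_linear'[where x = b and ?f1.0 = "(?D1 + ?DM)" and ?f0.0 = "?A * ?DM + ?F"],
      (simp add: asq)[1], (rule exI, (rule hom_rules | simp)+)[1], (simp_all add: nv)[2], (use nz in auto)[1], (rule slr_F[OF ab(5)])[1])
  have c2: "slr (?B * (?D1 + ?DM) + ?F)"
  by (rule slr_linear'[where x = b and ?f1.0 = "(?D1 + ?DM)" and ?f0.0 = "?F"],
      (simp add: asq)[1], (rule exI, (rule hom_rules | simp)+)[1], (simp_all add: nv)[2], (use nz in auto)[1], (rule slr_F[OF ab(5)])[1])
  have c7: "slr (?B * ?T1 + ?Y)"
  by (rule slr_linear'[where x = b and ?f1.0 = "?T1" and ?f0.0 = "?Y"],
      (simp add: asq)[1], (rule exI, (rule hom_rules | simp)+)[1], (simp_all add: nv)[2], (use nz in auto)[1], (rule slr_t1[OF ab(5)])[1])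
  show "slr (dm (vstrip ((a, b) # L) c))" using c1 by (simp add: strip_step_def)
  show "slr (?B * (?D1 + ?DM) + ?F)" "slr (?B * ?T1 + ?Y)" by (rule c2, rule c7)
  assume L: "L \<noteq> []"
  then have kk: "?k \<ge> 1" by (cases L) auto
  note k1 = net_nz1[OF ab(5) kk]
  have c3: "slr (?B * ?P + ?D2)"
  by (rule slr_linear'[where x = b and ?f1.0 = "?P" and ?f0.0 = "?D2"],
      (simp add: asq)[1], (rule exI, (rule hom_rules | simp)+)[1], (simp_all add: nv)[2], (use nz in auto)[1], (rule slr_P[OF ab(5) L])[1])
  have c4: "slr (?B * ?P + ?D1 + ?D2)"
  by (rule slr_linear'[where x = b and ?f1.0 = "?P" and ?f0.0 = "?D1 + ?D2"],
      (simp add: asq)[1], (rule exI, (rule hom_rules | simp)+)[1], (simp_all add: nv)[2], (use nz in auto)[1], (rule slr_P[OF ab(5) L])[1])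
  have c5: "slr (?B * ?P + ?D2 + (?T1 - ?T2))"
  by (rule slr_linear'[where x = b and ?f1.0 = "?P" and ?f0.0 = "?D2 + (?T1 - ?T2)"],
      (simp add: asq)[1], (rule exI, (rule hom_rules | simp)+)[1], (simp_all add: nv)[2], (use nz in auto)[1], (rule slr_P[OF ab(5) L])[1])
  have c6: "slr (?B * (?D1 + ?DM - ?T1) + (?F - ?X - ?Y))"
  by (rule slr_linear'[where x = b and ?f1.0 = "(?D1 + ?DM - ?T1)" and ?f0.0 = "(?F - ?X - ?Y)"],
      (simp add: asq)[1], (rule exI, (rule hom_rules | simp)+)[1], (simp_all add: nv)[2], (use k1 in auto)[1], (rule slr_V[OF ab(5) L])[1])
  have c8: "slr (?A * ?DM + ?B * (?D1 + ?DM) + ?F - (?A * ?T2 + ?B * ?T1 + ?X + ?Y))"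
  by (rule slr_linear'[where x = b and ?f1.0 = "(?D1 + ?DM - ?T1)" and ?f0.0 = "?A * (?DM - ?T2) + (?F - ?X - ?Y)"],
      (simp add: asq)[1], (rule exI, (rule hom_rules | simp)+)[1], (simp_all add: nv)[2], (use k1 in auto)[1], (rule slr_V[OF ab(5) L])[1])
  have c9: "slr (?A * ?DM + ?B * (?D1 + ?DM) + ?F - ((?A + ?B) * ?T1 + ?X + ?Y))"
  by (rule slr_linear'[where x = b and ?f1.0 = "(?D1 + ?DM - ?T1)" and ?f0.0 = "?A * (?DM - ?T1) + (?F - ?X - ?Y)"],
      (simp add: asq)[1], (rule exI, (rule hom_rules | simp)+)[1], (simp_all add: nv)[2], (use k1 in auto)[1], (rule slr_V[OF ab(5) L])[1])
  show "slr (?B * ?P + ?D2)" "slr (?B * ?P + ?D1 + ?D2)" "slr (?B * ?P + ?D2 + (?T1 - ?T2))" "slr (?B * (?D1 + ?DM - ?T1) + (?F - ?X - ?Y))"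
    by (rule c3, rule c4, rule c5, rule c6)
  show "slr (nU (vstrip ((a, b) # L) c))" "slr (nW (vstrip ((a, b) # L) c))"
    using c8 c9 by (simp_all add: strip_step_def)
qed

lemma net_Q:
  assumes "fresh L c" "b \<notin> svars L c"
  shows "b \<in> vars (Var b * pP (vstrip L c) + d2 (vstrip L c) + dm (vstrip L c))"
    "b \<in> vars (Var b * pP (vstrip L c) + d2 (vstrip L c) + (dm (vstrip L c) - t2 (vstrip L c)))"
    "b \<in> vars (Var b * pP (vstrip L c) + d2 (vstrip L c) + (t1 (vstrip L c) - t2 (vstrip L c)))"
    "Var b * pP (vstrip L c) + d2 (vstrip L c) \<noteq> 0"
    "Var b * pP (vstrip L c) + d2 (vstrip L c) + dm (vstrip L c) \<noteq> 0"
    "Var b * pP (vstrip L c) + d2 (vstrip L c) + (dm (vstrip L c) - t2 (vstrip L c)) \<noteq> 0"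
    "Var b * pP (vstrip L c) + d2 (vstrip L c) + (t1 (vstrip L c) - t2 (vstrip L c)) \<noteq> 0"
proof -
  note nv = notin_vars net_notin_vars[OF assms(2)] and nz = net_nz[OF assms(1)]
  have *: "b \<in> vars (Var b * pP (vstrip L c) + X)" if "b \<notin> vars X" for X
    using vars_split_sub(3)[of b "pP (vstrip L c)" X] that by (simp add: nv nz algebra_simps)
  have z: "p \<noteq> 0" if "b \<in> vars p" for p using that by auto
  show "b \<in> vars (Var b * pP (vstrip L c) + d2 (vstrip L c) + dm (vstrip L c))"
    "b \<in> vars (Var b * pP (vstrip L c) + d2 (vstrip L c) + (dm (vstrip L c) - t2 (vstrip L c)))"
    "b \<in> vars (Var b * pP (vstrip L c) + d2 (vstrip L c) + (t1 (vstrip L c) - t2 (vstrip L c)))"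
    using *[of "d2 (vstrip L c) + _"] by (simp_all add: nv add.assoc)
  then show "Var b * pP (vstrip L c) + d2 (vstrip L c) + dm (vstrip L c) \<noteq> 0"
    "Var b * pP (vstrip L c) + d2 (vstrip L c) + (dm (vstrip L c) - t2 (vstrip L c)) \<noteq> 0"
    "Var b * pP (vstrip L c) + d2 (vstrip L c) + (t1 (vstrip L c) - t2 (vstrip L c)) \<noteq> 0" by (auto intro: z)
  show "Var b * pP (vstrip L c) + d2 (vstrip L c) \<noteq> 0" by (rule z) (rule *, simp add: nv)
qed

lemma vars_Var_add: "x \<noteq> y \<Longrightarrow> vars (Var x + Var y) = {x, y}"
  using vars_split[of x 1 "Var y"] by auto

lemma slr_pair_Var: "slr f0 \<Longrightarrow> homogeneous f \<Longrightarrow> f = g * Var x + f0 \<Longrightarrow> x \<notin> vars f0 \<Longrightarrow> vars f \<noteq> {} \<Longrightarrow>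
    slr_pair (Upair f (Var x))"
  using pair_var[of f g x f0 1] by (simp add: Suc_le_eq card_gt_0_iff)

text \<open>The minor \<open>d1\<close> of the longer strip is \<open>a * (b * pP + d2)\<close>.
  Setting \<open>a = 0\<close> in the cofactor leaves two polynomials with leading coefficient
  \<open>pP\<close> in \<open>b\<close>, whose resultant is \<open>pP * d1\<close> of the tail; so
  the induction closes.\<close>

lemma slr_P_d1:
  assumes "fresh L c" "L \<noteq> []"
  shows "slr (pP (vstrip L c) * d1 (vstrip L c))"
  using assms
proof (induction L c rule: fresh.induct)
  case (1 c)
  then show ?case by simp
next
  case (2 a b L c)
  have ab: "a \<noteq> b" "b \<noteq> a" "a \<notin> svars L c" "b \<notin> svars L c" "fresh L c" using 2 by auto
  let ?P = "pP (vstrip L c)" and ?D1 = "d1 (vstrip L c)" and ?D2 = "d2 (vstrip L c)" and ?DM = "dm (vstrip L c)"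
  let ?F = "ff (vstrip L c)" and ?T1 = "t1 (vstrip L c)" and ?T2 = "t2 (vstrip L c)" and ?X = "ch (vstrip L c)"
  let ?Y = "ps (vstrip L c)" and ?k = "length L" and ?A = "Var a" and ?B = "Var b"
  note rl = net_rels[of L c]
  note nv = notin_vars net_notin_vars[OF ab(3)] net_notin_vars[OF ab(4)] ab(1,2)
  note nz = net_nz[OF ab(5)]
  have cardS: "card (svars L c) = 2 * ?k + 1" using ab card_svars by auto
  show ?case
  proof (cases "L = []")
    case True
    have ca: "c \<noteq> a" "a \<noteq> c" "c \<noteq> b" "b \<noteq> c" using ab True by auto
    note nv = notin_vars ca ab(1,2)
  have l1: "slr ((?A + ?B + Var c) * (?A * ?B))"
  by (rule slr_linear'[where x = c and ?f1.0 = "?A * ?B" and ?f0.0 = "(?A + ?B) * (?A * ?B)"],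
      (simp add: asq)[1], (rule exI, (rule hom_rules | simp)+)[1], (simp_all add: nv)[2], (use ca in auto)[1], (rule slr_Var_Var[OF ab(1)])[1])
    show ?thesis using l1 by (simp add: strip_step_def strip_end_def asq True)
  next
    case False
    then have kk: "?k \<ge> 1" by (cases L) auto
  note k1 = net_nz1[OF ab(5) kk]
  have fr: "fresh ((a, b) # L) c" using ab by simp
  note sc = slr_comps[OF fr] slr_comps(3-6,8,9)[OF fr False]
  have PP: "slr (?P * ?P)" using slr_P_sq[OF ab(5) False] by (simp add: power2_eq_square)
  note QV = net_Q(1-3)[OF ab(5,4)] and Qnz = net_Q(4-7)[OF ab(5,4)]
  have IH: "slr (?P * ?D1)"
    using 2 False by simp
  have l1: "slr (?P * (?B * ?P + ?D2))"
  by (rule slr_linear'[where x = b and ?f1.0 = "?P * ?P" and ?f0.0 = "?P * ?D2"],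
      (simp add: asq)[1], (rule exI, (rule hom_rules | simp)+)[1], (simp_all add: nv)[2], (use nz in auto)[1], (rule PP)[1])
  have l2: "slr (((?A + ?B) * ?P + ?D1 + ?D2) * (?B * ?P + ?D2))"
  by (rule slr_linear'[where x = a and ?f1.0 = "?P * (?B * ?P + ?D2)" and ?f0.0 = "(?B * ?P + ?D1 + ?D2) * (?B * ?P + ?D2)"],
      (simp add: asq)[1], (rule exI, (rule hom_rules | simp)+)[1], (simp_all add: nv)[2], (use nz Qnz in auto)[1], (rule l1)[1])
  have l3: "slr_pair (Upair ((?B * ?P + ?D2)) ((?B * ?P + ?D1 + ?D2)))"
  by (rule slr_pair_linear'[where x = b and ?f1.0 = "?P" and ?f0.0 = "?D2" and ?g1.0 = "?P" and ?g0.0 = "?D1 + ?D2"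
      and d = "Suc ?k" and e = "Suc ?k" and r = "?P * ?D1"],
      (simp_all add: asq)[2], (rule hom_cast, (rule hom_rules | simp)+)[1], (rule hom_cast, (rule hom_rules | simp)+)[1], (use kk in auto)[2], (simp_all add: nv)[2], (use nz in auto)[1], (simp_all add: nv)[2], (use nz in auto)[1], (rule slr_pair_PP[OF ab(5) False])[1], (simp add: algebra_simps)[1], (rule IH)[1])
  have l4: "slr (((?B * ?P + ?D2)) * ((?B * ?P + ?D1 + ?D2)))"
  proof (rule slr_factor')
    show "\<exists>d. hom d (((?B * ?P + ?D2)) * ((?B * ?P + ?D1 + ?D2)))" by (rule exI, (rule hom_rules | simp)+)
  qed (rule sc(10), rule sc(11), rule l3)
  have l4': "slr ((?B * ?P + ?D1 + ?D2) * (?B * ?P + ?D2))" using l4 by (simp add: mult.commute)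
  have l5: "slr (Var a * (((?A + ?B) * ?P + ?D1 + ?D2) * (?B * ?P + ?D2)))"
  by (rule slr_Var_mult'[where ?B1.0 = "?P * (?B * ?P + ?D2)" and ?B0.0 = "(?B * ?P + ?D1 + ?D2) * (?B * ?P + ?D2)"],
      (simp add: asq)[1], (rule exI[of _ "2 * ?k + 1"], rule hom_cast, (rule hom_rules | simp)+)[1], (simp_all add: nv)[2], (rule l2)[1], (rule l4')[1])
    show ?thesis using l5 by (simp add: strip_step_def asq)
  qed
qed

text \<open>Eliminating \<open>a\<close> gives minus a square by \<open>strip_I1\<close>, and the
  leading coefficients have degrees \<open>k\<close> and \<open>k + 1\<close> in the
  \<open>2 * k + 2\<close> variables of the tail and \<open>b\<close>, so their pair stops at
  once.\<close>

lemma pair_P_F: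
  assumes "fresh L c" "L \<noteq> []"
  shows "slr_pair (Upair (pP (vstrip L c)) (nF (vstrip L c)))"
  using assms
proof (induction L c rule: fresh.induct)
  case (1 c)
  then show ?case by simp
next
  case (2 a b L c)
  have ab: "a \<noteq> b" "b \<noteq> a" "a \<notin> svars L c" "b \<notin> svars L c" "fresh L c" using 2 by auto
  let ?P = "pP (vstrip L c)" and ?D1 = "d1 (vstrip L c)" and ?D2 = "d2 (vstrip L c)" and ?DM = "dm (vstrip L c)"
  let ?F = "ff (vstrip L c)" and ?T1 = "t1 (vstrip L c)" and ?T2 = "t2 (vstrip L c)" and ?X = "ch (vstrip L c)"
  let ?Y = "ps (vstrip L c)" and ?k = "length L" and ?A = "Var a" and ?B = "Var b"
  note rl = net_rels[of L c]
  note nv = notin_vars net_notin_vars[OF ab(3)] net_notin_vars[OF ab(4)] ab(1,2)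
  note nz = net_nz[OF ab(5)]
  have cardS: "card (svars L c) = 2 * ?k + 1" using ab card_svars by auto
  show ?case
  proof (cases "L = []")
    case True
    have ca: "c \<noteq> a" "a \<noteq> c" "c \<noteq> b" "b \<noteq> c" using ab True by auto
    note nv = notin_vars ca ab(1,2)
    have sq: "slr ((?A + Var c)\<^sup>2)"
      by (rule slr_square'[OF _ slr_Var_add[OF ca(2)]]) (rule exI[of _ 0], simp add: hom_add)
    have p: "slr_pair (Upair 1 (?A + Var c))"
      by (rule slr_pair_neg[of 0 _ 1 _ "{a, c}"]) (use ca in \<open>auto simp: hom_add vars_Var_add\<close>)
    have "slr_pair (Upair ((?A + ?B) + Var c) (?A * ?B + ?B * Var c))"
    proof (rule slr_pair_linear[where x = b and ?f1.0 = 1 and ?f0.0 = "?A + Var c" and ?g1.0 = "?A + Var c" and ?g0.0 = 0])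
      show "hom 1 (?A + ?B + Var c)" "hom 2 (?A * ?B + ?B * Var c)" by (rule hom_cast, (rule hom_rules | simp)+)+
      show "slr (1 * 0 - (?A + Var c) * (?A + Var c))" using slr_uminus[OF sq] by (simp add: power2_eq_square)
      show "?A + Var c \<noteq> 0" using vars_Var_add[OF ca(2)] by auto
    qed (use ca ab in \<open>auto simp: vars_Var_add algebra_simps p\<close>)
    then show ?thesis by (simp add: strip_step_def strip_end_def asq True)
  next
    case False
    then have kk: "?k \<ge> 1" by (cases L) auto
  note k1 = net_nz1[OF ab(5) kk]
  have fr: "fresh ((a, b) # L) c" using ab by simp
  note sc = slr_comps[OF fr] slr_comps(3-6,8,9)[OF fr False]
  note QV = net_Q(1-3)[OF ab(5,4)] and Qnz = net_Q(4-7)[OF ab(5,4)]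
  have sq: "slr ((?B * ?P + ?D2)\<^sup>2)" by (rule slr_square'[OF _ sc(10)]) (rule exI, rule hom_cast[where n = "Suc ?k"], (rule hom_rules | simp)+)
  have n1: "slr_pair (Upair (?P) (?B * ?P + ?D2 + ?DM))"
  by (rule slr_pair_neg[where d = "?k" and e = "Suc ?k" and V = "insert b (svars L c)"],
      (rule hom_cast, (rule hom_rules | simp)+)[1], (rule hom_cast, (rule hom_rules | simp)+)[1], (use k1 QV in auto)[1], (use kk in \<open>simp add: ab cardS \<close>)[1])
  have l1: "slr_pair (Upair (((?A + ?B) * ?P + ?D1 + ?D2)) (?A * (?B * ?P + ?D2) + (?A * ?DM + ?B * (?D1 + ?DM) + ?F)))"
  by (rule slr_pair_linear'[where x = a and ?f1.0 = "?P" and ?f0.0 = "(?B * ?P + ?D1 + ?D2)" and ?g1.0 = "?B * ?P + ?D2 + ?DM" and ?g0.0 = "?B * (?D1 + ?DM) + ?F"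
      and d = "Suc ?k" and e = "Suc (Suc ?k)" and r = "- ((?B * ?P + ?D2)\<^sup>2)"],
      (simp_all add: asq)[2], (rule hom_cast, (rule hom_rules | simp)+)[1], (rule hom_cast, (rule hom_rules | simp)+)[1], (use kk in auto)[2], (simp_all add: nv)[2], (use nz Qnz in auto)[1], (simp_all add: nv)[2], (use nz Qnz in auto)[1], (rule n1)[1], (rule strip_I1[OF rl])[1], (rule slr_uminus[OF sq])[1])
    show ?thesis using l1 by (simp add: strip_step_def asq)
  qed
qed

text \<open>Now \<open>b\<close> is eliminated: the leading coefficients are \<open>pP\<close> and
  \<open>nF\<close> of the tail, and the resultant is a product of \<open>d1\<close> with a
  polynomial linear in \<open>a\<close>.\<close>

lemma pair_P_dm:
  assumes "fresh ((a, b) # L) c" "L \<noteq> []"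
  shows "slr_pair (Upair (pP (vstrip ((a, b) # L) c)) (dm (vstrip ((a, b) # L) c)))"
proof -
  have ab: "a \<noteq> b" "b \<noteq> a" "a \<notin> svars L c" "b \<notin> svars L c" "fresh L c" using assms by auto
  let ?P = "pP (vstrip L c)" and ?D1 = "d1 (vstrip L c)" and ?D2 = "d2 (vstrip L c)" and ?DM = "dm (vstrip L c)"
  let ?F = "ff (vstrip L c)" and ?T1 = "t1 (vstrip L c)" and ?T2 = "t2 (vstrip L c)" and ?X = "ch (vstrip L c)"
  let ?Y = "ps (vstrip L c)" and ?k = "length L" and ?A = "Var a" and ?B = "Var b"
  note rl = net_rels[of L c]
  note nv = notin_vars net_notin_vars[OF ab(3)] net_notin_vars[OF ab(4)] ab(1,2)
  note nz = net_nz[OF ab(5)]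
  have cardS: "card (svars L c) = 2 * ?k + 1" using ab card_svars by auto
  have kk: "length L \<ge> 1" using assms by (cases L) auto
  note k1 = net_nz1[OF ab(5) kk]
  have l1: "slr (?D1 * (?A * ?P + ?D1))"
  by (rule slr_linear'[where x = a and ?f1.0 = "?P * ?D1" and ?f0.0 = "?D1 * ?D1"],
      (simp add: asq)[1], (rule exI, (rule hom_rules | simp)+)[1], (simp_all add: nv)[2], (use nz in auto)[1], (rule slr_P_d1[OF ab(5) assms(2)])[1])
  have l2: "slr_pair (Upair (((?A + ?B) * ?P + ?D1 + ?D2)) (?A * ?DM + ?B * (?D1 + ?DM) + ?F))"
  by (rule slr_pair_linear'[where x = b and ?f1.0 = "?P" and ?f0.0 = "?A * ?P + ?D1 + ?D2" and ?g1.0 = "(?D1 + ?DM)" and ?g0.0 = "?A * ?DM + ?F"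
      and d = "Suc ?k" and e = "Suc (Suc ?k)" and r = "- (?D1 * (?A * ?P + ?D1))"],
      (simp_all add: asq)[2], (rule hom_cast, (rule hom_rules | simp)+)[1], (rule hom_cast, (rule hom_rules | simp)+)[1], (use kk in auto)[2], (simp_all add: nv)[2], (use nz in auto)[1], (simp_all add: nv)[2], (use nz in auto)[1], (rule pair_P_F[OF ab(5) assms(2)])[1], (rule strip_I2[OF rl])[1], (rule slr_uminus[OF l1])[1])
  show ?thesis using l2 by (simp add: strip_step_def)
qed

lemma slr_P_dm:
  assumes "fresh L c" "L \<noteq> []"
  shows "slr (pP (vstrip L c) * dm (vstrip L c))"
  using assms
proof (induction L c rule: fresh.induct)
  case (1 c)
  then show ?case by simp
next
  case (2 a b L c)
  have ab: "a \<noteq> b" "b \<noteq> a" "a \<notin> svars L c" "b \<notin> svars L c" "fresh L c" using 2 by auto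
  let ?P = "pP (vstrip L c)" and ?D1 = "d1 (vstrip L c)" and ?D2 = "d2 (vstrip L c)" and ?DM = "dm (vstrip L c)"
  let ?F = "ff (vstrip L c)" and ?T1 = "t1 (vstrip L c)" and ?T2 = "t2 (vstrip L c)" and ?X = "ch (vstrip L c)"
  let ?Y = "ps (vstrip L c)" and ?k = "length L" and ?A = "Var a" and ?B = "Var b"
  note rl = net_rels[of L c]
  note nv = notin_vars net_notin_vars[OF ab(3)] net_notin_vars[OF ab(4)] ab(1,2)
  note nz = net_nz[OF ab(5)]
  have cardS: "card (svars L c) = 2 * ?k + 1" using ab card_svars by auto
  show ?case
  proof (cases "L = []")
    case True
    have ca: "c \<noteq> a" "a \<noteq> c" "c \<noteq> b" "b \<noteq> c" using ab True by auto
    note nv = notin_vars ca ab(1,2)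
  have l1: "slr ((?A + ?B + Var c) * (?B * Var c))"
  by (rule slr_linear'[where x = a and ?f1.0 = "?B * Var c" and ?f0.0 = "(?B + Var c) * (?B * Var c)"],
      (simp add: asq)[1], (rule exI, (rule hom_rules | simp)+)[1], (simp_all add: nv)[2], (use ca in auto)[1], (rule slr_Var_Var[OF ca(4)])[1])
    show ?thesis using l1 by (simp add: strip_step_def strip_end_def asq True)
  next
    case False
    then have kk: "?k \<ge> 1" by (cases L) auto
  note k1 = net_nz1[OF ab(5) kk]
  have fr: "fresh ((a, b) # L) c" using ab by simp
    show ?thesis
      by (rule slr_factor'[OF _ slr_P[OF fr] slr_comps(1)[OF fr] pair_P_dm[OF fr False]])
        (rule exI, rule hom_mult, rule net_homs, rule net_homs, simp)
  qed
qed

text \<open>With the factor \<open>a\<close> of \<open>d1\<close> split off and \<open>a = 0\<close>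
  in the rest, the two remaining factors have the resultant \<open>d1 * dm\<close> of the tail by
  \<open>strip_I3\<close>, which is the induction hypothesis.\<close>

lemma slr_d1_dm:
  assumes "fresh L c" "L \<noteq> []"
  shows "slr (d1 (vstrip L c) * dm (vstrip L c))"
  using assms
proof (induction L c rule: fresh.induct)
  case (1 c)
  then show ?case by simp
next
  case (2 a b L c)
  have ab: "a \<noteq> b" "b \<noteq> a" "a \<notin> svars L c" "b \<notin> svars L c" "fresh L c" using 2 by auto
  let ?P = "pP (vstrip L c)" and ?D1 = "d1 (vstrip L c)" and ?D2 = "d2 (vstrip L c)" and ?DM = "dm (vstrip L c)"
  let ?F = "ff (vstrip L c)" and ?T1 = "t1 (vstrip L c)" and ?T2 = "t2 (vstrip L c)" and ?X = "ch (vstrip L c)"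
  let ?Y = "ps (vstrip L c)" and ?k = "length L" and ?A = "Var a" and ?B = "Var b"
  note rl = net_rels[of L c]
  note nv = notin_vars net_notin_vars[OF ab(3)] net_notin_vars[OF ab(4)] ab(1,2)
  note nz = net_nz[OF ab(5)]
  have cardS: "card (svars L c) = 2 * ?k + 1" using ab card_svars by auto
  show ?case
  proof (cases "L = []")
    case True
    have ca: "c \<noteq> a" "a \<noteq> c" "c \<noteq> b" "b \<noteq> c" using ab True by auto
    note nv = notin_vars ca ab(1,2)
  have l0: "slr (?B * (?A * Var c))"
  by (rule slr_linear'[where x = b and ?f1.0 = "?A * Var c" and ?f0.0 = "0"],
      (simp add: asq)[1], (rule exI, (rule hom_rules | simp)+)[1], (simp_all add: nv)[2], (use ca in auto)[1], (rule slr_Var_Var[OF ca(2)])[1])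
    have l1: "slr (?B * ?B * (?A * Var c))"
      by (rule slr_square[of 4 _ ?B "?A * Var c" 0]) (rule hom_cast, (rule hom_rules | simp)+, simp_all add: power2_eq_square l0)
    show ?thesis using l1 by (simp add: strip_step_def strip_end_def asq True)
  next
    case False
    then have kk: "?k \<ge> 1" by (cases L) auto
  note k1 = net_nz1[OF ab(5) kk]
  have fr: "fresh ((a, b) # L) c" using ab by simp
  note sc = slr_comps[OF fr] slr_comps(3-6,8,9)[OF fr False]
  note QV = net_Q(1-3)[OF ab(5,4)] and Qnz = net_Q(4-7)[OF ab(5,4)]
  have IH: "slr (?D1 * ?DM)"
    using 2 False by simp
  have l1: "slr ((?B * ?P + ?D2) * ?DM)"
  by (rule slr_linear'[where x = b and ?f1.0 = "?P * ?DM" and ?f0.0 = "?D2 * ?DM"],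
      (simp add: asq)[1], (rule exI, (rule hom_rules | simp)+)[1], (simp_all add: nv)[2], (use nz k1 in auto)[1], (rule slr_P_dm[OF ab(5) False])[1])
  have l3: "slr_pair (Upair ((?B * ?P + ?D2)) (?B * (?D1 + ?DM) + ?F))"
  by (rule slr_pair_linear'[where x = b and ?f1.0 = "?P" and ?f0.0 = "?D2" and ?g1.0 = "(?D1 + ?DM)" and ?g0.0 = "?F"
      and d = "Suc ?k" and e = "Suc (Suc ?k)" and r = "?D1 * ?DM"],
      (simp_all add: asq)[2], (rule hom_cast, (rule hom_rules | simp)+)[1], (rule hom_cast, (rule hom_rules | simp)+)[1], (use kk in auto)[2], (simp_all add: nv)[2], (use nz in auto)[1], (simp_all add: nv)[2], (use nz in auto)[1], (rule pair_P_F[OF ab(5) False])[1], (rule strip_I3[OF rl])[1], (rule IH)[1])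
  have l4: "slr (((?B * ?P + ?D2)) * (?B * (?D1 + ?DM) + ?F))"
  proof (rule slr_factor')
    show "\<exists>d. hom d (((?B * ?P + ?D2)) * (?B * (?D1 + ?DM) + ?F))" by (rule exI, (rule hom_rules | simp)+)
  qed (rule sc(10), rule sc(2), rule l3)
  have l2: "slr ((?B * ?P + ?D2) * (?A * ?DM + ?B * (?D1 + ?DM) + ?F))"
  by (rule slr_linear'[where x = a and ?f1.0 = "(?B * ?P + ?D2) * ?DM" and ?f0.0 = "(?B * ?P + ?D2) * (?B * (?D1 + ?DM) + ?F)"],
      (simp add: asq)[1], (rule exI, (rule hom_rules | simp)+)[1], (simp_all add: nv)[2], (use nz k1 Qnz in auto)[1], (rule l1)[1])
  have l5: "slr (Var a * ((?B * ?P + ?D2) * (?A * ?DM + ?B * (?D1 + ?DM) + ?F)))"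
  by (rule slr_Var_mult'[where ?B1.0 = "(?B * ?P + ?D2) * ?DM" and ?B0.0 = "(?B * ?P + ?D2) * (?B * (?D1 + ?DM) + ?F)"],
      (simp add: asq)[1], (rule exI[of _ "2 * ?k + 2"], rule hom_cast, (rule hom_rules | simp)+)[1], (simp_all add: nv)[2], (rule l2)[1], (rule l4)[1])
    show ?thesis using l5 by (simp add: strip_step_def asq)
  qed
qed

text \<open>Needed because eliminating \<open>b\<close> from \<open>dm\<close> and \<open>d1\<close>
  leaves the leading coefficients \<open>nF\<close> and \<open>a * pP\<close>. The extra variable
  \<open>z\<close> raises the degree by one and the number of variables by one, so the balance stays
  negative.\<close>

lemma pair_aP_F:
  assumes "fresh L c" "L \<noteq> []" "z \<notin> svars L c"
  shows "slr_pair (Upair (Var z * pP (vstrip L c)) (nF (vstrip L c)))"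
  using assms
proof (induction L c rule: fresh.induct)
  case (1 c)
  then show ?case by simp
next
  case (2 a b L c)
  have ab: "a \<noteq> b" "b \<noteq> a" "a \<notin> svars L c" "b \<notin> svars L c" "fresh L c" using 2 by auto
  let ?P = "pP (vstrip L c)" and ?D1 = "d1 (vstrip L c)" and ?D2 = "d2 (vstrip L c)" and ?DM = "dm (vstrip L c)"
  let ?F = "ff (vstrip L c)" and ?T1 = "t1 (vstrip L c)" and ?T2 = "t2 (vstrip L c)" and ?X = "ch (vstrip L c)"
  let ?Y = "ps (vstrip L c)" and ?k = "length L" and ?A = "Var a" and ?B = "Var b"
  note rl = net_rels[of L c]
  note nv = notin_vars net_notin_vars[OF ab(3)] net_notin_vars[OF ab(4)] ab(1,2)
  note nz = net_nz[OF ab(5)]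
  have cardS: "card (svars L c) = 2 * ?k + 1" using ab card_svars by auto
  show ?case
  proof (cases "L = []")
    case True
    have ca: "c \<noteq> a" "a \<noteq> c" "c \<noteq> b" "b \<noteq> c" using ab True by auto
    note nv = notin_vars ca ab(1,2)
    have za: "z \<noteq> a" "z \<noteq> b" "z \<noteq> c" "a \<noteq> z" "b \<noteq> z" "c \<noteq> z" using 2(4) True by auto
    note nv = nv za
    have sq: "slr ((?A + Var c)\<^sup>2)"
      by (rule slr_square'[OF _ slr_Var_add[OF ca(2)]]) (rule exI[of _ 0], simp add: hom_add)
    have acnz: "?A + Var c \<noteq> 0" using vars_Var_add[OF ca(2)] by auto
    have vz: "vars (Var z + (?A + Var c)) = {z, a, c}" 
      using vars_split[of z 1 "?A + Var c"] za by (auto simp: vars_Var_add ca)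
    then have znz: "Var z + (?A + Var c) \<noteq> 0" by auto
    have p: "slr_pair (Upair (Var z) (?A + Var c))"
      by (rule slr_pair_neg[of 1 _ 1 _ "{z, a, c}"]) (use ca za in \<open>auto simp: hom_add vars_Var_add vz\<close>)
  have lz: "slr (Var z * (?A + Var c)\<^sup>2)"
  by (rule slr_linear'[where x = z and ?f1.0 = "(?A + Var c)\<^sup>2" and ?f0.0 = "0"],
      (simp add: asq)[1], (rule exI, (rule hom_rules | simp)+)[1], (simp_all add: nv)[2], (use acnz in auto)[1], (rule sq)[1])
    have "slr_pair (Upair (Var z * ((?A + ?B) + Var c)) (?A * ?B + ?B * Var c))"
    proof (rule slr_pair_linear'[where x = b and ?f1.0 = "Var z" and ?f0.0 = "Var z * (?A + Var c)" and ?g1.0 = "?A + Var c" and ?g0.0 = 0 and d = 2 and e = 2])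
      show "hom 2 (Var z * ((?A + ?B) + Var c))" "hom 2 (?A * ?B + ?B * Var c)" by (rule hom_cast, (rule hom_rules | simp)+)+
      show "slr (- (Var z * (?A + Var c)\<^sup>2))" by (rule slr_uminus[OF lz])
      show "b \<notin> vars (Var z)" "b \<notin> vars (Var z * (?A + Var c))" "b \<notin> vars (?A + Var c)" by (simp_all add: nv)
      show "Var z * ((?A + ?B) + Var c) = (Var z) * ?B + (Var z * (?A + Var c))" "?A * ?B + ?B * Var c = (?A + Var c) * ?B + 0"
        by (simp_all add: algebra_simps)
      show "Var z \<noteq> 0" using znz by simp
      show "?A + Var c \<noteq> 0" by (rule acnz)
      show "slr_pair (Upair (Var z) (?A + Var c))" by (rule p)
      show "(Var z) * 0 - Var z * (?A + Var c) * (?A + Var c) = - (Var z * (?A + Var c)\<^sup>2)"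
        by (simp add: asq)
    qed simp_all
    then show ?thesis by (simp add: strip_step_def strip_end_def True algebra_simps)
  next
    case False
    then have kk: "?k \<ge> 1" by (cases L) auto
  note k1 = net_nz1[OF ab(5) kk]
    have za: "z \<notin> svars L c" "z \<noteq> a" "z \<noteq> b" "a \<noteq> z" "b \<noteq> z" using 2(4) by auto
    note nv = nv net_notin_vars[OF za(1)] za
  have fr: "fresh ((a, b) # L) c" using ab by simp
  note sc = slr_comps[OF fr] slr_comps(3-6,8,9)[OF fr False]
  note QV = net_Q(1-3)[OF ab(5,4)] and Qnz = net_Q(4-7)[OF ab(5,4)]
  have sq: "slr ((?B * ?P + ?D2)\<^sup>2)" by (rule slr_square'[OF _ sc(10)]) (rule exI, rule hom_cast[where n = "Suc ?k"], (rule hom_rules | simp)+)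
  have zz: "z \<in> vars (Var z * ?P)" "vars ?P \<subseteq> vars (Var z * ?P)"
    using vars_split_sub[of z ?P "0"] by (simp_all add: nv nz mult.commute)
  then have fnz: "Var z * ?P \<noteq> 0" by auto
  have lz: "slr (Var z * (?B * ?P + ?D2)\<^sup>2)"
  by (rule slr_linear'[where x = z and ?f1.0 = "(?B * ?P + ?D2)\<^sup>2" and ?f0.0 = "0"],
      (simp add: asq)[1], (rule exI, (rule hom_rules | simp)+)[1], (simp_all add: nv)[2], (use Qnz in auto)[1], (rule sq)[1])
  have n1: "slr_pair (Upair (Var z * ?P) (?B * ?P + ?D2 + ?DM))"
  by (rule slr_pair_neg[where d = "Suc ?k" and e = "Suc ?k" and V = "insert z (insert b (svars L c))"],
      (rule hom_cast, (rule hom_rules | simp)+)[1], (rule hom_cast, (rule hom_rules | simp)+)[1], (use k1 QV zz in auto)[1], (use kk in \<open>simp add: ab cardS za\<close>)[1])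
  have l1: "slr_pair (Upair (Var z * ((?A + ?B) * ?P + ?D1 + ?D2)) (?A * (?B * ?P + ?D2) + (?A * ?DM + ?B * (?D1 + ?DM) + ?F)))"
  proof (rule slr_pair_linear'[where x = a and ?f1.0 = "Var z * ?P" and ?f0.0 = "Var z * (?B * ?P + ?D1 + ?D2)" and ?g1.0 = "?B * ?P + ?D2 + ?DM" and ?g0.0 = "?B * (?D1 + ?DM) + ?F"
      and d = "Suc (Suc ?k)" and e = "Suc (Suc ?k)" and r = "- (Var z * (?B * ?P + ?D2)\<^sup>2)"])
    show "Var z * ((?A + ?B) * ?P + ?D1 + ?D2) = (Var z * ?P) * Var a + (Var z * (?B * ?P + ?D1 + ?D2))" "?A * (?B * ?P + ?D2) + (?A * ?DM + ?B * (?D1 + ?DM) + ?F) = (?B * ?P + ?D2 + ?DM) * Var a + (?B * (?D1 + ?DM) + ?F)" by (simp_all add: asq)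
    show "hom (Suc (Suc ?k)) (Var z * ((?A + ?B) * ?P + ?D1 + ?D2))" by (rule hom_cast, (rule hom_rules | simp)+)
    show "hom (Suc (Suc ?k)) (?A * (?B * ?P + ?D2) + (?A * ?DM + ?B * (?D1 + ?DM) + ?F))" by (rule hom_cast, (rule hom_rules | simp)+)
    show "2 \<le> Suc (Suc ?k)" "2 \<le> Suc (Suc ?k)" using kk by auto
    show "a \<notin> vars (Var z * ?P)" "a \<notin> vars (Var z * (?B * ?P + ?D1 + ?D2))" "a \<notin> vars (?B * ?P + ?D2 + ?DM)" "a \<notin> vars (?B * (?D1 + ?DM) + ?F)"
      by (simp_all add: nv)
    show "Var z * ?P \<noteq> 0" "?B * ?P + ?D2 + ?DM \<noteq> 0" using fnz Qnz by auto
    show "slr_pair (Upair (Var z * ?P) (?B * ?P + ?D2 + ?DM))" by (rule n1)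
    show "(Var z * ?P) * (?B * (?D1 + ?DM) + ?F) - (Var z * (?B * ?P + ?D1 + ?D2)) * (?B * ?P + ?D2 + ?DM) = - (Var z * (?B * ?P + ?D2)\<^sup>2)" 
    proof -
      have "(Var z * ?P) * (?B * (?D1 + ?DM) + ?F) - (Var z * (?B * ?P + ?D1 + ?D2)) * (?B * ?P + ?D2 + ?DM) =
        Var z * (?P * (?B * (?D1 + ?DM) + ?F) - (?B * ?P + ?D1 + ?D2) * (?B * ?P + ?D2 + ?DM))" by (simp add: algebra_simps)
      then show ?thesis by (simp only: strip_I1[OF rl] mult_minus_right)
    qed
    show "slr (- (Var z * (?B * ?P + ?D2)\<^sup>2))" by (rule slr_uminus[OF lz])
  qed
    show ?thesis using l1 by (simp add: strip_step_def asq)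
  qed
qed

text \<open>The leading coefficients in \<open>b\<close> of \<open>nF\<close> and \<open>dm\<close>
  of the longer strip. Adding the second component to the first does not change the resultant, so
  the calculation of \<open>pair_aP_F\<close> carries over.\<close>

lemma pair_aPF_F:
  assumes "fresh L c" "L \<noteq> []" "z \<notin> svars L c"
  shows "slr_pair (Upair (Var z * pP (vstrip L c) + nF (vstrip L c)) (nF (vstrip L c)))"
  using assms
proof (induction L c rule: fresh.induct)
  case (1 c)
  then show ?case by simp
next
  case (2 a b L c)
  have ab: "a \<noteq> b" "b \<noteq> a" "a \<notin> svars L c" "b \<notin> svars L c" "fresh L c" using 2 by auto
  let ?P = "pP (vstrip L c)" and ?D1 = "d1 (vstrip L c)" and ?D2 = "d2 (vstrip L c)" and ?DM = "dm (vstrip L c)"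
  let ?F = "ff (vstrip L c)" and ?T1 = "t1 (vstrip L c)" and ?T2 = "t2 (vstrip L c)" and ?X = "ch (vstrip L c)"
  let ?Y = "ps (vstrip L c)" and ?k = "length L" and ?A = "Var a" and ?B = "Var b"
  note rl = net_rels[of L c]
  note nv = notin_vars net_notin_vars[OF ab(3)] net_notin_vars[OF ab(4)] ab(1,2)
  note nz = net_nz[OF ab(5)]
  have cardS: "card (svars L c) = 2 * ?k + 1" using ab card_svars by auto
  show ?case
  proof (cases "L = []")
    case True
    have ca: "c \<noteq> a" "a \<noteq> c" "c \<noteq> b" "b \<noteq> c" using ab True by auto
    note nv = notin_vars ca ab(1,2)
    have za: "z \<noteq> a" "z \<noteq> b" "z \<noteq> c" "a \<noteq> z" "b \<noteq> z" "c \<noteq> z" using 2(4) True by auto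
    note nv = nv za
    have sq: "slr ((?A + Var c)\<^sup>2)"
      by (rule slr_square'[OF _ slr_Var_add[OF ca(2)]]) (rule exI[of _ 0], simp add: hom_add)
    have acnz: "?A + Var c \<noteq> 0" using vars_Var_add[OF ca(2)] by auto
    have vz: "vars (Var z + (?A + Var c)) = {z, a, c}" 
      using vars_split[of z 1 "?A + Var c"] za by (auto simp: vars_Var_add ca)
    then have znz: "Var z + (?A + Var c) \<noteq> 0" by auto
    have p: "slr_pair (Upair (Var z + (?A + Var c)) (?A + Var c))"
      by (rule slr_pair_neg[of 1 _ 1 _ "{z, a, c}"]) (use ca za in \<open>auto simp: hom_add vars_Var_add vz\<close>)
  have lz: "slr (Var z * (?A + Var c)\<^sup>2)"
  by (rule slr_linear'[where x = z and ?f1.0 = "(?A + Var c)\<^sup>2" and ?f0.0 = "0"],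
      (simp add: asq)[1], (rule exI, (rule hom_rules | simp)+)[1], (simp_all add: nv)[2], (use acnz in auto)[1], (rule sq)[1])
    have "slr_pair (Upair (Var z * ((?A + ?B) + Var c) + (?A * ?B + ?B * Var c)) (?A * ?B + ?B * Var c))"
    proof (rule slr_pair_linear'[where x = b and ?f1.0 = "Var z + (?A + Var c)" and ?f0.0 = "Var z * (?A + Var c)" and ?g1.0 = "?A + Var c" and ?g0.0 = 0 and d = 2 and e = 2])
      show "hom 2 (Var z * ((?A + ?B) + Var c) + (?A * ?B + ?B * Var c))" "hom 2 (?A * ?B + ?B * Var c)" by (rule hom_cast, (rule hom_rules | simp)+)+
      show "slr (- (Var z * (?A + Var c)\<^sup>2))" by (rule slr_uminus[OF lz])
      show "b \<notin> vars (Var z + (?A + Var c))" "b \<notin> vars (Var z * (?A + Var c))" "b \<notin> vars (?A + Var c)" by (simp_all add: nv)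
      show "Var z * ((?A + ?B) + Var c) + (?A * ?B + ?B * Var c) = (Var z + (?A + Var c)) * ?B + (Var z * (?A + Var c))" "?A * ?B + ?B * Var c = (?A + Var c) * ?B + 0"
        by (simp_all add: algebra_simps)
      show "Var z + (?A + Var c) \<noteq> 0" using znz by simp
      show "?A + Var c \<noteq> 0" by (rule acnz)
      show "slr_pair (Upair (Var z + (?A + Var c)) (?A + Var c))" by (rule p)
      show "(Var z + (?A + Var c)) * 0 - Var z * (?A + Var c) * (?A + Var c) = - (Var z * (?A + Var c)\<^sup>2)"
        by (simp add: asq)
    qed simp_all
    then show ?thesis by (simp add: strip_step_def strip_end_def True algebra_simps)
  next
    case False
    then have kk: "?k \<ge> 1" by (cases L) auto
  note k1 = net_nz1[OF ab(5) kk]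
    have za: "z \<notin> svars L c" "z \<noteq> a" "z \<noteq> b" "a \<noteq> z" "b \<noteq> z" using 2(4) by auto
    note nv = nv net_notin_vars[OF za(1)] za
  have fr: "fresh ((a, b) # L) c" using ab by simp
  note sc = slr_comps[OF fr] slr_comps(3-6,8,9)[OF fr False]
  note QV = net_Q(1-3)[OF ab(5,4)] and Qnz = net_Q(4-7)[OF ab(5,4)]
  have sq: "slr ((?B * ?P + ?D2)\<^sup>2)" by (rule slr_square'[OF _ sc(10)]) (rule exI, rule hom_cast[where n = "Suc ?k"], (rule hom_rules | simp)+)
  have zz: "z \<in> vars (Var z * ?P + (?B * ?P + ?D2 + ?DM))" "vars ?P \<subseteq> vars (Var z * ?P + (?B * ?P + ?D2 + ?DM))"
    using vars_split_sub[of z ?P "?B * ?P + ?D2 + ?DM"] by (simp_all add: nv nz mult.commute)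
  then have fnz: "Var z * ?P + (?B * ?P + ?D2 + ?DM) \<noteq> 0" by auto
  have lz: "slr (Var z * (?B * ?P + ?D2)\<^sup>2)"
  by (rule slr_linear'[where x = z and ?f1.0 = "(?B * ?P + ?D2)\<^sup>2" and ?f0.0 = "0"],
      (simp add: asq)[1], (rule exI, (rule hom_rules | simp)+)[1], (simp_all add: nv)[2], (use Qnz in auto)[1], (rule sq)[1])
  have n1: "slr_pair (Upair (Var z * ?P + (?B * ?P + ?D2 + ?DM)) (?B * ?P + ?D2 + ?DM))"
  by (rule slr_pair_neg[where d = "Suc ?k" and e = "Suc ?k" and V = "insert z (insert b (svars L c))"],
      (rule hom_cast, (rule hom_rules | simp)+)[1], (rule hom_cast, (rule hom_rules | simp)+)[1], (use k1 QV zz in auto)[1], (use kk in \<open>simp add: ab cardS za\<close>)[1])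
  have l1: "slr_pair (Upair (Var z * ((?A + ?B) * ?P + ?D1 + ?D2) + (?A * (?B * ?P + ?D2) + (?A * ?DM + ?B * (?D1 + ?DM) + ?F))) (?A * (?B * ?P + ?D2) + (?A * ?DM + ?B * (?D1 + ?DM) + ?F)))"
  proof (rule slr_pair_linear'[where x = a and ?f1.0 = "Var z * ?P + (?B * ?P + ?D2 + ?DM)" and ?f0.0 = "Var z * (?B * ?P + ?D1 + ?D2) + (?B * (?D1 + ?DM) + ?F)" and ?g1.0 = "?B * ?P + ?D2 + ?DM" and ?g0.0 = "?B * (?D1 + ?DM) + ?F"
      and d = "Suc (Suc ?k)" and e = "Suc (Suc ?k)" and r = "- (Var z * (?B * ?P + ?D2)\<^sup>2)"])
    show "Var z * ((?A + ?B) * ?P + ?D1 + ?D2) + (?A * (?B * ?P + ?D2) + (?A * ?DM + ?B * (?D1 + ?DM) + ?F)) = (Var z * ?P + (?B * ?P + ?D2 + ?DM)) * Var a + (Var z * (?B * ?P + ?D1 + ?D2) + (?B * (?D1 + ?DM) + ?F))" "?A * (?B * ?P + ?D2) + (?A * ?DM + ?B * (?D1 + ?DM) + ?F) = (?B * ?P + ?D2 + ?DM) * Var a + (?B * (?D1 + ?DM) + ?F)" by (simp_all add: asq)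
    show "hom (Suc (Suc ?k)) (Var z * ((?A + ?B) * ?P + ?D1 + ?D2) + (?A * (?B * ?P + ?D2) + (?A * ?DM + ?B * (?D1 + ?DM) + ?F)))" by (rule hom_cast, (rule hom_rules | simp)+)
    show "hom (Suc (Suc ?k)) (?A * (?B * ?P + ?D2) + (?A * ?DM + ?B * (?D1 + ?DM) + ?F))" by (rule hom_cast, (rule hom_rules | simp)+)
    show "2 \<le> Suc (Suc ?k)" "2 \<le> Suc (Suc ?k)" using kk by auto
    show "a \<notin> vars (Var z * ?P + (?B * ?P + ?D2 + ?DM))" "a \<notin> vars (Var z * (?B * ?P + ?D1 + ?D2) + (?B * (?D1 + ?DM) + ?F))" "a \<notin> vars (?B * ?P + ?D2 + ?DM)" "a \<notin> vars (?B * (?D1 + ?DM) + ?F)"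
      by (simp_all add: nv)
    show "Var z * ?P + (?B * ?P + ?D2 + ?DM) \<noteq> 0" "?B * ?P + ?D2 + ?DM \<noteq> 0" using fnz Qnz by auto
    show "slr_pair (Upair (Var z * ?P + (?B * ?P + ?D2 + ?DM)) (?B * ?P + ?D2 + ?DM))" by (rule n1)
    show "(Var z * ?P + (?B * ?P + ?D2 + ?DM)) * (?B * (?D1 + ?DM) + ?F) - (Var z * (?B * ?P + ?D1 + ?D2) + (?B * (?D1 + ?DM) + ?F)) * (?B * ?P + ?D2 + ?DM) = - (Var z * (?B * ?P + ?D2)\<^sup>2)" 
    proof -
      have "(Var z * ?P + (?B * ?P + ?D2 + ?DM)) * (?B * (?D1 + ?DM) + ?F) - (Var z * (?B * ?P + ?D1 + ?D2) + (?B * (?D1 + ?DM) + ?F)) * (?B * ?P + ?D2 + ?DM) =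
        Var z * (?P * (?B * (?D1 + ?DM) + ?F) - (?B * ?P + ?D1 + ?D2) * (?B * ?P + ?D2 + ?DM))" by (simp add: algebra_simps)
      then show ?thesis by (simp only: strip_I1[OF rl] mult_minus_right)
    qed
    show "slr (- (Var z * (?B * ?P + ?D2)\<^sup>2))" by (rule slr_uminus[OF lz])
  qed
    show ?thesis using l1 by (simp add: strip_step_def asq)
  qed
qed

text \<open>The resultant in \<open>b\<close> keeps the factor \<open>a\<close> of
  \<open>d1\<close>, hence the rule for a bare variable times a polynomial; at \<open>a = 0\<close>
  the product \<open>dm * d1\<close> of the tail remains.\<close>

lemma pair_dm_d1:
  assumes "fresh L c" "L \<noteq> []"
  shows "slr_pair (Upair (dm (vstrip L c)) (d1 (vstrip L c)))"
  using assms
proof (induction L c rule: fresh.induct)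
  case (1 c)
  then show ?case by simp
next
  case (2 a b L c)
  have ab: "a \<noteq> b" "b \<noteq> a" "a \<notin> svars L c" "b \<notin> svars L c" "fresh L c" using 2 by auto
  let ?P = "pP (vstrip L c)" and ?D1 = "d1 (vstrip L c)" and ?D2 = "d2 (vstrip L c)" and ?DM = "dm (vstrip L c)"
  let ?F = "ff (vstrip L c)" and ?T1 = "t1 (vstrip L c)" and ?T2 = "t2 (vstrip L c)" and ?X = "ch (vstrip L c)"
  let ?Y = "ps (vstrip L c)" and ?k = "length L" and ?A = "Var a" and ?B = "Var b"
  note rl = net_rels[of L c]
  note nv = notin_vars net_notin_vars[OF ab(3)] net_notin_vars[OF ab(4)] ab(1,2)
  note nz = net_nz[OF ab(5)]
  have cardS: "card (svars L c) = 2 * ?k + 1" using ab card_svars by auto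
  show ?case
  proof (cases "L = []")
    case True
    have ca: "c \<noteq> a" "a \<noteq> c" "c \<noteq> b" "b \<noteq> c" using ab True by auto
    note nv = notin_vars ca ab(1,2)
    have p: "slr_pair (Upair (Var c) (?A))"
      by (rule slr_pair_Var[of "Var c" _ 0]) (use ca slr_Var hom_homogeneous[OF hom_Var] in auto)
  have l1: "slr_pair (Upair (?B * Var c) (?A * ?B))"
  by (rule slr_pair_linear'[where x = b and ?f1.0 = "Var c" and ?f0.0 = "0" and ?g1.0 = "?A" and ?g0.0 = "0"
      and d = "2" and e = "2" and r = "0"],
      (simp_all add: asq)[2], (rule hom_cast, (rule hom_rules | simp)+)[1], (rule hom_cast, (rule hom_rules | simp)+)[1], (auto)[1], (auto)[1], (simp_all add: nv)[2], (use ca in auto)[1], (simp_all add: nv)[2], (use ca in auto)[1], (rule p)[1], (simp)[1], (rule slr_0)[1])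
    show ?thesis using l1 by (simp add: strip_step_def strip_end_def asq True)
  next
    case False
    then have kk: "?k \<ge> 1" by (cases L) auto
  note k1 = net_nz1[OF ab(5) kk]
  have fr: "fresh ((a, b) # L) c" using ab by simp
  note sc = slr_comps[OF fr] slr_comps(3-6,8,9)[OF fr False]
  have m1: "slr (?DM * (?A * ?P + ?D1))"
  by (rule slr_linear'[where x = a and ?f1.0 = "?P * ?DM" and ?f0.0 = "?DM * ?D1"],
      (simp add: asq)[1], (rule exI, (rule hom_rules | simp)+)[1], (simp_all add: nv)[2], (use nz k1 in auto)[1], (rule slr_P_dm[OF ab(5) False])[1])
  have m2: "slr (?DM * ?D1)" using slr_d1_dm[OF ab(5) False] by (simp add: mult.commute)
  have m3: "slr (Var a * (?DM * (?A * ?P + ?D1)))"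
  by (rule slr_Var_mult'[where ?B1.0 = "?DM * ?P" and ?B0.0 = "?DM * ?D1"],
      (simp add: asq)[1], (rule exI[of _ "2 * ?k + 1"], rule hom_cast, (rule hom_rules | simp)+)[1], (simp_all add: nv)[2], (rule m1)[1], (rule m2)[1])
  have l1: "slr_pair (Upair (?A * ?DM + ?B * (?D1 + ?DM) + ?F) (?A * (?B * ?P + ?D2)))"
  by (rule slr_pair_linear'[where x = b and ?f1.0 = "(?D1 + ?DM)" and ?f0.0 = "?A * ?DM + ?F" and ?g1.0 = "?A * ?P" and ?g0.0 = "?A * ?D2"
      and d = "Suc (Suc ?k)" and e = "Suc (Suc ?k)" and r = "- (?A * (?DM * (?A * ?P + ?D1)))"],
      (simp_all add: asq)[2], (rule hom_cast, (rule hom_rules | simp)+)[1], (rule hom_cast, (rule hom_rules | simp)+)[1], (use kk in auto)[2], (simp_all add: nv)[2], (use nz in auto)[1], (simp_all add: nv)[2], (use nz in auto)[1], (rule slr_pair_sym[OF pair_aP_F[OF ab(5) False ab(3)]])[1], (rule strip_I10[OF rl])[1], (rule slr_uminus[OF m3])[1])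
    show ?thesis using l1 by (simp add: strip_step_def asq)
  qed
qed

text \<open>This product is the resultant of \<open>z * pP + nF\<close> and \<open>z * dm\<close> in
  the closing edge \<open>z\<close>.\<close>

lemma slr_F_dm:
  assumes "fresh ((a, b) # L) c" "L \<noteq> []"
  shows "slr (nF (vstrip ((a, b) # L) c) * dm (vstrip ((a, b) # L) c))"
proof -
  have ab: "a \<noteq> b" "b \<noteq> a" "a \<notin> svars L c" "b \<notin> svars L c" "fresh L c" using assms by auto
  let ?P = "pP (vstrip L c)" and ?D1 = "d1 (vstrip L c)" and ?D2 = "d2 (vstrip L c)" and ?DM = "dm (vstrip L c)"
  let ?F = "ff (vstrip L c)" and ?T1 = "t1 (vstrip L c)" and ?T2 = "t2 (vstrip L c)" and ?X = "ch (vstrip L c)"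
  let ?Y = "ps (vstrip L c)" and ?k = "length L" and ?A = "Var a" and ?B = "Var b"
  note rl = net_rels[of L c]
  note nv = notin_vars net_notin_vars[OF ab(3)] net_notin_vars[OF ab(4)] ab(1,2)
  note nz = net_nz[OF ab(5)]
  have cardS: "card (svars L c) = 2 * ?k + 1" using ab card_svars by auto
  have kk: "length L \<ge> 1" using assms by (cases L) auto
  note k1 = net_nz1[OF ab(5) kk]
  have fr: "fresh ((a, b) # L) c" using ab by simp
  note sc = slr_comps[OF fr] slr_comps(3-6,8,9)[OF fr assms(2)]
  have m1: "slr (?DM * (?A * ?P + ?D1))"
  by (rule slr_linear'[where x = a and ?f1.0 = "?P * ?DM" and ?f0.0 = "?DM * ?D1"],
      (simp add: asq)[1], (rule exI, (rule hom_rules | simp)+)[1], (simp_all add: nv)[2], (use nz k1 in auto)[1], (rule slr_P_dm[OF ab(5) assms(2)])[1])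
  have m2: "slr (?DM * ?D1)" using slr_d1_dm[OF ab(5) assms(2)] by (simp add: mult.commute)
  have m3: "slr (Var a * (?DM * (?A * ?P + ?D1)))"
  by (rule slr_Var_mult'[where ?B1.0 = "?DM * ?P" and ?B0.0 = "?DM * ?D1"],
      (simp add: asq)[1], (rule exI[of _ "2 * ?k + 1"], rule hom_cast, (rule hom_rules | simp)+)[1], (simp_all add: nv)[2], (rule m1)[1], (rule m2)[1])
  have apnz: "?A * ?P + (?D1 + ?DM) \<noteq> 0" using split_eq_0[of a ?P "(?D1 + ?DM)"] by (simp add: nv nz mult.commute)
  have l1: "slr_pair (Upair (?A * (?B * ?P + ?D2) + (?A * ?DM + ?B * (?D1 + ?DM) + ?F)) (?A * ?DM + ?B * (?D1 + ?DM) + ?F))"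
  proof (rule slr_pair_linear'[where x = b and ?f1.0 = "?A * ?P + (?D1 + ?DM)" and ?f0.0 = "?A * (?D2 + ?DM) + ?F" and ?g1.0 = "(?D1 + ?DM)" and ?g0.0 = "?A * ?DM + ?F"
      and d = "Suc (Suc ?k)" and e = "Suc (Suc ?k)" and r = "?A * (?DM * (?A * ?P + ?D1))"])
    show "?A * (?B * ?P + ?D2) + (?A * ?DM + ?B * (?D1 + ?DM) + ?F) = (?A * ?P + (?D1 + ?DM)) * Var b + (?A * (?D2 + ?DM) + ?F)" "?A * ?DM + ?B * (?D1 + ?DM) + ?F = ((?D1 + ?DM)) * Var b + (?A * ?DM + ?F)" by (simp_all add: asq)
    show "hom (Suc (Suc ?k)) (?A * (?B * ?P + ?D2) + (?A * ?DM + ?B * (?D1 + ?DM) + ?F))" by (rule hom_cast, (rule hom_rules | simp)+)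
    show "hom (Suc (Suc ?k)) (?A * ?DM + ?B * (?D1 + ?DM) + ?F)" by (rule hom_cast, (rule hom_rules | simp)+)
    show "2 \<le> Suc (Suc ?k)" "2 \<le> Suc (Suc ?k)" using kk by auto
    show "b \<notin> vars (?A * ?P + (?D1 + ?DM))" "b \<notin> vars (?A * (?D2 + ?DM) + ?F)" "b \<notin> vars ((?D1 + ?DM))" "b \<notin> vars (?A * ?DM + ?F)"
      by (simp_all add: nv)
    show "?A * ?P + (?D1 + ?DM) \<noteq> 0" "(?D1 + ?DM) \<noteq> 0" using nz apnz by auto
    show "slr_pair (Upair (?A * ?P + (?D1 + ?DM)) ((?D1 + ?DM)))" by (rule pair_aPF_F[OF ab(5) assms(2) ab(3)])
    show "(?A * ?P + (?D1 + ?DM)) * (?A * ?DM + ?F) - (?A * (?D2 + ?DM) + ?F) * ((?D1 + ?DM)) = ?A * (?DM * (?A * ?P + ?D1))" 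
    proof -
      have "(?A * ?P + (?D1 + ?DM)) * (?A * ?DM + ?F) - (?A * (?D2 + ?DM) + ?F) * (?D1 + ?DM) =
        ?A * (?A * ?P * ?DM + (?P * ?F - ?D2 * (?D1 + ?DM)))" by (simp add: algebra_simps)
      also have "\<dots> = ?A * (?DM * (?A * ?P + ?D1))" unfolding strip_I3[OF rl] by (simp add: algebra_simps)
      finally show ?thesis .
    qed
    show "slr (?A * (?DM * (?A * ?P + ?D1)))" by (rule m3)
  qed
  have sF: "slr (?A * (?B * ?P + ?D2) + (?A * ?DM + ?B * (?D1 + ?DM) + ?F))" using slr_F[OF fr] by (simp add: strip_step_def)
  have sD: "slr (?A * ?DM + ?B * (?D1 + ?DM) + ?F)" using slr_comps(1)[OF fr] by (simp add: strip_step_def)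
  have l2: "slr ((?A * (?B * ?P + ?D2) + (?A * ?DM + ?B * (?D1 + ?DM) + ?F)) * (?A * ?DM + ?B * (?D1 + ?DM) + ?F))"
  proof (rule slr_factor')
    show "\<exists>d. hom d ((?A * (?B * ?P + ?D2) + (?A * ?DM + ?B * (?D1 + ?DM) + ?F)) * (?A * ?DM + ?B * (?D1 + ?DM) + ?F))" by (rule exI, (rule hom_rules | simp)+)
  qed (rule sF, rule sD, rule l1)
  show ?thesis using l2 by (simp add: strip_step_def)
qed

section \<open>Minors that see the far vertex\<close>

lemma slr_P_d1S:
  assumes "fresh L c" "L \<noteq> []"
  shows "slr (pP (vstrip L c) * (d1 (vstrip L c) - nS (vstrip L c)))"
  using assms
proof (induction L c rule: fresh.induct)
  case (1 c)
  then show ?case by simp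
next
  case (2 a b L c)
  have ab: "a \<noteq> b" "b \<noteq> a" "a \<notin> svars L c" "b \<notin> svars L c" "fresh L c" using 2 by auto
  let ?P = "pP (vstrip L c)" and ?D1 = "d1 (vstrip L c)" and ?D2 = "d2 (vstrip L c)" and ?DM = "dm (vstrip L c)"
  let ?F = "ff (vstrip L c)" and ?T1 = "t1 (vstrip L c)" and ?T2 = "t2 (vstrip L c)" and ?X = "ch (vstrip L c)"
  let ?Y = "ps (vstrip L c)" and ?k = "length L" and ?A = "Var a" and ?B = "Var b"
  note rl = net_rels[of L c]
  note nv = notin_vars net_notin_vars[OF ab(3)] net_notin_vars[OF ab(4)] ab(1,2)
  note nz = net_nz[OF ab(5)]
  have cardS: "card (svars L c) = 2 * ?k + 1" using ab card_svars by auto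
  show ?case
  proof (cases "L = []")
    case True
    have ca: "c \<noteq> a" "a \<noteq> c" "c \<noteq> b" "b \<noteq> c" using ab True by auto
    note nv = notin_vars ca ab(1,2)
    have bcnz: "?B + Var c \<noteq> 0" using vars_Var_add[OF ca(4)] by auto
    have l0: "slr ((?B + Var c) * (?B + Var c))"
      using slr_square'[OF _ slr_Var_add[OF ca(4)]] by (simp add: power2_eq_square[symmetric]) (metis hom_add hom_Var)
  have l1: "slr ((?A + ?B + Var c) * (?B + Var c))"
  by (rule slr_linear'[where x = a and ?f1.0 = "(?B + Var c)" and ?f0.0 = "(?B + Var c) * (?B + Var c)"],
      (simp add: asq)[1], (rule exI, (rule hom_rules | simp)+)[1], (simp_all add: nv)[2], (use bcnz in auto)[1], (rule slr_Var_add[OF ca(4)])[1])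
  have l2: "slr (Var a * ((?A + ?B + Var c) * (?B + Var c)))"
  by (rule slr_Var_mult'[where ?B1.0 = "(?B + Var c)" and ?B0.0 = "(?B + Var c) * (?B + Var c)"],
      (simp add: asq)[1], (rule exI[of _ "1"], rule hom_cast, (rule hom_rules | simp)+)[1], (simp_all add: nv)[2], (rule l1)[1], (rule l0)[1])
    show ?thesis using l2 by (simp add: strip_step_def strip_end_def asq True)
  next
    case False
    then have kk: "?k \<ge> 1" by (cases L) auto
  note k1 = net_nz1[OF ab(5) kk]
  have fr: "fresh ((a, b) # L) c" using ab by simp
  note sc = slr_comps[OF fr] slr_comps(3-6,8,9)[OF fr False]
  have PP: "slr (?P * ?P)" using slr_P_sq[OF ab(5) False] by (simp add: power2_eq_square)
  note QV = net_Q(1-3)[OF ab(5,4)] and Qnz = net_Q(4-7)[OF ab(5,4)]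
  have IH: "slr (?P * (?D1 - (?T1 - ?T2)))"
    using 2 False by simp
  have l1: "slr (?P * (?B * ?P + ?D2 + (?T1 - ?T2)))"
  by (rule slr_linear'[where x = b and ?f1.0 = "?P * ?P" and ?f0.0 = "?P * (?D2 + (?T1 - ?T2))"],
      (simp add: asq)[1], (rule exI, (rule hom_rules | simp)+)[1], (simp_all add: nv)[2], (use nz in auto)[1], (rule PP)[1])
  have l2: "slr (((?A + ?B) * ?P + ?D1 + ?D2) * (?B * ?P + ?D2 + (?T1 - ?T2)))"
  by (rule slr_linear'[where x = a and ?f1.0 = "?P * (?B * ?P + ?D2 + (?T1 - ?T2))" and ?f0.0 = "(?B * ?P + ?D2 + (?T1 - ?T2)) * (?B * ?P + ?D1 + ?D2)"],
      (simp add: asq)[1], (rule exI, (rule hom_rules | simp)+)[1], (simp_all add: nv)[2], (use nz Qnz in auto)[1], (rule l1)[1])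
  have l3: "slr_pair (Upair ((?B * ?P + ?D2 + (?T1 - ?T2))) ((?B * ?P + ?D1 + ?D2)))"
  by (rule slr_pair_linear'[where x = b and ?f1.0 = "?P" and ?f0.0 = "?D2 + (?T1 - ?T2)" and ?g1.0 = "?P" and ?g0.0 = "?D1 + ?D2"
      and d = "Suc ?k" and e = "Suc ?k" and r = "?P * (?D1 - (?T1 - ?T2))"],
      (simp_all add: asq)[2], (rule hom_cast, (rule hom_rules | simp)+)[1], (rule hom_cast, (rule hom_rules | simp)+)[1], (use kk in auto)[2], (simp_all add: nv)[2], (use nz in auto)[1], (simp_all add: nv)[2], (use nz in auto)[1], (rule slr_pair_PP[OF ab(5) False])[1], (simp add: algebra_simps)[1], (rule IH)[1])
  have l4: "slr (((?B * ?P + ?D2 + (?T1 - ?T2))) * ((?B * ?P + ?D1 + ?D2)))"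
  proof (rule slr_factor')
    show "\<exists>d. hom d (((?B * ?P + ?D2 + (?T1 - ?T2))) * ((?B * ?P + ?D1 + ?D2)))" by (rule exI, (rule hom_rules | simp)+)
  qed (rule sc(12), rule sc(11), rule l3)
  have l5: "slr (Var a * (((?A + ?B) * ?P + ?D1 + ?D2) * (?B * ?P + ?D2 + (?T1 - ?T2))))"
  by (rule slr_Var_mult'[where ?B1.0 = "?P * (?B * ?P + ?D2 + (?T1 - ?T2))" and ?B0.0 = "(?B * ?P + ?D2 + (?T1 - ?T2)) * (?B * ?P + ?D1 + ?D2)"],
      (simp add: asq)[1], (rule exI[of _ "2 * ?k + 1"], rule hom_cast, (rule hom_rules | simp)+)[1], (simp_all add: nv)[2], (rule l2)[1], (rule l4)[1])
    show ?thesis using l5 by (simp add: strip_step_def asq)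
  qed
qed

lemma slr_Qt_Z:
  assumes "fresh ((a, b) # L) c" "L \<noteq> []"
  shows "slr ((Var b * pP (vstrip L c) + d2 (vstrip L c) + (t1 (vstrip L c) - t2 (vstrip L c))) * (Var b * pP (vstrip L c) + d1 (vstrip L c) + d2 (vstrip L c)))"
proof -
  have ab: "a \<noteq> b" "b \<noteq> a" "a \<notin> svars L c" "b \<notin> svars L c" "fresh L c" using assms by auto
  let ?P = "pP (vstrip L c)" and ?D1 = "d1 (vstrip L c)" and ?D2 = "d2 (vstrip L c)" and ?DM = "dm (vstrip L c)"
  let ?F = "ff (vstrip L c)" and ?T1 = "t1 (vstrip L c)" and ?T2 = "t2 (vstrip L c)" and ?X = "ch (vstrip L c)"
  let ?Y = "ps (vstrip L c)" and ?k = "length L" and ?A = "Var a" and ?B = "Var b"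
  note rl = net_rels[of L c]
  note nv = notin_vars net_notin_vars[OF ab(3)] net_notin_vars[OF ab(4)] ab(1,2)
  note nz = net_nz[OF ab(5)]
  have cardS: "card (svars L c) = 2 * ?k + 1" using ab card_svars by auto
  have kk: "length L \<ge> 1" using assms by (cases L) auto
  note k1 = net_nz1[OF ab(5) kk]
  have fr: "fresh ((a, b) # L) c" using ab by simp
  note sc = slr_comps[OF fr] slr_comps(3-6,8,9)[OF fr assms(2)]
  have l3: "slr_pair (Upair ((?B * ?P + ?D2 + (?T1 - ?T2))) ((?B * ?P + ?D1 + ?D2)))"
  by (rule slr_pair_linear'[where x = b and ?f1.0 = "?P" and ?f0.0 = "?D2 + (?T1 - ?T2)" and ?g1.0 = "?P" and ?g0.0 = "?D1 + ?D2"
      and d = "Suc ?k" and e = "Suc ?k" and r = "?P * (?D1 - (?T1 - ?T2))"],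
      (simp_all add: asq)[2], (rule hom_cast, (rule hom_rules | simp)+)[1], (rule hom_cast, (rule hom_rules | simp)+)[1], (use kk in auto)[2], (simp_all add: nv)[2], (use nz in auto)[1], (simp_all add: nv)[2], (use nz in auto)[1], (rule slr_pair_PP[OF ab(5) assms(2)])[1], (simp add: algebra_simps)[1], (rule slr_P_d1S[OF ab(5) assms(2)])[1])
  have l4: "slr (((?B * ?P + ?D2 + (?T1 - ?T2))) * ((?B * ?P + ?D1 + ?D2)))"
  proof (rule slr_factor')
    show "\<exists>d. hom d (((?B * ?P + ?D2 + (?T1 - ?T2))) * ((?B * ?P + ?D1 + ?D2)))" by (rule exI, (rule hom_rules | simp)+)
  qed (rule sc(12), rule sc(11), rule l3)
  show ?thesis using l4 by simp
qed

lemma pair_P_d1S: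
  assumes "fresh L c" "L \<noteq> []"
  shows "slr_pair (Upair (pP (vstrip L c)) (d1 (vstrip L c) - nS (vstrip L c)))"
  using assms
proof -
  have "slr_pair (Upair (pP (vstrip ((a, b) # L) c)) (d1 (vstrip ((a, b) # L) c) - nS (vstrip ((a, b) # L) c)))" if "fresh ((a, b) # L) c" for a b L c
  proof -
  have ab: "a \<noteq> b" "b \<noteq> a" "a \<notin> svars L c" "b \<notin> svars L c" "fresh L c" using that by auto
  let ?P = "pP (vstrip L c)" and ?D1 = "d1 (vstrip L c)" and ?D2 = "d2 (vstrip L c)" and ?DM = "dm (vstrip L c)"
  let ?F = "ff (vstrip L c)" and ?T1 = "t1 (vstrip L c)" and ?T2 = "t2 (vstrip L c)" and ?X = "ch (vstrip L c)"
  let ?Y = "ps (vstrip L c)" and ?k = "length L" and ?A = "Var a" and ?B = "Var b"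
  note rl = net_rels[of L c]
  note nv = notin_vars net_notin_vars[OF ab(3)] net_notin_vars[OF ab(4)] ab(1,2)
  note nz = net_nz[OF ab(5)]
  have cardS: "card (svars L c) = 2 * ?k + 1" using ab card_svars by auto
  show ?thesis
  proof (cases "L = []")
    case True
    have ca: "c \<noteq> a" "a \<noteq> c" "c \<noteq> b" "b \<noteq> c" using ab True by auto
    note nv = notin_vars ca ab(1,2)
    have bcnz: "?B + Var c \<noteq> 0" using vars_Var_add[OF ca(4)] by auto
    have sq: "slr ((?B + Var c)\<^sup>2)"
      by (rule slr_square'[OF _ slr_Var_add[OF ca(4)]]) (rule exI[of _ 0], simp add: hom_add)
    have p: "slr_pair (Upair 1 (?B + Var c))"
      by (rule slr_pair_neg[of 0 _ 1 _ "{b, c}"]) (use ca in \<open>auto simp: hom_add vars_Var_add\<close>)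
    have "slr_pair (Upair (?A + (?B + Var c)) (?A * (?B + Var c)))"
    proof (rule slr_pair_linear[where x = a and ?f1.0 = 1 and ?f0.0 = "(?B + Var c)" and ?g1.0 = "(?B + Var c)" and ?g0.0 = 0])
      show "hom 1 (?A + (?B + Var c))" "hom 2 (?A * (?B + Var c))" by (rule hom_cast, (rule hom_rules | simp)+)+
      show "slr (1 * 0 - (?B + Var c) * (?B + Var c))" using slr_uminus[OF sq] by (simp add: power2_eq_square)
    qed (use ca ab bcnz in \<open>auto simp: vars_Var_add algebra_simps p\<close>)
    then show ?thesis by (simp add: strip_step_def strip_end_def algebra_simps True)
  next
    case False
    then have kk: "?k \<ge> 1" by (cases L) auto
  note k1 = net_nz1[OF ab(5) kk]
  have fr: "fresh ((a, b) # L) c" using ab by simp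
  note sc = slr_comps[OF fr] slr_comps(3-6,8,9)[OF fr False]
  note QV = net_Q(1-3)[OF ab(5,4)] and Qnz = net_Q(4-7)[OF ab(5,4)]
  have n1: "slr_pair (Upair (?P) (?B * ?P + ?D2 + (?T1 - ?T2)))"
  by (rule slr_pair_neg[where d = "?k" and e = "Suc ?k" and V = "insert b (svars L c)"],
      (rule hom_cast, (rule hom_rules | simp)+)[1], (rule hom_cast, (rule hom_rules | simp)+)[1], (use k1 QV in auto)[1], (use kk in \<open>simp add: ab cardS \<close>)[1])
  have l1: "slr_pair (Upair (((?A + ?B) * ?P + ?D1 + ?D2)) (?A * (?B * ?P + ?D2 + (?T1 - ?T2))))"
  by (rule slr_pair_linear'[where x = a and ?f1.0 = "?P" and ?f0.0 = "(?B * ?P + ?D1 + ?D2)" and ?g1.0 = "?B * ?P + ?D2 + (?T1 - ?T2)" and ?g0.0 = "0"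
      and d = "Suc ?k" and e = "Suc (Suc ?k)" and r = "- ((?B * ?P + ?D2 + (?T1 - ?T2)) * (?B * ?P + ?D1 + ?D2))"],
      (simp_all add: asq)[2], (rule hom_cast, (rule hom_rules | simp)+)[1], (rule hom_cast, (rule hom_rules | simp)+)[1], (use kk in auto)[2], (simp_all add: nv)[2], (use nz Qnz in auto)[1], (simp_all add: nv)[2], (use nz Qnz in auto)[1], (rule n1)[1], (simp add: algebra_simps)[1], (rule slr_uminus[OF slr_Qt_Z[OF fr False]])[1])
    show ?thesis using l1 by (simp add: strip_step_def asq)
  qed
  qed
  then show ?thesis using assms by (cases L) auto
qed

text \<open>The combinations \<open>d1 - nS\<close> and \<open>d2 + nS\<close> alternate: a step
  turns the first into \<open>a * (b * pP + d2 + nS)\<close> and the second into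
  \<open>a * (d1 - nS)\<close>. So the pair with \<open>d2 + nS\<close> reduces to the one with
  \<open>d1 - nS\<close> of the tail.\<close>

lemma pair_P_d2S:
  assumes "fresh ((a, b) # L) c" "L \<noteq> []"
  shows "slr_pair (Upair (pP (vstrip ((a, b) # L) c)) (d2 (vstrip ((a, b) # L) c) + nS (vstrip ((a, b) # L) c)))"
proof -
  have ab: "a \<noteq> b" "b \<noteq> a" "a \<notin> svars L c" "b \<notin> svars L c" "fresh L c" using assms by auto
  let ?P = "pP (vstrip L c)" and ?D1 = "d1 (vstrip L c)" and ?D2 = "d2 (vstrip L c)" and ?DM = "dm (vstrip L c)"
  let ?F = "ff (vstrip L c)" and ?T1 = "t1 (vstrip L c)" and ?T2 = "t2 (vstrip L c)" and ?X = "ch (vstrip L c)"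
  let ?Y = "ps (vstrip L c)" and ?k = "length L" and ?A = "Var a" and ?B = "Var b"
  note rl = net_rels[of L c]
  note nv = notin_vars net_notin_vars[OF ab(3)] net_notin_vars[OF ab(4)] ab(1,2)
  note nz = net_nz[OF ab(5)]
  have cardS: "card (svars L c) = 2 * ?k + 1" using ab card_svars by auto
  have kk: "length L \<ge> 1" using assms by (cases L) auto
  note k1 = net_nz1[OF ab(5) kk]
  have l1: "slr ((?B * ?P + ?D1 + ?D2) * (?D1 - (?T1 - ?T2)))"
  by (rule slr_linear'[where x = b and ?f1.0 = "?P * (?D1 - (?T1 - ?T2))" and ?f0.0 = "(?D1 + ?D2) * (?D1 - (?T1 - ?T2))"],
      (simp add: asq)[1], (rule exI, (rule hom_rules | simp)+)[1], (simp_all add: nv)[2], (use nz k1 in auto)[1], (rule slr_P_d1S[OF ab(5) assms(2)])[1])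
  have l2: "slr_pair (Upair (((?A + ?B) * ?P + ?D1 + ?D2)) (?A * (?D1 - (?T1 - ?T2))))"
  by (rule slr_pair_linear'[where x = a and ?f1.0 = "?P" and ?f0.0 = "(?B * ?P + ?D1 + ?D2)" and ?g1.0 = "?D1 - (?T1 - ?T2)" and ?g0.0 = "0"
      and d = "Suc ?k" and e = "Suc (Suc ?k)" and r = "- ((?B * ?P + ?D1 + ?D2) * (?D1 - (?T1 - ?T2)))"],
      (simp_all add: asq)[2], (rule hom_cast, (rule hom_rules | simp)+)[1], (rule hom_cast, (rule hom_rules | simp)+)[1], (use kk in auto)[2], (simp_all add: nv)[2], (use nz k1 in auto)[1], (simp_all add: nv)[2], (use nz k1 in auto)[1], (rule pair_P_d1S[OF ab(5) assms(2)])[1], (simp add: algebra_simps)[1], (rule slr_uminus[OF l1])[1])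
  show ?thesis using l2 by (simp add: strip_step_def algebra_simps)
qed

text \<open>By \<open>strip_I4\<close> the resultant in \<open>a\<close> is no longer a square: its
  two factors differ by \<open>nS\<close>, so their own resultant in \<open>b\<close> is
  \<open>pP * nS\<close>.\<close>

lemma pair_P_V:
  assumes "fresh ((a, b) # L) c" "L \<noteq> []"
  shows "slr_pair (Upair (pP (vstrip ((a, b) # L) c)) (nV (vstrip ((a, b) # L) c)))"
proof -
  have ab: "a \<noteq> b" "b \<noteq> a" "a \<notin> svars L c" "b \<notin> svars L c" "fresh L c" using assms by auto
  let ?P = "pP (vstrip L c)" and ?D1 = "d1 (vstrip L c)" and ?D2 = "d2 (vstrip L c)" and ?DM = "dm (vstrip L c)"
  let ?F = "ff (vstrip L c)" and ?T1 = "t1 (vstrip L c)" and ?T2 = "t2 (vstrip L c)" and ?X = "ch (vstrip L c)"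
  let ?Y = "ps (vstrip L c)" and ?k = "length L" and ?A = "Var a" and ?B = "Var b"
  note rl = net_rels[of L c]
  note nv = notin_vars net_notin_vars[OF ab(3)] net_notin_vars[OF ab(4)] ab(1,2)
  note nz = net_nz[OF ab(5)]
  have cardS: "card (svars L c) = 2 * ?k + 1" using ab card_svars by auto
  have kk: "length L \<ge> 1" using assms by (cases L) auto
  note k1 = net_nz1[OF ab(5) kk]
  have fr: "fresh ((a, b) # L) c" using ab by simp
  note sc = slr_comps[OF fr] slr_comps(3-6,8,9)[OF fr assms(2)]
  note QV = net_Q(1-3)[OF ab(5,4)] and Qnz = net_Q(4-7)[OF ab(5,4)]
  have n1: "slr_pair (Upair (?P) (?B * ?P + ?D2 + (?DM - ?T2)))"
  by (rule slr_pair_neg[where d = "?k" and e = "Suc ?k" and V = "insert b (svars L c)"],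
      (rule hom_cast, (rule hom_rules | simp)+)[1], (rule hom_cast, (rule hom_rules | simp)+)[1], (use k1 QV in auto)[1], (use kk in \<open>simp add: ab cardS \<close>)[1])
  have l3: "slr_pair (Upair ((?B * ?P + ?D2)) ((?B * ?P + ?D2 + (?T1 - ?T2))))"
  by (rule slr_pair_linear'[where x = b and ?f1.0 = "?P" and ?f0.0 = "?D2" and ?g1.0 = "?P" and ?g0.0 = "?D2 + (?T1 - ?T2)"
      and d = "Suc ?k" and e = "Suc ?k" and r = "?P * (?T1 - ?T2)"],
      (simp_all add: asq)[2], (rule hom_cast, (rule hom_rules | simp)+)[1], (rule hom_cast, (rule hom_rules | simp)+)[1], (use kk in auto)[2], (simp_all add: nv)[2], (use nz in auto)[1], (simp_all add: nv)[2], (use nz in auto)[1], (rule slr_pair_PP[OF ab(5) assms(2)])[1], (simp add: algebra_simps)[1], (rule slr_P_S[OF ab(5)])[1])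
  have l4: "slr (((?B * ?P + ?D2)) * ((?B * ?P + ?D2 + (?T1 - ?T2))))"
  proof (rule slr_factor')
    show "\<exists>d. hom d (((?B * ?P + ?D2)) * ((?B * ?P + ?D2 + (?T1 - ?T2))))" by (rule exI, (rule hom_rules | simp)+)
  qed (rule sc(10), rule sc(12), rule l3)
  have l1: "slr_pair (Upair (((?A + ?B) * ?P + ?D1 + ?D2)) (?A * (?B * ?P + ?D2) + (?A * ?DM + ?B * (?D1 + ?DM) + ?F) - (?A * ?T2 + ?B * ?T1 + ?X + ?Y)))"
  by (rule slr_pair_linear'[where x = a and ?f1.0 = "?P" and ?f0.0 = "(?B * ?P + ?D1 + ?D2)" and ?g1.0 = "?B * ?P + ?D2 + (?DM - ?T2)" and ?g0.0 = "?B * (?D1 + ?DM - ?T1) + (?F - ?X - ?Y)"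
      and d = "Suc ?k" and e = "Suc (Suc ?k)" and r = "- ((?B * ?P + ?D2) * (?B * ?P + ?D2 + (?T1 - ?T2)))"],
      (simp_all add: asq)[2], (rule hom_cast, (rule hom_rules | simp)+)[1], (rule hom_cast, (rule hom_rules | simp)+)[1], (use kk in auto)[2], (simp_all add: nv)[2], (use nz Qnz in auto)[1], (simp_all add: nv)[2], (use nz Qnz in auto)[1], (rule n1)[1], (rule strip_I4[OF rl])[1], (rule slr_uminus[OF l4])[1])
  show ?thesis using l1 by (simp add: strip_step_def)
qed

lemma slr_P_W:
  assumes "fresh L c" "L \<noteq> []"
  shows "slr (pP (vstrip L c) * nW (vstrip L c))"
  using assms
proof (induction L c rule: fresh.induct)
  case (1 c)
  then show ?case by simp
next
  case (2 a b L c)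
  have ab: "a \<noteq> b" "b \<noteq> a" "a \<notin> svars L c" "b \<notin> svars L c" "fresh L c" using 2 by auto
  let ?P = "pP (vstrip L c)" and ?D1 = "d1 (vstrip L c)" and ?D2 = "d2 (vstrip L c)" and ?DM = "dm (vstrip L c)"
  let ?F = "ff (vstrip L c)" and ?T1 = "t1 (vstrip L c)" and ?T2 = "t2 (vstrip L c)" and ?X = "ch (vstrip L c)"
  let ?Y = "ps (vstrip L c)" and ?k = "length L" and ?A = "Var a" and ?B = "Var b"
  note rl = net_rels[of L c]
  note nv = notin_vars net_notin_vars[OF ab(3)] net_notin_vars[OF ab(4)] ab(1,2)
  note nz = net_nz[OF ab(5)]
  have cardS: "card (svars L c) = 2 * ?k + 1" using ab card_svars by auto
  show ?case
  proof (cases "L = []")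
    case True
    have ca: "c \<noteq> a" "a \<noteq> c" "c \<noteq> b" "b \<noteq> c" using ab True by auto
    note nv = notin_vars ca ab(1,2)
  have l1: "slr ((?A + ?B + Var c) * (?A * Var c))"
  by (rule slr_linear'[where x = b and ?f1.0 = "?A * Var c" and ?f0.0 = "(?A + Var c) * (?A * Var c)"],
      (simp add: asq)[1], (rule exI, (rule hom_rules | simp)+)[1], (simp_all add: nv)[2], (use ca in auto)[1], (rule slr_Var_Var[OF ca(2)])[1])
    show ?thesis using slr_uminus[OF l1] by (simp add: strip_step_def strip_end_def asq True)
  next
    case False
    then have kk: "?k \<ge> 1" by (cases L) auto
  note k1 = net_nz1[OF ab(5) kk]
  have fr: "fresh ((a, b) # L) c" using ab by simp
  note sc = slr_comps[OF fr] slr_comps(3-6,8,9)[OF fr False]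
  obtain a' b' L' where L: "L = (a', b') # L'" using False by (metis neq_Nil_conv surj_pair)
    show ?thesis
    \<comment> \<open>\<open>pair_P_V\<close> requires a tail of at least two triangles. The strip
      with two triangles in all is done by hand; there \<open>nW\<close> is the monomial
      \<open>b * a' * b'\<close>.\<close>
    proof (cases "L' = []")
      case True
    have sg: "c \<noteq> a'" "c \<noteq> b'" "c \<noteq> a" "c \<noteq> b" "a' \<noteq> b'" "a' \<noteq> c" "b' \<noteq> c" "a \<noteq> c" "b \<noteq> c" "a \<noteq> a'" "a \<noteq> b'" "b \<noteq> a'" "b \<noteq> b'" "a' \<noteq> a" "b' \<noteq> a" "a' \<noteq> b" "b' \<noteq> b" "b' \<noteq> a'"
      using ab L True by auto
    note nv = notin_vars sg ab(1,2)
  have l1: "slr (?B * (Var a' * Var b'))"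
  by (rule slr_linear'[where x = b and ?f1.0 = "Var a' * Var b'" and ?f0.0 = "0"],
      (simp add: asq)[1], (rule exI, (rule hom_rules | simp)+)[1], (simp_all add: nv)[2], (use sg in auto)[1], (rule slr_Var_Var[OF sg(5)])[1])
  have l2: "slr ((Var a' + Var b' + Var c) * (?B * (Var a' * Var b')))"
  by (rule slr_linear'[where x = c and ?f1.0 = "?B * (Var a' * Var b')" and ?f0.0 = "(Var a' + Var b') * (?B * (Var a' * Var b'))"],
      (simp add: asq)[1], (rule exI, (rule hom_rules | simp)+)[1], (simp_all add: nv)[2], (use sg in auto)[1], (rule l1)[1])
    have pnz: "(Var a' + Var b' + Var c) \<noteq> 0" using split_eq_0[of c 1 "Var a' + Var b'"] by (simp add: nv algebra_simps)
  have l3: "slr (((?A + ?B) * (Var a' + Var b' + Var c) + Var a' * Var b' + Var a' * Var c) * (?B * (Var a' * Var b')))"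
  by (rule slr_linear'[where x = a and ?f1.0 = "(Var a' + Var b' + Var c) * (?B * (Var a' * Var b'))" and ?f0.0 = "(?B * (Var a' + Var b' + Var c) + Var a' * Var b' + Var a' * Var c) * (?B * (Var a' * Var b'))"],
      (simp add: asq)[1], (rule exI, (rule hom_rules | simp)+)[1], (simp_all add: nv)[2], (use pnz in auto)[1], (rule l2)[1])
      show ?thesis using l3 by (simp add: strip_step_def strip_end_def asq True L)
    next
      case False
      note pv = pair_P_V[of a' b' L' c, folded L, OF ab(5) False]
  have l1: "slr (?D1 * (?A * ?P + ?D1 - (?T1 - ?T2)))"
  by (rule slr_linear'[where x = a and ?f1.0 = "?P * ?D1" and ?f0.0 = "?D1 * (?D1 - (?T1 - ?T2))"],
      (simp add: asq)[1], (rule exI, (rule hom_rules | simp)+)[1], (simp_all add: nv)[2], (use nz in auto)[1], (rule slr_P_d1[OF ab(5) \<open>L \<noteq> []\<close>])[1])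
  have l2: "slr_pair (Upair (((?A + ?B) * ?P + ?D1 + ?D2)) (?A * ?DM + ?B * (?D1 + ?DM) + ?F - ((?A + ?B) * ?T1 + ?X + ?Y)))"
  by (rule slr_pair_linear'[where x = b and ?f1.0 = "?P" and ?f0.0 = "?A * ?P + ?D1 + ?D2" and ?g1.0 = "(?D1 + ?DM - ?T1)" and ?g0.0 = "?A * (?DM - ?T1) + (?F - ?X - ?Y)"
      and d = "Suc ?k" and e = "Suc (Suc ?k)" and r = "- (?D1 * (?A * ?P + ?D1 - (?T1 - ?T2)))"],
      (simp_all add: asq)[2], (rule hom_cast, (rule hom_rules | simp)+)[1], (rule hom_cast, (rule hom_rules | simp)+)[1], (use kk in auto)[2], (simp_all add: nv)[2], (use nz k1 in auto)[1], (simp_all add: nv)[2], (use nz k1 in auto)[1], (rule pv)[1], (rule strip_I6[OF rl])[1], (rule slr_uminus[OF l1])[1])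
      have sP: "slr (((?A + ?B) * ?P + ?D1 + ?D2))" using slr_P[OF fr] by (simp add: strip_step_def)
      have sW: "slr (?A * ?DM + ?B * (?D1 + ?DM) + ?F - ((?A + ?B) * ?T1 + ?X + ?Y))" using sc(9)[OF \<open>L \<noteq> []\<close>] by (simp add: strip_step_def)
  have l3: "slr ((((?A + ?B) * ?P + ?D1 + ?D2)) * (?A * ?DM + ?B * (?D1 + ?DM) + ?F - ((?A + ?B) * ?T1 + ?X + ?Y)))"
  proof (rule slr_factor')
    show "\<exists>d. hom d ((((?A + ?B) * ?P + ?D1 + ?D2)) * (?A * ?DM + ?B * (?D1 + ?DM) + ?F - ((?A + ?B) * ?T1 + ?X + ?Y)))" by (rule exI, (rule hom_rules | simp)+)
  qed (rule sP, rule sW, rule l2)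
      show ?thesis using l3 by (simp add: strip_step_def)
    qed
  qed
qed

lemma slr_P_U:
  assumes "fresh ((a, b) # L) c" "L \<noteq> []"
  shows "slr (pP (vstrip ((a, b) # L) c) * nU (vstrip ((a, b) # L) c))"
proof -
  have ab: "a \<noteq> b" "b \<noteq> a" "a \<notin> svars L c" "b \<notin> svars L c" "fresh L c" using assms by auto
  let ?P = "pP (vstrip L c)" and ?D1 = "d1 (vstrip L c)" and ?D2 = "d2 (vstrip L c)" and ?DM = "dm (vstrip L c)"
  let ?F = "ff (vstrip L c)" and ?T1 = "t1 (vstrip L c)" and ?T2 = "t2 (vstrip L c)" and ?X = "ch (vstrip L c)"
  let ?Y = "ps (vstrip L c)" and ?k = "length L" and ?A = "Var a" and ?B = "Var b"
  note rl = net_rels[of L c]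
  note nv = notin_vars net_notin_vars[OF ab(3)] net_notin_vars[OF ab(4)] ab(1,2)
  note nz = net_nz[OF ab(5)]
  have cardS: "card (svars L c) = 2 * ?k + 1" using ab card_svars by auto
  have kk: "length L \<ge> 1" using assms by (cases L) auto
  note k1 = net_nz1[OF ab(5) kk]
  have fr: "fresh ((a, b) # L) c" using ab by simp
  note sc = slr_comps[OF fr] slr_comps(3-6,8,9)[OF fr assms(2)]
  obtain a' b' L' where L: "L = (a', b') # L'" using assms(2) by (metis neq_Nil_conv surj_pair)
    show ?thesis
    \<comment> \<open>For two triangles in all, \<open>nU\<close> is
      \<open>a' * (b * b' - a * c)\<close>, and \<open>pP\<close> becomes
      \<open>(a + b) * (b' + c)\<close> at \<open>a' = 0\<close>.\<close>
    proof (cases "L' = []")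
      case True
    have sg: "c \<noteq> a'" "c \<noteq> b'" "c \<noteq> a" "c \<noteq> b" "a' \<noteq> b'" "a' \<noteq> c" "b' \<noteq> c" "a \<noteq> c" "b \<noteq> c" "a \<noteq> a'" "a \<noteq> b'" "b \<noteq> a'" "b \<noteq> b'" "a' \<noteq> a" "b' \<noteq> a" "a' \<noteq> b" "b' \<noteq> b" "b' \<noteq> a'"
      using ab L True by auto
    note nv = notin_vars sg ab(1,2)
      have bnz: "Var b' + Var c \<noteq> 0" "?A + ?B + Var b' + Var c \<noteq> 0" "(?B * Var b' - ?A * Var c) \<noteq> 0" "vars (?A + ?B + Var b' + Var c) = {a, b, b', c}"
        using vars_split[of c 1 "Var b'"] vars_split[of a 1 "?B + (Var b' + Var c)"] vars_split[of b 1 "Var b' + Var c"] vars_Var_add[of b' c]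
          split_eq_0[of b "Var b'" "- (?A * Var c)"]
        by (auto simp: nv algebra_simps)
      have s1: "slr (?A + ?B + Var b' + Var c)"
        by (rule slr_hom_neg[of 1]) (rule hom_cast, (rule hom_rules | simp)+, simp only: bnz, simp add: nv)
  have s2: "slr ((?B * Var b' - ?A * Var c))"
  by (rule slr_linear'[where x = b and ?f1.0 = "Var b'" and ?f0.0 = "- (?A * Var c)"],
      (simp add: asq)[1], (rule exI, (rule hom_rules | simp)+)[1], (simp_all add: nv)[2], (use sg in auto)[1], (rule slr_Var)[1])
  have n1: "slr_pair (Upair (?A + ?B + Var b' + Var c) ((?B * Var b' - ?A * Var c)))"
  by (rule slr_pair_neg[where d = "1" and e = "2" and V = "{a, b, b', c}"],
      (rule hom_cast, (rule hom_rules | simp)+)[1], (rule hom_cast, (rule hom_rules | simp)+)[1], (use bnz(4) in blast)[1], (use kk in \<open>simp add: ab cardS sg\<close>)[1])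
  have b1: "slr ((?A + ?B + Var b' + Var c) * ((?B * Var b' - ?A * Var c)))"
  proof (rule slr_factor')
    show "\<exists>d. hom d ((?A + ?B + Var b' + Var c) * ((?B * Var b' - ?A * Var c)))" by (rule exI, (rule hom_rules | simp)+)
  qed (rule s1, rule s2, rule n1)
  have q0: "slr ((?A + ?B) * (Var b' + Var c))"
  by (rule slr_linear'[where x = a and ?f1.0 = "Var b' + Var c" and ?f0.0 = "?B * (Var b' + Var c)"],
      (simp add: asq)[1], (rule exI, (rule hom_rules | simp)+)[1], (simp_all add: nv)[2], (use bnz in auto)[1], (rule slr_Var_add[OF sg(7)])[1])
      have "slr_pair (Upair (Var b' + Var c) (Var c))"
        by (rule slr_pair_Var[of "Var b'" _ 1]) (use slr_Var hom_homogeneous[OF hom_add[OF hom_Var hom_Var]] vars_Var_add[OF sg(7)] sg in auto)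
      then have p0: "slr_pair (Upair (Var b' + Var c) (- Var c))" by (rule slr_pair_sign) auto
      have sq: "slr ((Var b' + Var c)\<^sup>2)"
        by (rule slr_square'[OF _ slr_Var_add[OF sg(7)]]) (rule exI[of _ 0], simp add: hom_add)
  have q1: "slr (?B * (Var b' + Var c)\<^sup>2)"
  by (rule slr_linear'[where x = b and ?f1.0 = "(Var b' + Var c)\<^sup>2" and ?f0.0 = "0"],
      (simp add: asq)[1], (rule exI, (rule hom_rules | simp)+)[1], (simp_all add: nv)[2], (use bnz in auto)[1], (rule sq)[1])
  have q2: "slr_pair (Upair ((?A + ?B) * (Var b' + Var c)) ((?B * Var b' - ?A * Var c)))"
  by (rule slr_pair_linear'[where x = a and ?f1.0 = "Var b' + Var c" and ?f0.0 = "?B * (Var b' + Var c)" and ?g1.0 = "- Var c" and ?g0.0 = "?B * Var b'"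
      and d = "2" and e = "2" and r = "?B * (Var b' + Var c)\<^sup>2"],
      (simp_all add: asq)[2], (rule hom_cast, (rule hom_rules | simp)+)[1], (rule hom_cast, (rule hom_rules | simp)+)[1], (auto)[1], (auto)[1], (simp_all add: nv)[2], (use bnz in auto)[1], (simp_all add: nv)[2], (use bnz in auto)[1], (rule p0)[1], (simp add: asq)[1], (rule q1)[1])
  have b0: "slr (((?A + ?B) * (Var b' + Var c)) * ((?B * Var b' - ?A * Var c)))"
  proof (rule slr_factor')
    show "\<exists>d. hom d (((?A + ?B) * (Var b' + Var c)) * ((?B * Var b' - ?A * Var c)))" by (rule exI, (rule hom_rules | simp)+)
  qed (rule q0, rule s2, rule q2)
  have h1: "slr (((?A + ?B) * (Var a' + Var b' + Var c) + Var a' * Var b' + Var a' * Var c) * (?B * Var b' - ?A * Var c))"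
  by (rule slr_linear'[where x = a' and ?f1.0 = "(?A + ?B + Var b' + Var c) * (?B * Var b' - ?A * Var c)" and ?f0.0 = "(?A + ?B) * (Var b' + Var c) * (?B * Var b' - ?A * Var c)"],
      (simp add: asq)[1], (rule exI, (rule hom_rules | simp)+)[1], (simp_all add: nv)[2], (use bnz in auto)[1], (rule b1)[1])
  have h2: "slr (Var a' * (((?A + ?B) * (Var a' + Var b' + Var c) + Var a' * Var b' + Var a' * Var c) * (?B * Var b' - ?A * Var c)))"
  by (rule slr_Var_mult'[where ?B1.0 = "(?A + ?B + Var b' + Var c) * (?B * Var b' - ?A * Var c)" and ?B0.0 = "(?A + ?B) * (Var b' + Var c) * (?B * Var b' - ?A * Var c)"],
      (simp add: asq)[1], (rule exI[of _ "3"], rule hom_cast, (rule hom_rules | simp)+)[1], (simp_all add: nv)[2], (rule h1)[1], (rule b0)[1])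
      show ?thesis using h2 by (simp add: strip_step_def strip_end_def asq True L)
    next
      case False
      note pv = pair_P_V[of a' b' L' c, folded L, OF ab(5) False]
      have p1: "slr ((?D1 - (?T1 - ?T2)) * ?P)" using slr_P_d1S[OF ab(5) assms(2)] by (simp add: mult.commute)
  have l1: "slr ((?D1 - (?T1 - ?T2)) * (?A * ?P + ?D1))"
  by (rule slr_linear'[where x = a and ?f1.0 = "(?D1 - (?T1 - ?T2)) * ?P" and ?f0.0 = "(?D1 - (?T1 - ?T2)) * ?D1"],
      (simp add: asq)[1], (rule exI, (rule hom_rules | simp)+)[1], (simp_all add: nv)[2], (use nz k1 in auto)[1], (rule p1)[1])
  have l2: "slr_pair (Upair (((?A + ?B) * ?P + ?D1 + ?D2)) (?A * ?DM + ?B * (?D1 + ?DM) + ?F - (?A * ?T2 + ?B * ?T1 + ?X + ?Y)))"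
  by (rule slr_pair_linear'[where x = b and ?f1.0 = "?P" and ?f0.0 = "?A * ?P + ?D1 + ?D2" and ?g1.0 = "(?D1 + ?DM - ?T1)" and ?g0.0 = "?A * (?DM - ?T2) + (?F - ?X - ?Y)"
      and d = "Suc ?k" and e = "Suc (Suc ?k)" and r = "- ((?D1 - (?T1 - ?T2)) * (?A * ?P + ?D1))"],
      (simp_all add: asq)[2], (rule hom_cast, (rule hom_rules | simp)+)[1], (rule hom_cast, (rule hom_rules | simp)+)[1], (use kk in auto)[2], (simp_all add: nv)[2], (use nz k1 in auto)[1], (simp_all add: nv)[2], (use nz k1 in auto)[1], (rule pv)[1], (rule strip_I7[OF rl])[1], (rule slr_uminus[OF l1])[1])
      have sP: "slr (((?A + ?B) * ?P + ?D1 + ?D2))" using slr_P[OF fr] by (simp add: strip_step_def)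
      have sU: "slr (?A * ?DM + ?B * (?D1 + ?DM) + ?F - (?A * ?T2 + ?B * ?T1 + ?X + ?Y))" using sc(8)[OF assms(2)] by (simp add: strip_step_def)
  have l3: "slr ((((?A + ?B) * ?P + ?D1 + ?D2)) * (?A * ?DM + ?B * (?D1 + ?DM) + ?F - (?A * ?T2 + ?B * ?T1 + ?X + ?Y)))"
  proof (rule slr_factor')
    show "\<exists>d. hom d ((((?A + ?B) * ?P + ?D1 + ?D2)) * (?A * ?DM + ?B * (?D1 + ?DM) + ?F - (?A * ?T2 + ?B * ?T1 + ?X + ?Y)))" by (rule exI, (rule hom_rules | simp)+)
  qed (rule sP, rule sU, rule l2)
      show ?thesis using l3 by (simp add: strip_step_def)
    qed
qed

text \<open>The resultant of the two factors in \<open>b\<close> is \<open>d1 * nW\<close> of the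
  tail. Its reducibility is an assumption because this lemma is used inside the induction that
  proves it.\<close>

lemma slr_Q_VG:
  assumes "fresh ((a, b) # L) c" "L \<noteq> []" "slr (d1 (vstrip L c) * nW (vstrip L c))"
  shows "slr ((Var b * pP (vstrip L c) + d2 (vstrip L c)) * (Var b * (d1 (vstrip L c) + dm (vstrip L c) - t1 (vstrip L c)) + (ff (vstrip L c) - ch (vstrip L c) - ps (vstrip L c))))"
proof -
  have ab: "a \<noteq> b" "b \<noteq> a" "a \<notin> svars L c" "b \<notin> svars L c" "fresh L c" using assms by auto
  let ?P = "pP (vstrip L c)" and ?D1 = "d1 (vstrip L c)" and ?D2 = "d2 (vstrip L c)" and ?DM = "dm (vstrip L c)"
  let ?F = "ff (vstrip L c)" and ?T1 = "t1 (vstrip L c)" and ?T2 = "t2 (vstrip L c)" and ?X = "ch (vstrip L c)"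
  let ?Y = "ps (vstrip L c)" and ?k = "length L" and ?A = "Var a" and ?B = "Var b"
  note rl = net_rels[of L c]
  note nv = notin_vars net_notin_vars[OF ab(3)] net_notin_vars[OF ab(4)] ab(1,2)
  note nz = net_nz[OF ab(5)]
  have cardS: "card (svars L c) = 2 * ?k + 1" using ab card_svars by auto
  have kk: "length L \<ge> 1" using assms by (cases L) auto
  note k1 = net_nz1[OF ab(5) kk]
  have fr: "fresh ((a, b) # L) c" using ab by simp
  note sc = slr_comps[OF fr] slr_comps(3-6,8,9)[OF fr assms(2)]
  obtain a' b' L' where L: "L = (a', b') # L'" using assms(2) by (metis neq_Nil_conv surj_pair)
    show ?thesis
    proof (cases "L' = []")
      case True
    have sg: "c \<noteq> a'" "c \<noteq> b'" "c \<noteq> a" "c \<noteq> b" "a' \<noteq> b'" "a' \<noteq> c" "b' \<noteq> c" "a \<noteq> c" "b \<noteq> c" "a \<noteq> a'" "a \<noteq> b'" "b \<noteq> a'" "b \<noteq> b'" "a' \<noteq> a" "b' \<noteq> a" "a' \<noteq> b" "b' \<noteq> b" "b' \<noteq> a'"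
      using ab L True by auto
    note nv = notin_vars sg ab(1,2)
  have s1: "slr ((Var a' + Var b' + Var c) * (Var a' * Var b'))"
  by (rule slr_linear'[where x = c and ?f1.0 = "Var a' * Var b'" and ?f0.0 = "(Var a' + Var b') * (Var a' * Var b')"],
      (simp add: asq)[1], (rule exI, (rule hom_rules | simp)+)[1], (simp_all add: nv)[2], (use sg in auto)[1], (rule slr_Var_Var[OF sg(5)])[1])
    have pnz: "(Var a' + Var b' + Var c) \<noteq> 0" using split_eq_0[of c 1 "Var a' + Var b'"] by (simp add: nv algebra_simps)
  have s2: "slr ((?B * (Var a' + Var b' + Var c) + Var a' * Var c) * (Var a' * Var b'))"
  by (rule slr_linear'[where x = b and ?f1.0 = "(Var a' + Var b' + Var c) * (Var a' * Var b')" and ?f0.0 = "Var a' * Var c * (Var a' * Var b')"],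
      (simp add: asq)[1], (rule exI, (rule hom_rules | simp)+)[1], (simp_all add: nv)[2], (use pnz in auto)[1], (rule s1)[1])
  have s3: "slr (Var a' * (Var b' * Var c))"
  by (rule slr_linear'[where x = a' and ?f1.0 = "Var b' * Var c" and ?f0.0 = "0"],
      (simp add: asq)[1], (rule exI, (rule hom_rules | simp)+)[1], (simp_all add: nv)[2], (use sg in auto)[1], (rule slr_Var_Var[OF sg(7)])[1])
    have s4: "slr (Var a' * Var c * (Var a' * Var b'))"
      by (rule slr_square[of 4 _ "Var a'" "Var b' * Var c" 0]) (rule hom_cast, (rule hom_rules | simp)+, simp_all add: power2_eq_square s3)
  have s5: "slr (Var b * ((?B * (Var a' + Var b' + Var c) + Var a' * Var c) * (Var a' * Var b')))"
  by (rule slr_Var_mult'[where ?B1.0 = "(Var a' + Var b' + Var c) * (Var a' * Var b')" and ?B0.0 = "Var a' * Var c * (Var a' * Var b')"],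
      (simp add: asq)[1], (rule exI[of _ "3"], rule hom_cast, (rule hom_rules | simp)+)[1], (simp_all add: nv)[2], (rule s2)[1], (rule s4)[1])
      show ?thesis using s5 by (simp add: strip_step_def strip_end_def asq True L)
    next
      case False
      note pv = pair_P_V[of a' b' L' c, folded L, OF ab(5) False]
  have l3: "slr_pair (Upair ((?B * ?P + ?D2)) ((?B * (?D1 + ?DM - ?T1) + (?F - ?X - ?Y))))"
  by (rule slr_pair_linear'[where x = b and ?f1.0 = "?P" and ?f0.0 = "?D2" and ?g1.0 = "(?D1 + ?DM - ?T1)" and ?g0.0 = "(?F - ?X - ?Y)"
      and d = "Suc ?k" and e = "Suc (Suc ?k)" and r = "?D1 * (?DM - ?T2)"],
      (simp_all add: asq)[2], (rule hom_cast, (rule hom_rules | simp)+)[1], (rule hom_cast, (rule hom_rules | simp)+)[1], (use kk in auto)[2], (simp_all add: nv)[2], (use nz k1 in auto)[1], (simp_all add: nv)[2], (use nz k1 in auto)[1], (rule pv)[1], (rule strip_I5[OF rl])[1], (rule assms(3))[1])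
  have l4: "slr (((?B * ?P + ?D2)) * ((?B * (?D1 + ?DM - ?T1) + (?F - ?X - ?Y))))"
  proof (rule slr_factor')
    show "\<exists>d. hom d (((?B * ?P + ?D2)) * ((?B * (?D1 + ?DM - ?T1) + (?F - ?X - ?Y))))" by (rule exI, (rule hom_rules | simp)+)
  qed (rule sc(10), rule sc(13), rule l3)
      show ?thesis using l4 by simp
    qed
qed

lemma slr_d1_W:
  assumes "fresh L c" "L \<noteq> []"
  shows "slr (d1 (vstrip L c) * nW (vstrip L c))"
  using assms
proof (induction L c rule: fresh.induct)
  case (1 c)
  then show ?case by simp
next
  case (2 a b L c)
  have ab: "a \<noteq> b" "b \<noteq> a" "a \<notin> svars L c" "b \<notin> svars L c" "fresh L c" using 2 by auto
  let ?P = "pP (vstrip L c)" and ?D1 = "d1 (vstrip L c)" and ?D2 = "d2 (vstrip L c)" and ?DM = "dm (vstrip L c)"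
  let ?F = "ff (vstrip L c)" and ?T1 = "t1 (vstrip L c)" and ?T2 = "t2 (vstrip L c)" and ?X = "ch (vstrip L c)"
  let ?Y = "ps (vstrip L c)" and ?k = "length L" and ?A = "Var a" and ?B = "Var b"
  have tn: "tail_net (length L) (svars L c) (vstrip L c)" using ab tail_net_vstrip by simp
  note rl = net_rels[of L c]
  note nv = notin_vars net_notin_vars[OF ab(3)] net_notin_vars[OF ab(4)] ab(1,2)
  note nz = net_nz[OF ab(5)]
  have cardS: "card (svars L c) = 2 * ?k + 1" using ab card_svars by auto
  show ?case
  proof (cases "L = []")
    case True
    have ca: "c \<noteq> a" "a \<noteq> c" "c \<noteq> b" "b \<noteq> c" using ab True by auto
    note nv = notin_vars ca ab(1,2)
  have l0: "slr (?A * (?B * Var c))"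
  by (rule slr_linear'[where x = a and ?f1.0 = "?B * Var c" and ?f0.0 = "0"],
      (simp add: asq)[1], (rule exI, (rule hom_rules | simp)+)[1], (simp_all add: nv)[2], (use ca in auto)[1], (rule slr_Var_Var[OF ca(4)])[1])
    have l1: "slr (?A * ?A * (?B * Var c))"
      by (rule slr_square[of 4 _ ?A "?B * Var c" 0]) (rule hom_cast, (rule hom_rules | simp)+, simp_all add: power2_eq_square l0)
    show ?thesis using slr_uminus[OF l1] by (simp add: strip_step_def strip_end_def asq True)
  next
    case False
    then have kk: "?k \<ge> 1" by (cases L) auto
  note k1 = net_nz1[OF ab(5) kk]
  have fr: "fresh ((a, b) # L) c" using ab by simp
  note sc = slr_comps[OF fr] slr_comps(3-6,8,9)[OF fr False]
  note QV = net_Q(1-3)[OF ab(5,4)] and Qnz = net_Q(4-7)[OF ab(5,4)]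
  obtain a' b' L' where L: "L = (a', b') # L'" using False by (metis neq_Nil_conv surj_pair)
  have IH: "slr (?D1 * (?DM - ?T2))"
    using 2 False by simp
    note qv = slr_Q_VG[OF fr False IH]
    show ?thesis
    \<comment> \<open>For a tail with one triangle \<open>nU\<close> vanishes, so after removing the
      factor \<open>a\<close> nothing depends on \<open>a\<close> any more and the case has to be
      separated.\<close>
    proof (cases "L' = []")
      case True
      then have U0: "?DM = ?T1" by (simp add: L strip_step_def strip_end_def)
    have "(?B * (?D1 + ?DM - ?T1) + (?F - ?X - ?Y)) \<noteq> 0"
      using k1(2) split_eq_0[of b "(?D1 + ?DM - ?T1)" "(?F - ?X - ?Y)"] by (auto simp: nv mult.commute)
    then have k1': "(?B * ?P + ?D2) * (?B * (?D1 + ?DM - ?T1) + (?F - ?X - ?Y)) \<noteq> 0" using Qnz(1) by simp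
  have l1: "slr (?A * ((?B * ?P + ?D2) * (?B * (?D1 + ?DM - ?T1) + (?F - ?X - ?Y))))"
  by (rule slr_linear'[where x = a and ?f1.0 = "(?B * ?P + ?D2) * (?B * (?D1 + ?DM - ?T1) + (?F - ?X - ?Y))" and ?f0.0 = "0"],
      (simp add: asq)[1], (rule exI, (rule hom_rules | simp)+)[1], (simp_all add: nv)[2], (use k1' in auto)[1], (rule qv)[1])
      have "d1 (vstrip ((a, b) # L) c) * nW (vstrip ((a, b) # L) c) = ?A * ((?B * ?P + ?D2) * (?B * (?D1 + ?DM - ?T1) + (?F - ?X - ?Y)))"
        using U0 by (simp add: strip_step_def algebra_simps)
      then show ?thesis using l1 by simp
    next
      case False
      note pu = slr_P_U[of a' b' L' c, folded L, OF ab(5) False]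
      have kk2: "?k \<ge> 2" using L False by (cases L') auto
  have k2: "?DM - ?T1 \<noteq> 0" using tn kk2 by (simp add: tail_net_def)
  have l1: "slr ((?B * ?P + ?D2) * (?DM - ?T1))"
  by (rule slr_linear'[where x = b and ?f1.0 = "?P * (?DM - ?T1)" and ?f0.0 = "?D2 * (?DM - ?T1)"],
      (simp add: asq)[1], (rule exI, (rule hom_rules | simp)+)[1], (simp_all add: nv)[2], (use nz k2 in auto)[1], (rule pu)[1])
  have l2: "slr ((?B * ?P + ?D2) * (?A * ?DM + ?B * (?D1 + ?DM) + ?F - ((?A + ?B) * ?T1 + ?X + ?Y)))"
  by (rule slr_linear'[where x = a and ?f1.0 = "(?B * ?P + ?D2) * (?DM - ?T1)" and ?f0.0 = "(?B * ?P + ?D2) * (?B * (?D1 + ?DM - ?T1) + (?F - ?X - ?Y))"],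
      (simp add: asq)[1], (rule exI, (rule hom_rules | simp)+)[1], (simp_all add: nv)[2], (use Qnz k2 in auto)[1], (rule l1)[1])
  have l3: "slr (Var a * ((?B * ?P + ?D2) * (?A * ?DM + ?B * (?D1 + ?DM) + ?F - ((?A + ?B) * ?T1 + ?X + ?Y))))"
  by (rule slr_Var_mult'[where ?B1.0 = "(?B * ?P + ?D2) * (?DM - ?T1)" and ?B0.0 = "(?B * ?P + ?D2) * (?B * (?D1 + ?DM - ?T1) + (?F - ?X - ?Y))"],
      (simp add: asq)[1], (rule exI[of _ "2 * ?k + 2"], rule hom_cast, (rule hom_rules | simp)+)[1], (simp_all add: nv)[2], (rule l2)[1], (rule qv)[1])
      show ?thesis using l3 by (simp add: strip_step_def algebra_simps)
    qed
  qed
qed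

text \<open>The exchange of \<open>nU\<close> and \<open>nW\<close> by a step reduces this to the
  products with \<open>nW\<close> of the tail, so no further induction is required.\<close>

lemma slr_d1_U:
  assumes "fresh ((a, b) # L) c" "L \<noteq> []"
  shows "slr (d1 (vstrip ((a, b) # L) c) * nU (vstrip ((a, b) # L) c))"
proof -
  have ab: "a \<noteq> b" "b \<noteq> a" "a \<notin> svars L c" "b \<notin> svars L c" "fresh L c" using assms by auto
  let ?P = "pP (vstrip L c)" and ?D1 = "d1 (vstrip L c)" and ?D2 = "d2 (vstrip L c)" and ?DM = "dm (vstrip L c)"
  let ?F = "ff (vstrip L c)" and ?T1 = "t1 (vstrip L c)" and ?T2 = "t2 (vstrip L c)" and ?X = "ch (vstrip L c)"
  let ?Y = "ps (vstrip L c)" and ?k = "length L" and ?A = "Var a" and ?B = "Var b"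
  note rl = net_rels[of L c]
  note nv = notin_vars net_notin_vars[OF ab(3)] net_notin_vars[OF ab(4)] ab(1,2)
  note nz = net_nz[OF ab(5)]
  have cardS: "card (svars L c) = 2 * ?k + 1" using ab card_svars by auto
  have kk: "length L \<ge> 1" using assms by (cases L) auto
  note k1 = net_nz1[OF ab(5) kk]
  have fr: "fresh ((a, b) # L) c" using ab by simp
  note QV = net_Q(1-3)[OF ab(5,4)] and Qnz = net_Q(4-7)[OF ab(5,4)]
  note qv = slr_Q_VG[OF fr assms(2) slr_d1_W[OF ab(5) assms(2)]]
  have l1: "slr ((?B * ?P + ?D2) * (?DM - ?T2))"
  by (rule slr_linear'[where x = b and ?f1.0 = "?P * (?DM - ?T2)" and ?f0.0 = "?D2 * (?DM - ?T2)"],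
      (simp add: asq)[1], (rule exI, (rule hom_rules | simp)+)[1], (simp_all add: nv)[2], (use nz k1 in auto)[1], (rule slr_P_W[OF ab(5) assms(2)])[1])
  have l2: "slr ((?B * ?P + ?D2) * (?A * ?DM + ?B * (?D1 + ?DM) + ?F - (?A * ?T2 + ?B * ?T1 + ?X + ?Y)))"
  by (rule slr_linear'[where x = a and ?f1.0 = "(?B * ?P + ?D2) * (?DM - ?T2)" and ?f0.0 = "(?B * ?P + ?D2) * (?B * (?D1 + ?DM - ?T1) + (?F - ?X - ?Y))"],
      (simp add: asq)[1], (rule exI, (rule hom_rules | simp)+)[1], (simp_all add: nv)[2], (use Qnz k1 in auto)[1], (rule l1)[1])
  have l3: "slr (Var a * ((?B * ?P + ?D2) * (?A * ?DM + ?B * (?D1 + ?DM) + ?F - (?A * ?T2 + ?B * ?T1 + ?X + ?Y))))"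
  by (rule slr_Var_mult'[where ?B1.0 = "(?B * ?P + ?D2) * (?DM - ?T2)" and ?B0.0 = "(?B * ?P + ?D2) * (?B * (?D1 + ?DM - ?T1) + (?F - ?X - ?Y))"],
      (simp add: asq)[1], (rule exI[of _ "2 * ?k + 2"], rule hom_cast, (rule hom_rules | simp)+)[1], (simp_all add: nv)[2], (rule l2)[1], (rule qv)[1])
  show ?thesis using l3 by (simp add: strip_step_def algebra_simps)
qed

text \<open>The leading coefficient in \<open>b\<close> is \<open>a * (a * pP + nV) * nS\<close>;
  with the bare factor \<open>a\<close> removed and \<open>a = 0\<close> put in, the same product
  for the tail is left.\<close>

lemma slr_V_S:
  assumes "fresh L c"
  shows "slr (nV (vstrip L c) * nS (vstrip L c))"
  using assms
proof (induction L c rule: fresh.induct)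
  case (1 c)
  show ?case by (simp add: strip_end_def slr_0)
next
  case (2 a b L c)
  have ab: "a \<noteq> b" "b \<noteq> a" "a \<notin> svars L c" "b \<notin> svars L c" "fresh L c" using 2 by auto
  let ?P = "pP (vstrip L c)" and ?D1 = "d1 (vstrip L c)" and ?D2 = "d2 (vstrip L c)" and ?DM = "dm (vstrip L c)"
  let ?F = "ff (vstrip L c)" and ?T1 = "t1 (vstrip L c)" and ?T2 = "t2 (vstrip L c)" and ?X = "ch (vstrip L c)"
  let ?Y = "ps (vstrip L c)" and ?k = "length L" and ?A = "Var a" and ?B = "Var b"
  note rl = net_rels[of L c]
  note nv = notin_vars net_notin_vars[OF ab(3)] net_notin_vars[OF ab(4)] ab(1,2)
  note nz = net_nz[OF ab(5)]
  have cardS: "card (svars L c) = 2 * ?k + 1" using ab card_svars by auto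
  have IH: "slr ((?D1 + ?DM - ?T1) * (?T1 - ?T2))"
    using 2 by simp
  have apv: "?A * ?P + (?D1 + ?DM - ?T1) \<noteq> 0" using split_eq_0[of a ?P "(?D1 + ?DM - ?T1)"] by (simp add: nv nz mult.commute)
  have l1: "slr ((?A * ?P + (?D1 + ?DM - ?T1)) * (?T1 - ?T2))"
  by (rule slr_linear'[where x = a and ?f1.0 = "?P * (?T1 - ?T2)" and ?f0.0 = "(?D1 + ?DM - ?T1) * (?T1 - ?T2)"],
      (simp add: asq)[1], (rule exI, (rule hom_rules | simp)+)[1], (simp_all add: nv)[2], (use nz in auto)[1], (rule slr_P_S[OF ab(5)])[1])
  have l2: "slr (Var a * ((?A * ?P + (?D1 + ?DM - ?T1)) * (?T1 - ?T2)))"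
  by (rule slr_Var_mult'[where ?B1.0 = "?P * (?T1 - ?T2)" and ?B0.0 = "(?D1 + ?DM - ?T1) * (?T1 - ?T2)"],
      (simp add: asq)[1], (rule exI[of _ "2 * ?k + 1"], rule hom_cast, (rule hom_rules | simp)+)[1], (simp_all add: nv)[2], (rule l1)[1], (rule IH)[1])
  have l3: "slr ((?A * (?B * ?P + ?D2) + (?A * ?DM + ?B * (?D1 + ?DM) + ?F) - (?A * ?T2 + ?B * ?T1 + ?X + ?Y)) * (?A * (?T1 - ?T2)))"
  by (rule slr_linear'[where x = b and ?f1.0 = "?A * ((?A * ?P + (?D1 + ?DM - ?T1)) * (?T1 - ?T2))" and ?f0.0 = "(?A * (?D2 + (?DM - ?T2)) + (?F - ?X - ?Y)) * (?A * (?T1 - ?T2))"],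
      (simp add: asq)[1], (rule exI, (rule hom_rules | simp)+)[1], (simp_all add: nv)[2], (use apv nz in auto)[1], (rule l2)[1])
  have "nV (vstrip ((a, b) # L) c) * nS (vstrip ((a, b) # L) c) = - ((?A * (?B * ?P + ?D2) + (?A * ?DM + ?B * (?D1 + ?DM) + ?F) - (?A * ?T2 + ?B * ?T1 + ?X + ?Y)) * (?A * (?T1 - ?T2)))" by (simp add: strip_step_def algebra_simps)
  then show ?case using slr_uminus[OF l3] by simp
qed

text \<open>The minor \<open>nS\<close> carries a factor from every triangle, so the outermost
  variables are not the right ones to remove. Eliminating \<open>a1\<close> and then the inner
  \<open>a\<close> leaves a pair of total degree \<open>2 * k + 4\<close>, while \<open>a2\<close>,
  \<open>b2\<close>, \<open>b1\<close>, \<open>b\<close> and the tail together still provide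
  \<open>2 * k + 5\<close> variables.\<close>

lemma pair_U_S_step:
  assumes "fresh ((a2, b2) # (a1, b1) # (a, b) # L) c"
  shows "slr_pair (Upair (nU (vstrip ((a2, b2) # (a1, b1) # (a, b) # L) c)) (nS (vstrip ((a2, b2) # (a1, b1) # (a, b) # L) c)))"
proof -
  have ab: "a \<noteq> b" "b \<noteq> a" "a \<notin> svars L c" "b \<notin> svars L c" "fresh L c" using assms by auto
  let ?P = "pP (vstrip L c)" and ?D1 = "d1 (vstrip L c)" and ?D2 = "d2 (vstrip L c)" and ?DM = "dm (vstrip L c)"
  let ?F = "ff (vstrip L c)" and ?T1 = "t1 (vstrip L c)" and ?T2 = "t2 (vstrip L c)" and ?X = "ch (vstrip L c)"
  let ?Y = "ps (vstrip L c)" and ?k = "length L" and ?A = "Var a" and ?B = "Var b"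
  have tn: "tail_net (length L) (svars L c) (vstrip L c)" using ab tail_net_vstrip by simp
  note rl = net_rels[of L c]
  note nv = notin_vars net_notin_vars[OF ab(3)] net_notin_vars[OF ab(4)] ab(1,2)
  note nz = net_nz[OF ab(5)]
  have cardS: "card (svars L c) = 2 * ?k + 1" using ab card_svars by auto
  have kk: True ..
  have h: "a2 \<noteq> b2" "a2 \<noteq> a1" "a2 \<noteq> b1" "a2 \<noteq> a" "a2 \<noteq> b" "b2 \<noteq> a1" "b2 \<noteq> b1" "b2 \<noteq> a" "b2 \<noteq> b"
    "a1 \<noteq> b1" "a1 \<noteq> a" "a1 \<noteq> b" "b1 \<noteq> a" "b1 \<noteq> b" "a2 \<notin> svars L c" "b2 \<notin> svars L c" "a1 \<notin> svars L c" "b1 \<notin> svars L c"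
    using assms by auto
  note nv = nv h h(1-14)[symmetric] net_notin_vars[OF h(15)] net_notin_vars[OF h(16)] net_notin_vars[OF h(17)] net_notin_vars[OF h(18)]

  \<comment> \<open>For a bare edge \<open>pP\<close> is 1 and the variable \<open>c\<close> is seen
    only through the second polynomial.\<close>
  have kP: "vars ?P \<union> vars (?T1 - ?T2) = svars L c \<or> vars ?P = svars L c"
  proof (cases "L = []")
    case True
    then show ?thesis by (simp add: strip_end_def)
  next
    case False
    then have "?k \<ge> 1" by (cases L) auto
    then show ?thesis using tn by (simp add: tail_net_def)
  qed
  have w1: "b \<in> vars (?B * ?P + ?D2 + (?DM - ?T2))" "vars ?P \<subseteq> vars (?B * ?P + ?D2 + (?DM - ?T2))"
    using vars_split_sub[of b ?P "?D2 + (?DM - ?T2)"] by (simp_all add: nv nz algebra_simps)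
  then have w1n: "?B * ?P + ?D2 + (?DM - ?T2) \<noteq> 0" by auto
  have w2: "vars (Var a2 * (?DM - ?T2) + Var b2 * (Var b1 * ?P + ?D1 + (?DM - ?T1)) + Var b1 * (?B * ?P + ?D2 + (?DM - ?T2)) + (?B * (?D1 + ?DM - ?T1) + (?F - ?X - ?Y))) = insert b1 (vars (?B * ?P + ?D2 + (?DM - ?T2) + Var b2 * ?P) \<union> vars (Var a2 * (?DM - ?T2) + Var b2 * (?D1 + (?DM - ?T1)) + (?B * (?D1 + ?DM - ?T1) + (?F - ?X - ?Y))))"
    if "?B * ?P + ?D2 + (?DM - ?T2) + Var b2 * ?P \<noteq> 0"
    using vars_split[of b1 "?B * ?P + ?D2 + (?DM - ?T2) + Var b2 * ?P" "Var a2 * (?DM - ?T2) + Var b2 * (?D1 + (?DM - ?T1)) + (?B * (?D1 + ?DM - ?T1) + (?F - ?X - ?Y))"] that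
    by (simp add: nv algebra_simps)
  have w3: "vars (?B * ?P + ?D2 + (?DM - ?T2) + Var b2 * ?P) = insert b2 (vars ?P \<union> vars (?B * ?P + ?D2 + (?DM - ?T2)))"
    using vars_split[of b2 ?P "?B * ?P + ?D2 + (?DM - ?T2)"] by (simp add: nv nz algebra_simps)
  have w4: "?B * ?P + ?D2 + (?DM - ?T2) + Var b2 * ?P \<noteq> 0" using w3 by auto
  have w5: "vars (Var a2 * (?A * (?T1 - ?T2))) = insert a2 (vars (?A * (?T1 - ?T2)))" using vars_split[of a2 "?A * (?T1 - ?T2)" 0] nz(2) by (simp add: nv mult.commute)
  have w6: "vars (?T1 - ?T2) \<subseteq> vars (?A * (?T1 - ?T2))" using vars_split_sub[of a "(?T1 - ?T2)" 0] by (simp add: nv nz mult.commute)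
  have F1nz: "Var a2 * (?DM - ?T2) + Var b2 * (Var b1 * ?P + ?D1 + (?DM - ?T1)) + Var b1 * (?B * ?P + ?D2 + (?DM - ?T2)) + (?B * (?D1 + ?DM - ?T1) + (?F - ?X - ?Y)) \<noteq> 0" using w2[OF w4] by auto
  have w7: "vars (Var a2 * (?T1 - ?T2)) = insert a2 (vars (?T1 - ?T2))" using vars_split[of a2 "(?T1 - ?T2)" 0] nz(2) by (simp add: nv mult.commute)
  have vs: "insert a2 (insert b2 (insert b1 (insert b (svars L c)))) \<subseteq> vars (Var a2 * (?DM - ?T2) + Var b2 * (Var b1 * ?P + ?D1 + (?DM - ?T1)) + Var b1 * (?B * ?P + ?D2 + (?DM - ?T2)) + (?B * (?D1 + ?DM - ?T1) + (?F - ?X - ?Y))) \<union> vars (Var a2 * (?T1 - ?T2))"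
    unfolding w2[OF w4] w3 w7 using kP w1 by auto

  have n1: "slr_pair (Upair (Var a2 * (?DM - ?T2) + Var b2 * (Var b1 * ?P + ?D1 + (?DM - ?T1)) + Var b1 * (?B * ?P + ?D2 + (?DM - ?T2)) + (?B * (?D1 + ?DM - ?T1) + (?F - ?X - ?Y))) (Var a2 * (?T1 - ?T2)))"
  by (rule slr_pair_neg[where d = "Suc (Suc ?k)" and e = "Suc (Suc ?k)" and V = "insert a2 (insert b2 (insert b1 (insert b (svars L c))))"],
      (rule hom_cast, (rule hom_rules | simp)+)[1], (rule hom_cast, (rule hom_rules | simp)+)[1], (rule vs)[1], (use kk in \<open>simp add: ab cardS h\<close>)[1])
  have znz: "(?B * ?P + ?D1 + ?D2) \<noteq> 0" using split_eq_0[of b ?P "?D1 + ?D2"] by (simp add: nv nz algebra_simps)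
  have y1nz: "(?B * (?D1 + ?DM - ?T1) + (?F - ?X - ?Y)) + Var b1 * (?B * ?P + ?D1 + ?D2) \<noteq> 0" using split_eq_0[of b1 "(?B * ?P + ?D1 + ?D2)" "(?B * (?D1 + ?DM - ?T1) + (?F - ?X - ?Y))"] znz by (simp add: nv algebra_simps)
  have p1: "slr ((?B * ?P + ?D1 + ?D2) * (?T1 - ?T2))"
  by (rule slr_linear'[where x = b and ?f1.0 = "?P * (?T1 - ?T2)" and ?f0.0 = "(?D1 + ?D2) * (?T1 - ?T2)"],
      (simp add: asq)[1], (rule exI, (rule hom_rules | simp)+)[1], (simp_all add: nv)[2], (use nz in auto)[1], (rule slr_P_S[OF ab(5)])[1])
  have p2: "slr ((?B * ?P + ?D1 + ?D2) * (Var a2 * (?T1 - ?T2)))"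
  by (rule slr_linear'[where x = a2 and ?f1.0 = "(?B * ?P + ?D1 + ?D2) * (?T1 - ?T2)" and ?f0.0 = "0"],
      (simp add: asq)[1], (rule exI, (rule hom_rules | simp)+)[1], (simp_all add: nv)[2], (use nz znz in auto)[1], (rule p1)[1])
  have p3: "slr (((?B * (?D1 + ?DM - ?T1) + (?F - ?X - ?Y)) + Var b1 * (?B * ?P + ?D1 + ?D2)) * (Var a2 * (?T1 - ?T2)))"
  by (rule slr_linear'[where x = b1 and ?f1.0 = "(?B * ?P + ?D1 + ?D2) * (Var a2 * (?T1 - ?T2))" and ?f0.0 = "(?B * (?D1 + ?DM - ?T1) + (?F - ?X - ?Y)) * (Var a2 * (?T1 - ?T2))"],
      (simp add: asq)[1], (rule exI, (rule hom_rules | simp)+)[1], (simp_all add: nv)[2], (use nz znz in auto)[1], (rule p2)[1])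
  have p4: "slr (((Var a2 + Var b2 + Var b1) * (?B * (?D1 + ?DM - ?T1) + (?F - ?X - ?Y)) + Var b2 * Var b1 * (?B * ?P + ?D1 + ?D2)) * (Var a2 * (?T1 - ?T2)))"
  by (rule slr_linear'[where x = b2 and ?f1.0 = "((?B * (?D1 + ?DM - ?T1) + (?F - ?X - ?Y)) + Var b1 * (?B * ?P + ?D1 + ?D2)) * (Var a2 * (?T1 - ?T2))" and ?f0.0 = "((Var a2 + Var b1) * (?B * (?D1 + ?DM - ?T1) + (?F - ?X - ?Y))) * (Var a2 * (?T1 - ?T2))"],
      (simp add: asq)[1], (rule exI, (rule hom_rules | simp)+)[1], (simp_all add: nv)[2], (use nz y1nz in auto)[1], (rule p3)[1])
  have l1: "slr_pair (Upair (?A * (Var a2 * (?DM - ?T2) + Var b2 * (Var b1 * ?P + ?D1 + (?DM - ?T1)) + Var b1 * (?B * ?P + ?D2 + (?DM - ?T2)) + (?B * (?D1 + ?DM - ?T1) + (?F - ?X - ?Y))) + ((Var a2 + Var b2 + Var b1) * (?B * (?D1 + ?DM - ?T1) + (?F - ?X - ?Y)) + Var b2 * Var b1 * (?B * ?P + ?D1 + ?D2))) (Var a2 * (?A * (?T1 - ?T2))))"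
  by (rule slr_pair_linear'[where x = a and ?f1.0 = "Var a2 * (?DM - ?T2) + Var b2 * (Var b1 * ?P + ?D1 + (?DM - ?T1)) + Var b1 * (?B * ?P + ?D2 + (?DM - ?T2)) + (?B * (?D1 + ?DM - ?T1) + (?F - ?X - ?Y))" and ?f0.0 = "(Var a2 + Var b2 + Var b1) * (?B * (?D1 + ?DM - ?T1) + (?F - ?X - ?Y)) + Var b2 * Var b1 * (?B * ?P + ?D1 + ?D2)" and ?g1.0 = "Var a2 * (?T1 - ?T2)" and ?g0.0 = "0"
      and d = "Suc (Suc (Suc ?k))" and e = "Suc (Suc (Suc ?k))" and r = "- (((Var a2 + Var b2 + Var b1) * (?B * (?D1 + ?DM - ?T1) + (?F - ?X - ?Y)) + Var b2 * Var b1 * (?B * ?P + ?D1 + ?D2)) * (Var a2 * (?T1 - ?T2)))"],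
      (simp_all add: asq)[2], (rule hom_cast, (rule hom_rules | simp)+)[1], (rule hom_cast, (rule hom_rules | simp)+)[1], (use kk in auto)[2], (simp_all add: nv)[2], (use nz F1nz in auto)[1], (simp_all add: nv)[2], (use nz F1nz in auto)[1], (rule n1)[1], (simp add: algebra_simps)[1], (rule slr_uminus[OF p4])[1])
  \<comment> \<open>The leading coefficient of \<open>nU\<close> in \<open>a1\<close>, first written
    with \<open>a\<close> split off, then through the minors of the strip starting with the triangle
    of \<open>a\<close> and \<open>b\<close>.\<close>
  have C1: "?A * (Var a2 * (?DM - ?T2) + Var b2 * (Var b1 * ?P + ?D1 + (?DM - ?T1)) + Var b1 * (?B * ?P + ?D2 + (?DM - ?T2)) + (?B * (?D1 + ?DM - ?T1) + (?F - ?X - ?Y))) + ((Var a2 + Var b2 + Var b1) * (?B * (?D1 + ?DM - ?T1) + (?F - ?X - ?Y)) + Var b2 * Var b1 * (?B * ?P + ?D1 + ?D2)) = Var a2 * nU (vstrip ((a, b) # L) c) + Var b2 * (Var b1 * pP (vstrip ((a, b) # L) c) + d2 (vstrip ((a, b) # L) c) + nW (vstrip ((a, b) # L) c)) + Var b1 * nV (vstrip ((a, b) # L) c) + nG (vstrip ((a, b) # L) c)" (is "_ = ?C")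
    by (simp add: strip_step_def algebra_simps)
  have aS: "Var a2 * (?A * (?T1 - ?T2)) = - (Var a2 * nS (vstrip ((a, b) # L) c))" (is "_ = - ?s")
    by (simp add: strip_step_def algebra_simps)
  have m1: "slr_pair (Upair ?C ?s)"
    using slr_pair_sign[OF l1[unfolded C1 aS], of ?C ?s] by simp
  have fN: "fresh ((a, b) # L) c" using ab by simp
  have tN: "tail_net (length ((a, b) # L)) (svars ((a, b) # L) c) (vstrip ((a, b) # L) c)" by (rule tail_net_vstrip[OF fN])
  have nzN: "nS (vstrip ((a, b) # L) c) \<noteq> 0" "nV (vstrip ((a, b) # L) c) \<noteq> 0" "?C \<noteq> 0"
  proof -
    show "nS (vstrip ((a, b) # L) c) \<noteq> 0" "nV (vstrip ((a, b) # L) c) \<noteq> 0" using tN unfolding tail_net_def by simp_all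
    have "?A * (Var a2 * (?DM - ?T2) + Var b2 * (Var b1 * ?P + ?D1 + (?DM - ?T1)) + Var b1 * (?B * ?P + ?D2 + (?DM - ?T2)) + (?B * (?D1 + ?DM - ?T1) + (?F - ?X - ?Y))) + ((Var a2 + Var b2 + Var b1) * (?B * (?D1 + ?DM - ?T1) + (?F - ?X - ?Y)) + Var b2 * Var b1 * (?B * ?P + ?D1 + ?D2)) \<noteq> 0" using split_eq_0[of a "Var a2 * (?DM - ?T2) + Var b2 * (Var b1 * ?P + ?D1 + (?DM - ?T1)) + Var b1 * (?B * ?P + ?D2 + (?DM - ?T2)) + (?B * (?D1 + ?DM - ?T1) + (?F - ?X - ?Y))" "(Var a2 + Var b2 + Var b1) * (?B * (?D1 + ?DM - ?T1) + (?F - ?X - ?Y)) + Var b2 * Var b1 * (?B * ?P + ?D1 + ?D2)"] F1nz by (simp add: nv mult.commute)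
    then show "?C \<noteq> 0" using C1 by simp
  qed
  have nN: "x \<notin> svars ((a, b) # L) c" if "x \<in> {a2, b2, a1, b1}" for x using that h by auto
  note nv = nv net_notin_vars[OF nN[of a2], simplified] net_notin_vars[OF nN[of b2], simplified]
    net_notin_vars[OF nN[of a1], simplified] net_notin_vars[OF nN[of b1], simplified]

  let ?UN = "nU (vstrip ((a, b) # L) c)" and ?VN = "nV (vstrip ((a, b) # L) c)" and ?SN = "nS (vstrip ((a, b) # L) c)" and ?GN = "nG (vstrip ((a, b) # L) c)" and ?PN = "pP (vstrip ((a, b) # L) c)" and ?D2N = "d2 (vstrip ((a, b) # L) c)" and ?WN = "nW (vstrip ((a, b) # L) c)"

  have q1: "slr ((Var b1 * ?VN + ?GN) * ?SN)"
  by (rule slr_linear'[where x = b1 and ?f1.0 = "?VN * ?SN" and ?f0.0 = "?GN * ?SN"],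
      (simp add: asq)[1], (rule exI, (rule hom_rules | simp)+)[1], (simp_all add: nv)[2], (use nzN in auto)[1], (rule slr_V_S[OF fN])[1])
  have bnz: "Var b1 * ?VN + ?GN \<noteq> 0" using split_eq_0[of b1 "?VN" "?GN"] nzN by (simp add: nv mult.commute)
  have q2: "slr ((Var b1 * ?VN + ?GN) * (Var a2 * ?SN))"
  by (rule slr_linear'[where x = a2 and ?f1.0 = "(Var b1 * ?VN + ?GN) * ?SN" and ?f0.0 = "0"],
      (simp add: asq)[1], (rule exI, (rule hom_rules | simp)+)[1], (simp_all add: nv)[2], (use nzN bnz in auto)[1], (rule q1)[1])
  have q3: "slr ((Var a2 + Var b2) * (Var b1 * ?VN + ?GN) * (Var a2 * ?SN))"
  by (rule slr_linear'[where x = b2 and ?f1.0 = "(Var b1 * ?VN + ?GN) * (Var a2 * ?SN)" and ?f0.0 = "Var a2 * (Var b1 * ?VN + ?GN) * (Var a2 * ?SN)"],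
      (simp add: asq)[1], (rule exI, (rule hom_rules | simp)+)[1], (simp_all add: nv)[2], (use nzN bnz in auto)[1], (rule q2)[1])
  have l2: "slr_pair (Upair (Var a1 * ?C + (Var a2 + Var b2) * (Var b1 * ?VN + ?GN)) (Var a1 * ?s))"
  by (rule slr_pair_linear'[where x = a1 and ?f1.0 = "?C" and ?f0.0 = "(Var a2 + Var b2) * (Var b1 * ?VN + ?GN)" and ?g1.0 = "?s" and ?g0.0 = "0"
      and d = "Suc (Suc (Suc (Suc ?k)))" and e = "Suc (Suc (Suc (Suc ?k)))" and r = "- ((Var a2 + Var b2) * (Var b1 * ?VN + ?GN) * (Var a2 * ?SN))"],
      (simp_all add: asq)[2], (rule hom_cast, (rule hom_rules | simp)+)[1], (rule hom_cast, (rule hom_rules | simp)+)[1], (use kk in auto)[2], (simp_all add: nv)[2], (use nzN in auto)[1], (simp_all add: nv)[2], (use nzN in auto)[1], (rule m1)[1], (simp add: algebra_simps)[1], (rule slr_uminus[OF q3])[1])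
  have "nU (vstrip ((a2, b2) # (a1, b1) # (a, b) # L) c) = Var a1 * ?C + (Var a2 + Var b2) * (Var b1 * ?VN + ?GN)" "nS (vstrip ((a2, b2) # (a1, b1) # (a, b) # L) c) = Var a1 * ?s"
    by (simp_all add: strip_step_def vstrip.simps(2)[of a1 b1] vstrip.simps(2)[of a2 b2] algebra_simps)
  then show ?thesis using l2 by simp
qed

subsection \<open>Reversing a strip\<close>

text \<open>Read from the other end, the last edge \<open>c\<close> comes first and is paired with
  the last long edge, so the short edges move by one place against the long ones and the first
  \<open>a\<close> becomes the final edge.\<close>

fun mir :: "('x \<times> 'x) list \<Rightarrow> 'x \<Rightarrow> ('x \<times> 'x) list \<times> 'x" where
  "mir [] c = ([], c)"
| "mir ((a, b) # L) c = (case mir L c of (M, e) \<Rightarrow> (M @ [(e, b)], a))"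

definition strip_on :: "('a::comm_ring_1 \<times> 'a) list \<Rightarrow> 'a net \<Rightarrow> 'a net" where
  "strip_on L N = foldr (\<lambda>(a, b). strip_step a b) L N"

lemma strip_on_snoc: "strip_on (L @ [(a, b)]) N = strip_on L (strip_step a b N)"
  by (simp add: strip_on_def)

lemma strip_eq_strip_on: "strip L c = strip_on L (strip_end c)"
  by (induction L c rule: strip.induct) (simp_all add: strip_on_def)

text \<open>
  Each component of a strip is a linear form in the data at its far end; the coefficients are
  those of the reversed strip.
\<close>

lemma mir_rows:
  fixes L :: "('a::comm_ring_1 \<times> 'a) list" and N0 :: "'a net" and c :: 'a
  defines "N \<equiv> strip L c"
  assumes "mir L c = (M, e)"
  shows "pP (strip_on (M @ [(e, b)]) N0) = (b * pP N + d1 N + d2 N) * pP N0 + pP N * (d1 N0 + d2 N0) \<and>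
    d1 (strip_on (M @ [(e, b)]) N0) = (b * t1 N + ch N + ps N) * pP N0 + t2 N * d1 N0 + t1 N * d2 N0 \<and>
    t1 (strip_on (M @ [(e, b)]) N0) = (b * pP N + d2 N) * t1 N0 + d1 N * t2 N0 + pP N * (ch N0 + ps N0) \<and>
    t2 (strip_on (M @ [(e, b)]) N0) = (b * pP N + d2 N + nS N) * t1 N0 + (d1 N - nS N) * t2 N0 + pP N * (ch N0 + ps N0) \<and>
    dm (strip_on (M @ [(e, b)]) N0) = (b * nV N + nG N) * pP N0 + (b * pP N + d2 N + nW N) * d1 N0 +
      nV N * d2 N0 + (b * pP N + d1 N + d2 N) * dm N0 + pP N * ff N0"
  unfolding N_def using assms(2)
proof (induction L c arbitrary: M e b N0 rule: strip.induct)
  case (1 c)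
  then show ?case by (simp add: strip_on_def strip_end_def strip_step_def algebra_simps)
next
  case (2 x y L c)
  obtain M' e' where m: "mir L c = (M', e')" by fastforce
  with 2 have M: "M = M' @ [(e', y)]" "e = x" by auto
  note IH = 2(1)[OF m, of y "strip_step x b N0"]
  have e: "strip_on (M @ [(e, b)]) N0 = strip_on (M' @ [(e', y)]) (strip_step x b N0)"
    using M strip_on_snoc by blast
  show ?case
    unfolding e
    using IH by (simp add: strip_step_def algebra_simps)
qed

text \<open>Reversal exchanges \<open>x\<close> with \<open>r\<close> and \<open>y\<close> with
  \<open>w\<close>, so it also moves the ground. In terms of two-component forests,
  \<open>d1\<close> separates \<open>x\<close> from \<open>y, r\<close>, which after reversal reads
  \<open>r\<close> against \<open>w, x\<close>, that is \<open>t1\<close>; likewise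
  \<open>dm\<close> becomes \<open>r, w\<close> against \<open>x\<close>, which is
  \<open>nV\<close>.\<close>

lemma mir_strip:
  fixes L :: "('a::comm_ring_1 \<times> 'a) list"
  assumes "mir L c = (M, e)"
  shows "pP (strip M e) = pP (strip L c)" "d1 (strip M e) = t1 (strip L c)"
    "t1 (strip M e) = d1 (strip L c)" "dm (strip M e) = nV (strip L c)"
    "nW (strip M e) = nW (strip L c)"
proof -
  have "pP (strip M e) = pP (strip L c) \<and> d1 (strip M e) = t1 (strip L c) \<and>
    t1 (strip M e) = d1 (strip L c) \<and> dm (strip M e) = nV (strip L c) \<and>
    t2 (strip M e) = d1 (strip L c) - nS (strip L c)"
    using assms
  proof (cases L)
    case Nil
    with assms show ?thesis by (simp add: strip_end_def)
  next
    case (Cons p L')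
    obtain x y where p: "p = (x, y)" by fastforce
    obtain M' e' where m: "mir L' c = (M', e')" by fastforce
    have M: "M = M' @ [(e', y)]" "e = x" using assms Cons p m by auto
    have e: "strip M e = strip_on (M' @ [(e', y)]) (strip_end x)"
      unfolding M strip_eq_strip_on ..
    show ?thesis
      unfolding e Cons p using mir_rows[OF m, of y "strip_end x"]
      by (simp add: strip_end_def strip_step_def algebra_simps)
  qed
  then show "pP (strip M e) = pP (strip L c)" "d1 (strip M e) = t1 (strip L c)"
    "t1 (strip M e) = d1 (strip L c)" "dm (strip M e) = nV (strip L c)"
    "nW (strip M e) = nW (strip L c)" by auto
qed

lemma vstrip_eq_strip: "vstrip L c = strip (map (map_prod Var Var) L) (Var c)"
  by (induction L c rule: vstrip.induct) auto

lemma mir_map: "mir L c = (M, e) \<Longrightarrow> mir (map (map_prod f f) L) (f c) = (map (map_prod f f) M, f e)"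
  by (induction L c arbitrary: M e rule: mir.induct) (auto split: prod.splits)

lemma svars_snoc: "svars (M @ [(p, q)]) x = insert x (insert q (svars M p))"
  by (induction M x rule: svars.induct) auto

lemma fresh_snoc:
  "fresh (M @ [(p, q)]) x \<longleftrightarrow> p \<noteq> q \<and> x \<noteq> q \<and> fresh M p \<and> q \<notin> svars M p \<and> x \<notin> svars M p"
  by (induction M x rule: fresh.induct) (auto simp: svars_snoc)

lemma length_mir: "mir L c = (M, e) \<Longrightarrow> length M = length L"
  by (induction L c arbitrary: M e rule: mir.induct) (auto split: prod.splits)

lemma svars_mir: "mir L c = (M, e) \<Longrightarrow> svars M e = svars L c"
  by (induction L c arbitrary: M e rule: mir.induct) (auto split: prod.splits simp: svars_snoc)

lemma svars_end: "c \<in> svars L c"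
  by (induction L c rule: svars.induct) auto

lemma fresh_mir: "mir L c = (M, e) \<Longrightarrow> fresh L c \<Longrightarrow> fresh M e"
proof (induction L c arbitrary: M e rule: mir.induct)
  case (2 a b L c)
  obtain M' e' where m: "mir L c = (M', e')" by fastforce
  with 2 have M: "M = M' @ [(e', b)]" "e = a" by auto
  have "fresh M' e'" "svars M' e' = svars L c" using 2 m svars_mir by auto
  with 2(3) svars_end[of e' M'] show ?case unfolding M fresh_snoc by auto
qed simp

lemma mir_vstrip:
  assumes "mir L c = (M, e)"
  shows "pP (vstrip M e) = pP (vstrip L c)" "d1 (vstrip M e) = t1 (vstrip L c)"
    "t1 (vstrip M e) = d1 (vstrip L c)" "dm (vstrip M e) = nV (vstrip L c)"
    "nW (vstrip M e) = nW (vstrip L c)"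
  using mir_strip[OF mir_map[OF assms, of Var]] by (simp_all add: vstrip_eq_strip)

text \<open>Reversal fixes \<open>pP\<close> and \<open>nW\<close> and exchanges \<open>d1\<close>
  with \<open>t1\<close>, so this is \<open>slr_d1_W\<close> for the reversed strip.\<close>

lemma slr_W_t1:
  assumes "fresh L c" "L \<noteq> []"
  shows "slr (nW (vstrip L c) * t1 (vstrip L c))"
proof -
  obtain M e where m: "mir L c = (M, e)" by fastforce
  have "M \<noteq> []" using length_mir[OF m] assms by auto
  then have "slr (d1 (vstrip M e) * nW (vstrip M e))" using slr_d1_W[OF fresh_mir[OF m assms(1)]] by simp
  then show ?thesis by (simp only: mir_vstrip(2,5)[OF m] mult.commute)
qed

lemma pair_V_t1:
  assumes "fresh L c" "L \<noteq> []"
  shows "slr_pair (Upair (nV (vstrip L c)) (t1 (vstrip L c)))"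
proof -
  obtain M e where m: "mir L c = (M, e)" by fastforce
  have "M \<noteq> []" using length_mir[OF m] assms by auto
  then have "slr_pair (Upair (dm (vstrip M e)) (d1 (vstrip M e)))" using pair_dm_d1[OF fresh_mir[OF m assms(1)]] by simp
  then show ?thesis by (simp add: mir_vstrip[OF m])
qed

text \<open>As \<open>ch\<close> of the longer strip is \<open>a * (b * t1 + ps)\<close>, the bare
  factor is removed first. At \<open>a = 0\<close> the resultant in \<open>b\<close> of the two
  remaining factors is, by \<open>strip_I8\<close>, minus the product \<open>nU * ch\<close> of the
  tail.\<close>

lemma slr_U_ch:
  assumes "fresh L c" "L \<noteq> []"
  shows "slr (nU (vstrip L c) * ch (vstrip L c))"
  using assms
proof (induction L c rule: fresh.induct)
  case (1 c)
  then show ?case by simp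
next
  case (2 a b L c)
  have ab: "a \<noteq> b" "b \<noteq> a" "a \<notin> svars L c" "b \<notin> svars L c" "fresh L c" using 2 by auto
  let ?P = "pP (vstrip L c)" and ?D1 = "d1 (vstrip L c)" and ?D2 = "d2 (vstrip L c)" and ?DM = "dm (vstrip L c)"
  let ?F = "ff (vstrip L c)" and ?T1 = "t1 (vstrip L c)" and ?T2 = "t2 (vstrip L c)" and ?X = "ch (vstrip L c)"
  let ?Y = "ps (vstrip L c)" and ?k = "length L" and ?A = "Var a" and ?B = "Var b"
  note rl = net_rels[of L c]
  note nv = notin_vars net_notin_vars[OF ab(3)] net_notin_vars[OF ab(4)] ab(1,2)
  note nz = net_nz[OF ab(5)]
  have cardS: "card (svars L c) = 2 * ?k + 1" using ab card_svars by auto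
  show ?case
  proof (cases "L = []")
    case True
    show ?thesis by (simp add: strip_step_def strip_end_def slr_0 True)
  next
    case False
    then have kk: "?k \<ge> 1" by (cases L) auto
  note k1 = net_nz1[OF ab(5) kk]
  have fr: "fresh ((a, b) # L) c" using ab by simp
  note sc = slr_comps[OF fr] slr_comps(3-6,8,9)[OF fr False]
  have IH: "slr ((?DM - ?T1) * ?X)"
    using 2 False by simp
  have bnz: "(?B * ?T1 + ?Y) \<noteq> 0" using split_eq_0[of b ?T1 ?Y] nz by (auto simp: nv mult.commute)
  have l1: "slr ((?DM - ?T2) * (?B * ?T1 + ?Y))"
  by (rule slr_linear'[where x = b and ?f1.0 = "(?DM - ?T2) * ?T1" and ?f0.0 = "(?DM - ?T2) * ?Y"],
      (simp add: asq)[1], (rule exI, (rule hom_rules | simp)+)[1], (simp_all add: nv)[2], (use nz k1 in auto)[1], (rule slr_W_t1[OF ab(5) False])[1])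
  have l2: "slr ((?A * ?DM + ?B * (?D1 + ?DM) + ?F - (?A * ?T2 + ?B * ?T1 + ?X + ?Y)) * (?B * ?T1 + ?Y))"
  by (rule slr_linear'[where x = a and ?f1.0 = "(?DM - ?T2) * (?B * ?T1 + ?Y)" and ?f0.0 = "(?B * (?D1 + ?DM - ?T1) + (?F - ?X - ?Y)) * (?B * ?T1 + ?Y)"],
      (simp add: asq)[1], (rule exI, (rule hom_rules | simp)+)[1], (simp_all add: nv)[2], (use k1 bnz in auto)[1], (rule l1)[1])
  have l3: "slr_pair (Upair ((?B * (?D1 + ?DM - ?T1) + (?F - ?X - ?Y))) ((?B * ?T1 + ?Y)))"
  by (rule slr_pair_linear'[where x = b and ?f1.0 = "(?D1 + ?DM - ?T1)" and ?f0.0 = "(?F - ?X - ?Y)" and ?g1.0 = "?T1" and ?g0.0 = "?Y"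
      and d = "Suc (Suc ?k)" and e = "Suc (Suc ?k)" and r = "- ((?DM - ?T1) * ?X)"],
      (simp_all add: asq)[2], (rule hom_cast, (rule hom_rules | simp)+)[1], (rule hom_cast, (rule hom_rules | simp)+)[1], (use kk in auto)[2], (simp_all add: nv)[2], (use nz k1 in auto)[1], (simp_all add: nv)[2], (use nz k1 in auto)[1], (rule pair_V_t1[OF ab(5) False])[1], (rule strip_I8[OF rl])[1], (rule slr_uminus[OF IH])[1])
  have l4: "slr (((?B * (?D1 + ?DM - ?T1) + (?F - ?X - ?Y))) * ((?B * ?T1 + ?Y)))"
  proof (rule slr_factor')
    show "\<exists>d. hom d (((?B * (?D1 + ?DM - ?T1) + (?F - ?X - ?Y))) * ((?B * ?T1 + ?Y)))" by (rule exI, (rule hom_rules | simp)+)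
  qed (rule sc(13), rule sc(7), rule l3)
  have l5: "slr (Var a * ((?A * ?DM + ?B * (?D1 + ?DM) + ?F - (?A * ?T2 + ?B * ?T1 + ?X + ?Y)) * (?B * ?T1 + ?Y)))"
  by (rule slr_Var_mult'[where ?B1.0 = "(?DM - ?T2) * (?B * ?T1 + ?Y)" and ?B0.0 = "(?B * (?D1 + ?DM - ?T1) + (?F - ?X - ?Y)) * (?B * ?T1 + ?Y)"],
      (simp add: asq)[1], (rule exI[of _ "2 * ?k + 3"], rule hom_cast, (rule hom_rules | simp)+)[1], (simp_all add: nv)[2], (rule l2)[1], (rule l4)[1])
  show ?thesis using l5 by (simp add: strip_step_def algebra_simps)
  qed
qed

text \<open>Too short for \<open>pair_U_S_step\<close>. Both polynomials contain \<open>a'\<close>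
  and are linear in \<open>c\<close>, and the leading coefficients agree up to sign.\<close>

lemma pair_U_S_2:
  assumes "fresh [(a, b), (a', b')] c"
  shows "slr_pair (Upair (nU (vstrip [(a, b), (a', b')] c)) (nS (vstrip [(a, b), (a', b')] c)))"
proof -
  have sg: "c \<noteq> a'" "c \<noteq> b'" "c \<noteq> a" "c \<noteq> b" "a' \<noteq> b'" "a' \<noteq> c" "b' \<noteq> c" "a \<noteq> c" "b \<noteq> c" "a \<noteq> a'" "a \<noteq> b'" "b \<noteq> a'" "b \<noteq> b'" "a' \<noteq> a" "b' \<noteq> a" "a' \<noteq> b" "b' \<noteq> b" "b' \<noteq> a'" "a \<noteq> b" "b \<noteq> a"
    using assms by auto
  note nv = notin_vars sg
  let ?A = "Var a" and ?B = "Var b"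
  have "slr_pair (Upair (Var a') (Var a'))"
    by (rule slr_pair_Var[of 0 _ 1]) (use slr_0 hom_homogeneous[OF hom_Var] in auto)
  then have p0: "slr_pair (Upair (- Var a') (Var a'))" by (rule slr_pair_uminus)
  have p1: "slr_pair (Upair (- (?A * Var a')) (?A * Var a'))"
  by (rule slr_pair_linear'[where x = a and ?f1.0 = "- Var a'" and ?f0.0 = "0" and ?g1.0 = "Var a'" and ?g0.0 = "0"
      and d = "2" and e = "2" and r = "0"],
      (simp_all add: asq)[2], (rule hom_cast, (rule hom_rules | simp)+)[1], (rule hom_cast, (rule hom_rules | simp)+)[1], (auto)[1], (auto)[1], (simp_all add: nv)[2], (use sg in auto)[1], (simp_all add: nv)[2], (use sg in auto)[1], (rule p0)[1], (simp)[1], (rule slr_0)[1])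
  have s1: "slr (?B * Var b' * ?A)"
  by (rule slr_linear'[where x = b' and ?f1.0 = "?B * ?A" and ?f0.0 = "0"],
      (simp add: asq)[1], (rule exI, (rule hom_rules | simp)+)[1], (simp_all add: nv)[2], (use sg in auto)[1], (rule slr_Var_Var[OF sg(20)])[1])
  have s0: "slr (Var a' * (?B * Var b' * ?A))"
  by (rule slr_linear'[where x = a' and ?f1.0 = "?B * Var b' * ?A" and ?f0.0 = "0"],
      (simp add: asq)[1], (rule exI, (rule hom_rules | simp)+)[1], (simp_all add: nv)[2], (use sg in auto)[1], (rule s1)[1])
  have s2: "slr (Var a' * Var a' * (?B * Var b' * ?A))"
    by (rule slr_square[of 5 _ "Var a'" "?B * Var b' * ?A" 0]) (rule hom_cast, (rule hom_rules | simp)+, simp_all add: power2_eq_square s0)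
  have p2: "slr_pair (Upair (Var a' * (?B * Var b' - ?A * Var c)) (?A * Var a' * Var c))"
  by (rule slr_pair_linear'[where x = c and ?f1.0 = "- (?A * Var a')" and ?f0.0 = "Var a' * (?B * Var b')" and ?g1.0 = "?A * Var a'" and ?g0.0 = "0"
      and d = "3" and e = "3" and r = "- (Var a' * Var a' * (?B * Var b' * ?A))"],
      (simp_all add: asq)[2], (rule hom_cast, (rule hom_rules | simp)+)[1], (rule hom_cast, (rule hom_rules | simp)+)[1], (auto)[1], (auto)[1], (simp_all add: nv)[2], (use sg in auto)[1], (simp_all add: nv)[2], (use sg in auto)[1], (rule p1)[1], (simp add: algebra_simps)[1], (rule slr_uminus[OF s2])[1])
  show ?thesis using p2 by (simp add: strip_step_def strip_end_def algebra_simps)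
qed

lemma pair_U_S:
  assumes "fresh L c" "length L \<ge> 2"
  shows "slr_pair (Upair (nU (vstrip L c)) (nS (vstrip L c)))"
proof -
  obtain a b a' b' L' where L: "L = (a, b) # (a', b') # L'"
    using assms(2) by (metis Suc_le_length_iff numeral_2_eq_2 surj_pair)
  show ?thesis
  proof (cases L')
    case Nil
    then show ?thesis using pair_U_S_2 assms L by blast
  next
    case (Cons p L'')
    then obtain a'' b'' where "L' = (a'', b'') # L''" by (metis surj_pair)
    then show ?thesis using pair_U_S_step assms L by blast
  qed
qed

subsection \<open>The three kinds of pairs\<close>

context
  fixes L :: "(nat \<times> nat) list" and c z :: nat
  assumes fr: "fresh L c" and len: "length L \<ge> 2" and z: "z \<notin> svars L c"
begin

private lemma tn: "tail_net (length L) (svars L c) (vstrip L c)"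
  by (rule tail_net_vstrip[OF fr])

private lemma L: "\<exists>a b L'. L = (a, b) # L' \<and> L' \<noteq> []"
  using len by (cases L) auto

private lemma nz_d2S: "d2 (vstrip L c) + (t1 (vstrip L c) - t2 (vstrip L c)) \<noteq> 0"
proof -
  obtain a b L' where L': "L = (a, b) # L'" "L' \<noteq> []" using L by blast
  have fr': "fresh L' c" using fr L' by simp
  have "length L' \<ge> 1" using L'(2) by (cases L') auto
  then have "d1 (vstrip L' c) - nS (vstrip L' c) \<noteq> 0"
    using tail_net_vstrip[OF fr'] by (simp add: tail_net_def)
  moreover have "d2 (vstrip L c) + nS (vstrip L c) = Var a * (d1 (vstrip L' c) - nS (vstrip L' c))"
    by (simp add: L' strip_step_def algebra_simps)
  ultimately show ?thesis by simp
qed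

text \<open>In this lemma and the next two the closing edge \<open>z\<close> is eliminated. The
  leading coefficients form a pair of the strip treated before, and the resultants are, up to sign,
  the products \<open>nF * dm\<close>, \<open>d1 * nU\<close> and \<open>nU * ch\<close>.\<close>

lemma slr_pair_dm: "slr_pair (Upair (Var z * pP (vstrip L c) + (d1 (vstrip L c) + dm (vstrip L c))) (Var z * dm (vstrip L c)))"
proof -
  have kk: "length L \<ge> 2" by (rule len)
  have LN: "L \<noteq> []" using len by auto
  note nv = notin_vars net_notin_vars[OF z]
  have nz: "pP (vstrip L c) \<noteq> 0" "d1 (vstrip L c) + dm (vstrip L c) \<noteq> 0" "dm (vstrip L c) \<noteq> 0"
    "dm (vstrip L c) - t1 (vstrip L c) \<noteq> 0" "t1 (vstrip L c) - t2 (vstrip L c) \<noteq> 0"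
    "d2 (vstrip L c) + (t1 (vstrip L c) - t2 (vstrip L c)) \<noteq> 0"
    using tn nz_d2S len unfolding tail_net_def by simp_all
  note rl = net_rels[of L c]
  obtain a b L' where L': "L = (a, b) # L'" "L' \<noteq> []" using L by blast
  have fr': "fresh ((a, b) # L') c" using fr L' by simp
  have p: "slr_pair (Upair (pP (vstrip L c)) (dm (vstrip L c)))" using pair_P_dm[OF fr' L'(2)] L' by simp
  have q: "slr ((d1 (vstrip L c) + dm (vstrip L c)) * dm (vstrip L c))" using slr_F_dm[OF fr' L'(2)] L' by simp
  have l1: "slr_pair (Upair (Var z * pP (vstrip L c) + (d1 (vstrip L c) + dm (vstrip L c))) (Var z * dm (vstrip L c)))"
  by (rule slr_pair_linear'[where x = z and ?f1.0 = "pP (vstrip L c)" and ?f0.0 = "(d1 (vstrip L c) + dm (vstrip L c))" and ?g1.0 = "dm (vstrip L c)" and ?g0.0 = "0"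
      and d = "Suc (length L)" and e = "Suc (Suc (length L))" and r = "- ((d1 (vstrip L c) + dm (vstrip L c)) * dm (vstrip L c))"],
      (simp_all add: asq)[2], (rule hom_cast, (rule hom_rules | simp)+)[1], (rule hom_cast, (rule hom_rules | simp)+)[1], (use kk in auto)[2], (simp_all add: nv)[2], (use nz in auto)[1], (simp_all add: nv)[2], (use nz in auto)[1], (rule p)[1], (simp)[1], (rule slr_uminus[OF q])[1])
  show ?thesis by (rule l1)
qed

lemma slr_pair_d2S: "slr_pair (Upair (Var z * pP (vstrip L c) + (d1 (vstrip L c) + dm (vstrip L c))) (Var z * (d2 (vstrip L c) + (t1 (vstrip L c) - t2 (vstrip L c))) + (ff (vstrip L c) - ch (vstrip L c))))"
proof -
  have kk: "length L \<ge> 2" by (rule len)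
  have LN: "L \<noteq> []" using len by auto
  note nv = notin_vars net_notin_vars[OF z]
  have nz: "pP (vstrip L c) \<noteq> 0" "d1 (vstrip L c) + dm (vstrip L c) \<noteq> 0" "dm (vstrip L c) \<noteq> 0"
    "dm (vstrip L c) - t1 (vstrip L c) \<noteq> 0" "t1 (vstrip L c) - t2 (vstrip L c) \<noteq> 0"
    "d2 (vstrip L c) + (t1 (vstrip L c) - t2 (vstrip L c)) \<noteq> 0"
    using tn nz_d2S len unfolding tail_net_def by simp_all
  note rl = net_rels[of L c]
  obtain a b L' where L': "L = (a, b) # L'" "L' \<noteq> []" using L by blast
  have fr': "fresh ((a, b) # L') c" using fr L' by simp
  have p: "slr_pair (Upair (pP (vstrip L c)) (d2 (vstrip L c) + (t1 (vstrip L c) - t2 (vstrip L c))))" using pair_P_d2S[OF fr' L'(2)] L' by simp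
  have q: "slr (d1 (vstrip L c) * (dm (vstrip L c) - t1 (vstrip L c)))" using slr_d1_U[OF fr' L'(2)] L' by simp
  have l1: "slr_pair (Upair (Var z * pP (vstrip L c) + (d1 (vstrip L c) + dm (vstrip L c))) (Var z * (d2 (vstrip L c) + (t1 (vstrip L c) - t2 (vstrip L c))) + (ff (vstrip L c) - ch (vstrip L c))))"
  by (rule slr_pair_linear'[where x = z and ?f1.0 = "pP (vstrip L c)" and ?f0.0 = "(d1 (vstrip L c) + dm (vstrip L c))" and ?g1.0 = "d2 (vstrip L c) + (t1 (vstrip L c) - t2 (vstrip L c))" and ?g0.0 = "ff (vstrip L c) - ch (vstrip L c)"
      and d = "Suc (length L)" and e = "Suc (Suc (length L))" and r = "d1 (vstrip L c) * (dm (vstrip L c) - t1 (vstrip L c))"],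
      (simp_all add: asq)[2], (rule hom_cast, (rule hom_rules | simp)+)[1], (rule hom_cast, (rule hom_rules | simp)+)[1], (use kk in auto)[2], (simp_all add: nv)[2], (use nz in auto)[1], (simp_all add: nv)[2], (use nz in auto)[1], (rule p)[1], (rule strip_I9[OF rl])[1], (rule q)[1])
  show ?thesis by (rule l1)
qed

lemma slr_pair_U: "slr_pair (Upair (Var z * (dm (vstrip L c) - t1 (vstrip L c))) (Var z * (t1 (vstrip L c) - t2 (vstrip L c)) - ch (vstrip L c)))"
proof -
  have kk: "length L \<ge> 2" by (rule len)
  have LN: "L \<noteq> []" using len by auto
  note nv = notin_vars net_notin_vars[OF z]
  have nz: "pP (vstrip L c) \<noteq> 0" "d1 (vstrip L c) + dm (vstrip L c) \<noteq> 0" "dm (vstrip L c) \<noteq> 0"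
    "dm (vstrip L c) - t1 (vstrip L c) \<noteq> 0" "t1 (vstrip L c) - t2 (vstrip L c) \<noteq> 0"
    "d2 (vstrip L c) + (t1 (vstrip L c) - t2 (vstrip L c)) \<noteq> 0"
    using tn nz_d2S len unfolding tail_net_def by simp_all
  note rl = net_rels[of L c]
  have p: "slr_pair (Upair ((dm (vstrip L c) - t1 (vstrip L c))) ((t1 (vstrip L c) - t2 (vstrip L c))))" using pair_U_S[OF fr len] by simp
  have q: "slr ((dm (vstrip L c) - t1 (vstrip L c)) * ch (vstrip L c))" using slr_U_ch[OF fr LN] by simp
  have l1: "slr_pair (Upair (Var z * (dm (vstrip L c) - t1 (vstrip L c))) (Var z * (t1 (vstrip L c) - t2 (vstrip L c)) - ch (vstrip L c)))"
  by (rule slr_pair_linear'[where x = z and ?f1.0 = "(dm (vstrip L c) - t1 (vstrip L c))" and ?f0.0 = "0" and ?g1.0 = "(t1 (vstrip L c) - t2 (vstrip L c))" and ?g0.0 = "- ch (vstrip L c)"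
      and d = "Suc (Suc (length L))" and e = "Suc (Suc (length L))" and r = "- ((dm (vstrip L c) - t1 (vstrip L c)) * ch (vstrip L c))"],
      (simp_all add: asq)[2], (rule hom_cast, (rule hom_rules | simp)+)[1], (rule hom_cast, (rule hom_rules | simp)+)[1], (use kk in auto)[2], (simp_all add: nv)[2], (use nz in auto)[1], (simp_all add: nv)[2], (use nz in auto)[1], (rule p)[1], (simp)[1], (rule slr_uminus[OF q])[1])
  show ?thesis by (rule l1)
qed

end

section \<open>Bordered determinants of networks\<close>

type_synonym 'a entry = "'a \<times> (nat \<Rightarrow> 'a) \<times> (nat \<Rightarrow> 'a)"

text \<open>An entry stands for one row and one column of the edge block: its weight on the
  diagonal, a row of the incidence block and a column of its negative transpose. Separate row and
  column vectors allow one entry of weight zero to represent an edge whose column was deleted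
  together with another whose row was deleted.\<close>

definition gm :: "nat \<Rightarrow> 'a::comm_ring_1 entry list \<Rightarrow> 'a mat" where
  "gm D xs = (let M = length xs in mat (M + D) (M + D) (\<lambda>(i, j).
     if i < M then (if j < M then (if i = j then fst (xs ! i) else 0) else fst (snd (xs ! i)) (j - M))
     else (if j < M then - snd (snd (xs ! j)) (i - M) else 0)))"

definition gd :: "nat \<Rightarrow> 'a::comm_ring_1 entry list \<Rightarrow> 'a" where
  "gd D xs = det (gm D xs)"

definition uv :: "nat \<Rightarrow> nat \<Rightarrow> 'a::comm_ring_1" where
  "uv i = (\<lambda>v. if v = i then 1 else 0)"

lemma gm_carrier [simp]: "gm D xs \<in> carrier_mat (length xs + D) (length xs + D)"
  by (simp add: gm_def Let_def)

lemma gm_dim [simp]: "dim_row (gm D xs) = length xs + D" "dim_col (gm D xs) = length xs + D"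
  by (simp_all add: gm_def Let_def)

lemma gm_index:
  "i < length xs + D \<Longrightarrow> j < length xs + D \<Longrightarrow> gm D xs $$ (i, j) =
     (if i < length xs then (if j < length xs then (if i = j then fst (xs ! i) else 0)
        else fst (snd (xs ! i)) (j - length xs))
      else (if j < length xs then - snd (snd (xs ! j)) (i - length xs) else 0))"
  by (simp add: gm_def Let_def)

lemma det_permute_both:
  fixes A :: "'a::comm_ring_1 mat"
  assumes A: "A \<in> carrier_mat n n" and p: "p permutes {0..<n}"
  shows "det (mat n n (\<lambda>(i, j). A $$ (p i, p j))) = det A"
proof -
  have pl: "i < n \<Longrightarrow> p i < n" for i using permutes_in_image[OF p, of i] by auto
  let ?B = "mat n n (\<lambda>(i, j). A $$ (i, p j))"
  have Bc: "?B \<in> carrier_mat n n" by simp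
  have "mat n n (\<lambda>(i, j). A $$ (p i, p j)) = mat n n (\<lambda>(i, j). ?B $$ (p i, j))"
    by (rule eq_matI) (auto simp: pl)
  then have 1: "det (mat n n (\<lambda>(i, j). A $$ (p i, p j))) = signof p * det ?B"
    using det_permute_rows[OF Bc p] by simp
  have T: "transpose_mat A \<in> carrier_mat n n" using A by simp
  have "?B = transpose_mat (mat n n (\<lambda>(i, j). transpose_mat A $$ (p i, j)))"
    using A by (intro eq_matI) (auto simp: pl)
  then have "det ?B = det (mat n n (\<lambda>(i, j). transpose_mat A $$ (p i, j)))"
    using det_transpose[of "mat n n (\<lambda>(i, j). transpose_mat A $$ (p i, j))" n] by simp
  also have "\<dots> = signof p * det A"
    using det_permute_rows[OF T p] det_transpose[OF A] by simp
  finally have "det (mat n n (\<lambda>(i, j). A $$ (p i, p j))) = signof p * (signof p * det A)"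
    using 1 by simp
  moreover have "(signof p :: 'a) * signof p = 1" by (simp add: sign_def)
  ultimately show ?thesis by (simp add: mult.assoc[symmetric])
qed

text \<open>Reordering the entries permutes rows and columns simultaneously, and the two signs
  cancel. So \<open>gd\<close> depends on the multiset of entries only, which is used freely below
  to move entries to the front.\<close>

lemma gd_perm:
  assumes "mset xs = mset ys"
  shows "gd D xs = gd D ys"
proof -
  let ?M = "length xs"
  have len: "length ys = ?M" using assms by (metis size_mset)
  obtain f where f: "bij_betw f {..<?M} {..<length ys}" "\<forall>i<?M. xs ! i = ys ! (f i)"
    using permutation_Ex_bij[OF assms] by blast
  define p where "p = (\<lambda>i. if i < ?M then f i else i)"
  have "bij_betw p {..<?M} {..<?M}"
    using f(1) len by (subst bij_betw_cong[of _ p f]) (auto simp: p_def)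
  then have "p permutes {..<?M}" by (rule bij_imp_permutes) (simp add: p_def)
  then have p: "p permutes {0..<?M + D}" by (rule permutes_subset) auto
  have pi: "p i < ?M \<longleftrightarrow> i < ?M" for i
    using permutes_in_image[OF \<open>p permutes {..<?M}\<close>, of i] by simp
  have pge: "\<not> i < ?M \<Longrightarrow> p i = i" for i by (simp add: p_def)
  have pinj: "p i = p j \<longleftrightarrow> i = j" for i j using permutes_inj[OF p] by (auto dest: injD)
  have pl: "i < ?M + D \<Longrightarrow> p i < ?M + D" for i using permutes_in_image[OF p, of i] by simp
  have "gm D xs = mat (?M + D) (?M + D) (\<lambda>(i, j). gm D ys $$ (p i, p j))"
  proof (rule eq_matI)
    fix i j assume "i < dim_row (mat (?M + D) (?M + D) (\<lambda>(i, j). gm D ys $$ (p i, p j)))"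
      "j < dim_col (mat (?M + D) (?M + D) (\<lambda>(i, j). gm D ys $$ (p i, p j)))"
    then have ij: "i < ?M + D" "j < ?M + D" by auto
    have x: "k < ?M \<Longrightarrow> xs ! k = ys ! p k" for k using f(2) by (simp add: p_def)
    show "gm D xs $$ (i, j) = mat (?M + D) (?M + D) (\<lambda>(i, j). gm D ys $$ (p i, p j)) $$ (i, j)"
      using ij pl[OF ij(1)] pl[OF ij(2)] by (simp add: gm_index len pi pinj x pge)
  qed simp_all
  then show ?thesis
    unfolding gd_def using det_permute_both[OF _ p, of "gm D ys"] gm_carrier[of D ys]
    by (simp add: len del: gm_carrier)
qed

lemma mat_delete_gm: "mat_delete (gm D (x # xs)) 0 0 = gm D xs"
proof (rule eq_matI)
  fix i j assume "i < dim_row (gm D xs)" "j < dim_col (gm D xs)"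
  then have ij: "i < length xs + D" "j < length xs + D" by auto
  have "mat_delete (gm D (x # xs)) 0 0 $$ (i, j) = gm D (x # xs) $$ (Suc i, Suc j)"
    using mat_delete_index[of "gm D (x # xs)" "length xs + D" 0 0 i j] ij gm_carrier[of D "x # xs"]
    by (simp add: insert_index_def del: gm_carrier)
  then show "mat_delete (gm D (x # xs)) 0 0 $$ (i, j) = gm D xs $$ (i, j)"
    using ij by (simp add: gm_index)
qed (simp_all add: mat_delete_def)

text \<open>Laplace expansion along the first row. The cofactors \<open>w\<close> do not involve
  \<open>\<delta>\<close> or \<open>R\<close>, so all linearity properties of the first entry,
  including deletion and contraction, follow from this one statement.\<close>

lemma gd_row_linear:
  fixes C :: "nat \<Rightarrow> 'a::comm_ring_1"
  shows "\<exists>w. \<forall>\<delta> R. gd D ((\<delta>, R, C) # xs) = \<delta> * gd D xs + (\<Sum>v<D. R v * w v)"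
proof -
  let ?M = "Suc (length xs)"
  define w where "w = (\<lambda>v. cofactor (gm D ((0, (\<lambda>_. 0), C) # xs)) 0 (?M + v))"
  have "gd D ((\<delta>, R, C) # xs) = \<delta> * gd D xs + (\<Sum>v<D. R v * w v)" for \<delta> R
  proof -
    let ?A = "gm D ((\<delta>, R, C) # xs)"
    have A: "?A \<in> carrier_mat (?M + D) (?M + D)" using gm_carrier[of D "(\<delta>, R, C) # xs"] by simp
    have cof: "cofactor ?A 0 (?M + v) = w v" if "v < D" for v
    proof -
      have "mat_delete ?A 0 (?M + v) = mat_delete (gm D ((0, (\<lambda>_. 0), C) # xs)) 0 (?M + v)"
        using that by (intro eq_matI) (auto simp: mat_delete_def gm_index nth_Cons split: nat.splits)
      then show ?thesis by (simp add: cofactor_def w_def)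
    qed
    have "gd D ((\<delta>, R, C) # xs) = (\<Sum>j<?M + D. ?A $$ (0, j) * cofactor ?A 0 j)"
      unfolding gd_def using laplace_expansion_row[OF A, of 0] by simp
    also have "\<dots> = (\<Sum>j<?M. ?A $$ (0, j) * cofactor ?A 0 j) + (\<Sum>v<D. ?A $$ (0, ?M + v) * cofactor ?A 0 (?M + v))"
    proof -
      have "{..<?M + D} = {..<?M} \<union> (\<lambda>v. ?M + v) ` {..<D}"
        by (auto simp: image_iff) (metis add.commute add_diff_inverse_nat add_less_cancel_left lessThan_iff not_less plus_nat.simps(2))
      moreover have "{..<?M} \<inter> (\<lambda>v. ?M + v) ` {..<D} = {}" by auto
      moreover have "inj_on (\<lambda>v. ?M + v) {..<D}" by (auto simp: inj_on_def)
      ultimately show ?thesis by (simp add: sum.union_disjoint sum.reindex del: sum.lessThan_Suc)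
    qed
    also have "(\<Sum>j<?M. ?A $$ (0, j) * cofactor ?A 0 j) = \<delta> * gd D xs"
    proof -
      have "(\<Sum>j<?M. ?A $$ (0, j) * cofactor ?A 0 j) = (\<Sum>j<?M. if j = 0 then \<delta> * cofactor ?A 0 0 else 0)"
        by (intro sum.cong) (auto simp: gm_index)
      also have "\<dots> = \<delta> * cofactor ?A 0 0" by simp
      also have "cofactor ?A 0 0 = gd D xs" by (simp add: cofactor_def gd_def mat_delete_gm)
      finally show ?thesis .
    qed
    also have "(\<Sum>v<D. ?A $$ (0, ?M + v) * cofactor ?A 0 (?M + v)) = (\<Sum>v<D. R v * w v)"
    proof (rule sum.cong)
      fix v assume "v \<in> {..<D}"
      moreover from this have "?A $$ (0, ?M + v) = R v" by (simp add: gm_index)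
      ultimately show "?A $$ (0, ?M + v) * cofactor ?A 0 (?M + v) = R v * w v"
        using cof by (simp only: lessThan_iff)
    qed simp
    finally show ?thesis .
  qed
  then show ?thesis by blast
qed

definition flip_entry :: "'a entry \<Rightarrow> 'a entry" where
  "flip_entry = (\<lambda>(\<delta>, R, C). (\<delta>, C, R))"

text \<open>Transposition changes the sign of both off-diagonal blocks; conjugating by a diagonal
  sign matrix restores them. This makes every row lemma into a column lemma.\<close>

lemma gd_flip:
  fixes xs :: "'a::comm_ring_1 entry list"
  shows "gd D (map flip_entry xs) = gd D xs"
proof -
  let ?M = "length xs" and ?n = "length xs + D"
  define S where "S = mat ?n ?n (\<lambda>(i, j). if i = j then (if i < ?M then 1 else - 1 :: 'a) else 0)"
  have S: "S \<in> carrier_mat ?n ?n" by (simp add: S_def)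
  have T: "transpose_mat (gm D xs) \<in> carrier_mat ?n ?n" by simp
  have row: "S * A = mat ?n ?n (\<lambda>(i, j). (if i < ?M then 1 else - 1) * A $$ (i, j))"
    if "A \<in> carrier_mat ?n ?n" for A :: "'a mat"
  proof (rule eq_matI)
    fix i j assume "i < dim_row (mat ?n ?n (\<lambda>(i, j). (if i < ?M then 1 else - 1) * A $$ (i, j)))"
      "j < dim_col (mat ?n ?n (\<lambda>(i, j). (if i < ?M then 1 else - 1) * A $$ (i, j)))"
    then have ij: "i < ?n" "j < ?n" by auto
    have "(S * A) $$ (i, j) = (\<Sum>k<?n. S $$ (i, k) * A $$ (k, j))"
      using ij that by (simp add: S_def scalar_prod_def lessThan_atLeast0)
    also have "\<dots> = (\<Sum>k<?n. if k = i then (if i < ?M then 1 else - 1) * A $$ (i, j) else 0)"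
      using ij by (intro sum.cong) (auto simp: S_def)
    finally show "(S * A) $$ (i, j) = mat ?n ?n (\<lambda>(i, j). (if i < ?M then 1 else - 1) * A $$ (i, j)) $$ (i, j)"
      using ij by simp
  qed (use that in \<open>simp_all add: S_def\<close>)
  have col: "A * S = mat ?n ?n (\<lambda>(i, j). A $$ (i, j) * (if j < ?M then 1 else - 1))"
    if "A \<in> carrier_mat ?n ?n" for A :: "'a mat"
  proof (rule eq_matI)
    fix i j assume "i < dim_row (mat ?n ?n (\<lambda>(i, j). A $$ (i, j) * (if j < ?M then 1 else - 1)))"
      "j < dim_col (mat ?n ?n (\<lambda>(i, j). A $$ (i, j) * (if j < ?M then 1 else - 1)))"
    then have ij: "i < ?n" "j < ?n" by auto
    have "(A * S) $$ (i, j) = (\<Sum>k<?n. A $$ (i, k) * S $$ (k, j))"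
      using ij that by (simp add: S_def scalar_prod_def lessThan_atLeast0)
    also have "\<dots> = (\<Sum>k<?n. if k = j then A $$ (i, j) * (if j < ?M then 1 else - 1) else 0)"
      using ij by (intro sum.cong) (auto simp: S_def)
    finally show "(A * S) $$ (i, j) = mat ?n ?n (\<lambda>(i, j). A $$ (i, j) * (if j < ?M then 1 else - 1)) $$ (i, j)"
      using ij by simp
  qed (use that in \<open>simp_all add: S_def\<close>)
  have SS: "S * S = 1\<^sub>m ?n"
    unfolding row[OF S] by (rule eq_matI) (auto simp: S_def)
  have "det S * det S = 1" using det_mult[OF S S] SS by simp
  have "gm D (map flip_entry xs) = S * transpose_mat (gm D xs) * S"
    unfolding col[OF mult_carrier_mat[OF S T]] unfolding row[OF T]
    by (rule eq_matI) (auto simp: gm_index flip_entry_def split: prod.splits)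
  then have "gd D (map flip_entry xs) = det S * det (transpose_mat (gm D xs)) * det S"
    unfolding gd_def using det_mult[OF mult_carrier_mat[OF S T] S] det_mult[OF S T] by simp
  also have "\<dots> = (det S * det S) * gd D xs"
    unfolding gd_def by (simp add: det_transpose[OF gm_carrier])
  finally show ?thesis using \<open>det S * det S = 1\<close> by simp
qed

text \<open>Deletion and contraction: an edge contributes its weight when it is deleted, and an
  entry of weight zero when it is contracted.\<close>

lemma gd_edge: "gd D ((\<alpha>, R, C) # xs) = \<alpha> * gd D xs + gd D ((0, R, C) # xs)"
  using gd_row_linear[of D C xs] by (metis (no_types, lifting) add.left_neutral mult_zero_left)

lemma gd_add_row: "gd D ((0, (\<lambda>v. R v + R' v), C) # xs) = gd D ((0, R, C) # xs) + gd D ((0, R', C) # xs)"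
proof -
  obtain w where w: "\<And>\<delta> R. gd D ((\<delta>, R, C) # xs) = \<delta> * gd D xs + (\<Sum>v<D. R v * w v)"
    using gd_row_linear[of D C xs] by blast
  show ?thesis unfolding w by (simp add: distrib_right sum.distrib)
qed

lemma gd_scale_row: "gd D ((0, (\<lambda>v. k * R v), C) # xs) = k * gd D ((0, R, C) # xs)"
proof -
  obtain w where w: "\<And>\<delta> R. gd D ((\<delta>, R, C) # xs) = \<delta> * gd D xs + (\<Sum>v<D. R v * w v)"
    using gd_row_linear[of D C xs] by blast
  show ?thesis unfolding w by (simp add: sum_distrib_left mult.assoc)
qed

lemma gd_swap: "gd D (x # y # xs) = gd D (y # x # xs)"
  by (rule gd_perm) simp

lemma gd_dup_row: "gd D ((0, R, C) # (0, R, C') # xs) = 0"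
proof -
  let ?A = "gm D ((0, R, C) # (0, R, C') # xs)"
  have "row ?A 0 = row ?A 1"
    by (rule eq_vecI) (auto simp: gm_index nth_Cons split: nat.splits)
  then show ?thesis
    unfolding gd_def
    using det_identical_rows[of ?A "length xs + 2 + D" 0 1] gm_carrier[of D "(0, R, C) # (0, R, C') # xs"]
    by simp
qed

lemma flip_entry_Pair [simp]: "flip_entry (\<delta>, R, C) = (\<delta>, C, R)"
  by (simp add: flip_entry_def)

lemma gd_flip1: "gd D ((\<delta>, R, C) # xs) = gd D ((\<delta>, C, R) # map flip_entry xs)"
  using gd_flip[of D "(\<delta>, R, C) # xs"] by simp

lemma gd_flip2: "gd D ((\<delta>, R, C) # (\<delta>', R', C') # xs) = gd D ((\<delta>, C, R) # (\<delta>', C', R') # map flip_entry xs)"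
  using gd_flip[of D "(\<delta>, R, C) # (\<delta>', R', C') # xs"] by simp

lemma gd_dup_col: "gd D ((0, R, C) # (0, R', C) # xs) = 0"
  unfolding gd_flip2[of D 0 R] by (rule gd_dup_row)

lemma gd_add_row2:
  "gd D (x # (0, (\<lambda>v. R v + R' v), C) # xs) = gd D (x # (0, R, C) # xs) + gd D (x # (0, R', C) # xs)"
  unfolding gd_swap[of D x] by (rule gd_add_row)

text \<open>Polarisation of \<open>gd_dup_row\<close>: for a fixed distribution of columns,
  \<open>gd\<close> is alternating in the rows of the entries of weight zero.\<close>

lemma gd_swap_row:
  "gd D ((0, R, C) # (0, R', C') # xs) = - gd D ((0, R', C) # (0, R, C') # xs)"
proof -
  have "0 = gd D ((0, (\<lambda>v. R v + R' v), C) # (0, (\<lambda>v. R v + R' v), C') # xs)"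
    by (simp only: gd_dup_row)
  also have "\<dots> = gd D ((0, R, C) # (0, R', C') # xs) + gd D ((0, R', C) # (0, R, C') # xs)"
    by (simp only: gd_add_row gd_add_row2 gd_dup_row add_0_left add_0_right add.commute)
  finally show ?thesis by (simp add: eq_neg_iff_add_eq_0)
qed

lemma gd_swap_col:
  "gd D ((0, R, C) # (0, R', C') # xs) = - gd D ((0, R, C') # (0, R', C) # xs)"
  unfolding gd_flip2[of D 0 R] by (rule gd_swap_row)

text \<open>A vector on the vertices orthogonal to all rows, extended by zero on the edge
  coordinates, lies in the kernel of \<open>gm\<close>. It serves for a vertex without edges, a
  network without ground and a disconnected graph.\<close>

lemma gd_kernel:
  fixes xs :: "'a::idom entry list"
  assumes "\<And>x. x \<in> set xs \<Longrightarrow> (\<Sum>v<D. fst (snd x) v * u v) = 0" "w < D" "u w \<noteq> 0"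
  shows "gd D xs = 0"
proof -
  let ?M = "length xs" and ?n = "length xs + D"
  let ?u = "vec ?n (\<lambda>i. if i < ?M then 0 else u (i - ?M))"
  have "?u $ (?M + w) \<noteq> 0" using assms(2,3) by simp
  then have nz: "?u \<noteq> 0\<^sub>v ?n" using assms(2) by (metis add_less_cancel_left index_zero_vec(1))
  have "gm D xs *\<^sub>v ?u = 0\<^sub>v ?n"
  proof (rule eq_vecI)
    fix i assume "i < dim_vec (0\<^sub>v ?n)"
    then have i: "i < ?n" by simp
    have "(gm D xs *\<^sub>v ?u) $ i = (\<Sum>j<?n. gm D xs $$ (i, j) * ?u $ j)"
      using i by (simp add: scalar_prod_def lessThan_atLeast0)
    also have "\<dots> = (\<Sum>j\<in>(\<lambda>v. ?M + v) ` {..<D}. gm D xs $$ (i, j) * ?u $ j)"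
    proof (rule sum.mono_neutral_right)
      show "\<forall>j\<in>{..<?n} - (\<lambda>v. ?M + v) ` {..<D}. gm D xs $$ (i, j) * ?u $ j = 0"
      proof
        fix j assume j: "j \<in> {..<?n} - (\<lambda>v. ?M + v) ` {..<D}"
        have "j < ?M"
        proof (rule ccontr)
          assume "\<not> j < ?M"
          then have "j = ?M + (j - ?M)" "j - ?M < D" using j by auto
          with j show False by blast
        qed
        with j show "gm D xs $$ (i, j) * ?u $ j = 0" by simp
      qed
    qed auto
    also have "\<dots> = (\<Sum>v<D. gm D xs $$ (i, ?M + v) * u v)"
      by (subst sum.reindex) (auto simp: inj_on_def)
    also have "\<dots> = 0"
    proof (cases "i < ?M")
      case True
      then have "(\<Sum>v<D. gm D xs $$ (i, ?M + v) * u v) = (\<Sum>v<D. fst (snd (xs ! i)) v * u v)"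
        by (intro sum.cong) (auto simp: gm_index)
      then show ?thesis using assms(1)[of "xs ! i"] True by simp
    next
      case False
      with i show ?thesis by (intro sum.neutral) (auto simp: gm_index)
    qed
    finally show "(gm D xs *\<^sub>v ?u) $ i = 0\<^sub>v ?n $ i" using i by simp
  qed simp
  then show ?thesis
    unfolding gd_def det_0_iff_vec_prod_zero[OF gm_carrier[of D xs]]
    using nz \<open>gm D xs *\<^sub>v ?u = 0\<^sub>v ?n\<close> vec_carrier by blast
qed

lemma gd_uncovered_row:
  fixes xs :: "'a::idom entry list"
  assumes "j < D" "\<And>x. x \<in> set xs \<Longrightarrow> fst (snd x) j = 0"
  shows "gd D xs = 0"
proof (rule gd_kernel[where u = "uv j" and w = j])
  fix x assume x: "x \<in> set xs"
  have "(\<Sum>v<D. fst (snd x) v * uv j v) = (\<Sum>v<D. if v = j then fst (snd x) j else 0)"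
    by (intro sum.cong) (auto simp: uv_def)
  also have "\<dots> = 0" using assms x by (intro sum.neutral) auto
  finally show "(\<Sum>v<D. fst (snd x) v * uv j v) = 0" .
qed (use assms in \<open>auto simp: uv_def\<close>)

lemma gd_uncovered_col:
  fixes xs :: "'a::idom entry list"
  assumes "j < D" "\<And>x. x \<in> set xs \<Longrightarrow> snd (snd x) j = 0"
  shows "gd D xs = 0"
proof -
  have "gd D (map flip_entry xs) = 0"
    by (rule gd_uncovered_row[OF assms(1)]) (use assms(2) in \<open>auto simp: flip_entry_def\<close>)
  then show ?thesis by (simp add: gd_flip)
qed

lemma gd_sum_zero_row:
  fixes xs :: "'a::idom entry list"
  assumes "D > 0" "\<And>x. x \<in> set xs \<Longrightarrow> (\<Sum>v<D. fst (snd x) v) = 0"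
  shows "gd D xs = 0"
  by (rule gd_kernel[where u = "\<lambda>_. 1" and w = 0]) (use assms in auto)

text \<open>With all weights zero and as many entries as vertices, only the two off-diagonal blocks
  survive; their contributions form a square, so no sign is left over.\<close>

lemma gd_square:
  fixes T :: "nat \<Rightarrow> nat \<Rightarrow> 'a::idom"
  shows "gd D (map (\<lambda>i. (0, T i, T i)) [0..<D]) = det (mat D D (\<lambda>(i, v). T i v)) ^ 2"
proof -
  let ?T = "mat D D (\<lambda>(i, v). T i v)"
  have T: "?T \<in> carrier_mat D D" by simp
  have "gm D (map (\<lambda>i. (0, T i, T i)) [0..<D]) = four_block_mat (0\<^sub>m D D) ?T (- transpose_mat ?T) (0\<^sub>m D D)"
    by (rule eq_matI) (auto simp: gm_index)
  then have "gd D (map (\<lambda>i. (0, T i, T i)) [0..<D]) =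
      det (four_block_mat (0\<^sub>m D D) ?T (- transpose_mat ?T) (0\<^sub>m D D))"
    by (simp add: gd_def)
  also have "\<dots> = det (0\<^sub>m D D * 0\<^sub>m D D - ?T * (- transpose_mat ?T))"
    by (rule det_four_block_mat[of _ D]) auto
  also have "0\<^sub>m D D * 0\<^sub>m D D - ?T * (- transpose_mat ?T) = ?T * transpose_mat ?T"
  proof -
    have "?T * (- transpose_mat ?T) = - (?T * transpose_mat ?T)"
      by (rule uminus_mult_right_mat) auto
    then show ?thesis by (intro eq_matI) auto
  qed
  also have "det (?T * transpose_mat ?T) = det ?T ^ 2"
    using det_mult[OF T, of "transpose_mat ?T"] det_transpose[OF T] by (simp add: power2_eq_square)
  finally show ?thesis .
qed

lemma gd_units:
  assumes "distinct is" "set is = {0..<D}"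
  shows "gd D (map (\<lambda>i. (0, uv i, uv i)) is) = (1 :: 'a::idom)"
proof -
  have "mset is = mset [0..<D]" using assms by (metis atLeastLessThan_upt distinct_upt set_eq_iff_mset_eq_distinct)
  then have "gd D (map (\<lambda>i. (0, uv i, uv i)) is) = gd D (map (\<lambda>i. (0 :: 'a, uv i, uv i)) [0..<D])"
    by (intro gd_perm) (simp only: mset_map)
  also have "\<dots> = det (mat D D (\<lambda>(i, v). uv i v :: 'a)) ^ 2" by (rule gd_square)
  also have "mat D D (\<lambda>(i, v). uv i v :: 'a) = 1\<^sub>m D"
    by (rule eq_matI) (auto simp: uv_def)
  finally show ?thesis by simp
qed

section \<open>Evaluation of the strip\<close>

definition vsub :: "(nat \<Rightarrow> 'a::comm_ring_1) \<Rightarrow> (nat \<Rightarrow> 'a) \<Rightarrow> nat \<Rightarrow> 'a" where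
  "vsub R R' = (\<lambda>v. R v - R' v)"

lemma vsub_apply [simp]: "vsub R R' v = R v - R' v"
  by (simp add: vsub_def)

abbreviation tst :: "(nat \<Rightarrow> 'a::comm_ring_1) \<Rightarrow> (nat \<Rightarrow> 'a) \<Rightarrow> 'a entry" where
  "tst R C \<equiv> (0, R, C)"

lemma gd_sub_row: "gd D (tst (vsub R R') C # xs) = gd D (tst R C # xs) - gd D (tst R' C # xs)"
  using gd_add_row[of D R "\<lambda>v. (- 1) * R' v" C xs] gd_scale_row[of D "- 1" R' C xs]
  by (simp add: vsub_def)

lemma gd_sub_col: "gd D (tst R (vsub C C') # xs) = gd D (tst R C # xs) - gd D (tst R C' # xs)"
  unfolding gd_flip1[of D 0 R] by (rule gd_sub_row)

lemma gd_sub_row2: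
  "gd D (x # tst (vsub R R') C # xs) = gd D (x # tst R C # xs) - gd D (x # tst R' C # xs)"
  unfolding gd_swap[of D x] by (rule gd_sub_row)

lemma gd_sub_col2:
  "gd D (x # tst R (vsub C C') # xs) = gd D (x # tst R C # xs) - gd D (x # tst R C' # xs)"
  unfolding gd_swap[of D x] by (rule gd_sub_col)

lemma gd_rot3: "gd D (x # y # z # xs) = gd D (z # x # y # xs)"
  by (rule gd_perm) simp

lemma gd_sub_row3:
  "gd D (x # y # tst (vsub R R') C # xs) = gd D (x # y # tst R C # xs) - gd D (x # y # tst R' C # xs)"
  unfolding gd_rot3[of D x y] by (rule gd_sub_row)

lemma gd_sub_col3:
  "gd D (x # y # tst R (vsub C C') # xs) = gd D (x # y # tst R C # xs) - gd D (x # y # tst R C' # xs)"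
  unfolding gd_rot3[of D x y] by (rule gd_sub_col)

lemma gd_dup_row13: "gd D (tst R C # y # tst R C' # xs) = 0"
  using gd_dup_row[of D R C C' "y # xs"] gd_perm[of "tst R C # y # tst R C' # xs" "tst R C # tst R C' # y # xs" D]
  by simp

lemma gd_dup_col13: "gd D (tst R C # y # tst R' C # xs) = 0"
  using gd_dup_col[of D R C R' "y # xs"] gd_perm[of "tst R C # y # tst R' C # xs" "tst R C # tst R' C # y # xs" D]
  by simp

lemma gd_dup_row23: "gd D (y # tst R C # tst R C' # xs) = 0"
  using gd_dup_row[of D R C C' "y # xs"] gd_perm[of "y # tst R C # tst R C' # xs" "tst R C # tst R C' # y # xs" D]
  by simp

lemma gd_dup_col23: "gd D (y # tst R C # tst R' C # xs) = 0"
  using gd_dup_col[of D R C R' "y # xs"] gd_perm[of "y # tst R C # tst R' C # xs" "tst R C # tst R' C # y # xs" D]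
  by simp

lemmas gd_sub = gd_sub_row gd_sub_col gd_sub_row2 gd_sub_col2 gd_sub_row3 gd_sub_col3
lemmas gd_dup = gd_dup_row gd_dup_col gd_dup_row13 gd_dup_col13 gd_dup_row23 gd_dup_col23

lemma gd_clear: "gd D (tst R C # tst R' C' # xs) = gd D (tst R C # tst (vsub R' R) (vsub C' C) # xs)"
  by (simp add: gd_sub gd_dup)

lemma gd_clear2: "gd D (x # tst R C # tst R' C' # xs) = gd D (x # tst R C # tst (vsub R' R) (vsub C' C) # xs)"
  by (simp add: gd_sub gd_dup)

abbreviation edg :: "'a::comm_ring_1 \<Rightarrow> (nat \<Rightarrow> 'a) \<Rightarrow> 'a entry" where
  "edg \<alpha> u \<equiv> (\<alpha>, u, u)"

definition avoids :: "nat \<Rightarrow> 'a::comm_ring_1 entry list \<Rightarrow> bool" where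
  "avoids j xs \<longleftrightarrow> (\<forall>x\<in>set xs. fst (snd x) j = 0 \<and> snd (snd x) j = 0)"

lemma avoids_Nil [simp]: "avoids j []"
  by (simp add: avoids_def)

lemma avoids_Cons [simp]: "avoids j ((\<delta>, R, C) # xs) \<longleftrightarrow> R j = 0 \<and> C j = 0 \<and> avoids j xs"
  by (auto simp: avoids_def)

lemma avoids_append [simp]: "avoids j (xs @ ys) \<longleftrightarrow> avoids j xs \<and> avoids j ys"
  by (auto simp: avoids_def)

lemma uv_same [simp]: "uv i i = 1" by (simp add: uv_def)
lemma uv_other [simp]: "i \<noteq> j \<Longrightarrow> uv i j = 0" by (simp add: uv_def)

context
  fixes j D :: nat and x y :: "nat \<Rightarrow> 'a::idom"
  assumes j: "j < D" and x: "x j = 0" and y: "y j = 0"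
begin

lemma gd_avoids:
  fixes xs :: "'a entry list"
  shows "avoids j xs \<Longrightarrow> gd D xs = 0"
  by (rule gd_uncovered_row[OF j]) (auto simp: avoids_def)

lemma gd_uncov_row:
  fixes xs :: "'a entry list"
  shows "avoids j xs \<Longrightarrow> R j = 0 \<Longrightarrow> gd D ((\<delta>, R, C) # xs) = 0"
  by (rule gd_uncovered_row[OF j]) (auto simp: avoids_def)

lemma gd_uncov_col:
  fixes xs :: "'a entry list"
  shows "avoids j xs \<Longrightarrow> C j = 0 \<Longrightarrow> gd D ((\<delta>, R, C) # xs) = 0"
  by (rule gd_uncovered_col[OF j]) (auto simp: avoids_def)

lemma gd_uncov_col2:
  fixes xs :: "'a entry list"
  shows "avoids j xs \<Longrightarrow> C j = 0 \<Longrightarrow> C' j = 0 \<Longrightarrow> gd D ((\<delta>, R, C) # (\<delta>', R', C') # xs) = 0"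
  by (rule gd_uncovered_col[OF j]) (auto simp: avoids_def)

text \<open>The vertex \<open>j\<close> meets only the two edges \<open>a\<close> and
  \<open>b\<close>. Deleting both leaves it uncovered and gives zero; contracting one of them pins
  \<open>j\<close>; contracting both and subtracting one row from the other pins \<open>j\<close>
  and joins \<open>x\<close> to \<open>y\<close>.\<close>

lemma gd_vertex0:
  assumes xs: "avoids j xs"
  shows "gd D (edg a (vsub (uv j) x) # edg b (vsub (uv j) y) # xs) =
    (a + b) * gd D (tst (uv j) (uv j) # xs) + gd D (tst (uv j) (uv j) # tst (vsub x y) (vsub x y) # xs)"
proof -
  let ?X = "vsub (uv j) x" and ?Y = "vsub (uv j) y"
  have s: "gd D (tst (vsub (uv j) z) (vsub (uv j) z) # ys) = gd D (tst (uv j) (uv j) # ys)"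
    if "z j = 0" "avoids j ys" for z and ys :: "'a entry list"
    using gd_sub_row[of D "uv j" z "vsub (uv j) z" ys] gd_sub_col[of D "uv j" "uv j" z ys]
      gd_uncov_row[of ys z 0 "vsub (uv j) z"] gd_uncov_col[of ys z 0 "uv j"] that by simp
  have "gd D (edg a ?X # edg b ?Y # xs) =
      a * (b * gd D xs + gd D (edg 0 ?Y # xs)) + gd D (edg 0 ?X # edg b ?Y # xs)"
    using gd_edge[of D a ?X ?X "edg b ?Y # xs"] gd_edge[of D b ?Y ?Y xs] by (simp del: vsub_apply)
  also have "gd D (edg 0 ?X # edg b ?Y # xs) = b * gd D (edg 0 ?X # xs) + gd D (edg 0 ?X # edg 0 ?Y # xs)"
    using gd_edge[of D b ?Y ?Y "edg 0 ?X # xs"] by (simp add: gd_swap[of D "(0, ?X, ?X)"] del: vsub_apply)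
  also have "gd D (edg 0 ?X # edg 0 ?Y # xs) = gd D (edg 0 ?X # edg 0 (vsub ?Y ?X) # xs)"
    by (rule gd_clear)
  also have "\<dots> = gd D (edg 0 ?X # edg 0 (vsub x y) # xs)"
  proof -
    have "vsub ?Y ?X = vsub x y" by (rule ext) simp
    then show ?thesis by simp
  qed
  also have "\<dots> = gd D (tst (uv j) (uv j) # tst (vsub x y) (vsub x y) # xs)"
    by (rule s) (use x y xs in simp_all)
  finally show ?thesis
    using s[of x xs, OF x xs] s[of y xs, OF y xs] gd_avoids[OF xs] by (simp add: algebra_simps del: vsub_apply)
qed

lemma gd_vertex1:
  assumes xs: "avoids j xs"
  shows "gd D (tst (uv j) (uv j) # edg a (vsub (uv j) x) # edg b (vsub (uv j) y) # xs) =
    a * b * gd D (tst (uv j) (uv j) # xs) + b * gd D (tst (uv j) (uv j) # tst x x # xs) +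
    a * gd D (tst (uv j) (uv j) # tst y y # xs) + gd D (tst (uv j) (uv j) # tst x x # tst y y # xs)"
proof -
  let ?X = "vsub (uv j) x" and ?Y = "vsub (uv j) y" and ?u = "tst (uv j) (uv j)"
  have e: "gd D (?u # edg \<alpha> (vsub (uv j) z) # ys) = \<alpha> * gd D (?u # ys) + gd D (?u # tst z z # ys)" for \<alpha> z and ys :: "'a entry list"
  proof -
    have "gd D (?u # edg \<alpha> (vsub (uv j) z) # ys) = \<alpha> * gd D (?u # ys) + gd D (?u # edg 0 (vsub (uv j) z) # ys)"
      using gd_edge[of D \<alpha> "vsub (uv j) z" "vsub (uv j) z" "?u # ys"] by (simp add: gd_swap[of D ?u])
    also have "gd D (?u # edg 0 (vsub (uv j) z) # ys) = gd D (?u # tst z z # ys)"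
      by (simp add: gd_sub gd_dup del: vsub_apply)
    finally show ?thesis .
  qed
  have e2: "gd D (?u # tst x x # edg b ?Y # xs) = b * gd D (?u # tst x x # xs) + gd D (?u # tst x x # tst y y # xs)"
    using e[of b y "tst x x # xs"] gd_perm[of "?u # tst x x # edg b ?Y # xs" "?u # edg b ?Y # tst x x # xs" D]
      gd_perm[of "?u # tst x x # tst y y # xs" "?u # tst y y # tst x x # xs" D] by simp
  show ?thesis unfolding e e2 by (simp add: algebra_simps del: vsub_apply)
qed

text \<open>The first entry covers \<open>j\<close> by its row only, so one of the two edges must
  supply the column at \<open>j\<close>. Exchanging rows or columns between the entries then
  collects a unit entry at \<open>j\<close>.\<close>

lemma gd_vertex2:
  assumes xs: "avoids j xs" and v: "v j = 0"
  shows "gd D (tst (uv j) v # edg a (vsub (uv j) x) # edg b (vsub (uv j) y) # xs) =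
    b * gd D (tst (uv j) (uv j) # tst x v # xs) + a * gd D (tst (uv j) (uv j) # tst y v # xs) +
    gd D (tst (uv j) (uv j) # tst x (vsub x y) # tst y v # xs)"
proof -
  let ?X = "vsub (uv j) x" and ?Y = "vsub (uv j) y" and ?u = "tst (uv j) v"
  have one: "gd D (?u # edg 0 (vsub (uv j) z) # ys) = gd D (tst (uv j) (uv j) # tst z v # ys)"
    if z: "z j = 0" and ys: "avoids j ys" for z and ys :: "'a entry list"
  proof -
    have "gd D (?u # edg 0 (vsub (uv j) z) # ys) = - gd D (?u # tst z (vsub (uv j) z) # ys)"
      by (simp add: gd_sub_row2 gd_dup_row)
    also have "\<dots> = - gd D (?u # tst z (uv j) # ys)"
      using z ys v by (simp add: gd_sub_col2 gd_uncov_col2)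
    also have "\<dots> = gd D (tst (uv j) (uv j) # tst z v # ys)" by (simp add: gd_swap_col[of D "uv j" v])
    finally show ?thesis .
  qed
  have e: "gd D (?u # edg \<alpha> z # ys) = \<alpha> * gd D (?u # ys) + gd D (?u # edg 0 z # ys)" for \<alpha> z and ys :: "'a entry list"
    using gd_edge[of D \<alpha> z z "?u # ys"] by (simp add: gd_swap[of D ?u])
  have e2: "gd D (?u # edg 0 ?X # edg b ?Y # xs) = b * gd D (?u # edg 0 ?X # xs) + gd D (?u # edg 0 ?X # edg 0 ?Y # xs)"
    using e[of b ?Y "edg 0 ?X # xs"] gd_perm[of "?u # edg 0 ?X # edg b ?Y # xs" "?u # edg b ?Y # edg 0 ?X # xs" D]
      gd_perm[of "?u # edg 0 ?X # edg 0 ?Y # xs" "?u # edg 0 ?Y # edg 0 ?X # xs" D] by simp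
  have "gd D (?u # edg 0 ?X # edg 0 ?Y # xs) = gd D (?u # edg 0 ?X # edg 0 (vsub ?Y ?X) # xs)"
    by (rule gd_clear2)
  also have "\<dots> = gd D (?u # edg 0 ?X # edg 0 (vsub x y) # xs)"
  proof -
    have "vsub ?Y ?X = vsub x y" by (rule ext) simp
    then show ?thesis by simp
  qed
  also have "\<dots> = gd D (tst (uv j) (uv j) # tst x v # tst (vsub x y) (vsub x y) # xs)"
    by (rule one) (use x y xs in simp_all)
  also have "\<dots> = - gd D (tst (uv j) (uv j) # tst x v # tst y (vsub x y) # xs)"
    by (simp only: gd_sub_row3 gd_dup diff_0)
  also have "\<dots> = gd D (tst (uv j) (uv j) # tst x (vsub x y) # tst y v # xs)"
  proof -
    have "gd D (tst (uv j) (uv j) # tst x v # tst y (vsub x y) # xs) =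
        gd D (tst x v # tst y (vsub x y) # tst (uv j) (uv j) # xs)" by (rule gd_perm) simp
    also have "\<dots> = - gd D (tst x (vsub x y) # tst y v # tst (uv j) (uv j) # xs)" by (rule gd_swap_col)
    also have "gd D (tst x (vsub x y) # tst y v # tst (uv j) (uv j) # xs) =
        gd D (tst (uv j) (uv j) # tst x (vsub x y) # tst y v # xs)" by (rule gd_perm) simp
    finally show ?thesis by (simp only: minus_minus)
  qed
  finally have 3: "gd D (?u # edg 0 ?X # edg 0 ?Y # xs) = gd D (tst (uv j) (uv j) # tst x (vsub x y) # tst y v # xs)" .
  have 0: "gd D (?u # xs) = 0" using xs v by (simp add: gd_uncov_col)
  show ?thesis
    unfolding e[of a] e[of b] e2 3 one[of x xs, OF x xs] one[of y xs, OF y xs] 0 by (simp add: algebra_simps del: vsub_apply)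
qed

end

definition net_at :: "nat \<Rightarrow> (nat \<Rightarrow> 'a::comm_ring_1) \<Rightarrow> (nat \<Rightarrow> 'a) \<Rightarrow> (nat \<Rightarrow> 'a) \<Rightarrow> 'a entry list \<Rightarrow> 'a net" where
  "net_at D x y w xs = \<lparr>pP = gd D xs,
     d1 = gd D (tst x x # xs) - gd D (tst x y # xs),
     d2 = gd D (tst y y # xs) - gd D (tst x y # xs),
     dm = gd D (tst x y # xs),
     ff = gd D (tst x x # tst y y # xs),
     t1 = gd D (tst x w # xs), t2 = gd D (tst y w # xs),
     ch = gd D (tst x x # tst y w # xs), ps = gd D (tst x w # tst y y # xs),
     om = gd D (tst w w # xs),
     x1 = gd D (tst x x # tst w w # xs), x2 = gd D (tst x y # tst w w # xs),
     x3 = gd D (tst y y # tst w w # xs), f4 = gd D (tst x x # tst y y # tst w w # xs)\<rparr>"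

lemma gd_sym1:
  assumes "map flip_entry xs = xs"
  shows "gd D (tst R C # xs) = gd D (tst C R # xs)"
  using gd_flip1[of D 0 R C xs] assms by simp

text \<open>This is the origin of \<open>strip_step\<close>. In the new strip \<open>j\<close> is
  the first vertex and \<open>x\<close> the second; in the old one \<open>j\<close> is pinned by a
  unit entry and \<open>x, y\<close> come first. Symmetry of \<open>xs\<close> makes the minors
  \<open>g\<close> symmetric.\<close>

lemma net_at_step:
  fixes x y w :: "nat \<Rightarrow> 'a::idom"
  assumes j: "j < D" and xj: "x j = 0" and yj: "y j = 0" and wj: "w j = 0"
    and xs: "avoids j xs" and sym: "map flip_entry xs = xs"
  shows "net_at D (uv j) x w (edg a (vsub (uv j) x) # edg b (vsub (uv j) y) # xs) =
    strip_step a b (net_at D x y w (tst (uv j) (uv j) # xs))"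
proof -
  let ?u = "tst (uv j) (uv j) :: 'a entry" and ?A = "edg a (vsub (uv j) x)" and ?B = "edg b (vsub (uv j) y)"
  let ?Z = "?u # xs" and ?N = "net_at D x y w (?u # xs)"
  note v0 = gd_vertex0[of j D x y, OF j xj yj] and v1 = gd_vertex1[of j D x y, OF j xj yj] and v2 = gd_vertex2[of j D x y, OF j xj yj]
  have pull1: "gd D (t # ?A # ?B # ys) = gd D (?A # ?B # t # ys)" for t ys by (rule gd_perm) simp
  have pull2: "gd D (t # s # ?A # ?B # ys) = gd D (?A # ?B # t # s # ys)" for t s ys by (rule gd_perm) simp
  have push2: "gd D (t # s # ?A # ?B # ys) = gd D (t # ?A # ?B # s # ys)" for t s ys by (rule gd_perm) simp
  have push3: "gd D (t # s # r # ?A # ?B # ys) = gd D (t # ?A # ?B # s # r # ys)" for t s r ys by (rule gd_perm) simp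
  have back1: "gd D (?u # t # xs) = gd D (t # ?Z)" for t by (rule gd_perm) simp
  have back2: "gd D (?u # t # s # xs) = gd D (t # s # ?Z)" for t s by (rule gd_perm) simp
  have back3: "gd D (?u # t # s # r # xs) = gd D (t # s # r # ?Z)" for t s r by (rule gd_perm) simp
  have sZ: "map flip_entry ?Z = ?Z" using sym by simp
  have yx: "gd D (tst y x # ?Z) = gd D (tst x y # ?Z)" by (rule gd_sym1[OF sZ])
  have wx: "gd D (tst w x # ?Z) = gd D (tst x w # ?Z)" by (rule gd_sym1[OF sZ])
  have yxw: "gd D (tst y x # tst w w # ?Z) = gd D (tst x y # tst w w # ?Z)"
    by (rule gd_sym1) (use sym in simp)
  have yyxx: "gd D (tst y y # tst x x # ys) = gd D (tst x x # tst y y # ys)" for ys by (rule gd_swap)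
  have xyyx: "gd D (tst x y # tst y x # ys) = - gd D (tst x x # tst y y # ys)" for ys by (rule gd_swap_col)
  have xyyw: "gd D (tst x y # tst y w # ys) = - gd D (tst x w # tst y y # ys)" for ys by (rule gd_swap_col)
  have ywxx: "gd D (tst y w # tst x x # ys) = gd D (tst x x # tst y w # ys)" for ys by (rule gd_swap)
  have yyxw: "gd D (tst y y # tst x w # ys) = gd D (tst x w # tst y y # ys)" for ys by (rule gd_swap)
  have yxxw: "gd D (tst y x # tst x w # ys) = - gd D (tst x x # tst y w # ys)" for ys
    unfolding gd_swap_row[of D y] gd_swap[of D "tst x x"] ..
  note rw = gd_sub gd_dup yx wx yxw yyxx xyyx xyyw ywxx yyxw yxxw
  have P: "gd D (?A # ?B # xs) = (a + b) * pP ?N + d1 ?N + d2 ?N"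
    unfolding v0[OF xs] unfolding back1 by (simp add: rw net_at_def algebra_simps)
  have xx: "gd D (?u # ?A # ?B # xs) = a * b * pP ?N + b * (d1 ?N + dm ?N) + a * (d2 ?N + dm ?N) + ff ?N"
    unfolding v1[OF xs] unfolding back1 back2 by (simp add: rw net_at_def)
  have xy: "gd D (tst (uv j) x # ?A # ?B # xs) = a * dm ?N + b * (d1 ?N + dm ?N) + ff ?N"
    unfolding v2[of xs x, OF xs xj] unfolding back1 back2 by (simp add: rw net_at_def)
  have yy: "gd D (tst x x # ?A # ?B # xs) = (a + b) * (d1 ?N + dm ?N) + ff ?N"
    using v0[of "tst x x # xs" a b] xs xj unfolding pull1 unfolding back1 back2 by (simp add: rw net_at_def)
  have xw: "gd D (tst (uv j) w # ?A # ?B # xs) = a * t2 ?N + b * t1 ?N + ch ?N + ps ?N"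
    unfolding v2[of xs w, OF xs wj] unfolding back1 back2 by (simp add: rw net_at_def)
  have yw: "gd D (tst x w # ?A # ?B # xs) = (a + b) * t1 ?N + ch ?N + ps ?N"
    using v0[of "tst x w # xs" a b] xs xj wj unfolding pull1 unfolding back1 back2 by (simp add: rw net_at_def)
  have ww: "gd D (tst w w # ?A # ?B # xs) = (a + b) * om ?N + x1 ?N - 2 * x2 ?N + x3 ?N"
    using v0[of "tst w w # xs" a b] xs wj unfolding pull1 unfolding back1 back2 by (simp add: rw net_at_def)
  have f: "gd D (?u # tst x x # ?A # ?B # xs) = a * (b * (d1 ?N + dm ?N) + ff ?N)"
    using v1[of "tst x x # xs" a b] xs xj unfolding push2 unfolding back1 back2 back3
    by (simp add: rw net_at_def algebra_simps)
  have c: "gd D (?u # tst x w # ?A # ?B # xs) = a * (b * t1 ?N + ps ?N)"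
    using v1[of "tst x w # xs" a b] xs xj wj unfolding push2 unfolding back1 back2 back3
    by (simp add: rw net_at_def algebra_simps)
  have p: "gd D (tst (uv j) w # tst x x # ?A # ?B # xs) = a * ch ?N"
    using v2[of "tst x x # xs" w a b] xs xj wj unfolding push2 unfolding back1 back2 back3
    by (simp add: rw net_at_def algebra_simps)
  have g1: "gd D (?u # tst w w # ?A # ?B # xs) = a * b * om ?N + a * x3 ?N + b * x1 ?N + f4 ?N"
    using v1[of "tst w w # xs" a b] xs wj unfolding push2 unfolding back1 back2 back3
    by (simp add: rw net_at_def algebra_simps)
  have g2: "gd D (tst (uv j) x # tst w w # ?A # ?B # xs) = a * x2 ?N + b * x1 ?N + f4 ?N"
    using v2[of "tst w w # xs" x a b] xs xj wj unfolding push2 unfolding back1 back2 back3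
    by (simp add: rw net_at_def algebra_simps)
  have g3: "gd D (tst x x # tst w w # ?A # ?B # xs) = (a + b) * x1 ?N + f4 ?N"
    using v0[of "tst x x # tst w w # xs" a b] xs xj wj unfolding pull2 unfolding back1 back2 back3
    by (simp add: rw net_at_def algebra_simps)
  have g4: "gd D (?u # tst x x # tst w w # ?A # ?B # xs) = a * (b * x1 ?N + f4 ?N)"
  proof -
    have back4: "gd D (?u # t # s # r # q # xs) = gd D (t # s # r # q # ?Z)" for t s r q
      by (rule gd_perm) simp
    show ?thesis
      using v1[of "tst x x # tst w w # xs" a b] xs xj wj unfolding push3 unfolding back4 back3 back2 back1
      by (simp add: rw net_at_def algebra_simps)
  qed
  have eq: "net_at D (uv j) x w (?A # ?B # xs) = \<lparr>pP = gd D (?A # ?B # xs),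
     d1 = gd D (?u # ?A # ?B # xs) - gd D (tst (uv j) x # ?A # ?B # xs),
     d2 = gd D (tst x x # ?A # ?B # xs) - gd D (tst (uv j) x # ?A # ?B # xs),
     dm = gd D (tst (uv j) x # ?A # ?B # xs),
     ff = gd D (?u # tst x x # ?A # ?B # xs),
     t1 = gd D (tst (uv j) w # ?A # ?B # xs), t2 = gd D (tst x w # ?A # ?B # xs),
     ch = gd D (?u # tst x w # ?A # ?B # xs), ps = gd D (tst (uv j) w # tst x x # ?A # ?B # xs),
     om = gd D (tst w w # ?A # ?B # xs),
     x1 = gd D (?u # tst w w # ?A # ?B # xs), x2 = gd D (tst (uv j) x # tst w w # ?A # ?B # xs),
     x3 = gd D (tst x x # tst w w # ?A # ?B # xs), f4 = gd D (?u # tst x x # tst w w # ?A # ?B # xs)\<rparr>"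
    by (simp only: net_at_def)
  show ?thesis
    unfolding eq unfolding P xx xy yy xw yw ww f c p g1 g2 g3 g4 strip_step_def
    by (simp add: algebra_simps)
qed

fun strip_edges :: "nat \<Rightarrow> ('a::comm_ring_1 \<times> 'a) list \<Rightarrow> 'a \<Rightarrow> 'a entry list" where
  "strip_edges i [] c = [edg c (vsub (uv i) (uv (Suc i)))]"
| "strip_edges i ((a, b) # L) c = edg a (vsub (uv i) (uv (Suc i))) # edg b (vsub (uv i) (uv (i + 2)))
     # strip_edges (Suc i) L c"

text \<open>Eliminated vertices stay as pinned columns, so the number \<open>D\<close> of columns is
  constant during the induction along the strip.\<close>

definition units :: "nat \<Rightarrow> 'a::comm_ring_1 entry list" where
  "units i = map (\<lambda>v. tst (uv v) (uv v)) [0..<i]"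

lemma units_Suc: "units (Suc i) = units i @ [tst (uv i) (uv i)]"
  by (simp add: units_def)

lemma flip_units [simp]: "map flip_entry (units i) = units i"
  by (simp add: units_def)

lemma flip_strip_edges [simp]: "map flip_entry (strip_edges i L c) = strip_edges i L c"
  by (induction i L c rule: strip_edges.induct) auto

lemma avoids_units [simp]: "j \<ge> i \<Longrightarrow> avoids j (units i)"
  by (auto simp: units_def avoids_def)

lemma avoids_strip_edges [simp]: "j < i \<Longrightarrow> avoids j (strip_edges i L c)"
  by (induction i L c rule: strip_edges.induct) auto

lemma net_at_perm: "mset xs = mset ys \<Longrightarrow> net_at D x y w xs = net_at D x y w ys"
  by (simp add: net_at_def gd_perm[of xs ys] gd_perm[of "t # xs" "t # ys" for t]
      gd_perm[of "t # s # xs" "t # s # ys" for t s] gd_perm[of "t # s # r # xs" "t # s # r # ys" for t s r])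

text \<open>The strip starts at vertex \<open>i\<close>, the vertices below it are pinned, and
  \<open>D - 1\<close> is the ground. In the base case only the last edge is left, joining
  \<open>D - 2\<close> to the ground.\<close>

lemma net_at_strip_edges:
  fixes L :: "('a::idom \<times> 'a) list"
  assumes "D = i + length L + 2"
  shows "net_at D (uv i) (uv (Suc i)) (uv (D - 2))
     (tst (uv (D - 1)) (uv (D - 1)) # units i @ strip_edges i L c) = strip L c"
  using assms
proof (induction i L c rule: strip_edges.induct)
  case (1 i c)
  let ?x = "uv i :: nat \<Rightarrow> 'a" and ?R = "uv (Suc i) :: nat \<Rightarrow> 'a"
  have D: "D = Suc (Suc i)" "D - 1 = Suc i" "D - 2 = i" using 1 by auto
  have av: "avoids i (tst ?R ?R # units i)" by simp
  have e: "gd D (t @ tst ?R ?R # units i @ [edg c (vsub ?x ?R)]) =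
      c * gd D (t @ tst ?R ?R # units i) + gd D (edg 0 (vsub ?x ?R) # t @ tst ?R ?R # units i)" for t
  proof -
    have "gd D (t @ tst ?R ?R # units i @ [edg c (vsub ?x ?R)]) = gd D (edg c (vsub ?x ?R) # t @ tst ?R ?R # units i)"
      by (rule gd_perm) simp
    then show ?thesis using gd_edge[of D c] by simp
  qed
  have un: "gd D (tst ?x ?x # tst ?R ?R # units i) = 1"
  proof -
    have "gd D (tst ?x ?x # tst ?R ?R # units i) = gd D (units (Suc (Suc i)))"
      by (rule gd_perm) (simp add: units_Suc)
    also have "\<dots> = 1" unfolding units_def D by (rule gd_units) auto
    finally show ?thesis .
  qed
  have q0: "gd D (edg 0 (vsub ?x ?R) # tst ?R ?R # units i) = 1"
    using un by (simp add: gd_sub gd_dup)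
  have q1: "gd D (edg 0 (vsub ?x ?R) # tst ?x ?x # tst ?R ?R # units i) = 0"
    by (simp add: gd_sub gd_dup)
  have n: "gd D (tst ?R ?R # units i) = 0"
    by (rule gd_avoids[of i D "\<lambda>_. 0" "\<lambda>_. 0"]) (use D in auto)
  have P: "gd D (tst ?R ?R # units i @ [edg c (vsub ?x ?R)]) = 1"
    using e[of "[]"] n q0 by simp
  have xx: "gd D (tst ?x ?x # tst ?R ?R # units i @ [edg c (vsub ?x ?R)]) = c"
    using e[of "[tst ?x ?x]"] un q1 by simp
  show ?case
    unfolding D net_at_def strip_edges.simps strip.simps strip_end_def using P xx D
    by (simp add: gd_dup)
next
  case (2 i a b L c)
  let ?\<rho> = "tst (uv (D - 1)) (uv (D - 1)) :: 'a entry"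
  have "net_at D (uv i) (uv (Suc i)) (uv (D - 2)) (?\<rho> # units i @ strip_edges i ((a, b) # L) c) =
    net_at D (uv i) (uv (Suc i)) (uv (D - 2)) (edg a (vsub (uv i) (uv (Suc i))) # edg b (vsub (uv i) (uv (i + 2)))
      # ?\<rho> # units i @ strip_edges (Suc i) L c)"
    by (rule net_at_perm) simp
  also have "\<dots> = strip_step a b (net_at D (uv (Suc i)) (uv (i + 2)) (uv (D - 2))
      (tst (uv i) (uv i) # ?\<rho> # units i @ strip_edges (Suc i) L c))"
    by (rule net_at_step) (use 2(2) in simp_all)
  also have "net_at D (uv (Suc i)) (uv (i + 2)) (uv (D - 2))
      (tst (uv i) (uv i) # ?\<rho> # units i @ strip_edges (Suc i) L c) = strip L c"
    using 2 net_at_perm[of "tst (uv i) (uv i) # ?\<rho> # units i @ strip_edges (Suc i) L c"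
      "?\<rho> # units (Suc i) @ strip_edges (Suc i) L c" D "uv (Suc i)" "uv (i + 2)" "uv (D - 2)"]
    by (simp add: units_Suc)
  finally show ?case by simp
qed

section \<open>Quadratic relations\<close>

text \<open>
  With \<open>g\<close> the symmetric matrix of the \<open>G\<close>'s and \<open>C\<close> the matrix with diagonal \<open>X3, X1, F\<close> and
  off-diagonal entries \<open>- X2, - Y, - X\<close>, these are the entries of \<open>P C = adj g\<close>, \<open>g C = P K\<close> and
  \<open>adj C = K g\<close>. The last two are needed at the points where \<open>P\<close> vanishes.
\<close>

definition lag :: "'a::comm_ring_1 \<Rightarrow> 'a \<Rightarrow> 'a \<Rightarrow> 'a \<Rightarrow> 'a \<Rightarrow> 'a \<Rightarrow> 'a \<Rightarrow> 'a \<Rightarrow> 'a \<Rightarrow> 'a \<Rightarrow> 'a \<Rightarrow> 'a \<Rightarrow> 'a \<Rightarrow> 'a \<Rightarrow> bool" where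
  "lag P G11 G12 G22 G13 G23 G33 F X Y X1 X2 X3 K \<longleftrightarrow>
    P * F = G11 * G22 - G12 * G12 \<and>
    P * X1 = G11 * G33 - G13 * G13 \<and>
    P * X3 = G22 * G33 - G23 * G23 \<and>
    P * X = G11 * G23 - G12 * G13 \<and>
    P * Y = G13 * G22 - G12 * G23 \<and>
    P * X2 = G12 * G33 - G13 * G23 \<and>
    P * K = G11 * X3 - G12 * X2 - G13 * Y \<and>
    P * K = G22 * X1 - G12 * X2 - G23 * X \<and>
    P * K = G33 * F - G13 * Y - G23 * X \<and>
    G12 * X1 = G11 * X2 + G13 * X \<and>
    G13 * F = G11 * Y + G12 * X \<and>
    G12 * X3 = G22 * X2 + G23 * Y \<and>
    G23 * F = G12 * Y + G22 * X \<and>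
    G13 * X3 = G23 * X2 + G33 * Y \<and>
    G23 * X1 = G13 * X2 + G33 * X \<and>
    K * G11 = X1 * F - X * X \<and>
    K * G22 = X3 * F - Y * Y \<and>
    K * G33 = X1 * X3 - X2 * X2 \<and>
    K * G12 = X2 * F + X * Y \<and>
    K * G13 = X2 * X + Y * X1 \<and>
    K * G23 = X2 * Y + X * X3"

text \<open>The fourteen components are homogeneous coordinates on the Lagrangian Grassmannian of a
  symplectic space of dimension six: for \<open>P = 1\<close> they are, up to sign, all minors of a
  symmetric three-by-three matrix, and \<open>lag\<close> lists the 21 quadrics. A step is linear in
  these coordinates, and each new quadric is an explicit combination of old ones, so nothing is
  divided by \<open>P\<close>.\<close>

lemma lag_step:
  fixes P :: "'a::comm_ring_1"
  assumes "lag P G11 G12 G22 G13 G23 G33 F X Y X1 X2 X3 K"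
  shows "lag ((a + b) * P + G11 - 2 * G12 + G22) (a * b * P + b * G11 + a * G22 + F) (b * G11 + a * G12 + F) ((a + b) * G11 + F) (a * G23 + b * G13 + X + Y) ((a + b) * G13 + X + Y) ((a + b) * G33 + X1 - 2 * X2 + X3) (a * b * G11 + a * F) (a * b * G13 + a * Y) (a * X) (a * b * G33 + b * X1 + a * X3 + K) (a * X2 + b * X1 + K) ((a + b) * X1 + K) (a * b * X1 + a * K)"
proof -
  have z: "P * F - (G11 * G22 - G12 * G12) = 0"
    "P * X1 - (G11 * G33 - G13 * G13) = 0"
    "P * X3 - (G22 * G33 - G23 * G23) = 0"
    "P * X - (G11 * G23 - G12 * G13) = 0"
    "P * Y - (G13 * G22 - G12 * G23) = 0"
    "P * X2 - (G12 * G33 - G13 * G23) = 0"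
    "P * K - (G11 * X3 - G12 * X2 - G13 * Y) = 0"
    "P * K - (G22 * X1 - G12 * X2 - G23 * X) = 0"
    "P * K - (G33 * F - G13 * Y - G23 * X) = 0"
    "G12 * X1 - (G11 * X2 + G13 * X) = 0"
    "G13 * F - (G11 * Y + G12 * X) = 0"
    "G12 * X3 - (G22 * X2 + G23 * Y) = 0"
    "G23 * F - (G12 * Y + G22 * X) = 0"
    "G13 * X3 - (G23 * X2 + G33 * Y) = 0"
    "G23 * X1 - (G13 * X2 + G33 * X) = 0"
    "K * G11 - (X1 * F - X * X) = 0"
    "K * G22 - (X3 * F - Y * Y) = 0"
    "K * G33 - (X1 * X3 - X2 * X2) = 0"
    "K * G12 - (X2 * F + X * Y) = 0"
    "K * G13 - (X2 * X + Y * X1) = 0"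
    "K * G23 - (X2 * Y + X * X3) = 0"
    using assms unfolding lag_def right_minus_eq by blast+
  have g0: "((a + b) * P + G11 - 2 * G12 + G22) * (a * b * G11 + a * F) - ((a * b * P + b * G11 + a * G22 + F) * ((a + b) * G11 + F) - (b * G11 + a * G12 + F) * (b * G11 + a * G12 + F)) =
      a * a * (P * F - (G11 * G22 - G12 * G12))"
    by (simp add: algebra_simps)
  have g1: "((a + b) * P + G11 - 2 * G12 + G22) * (a * b * G33 + b * X1 + a * X3 + K) - ((a * b * P + b * G11 + a * G22 + F) * ((a + b) * G33 + X1 - 2 * X2 + X3) - (a * G23 + b * G13 + X + Y) * (a * G23 + b * G13 + X + Y)) =
      b * b * (P * X1 - (G11 * G33 - G13 * G13)) + a * a * (P * X3 - (G22 * G33 - G23 * G23)) + 2 * a * b * (P * X2 - (G12 * G33 - G13 * G23)) + b * (P * K - (G11 * X3 - G12 * X2 - G13 * Y)) + b * (P * K - (G33 * F - G13 * Y - G23 * X)) + a * (P * K - (G22 * X1 - G12 * X2 - G23 * X)) + a * (P * K - (G33 * F - G13 * Y - G23 * X)) + (K * G11 - (X1 * F - X * X)) + (K * G22 - (X3 * F - Y * Y)) - b * (P * K - (G22 * X1 - G12 * X2 - G23 * X)) - a * (P * K - (G11 * X3 - G12 * X2 - G13 * Y)) - 2 * b * (G12 * X1 - (G11 * X2 + G13 * X)) - 2 * a * (G12 * X3 - (G22 * X2 + G23 * Y)) - 2 * (K * G12 - (X2 * F + X * Y))"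
    by (simp add: algebra_simps)
  have g2: "((a + b) * P + G11 - 2 * G12 + G22) * ((a + b) * X1 + K) - (((a + b) * G11 + F) * ((a + b) * G33 + X1 - 2 * X2 + X3) - ((a + b) * G13 + X + Y) * ((a + b) * G13 + X + Y)) =
      b * b * (P * X1 - (G11 * G33 - G13 * G13)) + 2 * a * b * (P * X1 - (G11 * G33 - G13 * G13)) + a * a * (P * X1 - (G11 * G33 - G13 * G13)) + b * (P * K - (G11 * X3 - G12 * X2 - G13 * Y)) + b * (P * K - (G33 * F - G13 * Y - G23 * X)) + a * (P * K - (G11 * X3 - G12 * X2 - G13 * Y)) + a * (P * K - (G33 * F - G13 * Y - G23 * X)) + (K * G11 - (X1 * F - X * X)) + (K * G22 - (X3 * F - Y * Y)) - b * (P * K - (G22 * X1 - G12 * X2 - G23 * X)) - a * (P * K - (G22 * X1 - G12 * X2 - G23 * X)) - 2 * b * (G12 * X1 - (G11 * X2 + G13 * X)) - 2 * a * (G12 * X1 - (G11 * X2 + G13 * X)) - 2 * (K * G12 - (X2 * F + X * Y))"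
    by (simp add: algebra_simps)
  have g3: "((a + b) * P + G11 - 2 * G12 + G22) * (a * b * G13 + a * Y) - ((a * b * P + b * G11 + a * G22 + F) * ((a + b) * G13 + X + Y) - (b * G11 + a * G12 + F) * (a * G23 + b * G13 + X + Y)) =
      a * a * (P * Y - (G13 * G22 - G12 * G23)) + a * (G23 * F - (G12 * Y + G22 * X)) - a * b * (P * X - (G11 * G23 - G12 * G13)) - a * (G13 * F - (G11 * Y + G12 * X))"
    by (simp add: algebra_simps)
  have g4: "((a + b) * P + G11 - 2 * G12 + G22) * (a * X) - ((a * G23 + b * G13 + X + Y) * ((a + b) * G11 + F) - (b * G11 + a * G12 + F) * ((a + b) * G13 + X + Y)) =
      a * b * (P * X - (G11 * G23 - G12 * G13)) + a * a * (P * X - (G11 * G23 - G12 * G13)) + a * (G13 * F - (G11 * Y + G12 * X)) - a * (G23 * F - (G12 * Y + G22 * X))"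
    by (simp add: algebra_simps)
  have g5: "((a + b) * P + G11 - 2 * G12 + G22) * (a * X2 + b * X1 + K) - ((b * G11 + a * G12 + F) * ((a + b) * G33 + X1 - 2 * X2 + X3) - (a * G23 + b * G13 + X + Y) * ((a + b) * G13 + X + Y)) =
      b * b * (P * X1 - (G11 * G33 - G13 * G13)) + a * b * (P * X1 - (G11 * G33 - G13 * G13)) + a * b * (P * X2 - (G12 * G33 - G13 * G23)) + a * a * (P * X2 - (G12 * G33 - G13 * G23)) + b * (P * K - (G11 * X3 - G12 * X2 - G13 * Y)) + b * (P * K - (G33 * F - G13 * Y - G23 * X)) + a * (P * K - (G33 * F - G13 * Y - G23 * X)) + (K * G11 - (X1 * F - X * X)) + (K * G22 - (X3 * F - Y * Y)) - b * (P * K - (G22 * X1 - G12 * X2 - G23 * X)) - 2 * b * (G12 * X1 - (G11 * X2 + G13 * X)) - a * (G12 * X1 - (G11 * X2 + G13 * X)) - a * (G12 * X3 - (G22 * X2 + G23 * Y)) - 2 * (K * G12 - (X2 * F + X * Y))"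
    by (simp add: algebra_simps)
  have g6: "((a + b) * P + G11 - 2 * G12 + G22) * (a * b * X1 + a * K) - ((a * b * P + b * G11 + a * G22 + F) * ((a + b) * X1 + K) - (b * G11 + a * G12 + F) * (a * X2 + b * X1 + K) - (a * G23 + b * G13 + X + Y) * (a * X)) =
      a * a * (P * K - (G22 * X1 - G12 * X2 - G23 * X)) + a * (K * G11 - (X1 * F - X * X)) - a * b * (G12 * X1 - (G11 * X2 + G13 * X)) - a * (K * G12 - (X2 * F + X * Y))"
    by (simp add: algebra_simps)
  have g7: "((a + b) * P + G11 - 2 * G12 + G22) * (a * b * X1 + a * K) - (((a + b) * G11 + F) * (a * b * G33 + b * X1 + a * X3 + K) - (b * G11 + a * G12 + F) * (a * X2 + b * X1 + K) - ((a + b) * G13 + X + Y) * (a * b * G13 + a * Y)) =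
      a * b * b * (P * X1 - (G11 * G33 - G13 * G13)) + a * a * b * (P * X1 - (G11 * G33 - G13 * G13)) + a * b * (P * K - (G11 * X3 - G12 * X2 - G13 * Y)) + a * b * (P * K - (G33 * F - G13 * Y - G23 * X)) + a * a * (P * K - (G11 * X3 - G12 * X2 - G13 * Y)) + a * (K * G22 - (X3 * F - Y * Y)) - a * b * (P * K - (G22 * X1 - G12 * X2 - G23 * X)) - a * b * (G12 * X1 - (G11 * X2 + G13 * X)) - a * (K * G12 - (X2 * F + X * Y))"
    by (simp add: algebra_simps)
  have g8: "((a + b) * P + G11 - 2 * G12 + G22) * (a * b * X1 + a * K) - (((a + b) * G33 + X1 - 2 * X2 + X3) * (a * b * G11 + a * F) - (a * G23 + b * G13 + X + Y) * (a * X) - ((a + b) * G13 + X + Y) * (a * b * G13 + a * Y)) =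
      a * b * b * (P * X1 - (G11 * G33 - G13 * G13)) + a * a * b * (P * X1 - (G11 * G33 - G13 * G13)) + a * b * (P * K - (G11 * X3 - G12 * X2 - G13 * Y)) + a * b * (P * K - (G33 * F - G13 * Y - G23 * X)) + a * a * (P * K - (G33 * F - G13 * Y - G23 * X)) + a * (K * G11 - (X1 * F - X * X)) + a * (K * G22 - (X3 * F - Y * Y)) - a * b * (P * K - (G22 * X1 - G12 * X2 - G23 * X)) - 2 * a * b * (G12 * X1 - (G11 * X2 + G13 * X)) - 2 * a * (K * G12 - (X2 * F + X * Y))"
    by (simp add: algebra_simps)
  have g9: "(b * G11 + a * G12 + F) * (a * b * G33 + b * X1 + a * X3 + K) - ((a * b * P + b * G11 + a * G22 + F) * (a * X2 + b * X1 + K) + (a * G23 + b * G13 + X + Y) * (a * b * G13 + a * Y)) =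
      a * b * (P * K - (G22 * X1 - G12 * X2 - G23 * X)) + a * b * (G12 * X1 - (G11 * X2 + G13 * X)) + a * a * (G12 * X3 - (G22 * X2 + G23 * Y)) + a * (K * G12 - (X2 * F + X * Y)) - a * b * b * (P * X1 - (G11 * G33 - G13 * G13)) - a * a * b * (P * X2 - (G12 * G33 - G13 * G23)) - a * b * (P * K - (G11 * X3 - G12 * X2 - G13 * Y)) - a * b * (P * K - (G33 * F - G13 * Y - G23 * X)) - a * (K * G22 - (X3 * F - Y * Y))"
    by (simp add: algebra_simps)
  have g10: "(a * G23 + b * G13 + X + Y) * (a * b * G11 + a * F) - ((a * b * P + b * G11 + a * G22 + F) * (a * X) + (b * G11 + a * G12 + F) * (a * b * G13 + a * Y)) =
      a * a * (G23 * F - (G12 * Y + G22 * X)) - a * a * b * (P * X - (G11 * G23 - G12 * G13))"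
    by (simp add: algebra_simps)
  have g11: "(b * G11 + a * G12 + F) * ((a + b) * X1 + K) - (((a + b) * G11 + F) * (a * X2 + b * X1 + K) + ((a + b) * G13 + X + Y) * (a * X)) =
      a * b * (G12 * X1 - (G11 * X2 + G13 * X)) + a * a * (G12 * X1 - (G11 * X2 + G13 * X)) + a * (K * G12 - (X2 * F + X * Y)) - a * (K * G11 - (X1 * F - X * X))"
    by (simp add: algebra_simps)
  have g12: "((a + b) * G13 + X + Y) * (a * b * G11 + a * F) - ((b * G11 + a * G12 + F) * (a * X) + ((a + b) * G11 + F) * (a * b * G13 + a * Y)) =
      a * a * (G13 * F - (G11 * Y + G12 * X))"
    by (simp add: algebra_simps)
  have g13: "(a * G23 + b * G13 + X + Y) * ((a + b) * X1 + K) - (((a + b) * G13 + X + Y) * (a * X2 + b * X1 + K) + ((a + b) * G33 + X1 - 2 * X2 + X3) * (a * X)) =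
      a * b * (G23 * X1 - (G13 * X2 + G33 * X)) + a * a * (G23 * X1 - (G13 * X2 + G33 * X)) + a * (K * G23 - (X2 * Y + X * X3)) - a * (K * G13 - (X2 * X + Y * X1))"
    by (simp add: algebra_simps)
  have g14: "((a + b) * G13 + X + Y) * (a * b * G33 + b * X1 + a * X3 + K) - ((a * G23 + b * G13 + X + Y) * (a * X2 + b * X1 + K) + ((a + b) * G33 + X1 - 2 * X2 + X3) * (a * b * G13 + a * Y)) =
      a * a * (G13 * X3 - (G23 * X2 + G33 * Y)) + a * (K * G13 - (X2 * X + Y * X1)) - a * b * (G23 * X1 - (G13 * X2 + G33 * X)) - a * (K * G23 - (X2 * Y + X * X3))"
    by (simp add: algebra_simps)
  have g15: "(a * b * X1 + a * K) * (a * b * P + b * G11 + a * G22 + F) - ((a * b * G33 + b * X1 + a * X3 + K) * (a * b * G11 + a * F) - (a * b * G13 + a * Y) * (a * b * G13 + a * Y)) =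
      a * a * b * b * (P * X1 - (G11 * G33 - G13 * G13)) + a * a * b * (P * K - (G11 * X3 - G12 * X2 - G13 * Y)) + a * a * b * (P * K - (G33 * F - G13 * Y - G23 * X)) + a * a * (K * G22 - (X3 * F - Y * Y)) - a * a * b * (P * K - (G22 * X1 - G12 * X2 - G23 * X))"
    by (simp add: algebra_simps)
  have g16: "(a * b * X1 + a * K) * ((a + b) * G11 + F) - (((a + b) * X1 + K) * (a * b * G11 + a * F) - (a * X) * (a * X)) =
      a * a * (K * G11 - (X1 * F - X * X))"
    by (simp add: algebra_simps)
  have g17: "(a * b * X1 + a * K) * ((a + b) * G33 + X1 - 2 * X2 + X3) - ((a * b * G33 + b * X1 + a * X3 + K) * ((a + b) * X1 + K) - (a * X2 + b * X1 + K) * (a * X2 + b * X1 + K)) =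
      a * a * (K * G33 - (X1 * X3 - X2 * X2))"
    by (simp add: algebra_simps)
  have g18: "(a * b * X1 + a * K) * (b * G11 + a * G12 + F) - ((a * X2 + b * X1 + K) * (a * b * G11 + a * F) + (a * b * G13 + a * Y) * (a * X)) =
      a * a * b * (G12 * X1 - (G11 * X2 + G13 * X)) + a * a * (K * G12 - (X2 * F + X * Y))"
    by (simp add: algebra_simps)
  have g19: "(a * b * X1 + a * K) * (a * G23 + b * G13 + X + Y) - ((a * X2 + b * X1 + K) * (a * b * G13 + a * Y) + (a * X) * (a * b * G33 + b * X1 + a * X3 + K)) =
      a * a * b * (G23 * X1 - (G13 * X2 + G33 * X)) + a * a * (K * G23 - (X2 * Y + X * X3))"
    by (simp add: algebra_simps)
  have g20: "(a * b * X1 + a * K) * ((a + b) * G13 + X + Y) - ((a * X2 + b * X1 + K) * (a * X) + (a * b * G13 + a * Y) * ((a + b) * X1 + K)) =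
      a * a * (K * G13 - (X2 * X + Y * X1))"
    by (simp add: algebra_simps)
  show ?thesis
    unfolding lag_def
    by (intro conjI; rule right_minus_eq[THEN iffD1];
      simp only: g0 g1 g2 g3 g4 g5 g6 g7 g8 g9 g10 g11 g12 g13 g14 g15 g16 g17 g18 g19 g20 z mult_zero_right add_0_left add_0_right diff_0_right diff_0 minus_zero)
qed

text \<open>Same principle for an additional edge of weight \<open>z\<close> from the ground to the
  first vertex.\<close>

lemma lag_edge:
  fixes P :: "'a::comm_ring_1"
  assumes "lag P G11 G12 G22 G13 G23 G33 F X Y X1 X2 X3 K"
  shows "lag (z * P + G11) (z * G11) (z * G12) (z * G22 + F) (z * G13) (z * G23 + X) (z * G33 + X1) (z * F) (z * X) (z * Y) (z * X1) (z * X2) (z * X3 + K) (z * K)"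
proof -
  have z: "P * F - (G11 * G22 - G12 * G12) = 0"
    "P * X1 - (G11 * G33 - G13 * G13) = 0"
    "P * X3 - (G22 * G33 - G23 * G23) = 0"
    "P * X - (G11 * G23 - G12 * G13) = 0"
    "P * Y - (G13 * G22 - G12 * G23) = 0"
    "P * X2 - (G12 * G33 - G13 * G23) = 0"
    "P * K - (G11 * X3 - G12 * X2 - G13 * Y) = 0"
    "P * K - (G22 * X1 - G12 * X2 - G23 * X) = 0"
    "P * K - (G33 * F - G13 * Y - G23 * X) = 0"
    "G12 * X1 - (G11 * X2 + G13 * X) = 0"
    "G13 * F - (G11 * Y + G12 * X) = 0"
    "G12 * X3 - (G22 * X2 + G23 * Y) = 0"
    "G23 * F - (G12 * Y + G22 * X) = 0"
    "G13 * X3 - (G23 * X2 + G33 * Y) = 0"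
    "G23 * X1 - (G13 * X2 + G33 * X) = 0"
    "K * G11 - (X1 * F - X * X) = 0"
    "K * G22 - (X3 * F - Y * Y) = 0"
    "K * G33 - (X1 * X3 - X2 * X2) = 0"
    "K * G12 - (X2 * F + X * Y) = 0"
    "K * G13 - (X2 * X + Y * X1) = 0"
    "K * G23 - (X2 * Y + X * X3) = 0"
    using assms unfolding lag_def right_minus_eq by blast+
  have g0: "(z * P + G11) * (z * F) - ((z * G11) * (z * G22 + F) - (z * G12) * (z * G12)) =
      z * z * (P * F - (G11 * G22 - G12 * G12))"
    by (simp add: algebra_simps)
  have g1: "(z * P + G11) * (z * X1) - ((z * G11) * (z * G33 + X1) - (z * G13) * (z * G13)) =
      z * z * (P * X1 - (G11 * G33 - G13 * G13))"
    by (simp add: algebra_simps)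
  have g2: "(z * P + G11) * (z * X3 + K) - ((z * G22 + F) * (z * G33 + X1) - (z * G23 + X) * (z * G23 + X)) =
      z * z * (P * X3 - (G22 * G33 - G23 * G23)) + z * (P * K - (G22 * X1 - G12 * X2 - G23 * X)) + z * (P * K - (G33 * F - G13 * Y - G23 * X)) + (K * G11 - (X1 * F - X * X)) - z * (P * K - (G11 * X3 - G12 * X2 - G13 * Y))"
    by (simp add: algebra_simps)
  have g3: "(z * P + G11) * (z * X) - ((z * G11) * (z * G23 + X) - (z * G12) * (z * G13)) =
      z * z * (P * X - (G11 * G23 - G12 * G13))"
    by (simp add: algebra_simps)
  have g4: "(z * P + G11) * (z * Y) - ((z * G13) * (z * G22 + F) - (z * G12) * (z * G23 + X)) =
      z * z * (P * Y - (G13 * G22 - G12 * G23)) - z * (G13 * F - (G11 * Y + G12 * X))"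
    by (simp add: algebra_simps)
  have g5: "(z * P + G11) * (z * X2) - ((z * G12) * (z * G33 + X1) - (z * G13) * (z * G23 + X)) =
      z * z * (P * X2 - (G12 * G33 - G13 * G23)) - z * (G12 * X1 - (G11 * X2 + G13 * X))"
    by (simp add: algebra_simps)
  have g6: "(z * P + G11) * (z * K) - ((z * G11) * (z * X3 + K) - (z * G12) * (z * X2) - (z * G13) * (z * Y)) =
      z * z * (P * K - (G11 * X3 - G12 * X2 - G13 * Y))"
    by (simp add: algebra_simps)
  have g7: "(z * P + G11) * (z * K) - ((z * G22 + F) * (z * X1) - (z * G12) * (z * X2) - (z * G23 + X) * (z * X)) =
      z * z * (P * K - (G22 * X1 - G12 * X2 - G23 * X)) + z * (K * G11 - (X1 * F - X * X))"
    by (simp add: algebra_simps)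
  have g8: "(z * P + G11) * (z * K) - ((z * G33 + X1) * (z * F) - (z * G13) * (z * Y) - (z * G23 + X) * (z * X)) =
      z * z * (P * K - (G33 * F - G13 * Y - G23 * X)) + z * (K * G11 - (X1 * F - X * X))"
    by (simp add: algebra_simps)
  have g9: "(z * G12) * (z * X1) - ((z * G11) * (z * X2) + (z * G13) * (z * X)) =
      z * z * (G12 * X1 - (G11 * X2 + G13 * X))"
    by (simp add: algebra_simps)
  have g10: "(z * G13) * (z * F) - ((z * G11) * (z * Y) + (z * G12) * (z * X)) =
      z * z * (G13 * F - (G11 * Y + G12 * X))"
    by (simp add: algebra_simps)
  have g11: "(z * G12) * (z * X3 + K) - ((z * G22 + F) * (z * X2) + (z * G23 + X) * (z * Y)) =
      z * z * (G12 * X3 - (G22 * X2 + G23 * Y)) + z * (K * G12 - (X2 * F + X * Y))"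
    by (simp add: algebra_simps)
  have g12: "(z * G23 + X) * (z * F) - ((z * G12) * (z * Y) + (z * G22 + F) * (z * X)) =
      z * z * (G23 * F - (G12 * Y + G22 * X))"
    by (simp add: algebra_simps)
  have g13: "(z * G13) * (z * X3 + K) - ((z * G23 + X) * (z * X2) + (z * G33 + X1) * (z * Y)) =
      z * z * (G13 * X3 - (G23 * X2 + G33 * Y)) + z * (K * G13 - (X2 * X + Y * X1))"
    by (simp add: algebra_simps)
  have g14: "(z * G23 + X) * (z * X1) - ((z * G13) * (z * X2) + (z * G33 + X1) * (z * X)) =
      z * z * (G23 * X1 - (G13 * X2 + G33 * X))"
    by (simp add: algebra_simps)
  have g15: "(z * K) * (z * G11) - ((z * X1) * (z * F) - (z * X) * (z * X)) =
      z * z * (K * G11 - (X1 * F - X * X))"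
    by (simp add: algebra_simps)
  have g16: "(z * K) * (z * G22 + F) - ((z * X3 + K) * (z * F) - (z * Y) * (z * Y)) =
      z * z * (K * G22 - (X3 * F - Y * Y))"
    by (simp add: algebra_simps)
  have g17: "(z * K) * (z * G33 + X1) - ((z * X1) * (z * X3 + K) - (z * X2) * (z * X2)) =
      z * z * (K * G33 - (X1 * X3 - X2 * X2))"
    by (simp add: algebra_simps)
  have g18: "(z * K) * (z * G12) - ((z * X2) * (z * F) + (z * X) * (z * Y)) =
      z * z * (K * G12 - (X2 * F + X * Y))"
    by (simp add: algebra_simps)
  have g19: "(z * K) * (z * G13) - ((z * X2) * (z * X) + (z * Y) * (z * X1)) =
      z * z * (K * G13 - (X2 * X + Y * X1))"
    by (simp add: algebra_simps)
  have g20: "(z * K) * (z * G23 + X) - ((z * X2) * (z * Y) + (z * X) * (z * X3 + K)) =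
      z * z * (K * G23 - (X2 * Y + X * X3))"
    by (simp add: algebra_simps)
  show ?thesis
    unfolding lag_def
    by (intro conjI; rule right_minus_eq[THEN iffD1];
      simp only: g0 g1 g2 g3 g4 g5 g6 g7 g8 g9 g10 g11 g12 g13 g14 g15 g16 g17 g18 g19 g20 z mult_zero_right add_0_left add_0_right diff_0_right diff_0 minus_zero)
qed

definition net_lag :: "'a::comm_ring_1 net \<Rightarrow> bool" where
  "net_lag N \<longleftrightarrow> lag (pP N) (d1 N + dm N) (dm N) (d2 N + dm N) (t1 N) (t2 N) (om N) (ff N) (ch N) (ps N)
     (x1 N) (x2 N) (x3 N) (f4 N)"

lemma net_lag_strip: "net_lag (strip L c)"
proof (induction L c rule: strip.induct)
  case (1 c)
  show ?case by (simp add: net_lag_def lag_def strip_end_def)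
next
  case (2 a b L c)
  show ?case
    using lag_step[OF 2[unfolded net_lag_def], of a b]
    by (simp add: net_lag_def strip_step_def algebra_simps)
qed

lemma mir_d2_row:
  fixes L :: "('a::comm_ring_1 \<times> 'a) list" and N0 :: "'a net" and c :: 'a
  defines "N \<equiv> strip L c"
  assumes "mir L c = (M, e)"
  shows "d2 (strip_on (M @ [(e, b)]) N0) = (b * (om N - t1 N) + x1 N - 2 * x2 N + x3 N - ch N - ps N
      + x2 N - x2 N) * pP N0 + (om N - t2 N) * d1 N0 + (om N - t1 N) * d2 N0"
  unfolding N_def using assms(2)
proof (induction L c arbitrary: M e b N0 rule: strip.induct)
  case (1 c)
  then show ?case by (simp add: strip_on_def strip_end_def strip_step_def algebra_simps)
next
  case (2 x y L c)
  obtain M' e' where m: "mir L c = (M', e')" by fastforce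
  with 2 have M: "M = M' @ [(e', y)]" "e = x" by auto
  note IH = 2(1)[OF m, of y "strip_step x b N0"]
  have e: "strip_on (M @ [(e, b)]) N0 = strip_on (M' @ [(e', y)]) (strip_step x b N0)"
    using M strip_on_snoc by blast
  show ?case
    unfolding e
    using IH by (simp add: strip_step_def algebra_simps)
qed

text \<open>The forest separating \<open>y\<close> from \<open>x, r\<close> reads after reversal as
  \<open>w\<close> against \<open>r, x\<close>. This needs the row of \<open>w\<close>, which is why
  \<open>om\<close> enters.\<close>

lemma mir_d2:
  fixes L :: "('a::comm_ring_1 \<times> 'a) list"
  assumes "mir L c = (M, e)"
  shows "d2 (strip M e) = om (strip L c) - t1 (strip L c)"
proof (cases L)
  case Nil
  with assms show ?thesis by (simp add: strip_end_def)
next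
  case (Cons p L')
  obtain x y where p: "p = (x, y)" by fastforce
  obtain M' e' where m: "mir L' c = (M', e')" by fastforce
  have M: "M = M' @ [(e', y)]" "e = x" using assms Cons p m by auto
  have e: "strip M e = strip_on (M' @ [(e', y)]) (strip_end x)"
    unfolding M strip_eq_strip_on ..
  show ?thesis
    unfolding e Cons p using mir_d2_row[OF m, of y "strip_end x"]
    by (simp add: strip_end_def strip_step_def algebra_simps)
qed

text \<open>The minors of second order are determined by those of first order through the quadratic
  relations once \<open>pP\<close> can be cancelled, so no further row recursion is
  required.\<close>

lemma mir_quadratic:
  fixes L :: "('a::idom \<times> 'a) list"
  assumes m: "mir L c = (M, e)" and P: "pP (strip L c) \<noteq> 0"
  shows "ff (strip M e) = x1 (strip L c)" "ch (strip M e) = ch (strip L c)"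
proof -
  let ?N = "strip L c" and ?M = "strip M e"
  note s = mir_strip[OF m] mir_d2[OF m]
  have t2: "t2 ?M = d1 ?N - (t1 ?N - t2 ?N)" using s(5) unfolding s(4) by (simp add: algebra_simps)
  have r: "pP ?N * x1 ?N = (d1 ?N + dm ?N) * om ?N - t1 ?N * t1 ?N"
    "pP ?N * ch ?N = (d1 ?N + dm ?N) * t2 ?N - dm ?N * t1 ?N"
    "pP ?M * ff ?M = (d1 ?M + dm ?M) * (d2 ?M + dm ?M) - dm ?M * dm ?M"
    "pP ?M * ch ?M = (d1 ?M + dm ?M) * t2 ?M - dm ?M * t1 ?M"
    using net_lag_strip[of L c] net_lag_strip[of M e] by (simp_all only: net_lag_def lag_def)
  have "pP ?N * ff ?M = pP ?N * x1 ?N" using r(3) unfolding s(1-4,6) r(1) by (simp add: algebra_simps)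
  with P show "ff ?M = x1 ?N" by simp
  have "pP ?N * ch ?M = pP ?N * ch ?N" using r(4) unfolding s(1-4,6) t2 r(2) by (simp add: algebra_simps)
  with P show "ch ?M = ch ?N" by simp
qed

section \<open>Dodgson polynomials as bordered determinants\<close>

lemma ex_reindex_permutation:
  fixes \<rho> \<rho>' :: "nat \<Rightarrow> 'b"
  assumes "inj_on \<rho> {..<n}" "inj_on \<rho>' {..<n}" "\<rho> ` {..<n} = \<rho>' ` {..<n}"
  shows "\<exists>p. p permutes {0..<n} \<and> (\<forall>r<n. \<rho> (p r) = \<rho>' r)"
proof -
  define p where "p r = (if r < n then inv_into {..<n} \<rho> (\<rho>' r) else r)" for r
  have b: "bij_betw \<rho>' {..<n} (\<rho> ` {..<n})" "bij_betw \<rho> {..<n} (\<rho> ` {..<n})"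
    using assms by (simp_all add: bij_betw_def)
  have "bij_betw (inv_into {..<n} \<rho> \<circ> \<rho>') {..<n} {..<n}"
    by (rule bij_betw_trans[OF b(1) bij_betw_inv_into[OF b(2)]])
  then have "bij_betw p {..<n} {..<n}"
    by (subst bij_betw_cong[of _ p "inv_into {..<n} \<rho> \<circ> \<rho>'"]) (auto simp: p_def)
  then have "p permutes {..<n}" by (rule bij_imp_permutes) (simp add: p_def)
  moreover have "\<rho> (p r) = \<rho>' r" if "r < n" for r
    using that assms(3) f_inv_into_f[of "\<rho>' r" \<rho> "{..<n}"] by (auto simp: p_def)
  ultimately show ?thesis by (auto simp: lessThan_atLeast0)
qed

text \<open>\<open>submatrix\<close> lists the surviving rows and columns in increasing order, a
  bordered determinant in the order of its entries. Any two enumerations differ by permutations,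
  hence by a sign.\<close>

lemma det_reindex:
  fixes A :: "'b \<Rightarrow> 'c \<Rightarrow> 'a::comm_ring_1"
  assumes \<rho>: "inj_on \<rho> {..<n}" "inj_on \<rho>' {..<n}" "\<rho> ` {..<n} = \<rho>' ` {..<n}"
    and \<kappa>: "inj_on \<kappa> {..<n}" "inj_on \<kappa>' {..<n}" "\<kappa> ` {..<n} = \<kappa>' ` {..<n}"
  shows "det (mat n n (\<lambda>(r, c). A (\<rho>' r) (\<kappa>' c))) = det (mat n n (\<lambda>(r, c). A (\<rho> r) (\<kappa> c))) \<or>
    det (mat n n (\<lambda>(r, c). A (\<rho>' r) (\<kappa>' c))) = - det (mat n n (\<lambda>(r, c). A (\<rho> r) (\<kappa> c)))"
proof -
  obtain p q where p: "p permutes {0..<n}" "\<And>r. r < n \<Longrightarrow> \<rho> (p r) = \<rho>' r"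
    and q: "q permutes {0..<n}" "\<And>r. r < n \<Longrightarrow> \<kappa> (q r) = \<kappa>' r"
    using ex_reindex_permutation[OF \<rho>] ex_reindex_permutation[OF \<kappa>] by blast
  have pl: "r < n \<Longrightarrow> p r < n" and ql: "r < n \<Longrightarrow> q r < n" for r
    using permutes_in_image[OF p(1), of r] permutes_in_image[OF q(1), of r] by auto
  let ?A = "mat n n (\<lambda>(r, c). A (\<rho> r) (\<kappa> c))" and ?B = "mat n n (\<lambda>(r, c). A (\<rho> r) (\<kappa>' c))"
  have "mat n n (\<lambda>(r, c). A (\<rho>' r) (\<kappa>' c)) = mat n n (\<lambda>(r, c). ?B $$ (p r, c))"
    by (rule eq_matI) (auto simp: pl p(2))
  then have 1: "det (mat n n (\<lambda>(r, c). A (\<rho>' r) (\<kappa>' c))) = signof p * det ?B"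
    using det_permute_rows[of ?B n p] p(1) by simp
  have T: "transpose_mat ?A \<in> carrier_mat n n" by simp
  have "transpose_mat ?B = mat n n (\<lambda>(r, c). transpose_mat ?A $$ (q r, c))"
    by (rule eq_matI) (auto simp: ql q(2))
  then have "det (transpose_mat ?B) = signof q * det (transpose_mat ?A)"
    using det_permute_rows[OF T q(1)] by simp
  then have 2: "det ?B = signof q * det ?A"
    using det_transpose[of ?A n] det_transpose[of ?B n] by simp
  show ?thesis unfolding 1 2 by (auto simp: sign_def)
qed

lemma pick_image:
  assumes "finite I"
  shows "inj_on (pick (- I)) {..<n}"
    "n = card {r. r < N \<and> r \<in> - I} \<Longrightarrow> pick (- I) ` {..<n} = {r. r < N \<and> r \<in> - I}"
proof -
  have inf: "infinite (- I)" using assms by (simp add: finite_compl)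
  show inj: "inj_on (pick (- I)) {..<n}"
    using pick_eq_iff_inf[OF inf] by (auto intro: inj_onI)
  assume n: "n = card {r. r < N \<and> r \<in> - I}"
  have "pick (- I) ` {..<n} \<subseteq> {r. r < N \<and> r \<in> - I}"
    using pick_in_set_inf[OF inf] pick_le[of _ N "- I"] n by (auto simp: conj_commute)
  moreover have "card (pick (- I) ` {..<n}) = card {r. r < N \<and> r \<in> - I}"
    using card_image[OF inj] n by simp
  ultimately show "pick (- I) ` {..<n} = {r. r < N \<and> r \<in> - I}"
    by (intro card_subset_eq) auto
qed

definition ew :: "multigraph \<Rightarrow> nat \<Rightarrow> nat \<Rightarrow> 'a::comm_ring_1" where
  "ew G e = vsub (uv (fst (edges G ! e))) (uv (snd (edges G ! e)))"

lemma incidence_ew: "e < nedges G \<Longrightarrow> v < nverts G - 1 \<Longrightarrow> incidence_mat G $$ (e, v) = ew G e v"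
  by (simp add: incidence_mat_def ew_def uv_def)

abbreviation redge :: "multigraph \<Rightarrow> nat set \<Rightarrow> nat \<Rightarrow> int_mpoly entry" where
  "redge G K e \<equiv> edg (if e \<in> K then 0 else Var e) (ew G e)"

text \<open>The list \<open>js\<close> consists of the edges that lose only their column and
  \<open>is\<close> of those that lose only their row, while \<open>es\<close> keeps both. A
  surviving row from \<open>js\<close> and a surviving column from \<open>is\<close> meet off the
  diagonal, so matching them gives entries of weight zero.\<close>

lemma dodgson_gd:
  fixes G :: multigraph
  defines "N \<equiv> nedges G"
  assumes d: "distinct (js @ es)" "distinct (is @ es)" and len: "length js = length is"
    and dis: "set js \<inter> set is = {}"
    and s: "set (js @ es) = {..<N} - I" "set (is @ es) = {..<N} - J"
    and IJ: "I \<subseteq> {..<N}" "J \<subseteq> {..<N}"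
    and g: "g = gd (nverts G - 1) (map2 (\<lambda>j i. tst (ew G j) (ew G i)) js is @ map (redge G K) es)"
  shows "dodgson G I J K = g \<or> dodgson G I J K = - g"
proof -
  let ?D = "nverts G - 1" and ?A = "\<lambda>r c. graph_mat G K $$ (r, c)"
  define xs where "xs = map2 (\<lambda>j i. tst (ew G j) (ew G i)) js is @ map (redge G K) es"
  define M where "M = length js + length es"
  define n where "n = M + ?D"
  define enum where "enum ks r = (if r < M then (ks @ es) ! r else r - M + N)" for ks :: "nat list" and r
  have fin: "finite I" "finite J" using IJ finite_subset by auto
  have lenx: "length xs = M" using len by (simp add: M_def xs_def)
  have enum: "inj_on (enum ks) {..<n} \<and> enum ks ` {..<n} = {r. r < N + ?D \<and> r \<in> - X} \<and>
      n = card {r. r < N + ?D \<and> r \<in> - X}"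
    if k: "distinct (ks @ es)" "length ks = length js" "set (ks @ es) = {..<N} - X" "X \<subseteq> {..<N}" for ks X
  proof -
    have l: "length (ks @ es) = M" using k by (simp add: M_def)
    have lt: "(ks @ es) ! r < N \<and> (ks @ es) ! r \<notin> X" if "r < M" for r
      using nth_mem[of r "ks @ es"] k(3) that l by auto
    have inj: "inj_on (enum ks) {..<n}"
    proof (rule inj_onI)
      fix r r' assume "enum ks r = enum ks r'"
      then show "r = r'"
        using nth_eq_iff_index_eq[OF k(1), of r r'] lt[of r] lt[of r'] l
        by (cases "r < M"; cases "r' < M") (auto simp: enum_def)
    qed
    have im: "enum ks ` {..<n} = {r. r < N + ?D \<and> r \<in> - X}"
    proof (intro equalityI subsetI)
      fix x assume "x \<in> enum ks ` {..<n}"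
      then obtain r where "r < n" "x = enum ks r" by auto
      then show "x \<in> {r. r < N + ?D \<and> r \<in> - X}"
        using lt[of r] k(4) by (cases "r < M") (auto simp: enum_def n_def)
    next
      fix x assume x: "x \<in> {r. r < N + ?D \<and> r \<in> - X}"
      show "x \<in> enum ks ` {..<n}"
      proof (cases "x < N")
        case True
        then have "x \<in> set (ks @ es)" using k(3) x by auto
        then obtain r where "r < M" "(ks @ es) ! r = x" unfolding in_set_conv_nth l by blast
        then show ?thesis by (intro image_eqI[of _ _ r]) (auto simp: enum_def n_def)
      next
        case False
        then show ?thesis using x by (intro image_eqI[of _ _ "x - N + M"]) (auto simp: enum_def n_def)
      qed
    qed
    have "n = card {r. r < N + ?D \<and> r \<in> - X}"
      using card_image[OF inj] im by simp
    with inj im show ?thesis by blast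
  qed
  have R: "inj_on (enum js) {..<n}" "enum js ` {..<n} = {r. r < N + ?D \<and> r \<in> - I}" "n = card {r. r < N + ?D \<and> r \<in> - I}"
    using enum[OF d(1) refl s(1) IJ(1)] by blast+
  have C: "inj_on (enum is) {..<n}" "enum is ` {..<n} = {r. r < N + ?D \<and> r \<in> - J}" "n = card {r. r < N + ?D \<and> r \<in> - J}"
    using enum[OF d(2) len[symmetric] s(2) IJ(2)] by blast+
  have dim: "dim_row (graph_mat G K) = N + ?D" "dim_col (graph_mat G K) = N + ?D"
    by (simp_all add: graph_mat_def incidence_mat_def N_def)
  have sub: "submatrix (graph_mat G K) (- I) (- J) = mat n n (\<lambda>(r, c). ?A (pick (- I) r) (pick (- J) c))"
    unfolding submatrix_def dim R(3)[symmetric] C(3)[symmetric] ..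
  have le: "e \<in> set es \<Longrightarrow> e < N" "e \<in> set js \<Longrightarrow> e < N" "e \<in> set is \<Longrightarrow> e < N" for e using s by auto
  have gmx: "gm ?D xs = mat n n (\<lambda>(r, c). ?A (enum js r) (enum is c))"
  proof (rule eq_matI)
    fix r c assume "r < dim_row (mat n n (\<lambda>(r, c). ?A (enum js r) (enum is c)))"
      "c < dim_col (mat n n (\<lambda>(r, c). ?A (enum js r) (enum is c)))"
    then have rc: "r < n" "c < n" by auto
    have er: "(js @ es) ! r < N" if "r < M" using nth_mem[of r "js @ es"] that s(1) by (auto simp: M_def)
    have ec: "(is @ es) ! c < N" if "c < M" using nth_mem[of c "is @ es"] that s(2) len by (auto simp: M_def)
    have xr: "fst (snd (xs ! r)) = ew G ((js @ es) ! r)" if "r < M"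
      using that len by (auto simp: nth_append M_def xs_def)
    have xc: "snd (snd (xs ! c)) = ew G ((is @ es) ! c)" if "c < M"
      using that len by (auto simp: nth_append M_def xs_def)
    have diag: "?A ((js @ es) ! r) ((is @ es) ! c) = (if r = c then fst (xs ! r) else 0)" if "r < M" "c < M"
    proof -
      have A: "?A ((js @ es) ! r) ((is @ es) ! c) = (if (js @ es) ! r = (is @ es) ! c \<and> (js @ es) ! r \<notin> K then Var ((js @ es) ! r) else 0)"
        using er[OF that(1)] ec[OF that(2)] by (simp add: graph_mat_def N_def incidence_mat_def)
      have eq: "(js @ es) ! r = (is @ es) ! c \<longleftrightarrow> r = c \<and> \<not> r < length js"
      proof
        assume e: "(js @ es) ! r = (is @ es) ! c"
        have "(js @ es) ! r \<notin> set is" if "r < length js" using that dis by (metis disjoint_iff nth_append nth_mem)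
        moreover have "(is @ es) ! c \<notin> set js" if "c < length is" using that dis by (metis disjoint_iff nth_append nth_mem)
        moreover have "(js @ es) ! r \<in> set js" if "r < length js" using that by (simp add: nth_append)
        moreover have "(js @ es) ! r \<in> set es" if "\<not> r < length js" using that \<open>r < M\<close> by (simp add: nth_append M_def)
        moreover have "(is @ es) ! c \<in> set is" if "c < length is" using that by (simp add: nth_append)
        moreover have "(is @ es) ! c \<in> set es" if "\<not> c < length is" using that \<open>c < M\<close> len by (simp add: nth_append M_def)
        moreover have "set js \<inter> set es = {}" "set is \<inter> set es = {}" using d by auto
        ultimately have "\<not> r < length js" "\<not> c < length is" using e by (metis disjoint_iff)+
        then show "r = c \<and> \<not> r < length js"
          using e that len d(1) by (auto simp: nth_append M_def nth_eq_iff_index_eq)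
      qed (use len in \<open>auto simp: nth_append\<close>)
      show ?thesis
        unfolding A eq using that len by (auto simp: nth_append M_def xs_def)
    qed
    show "gm ?D xs $$ (r, c) = mat n n (\<lambda>(r, c). ?A (enum js r) (enum is c)) $$ (r, c)"
    proof (cases "r < M")
      case True
      show ?thesis
      proof (cases "c < M")
        case T: True
        then show ?thesis
          using True rc diag by (simp add: gm_index lenx enum_def n_def)
      next
        case False
        have "?A ((js @ es) ! r) (c - M + N) = ew G ((js @ es) ! r) (c - M)"
          using False True rc er[OF True] incidence_ew[of "(js @ es) ! r" G "c - M"]
          by (simp add: graph_mat_def N_def n_def incidence_mat_def)
        then show ?thesis
          using True False rc xr[OF True] by (simp add: gm_index lenx enum_def n_def)
      qed
    next
      case False
      show ?thesis
      proof (cases "c < M")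
        case True
        have "?A (r - M + N) ((is @ es) ! c) = - ew G ((is @ es) ! c) (r - M)"
          using False True rc ec[OF True] incidence_ew[of "(is @ es) ! c" G "r - M"]
          by (simp add: graph_mat_def N_def n_def incidence_mat_def)
        then show ?thesis
          using True False rc xc[OF True] by (simp add: gm_index lenx enum_def n_def)
      next
        case F: False
        obtain r' c' where "r = M + r'" "c = M + c'"
          using False F by (metis le_add_diff_inverse not_less)
        then show ?thesis
          using rc by (simp add: gm_index lenx enum_def n_def graph_mat_def N_def incidence_mat_def)
      qed
    qed
  qed (simp_all only: gm_dim lenx n_def dim_row_mat dim_col_mat)
  have "det (mat n n (\<lambda>(r, c). ?A (pick (- I) r) (pick (- J) c))) = det (mat n n (\<lambda>(r, c). ?A (enum js r) (enum is c)))
    \<or> det (mat n n (\<lambda>(r, c). ?A (pick (- I) r) (pick (- J) c))) = - det (mat n n (\<lambda>(r, c). ?A (enum js r) (enum is c)))"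
    using R(2) C(2) pick_image(2)[OF fin(1) R(3)] pick_image(2)[OF fin(2) C(3)]
    by (intro det_reindex R(1) C(1) pick_image(1) fin) simp_all
  then show ?thesis
    unfolding dodgson_def sub g gd_def xs_def[symmetric] gmx .
qed

declare vsub_apply [simp del]

section \<open>Closing the strip and changing the ground vertex\<close>

text \<open>The edge \<open>z\<close> joins the ground to \<open>x\<close>. A minor that already has
  both a row and a column at \<open>x\<close>, or only one of them, is merely multiplied by
  \<open>z\<close>; the others also receive the minor with an added row and column
  \<open>x\<close>.\<close>

definition strip_close :: "'a::comm_ring_1 \<Rightarrow> 'a net \<Rightarrow> 'a net" where
  "strip_close z N = \<lparr>
     pP = z * pP N + (d1 N + dm N),
     d1 = z * d1 N,
     d2 = z * d2 N + ff N,
     dm = z * dm N,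
     ff = z * ff N,
     t1 = z * t1 N,
     t2 = z * t2 N + ch N,
     ch = z * ch N,
     ps = z * ps N,
     om = z * om N + x1 N,
     x1 = z * x1 N,
     x2 = z * x2 N,
     x3 = z * x3 N + f4 N,
     f4 = z * f4 N\<rparr>"

lemma net_lag_close: "net_lag N \<Longrightarrow> net_lag (strip_close z N)"
  using lag_edge[of "pP N" "d1 N + dm N" "dm N" "d2 N + dm N" "t1 N" "t2 N" "om N" "ff N" "ch N" "ps N" "x1 N" "x2 N" "x3 N" "f4 N" z]
  by (simp add: net_lag_def strip_close_def algebra_simps)

lemma net_at_close:
  fixes x y w :: "nat \<Rightarrow> 'a::comm_ring_1"
  assumes sym: "map flip_entry xs = xs"
  shows "net_at D x y w (tst \<rho> \<rho> # edg z (vsub \<rho> x) # xs) = strip_close z (net_at D x y w (tst \<rho> \<rho> # xs))"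
proof -
  let ?\<rho> = "tst \<rho> \<rho>" and ?e = "edg z (vsub \<rho> x)"
  have base: "gd D (?e # ?\<rho> # ys) = z * gd D (?\<rho> # ys) + gd D (tst x x # ?\<rho> # ys)" for ys
    using gd_edge[of D z "vsub \<rho> x" "vsub \<rho> x" "?\<rho> # ys"] by (simp add: gd_sub gd_dup)
  have 0: "gd D (?\<rho> # ?e # xs) = z * gd D (?\<rho> # xs) + gd D (tst x x # ?\<rho> # xs)"
    using base[of xs] by (simp add: gd_swap[of D ?\<rho>])
  have 1: "gd D (t # ?\<rho> # ?e # xs) = z * gd D (t # ?\<rho> # xs) + gd D (tst x x # t # ?\<rho> # xs)" for t
    using base[of "t # xs"] gd_perm[of "t # ?\<rho> # ?e # xs" "?e # ?\<rho> # t # xs" D]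
      gd_perm[of "?\<rho> # t # xs" "t # ?\<rho> # xs" D] gd_perm[of "tst x x # ?\<rho> # t # xs" "tst x x # t # ?\<rho> # xs" D]
    by (simp)
  have 2: "gd D (t # s # ?\<rho> # ?e # xs) = z * gd D (t # s # ?\<rho> # xs) + gd D (tst x x # t # s # ?\<rho> # xs)" for t s
    using base[of "t # s # xs"] gd_perm[of "t # s # ?\<rho> # ?e # xs" "?e # ?\<rho> # t # s # xs" D]
      gd_perm[of "?\<rho> # t # s # xs" "t # s # ?\<rho> # xs" D]
      gd_perm[of "tst x x # ?\<rho> # t # s # xs" "tst x x # t # s # ?\<rho> # xs" D]
    by (simp)
  have 3: "gd D (t # s # r # ?\<rho> # ?e # xs) = z * gd D (t # s # r # ?\<rho> # xs) + gd D (tst x x # t # s # r # ?\<rho> # xs)" for t s r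
    using base[of "t # s # r # xs"] gd_perm[of "t # s # r # ?\<rho> # ?e # xs" "?e # ?\<rho> # t # s # r # xs" D]
      gd_perm[of "?\<rho> # t # s # r # xs" "t # s # r # ?\<rho> # xs" D]
      gd_perm[of "tst x x # ?\<rho> # t # s # r # xs" "tst x x # t # s # r # ?\<rho> # xs" D]
    by (simp)
  show ?thesis
    unfolding net_at_def strip_close_def 0 1 2 3 by (simp add: gd_dup algebra_simps)
qed

definition bal :: "nat \<Rightarrow> 'a::comm_ring_1 entry list \<Rightarrow> bool" where
  "bal D xs \<longleftrightarrow> (\<forall>x\<in>set xs. (\<Sum>v<D. fst (snd x) v) = 0 \<and> (\<Sum>v<D. snd (snd x) v) = 0)"

lemma bal_Nil [simp]: "bal D []"
  by (simp add: bal_def)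

lemma bal_Cons [simp]: "bal D ((\<delta>, R, C) # xs) \<longleftrightarrow> (\<Sum>v<D. R v) = 0 \<and> (\<Sum>v<D. C v) = 0 \<and> bal D xs"
  by (auto simp: bal_def)

lemma sum_uv: "i < D \<Longrightarrow> (\<Sum>v<D. uv i v) = 1"
  by (simp add: uv_def)

text \<open>Two vectors of total 1 differ by a vector of total 0, and a network in which all rows
  have total 0 is singular. So neither the choice of ground nor using different vertices for its row
  and column matters.\<close>

lemma gd_ground:
  fixes p q :: "nat \<Rightarrow> 'a::idom"
  assumes D: "D > 0" and xs: "bal D xs"
    and s: "(\<Sum>v<D. p v) = 1" "(\<Sum>v<D. q v) = 1" "(\<Sum>v<D. \<rho> v) = 1"
  shows "gd D (tst p q # xs) = gd D (tst \<rho> \<rho> # xs)"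
proof -
  have "gd D (tst (vsub p \<rho>) q # xs) = 0"
    by (rule gd_sum_zero_row[OF D]) (use xs s in \<open>auto simp: bal_def vsub_apply sum_subtractf\<close>)
  moreover have "gd D (tst (vsub q \<rho>) \<rho> # map flip_entry xs) = 0"
    by (rule gd_sum_zero_row[OF D]) (use xs s in \<open>auto simp: bal_def vsub_apply sum_subtractf flip_entry_def\<close>)
  then have "gd D (tst \<rho> (vsub q \<rho>) # xs) = 0" unfolding gd_flip1[of D 0 \<rho> "vsub q \<rho>"] .
  ultimately show ?thesis by (simp only: gd_sub_row gd_sub_col right_minus_eq)
qed

text \<open>Subtracting one test entry from the other makes the latter balanced, and the first can
  then be exchanged for any ground.\<close>

lemma gd_ground2:
  fixes p q :: "nat \<Rightarrow> 'a::idom"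
  assumes D: "D > 0" and xs: "bal D xs"
    and s: "(\<Sum>v<D. p v) = 1" "(\<Sum>v<D. q v) = 1" "(\<Sum>v<D. p' v) = 1" "(\<Sum>v<D. q' v) = 1" "(\<Sum>v<D. \<rho> v) = 1"
  shows "gd D (tst p q # tst p' q' # xs) = gd D (tst (vsub p' p) (vsub q' q) # tst \<rho> \<rho> # xs)"
proof -
  have "gd D (tst p q # tst p' q' # xs) = gd D (tst p q # tst (vsub p' p) (vsub q' q) # xs)"
    by (rule gd_clear)
  also have "\<dots> = gd D (tst \<rho> \<rho> # tst (vsub p' p) (vsub q' q) # xs)"
    by (rule gd_ground) (use assms in \<open>simp_all add: vsub_apply sum_subtractf\<close>)
  finally show ?thesis unfolding gd_swap[of D "tst \<rho> \<rho>"] .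
qed

text \<open>\<open>uv D\<close> is zero on the columns below \<open>D\<close>: this is the vertex
  whose column is left out, for the zigzag graph the deleted one.\<close>

lemma gd_outside: "gd D (tst (uv D) C # xs) = 0" "gd D (tst R (uv D) # xs) = 0"
proof -
  have *: "gd D (tst (uv D) C # xs) = 0" for C and xs :: "'a entry list"
  proof -
    obtain w where "\<And>\<delta> R. gd D ((\<delta>, R, C) # xs) = \<delta> * gd D xs + (\<Sum>v<D. R v * w v)"
      using gd_row_linear[of D C xs] by blast
    then show ?thesis by (simp add: uv_def sum.neutral)
  qed
  show "gd D (tst (uv D) C # xs) = 0" by (rule *)
  show "gd D (tst R (uv D) # xs) = 0" unfolding gd_flip1[of D 0 R] by (rule *)
qed

lemma gd_outside2: "gd D (t # tst (uv D) C # xs) = 0" "gd D (t # tst R (uv D) # xs) = 0"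
  unfolding gd_swap[of D t] by (rule gd_outside)+

section \<open>The completed zigzag graph without the vertex \<open>h + 1\<close>\<close>

abbreviation wedge :: "multigraph \<Rightarrow> (nat \<Rightarrow> 'a::comm_ring_1) \<Rightarrow> nat \<Rightarrow> 'a entry" where
  "wedge G w e \<equiv> edg (w e) (ew G e)"

text \<open>Edges \<open>j\<close> and \<open>h + 2 + j\<close> lead from vertex \<open>j\<close> to
  \<open>j + 1\<close> and \<open>j + 2\<close>. For \<open>j < h - 1\<close> they form the strip on
  the vertices \<open>0\<close> to \<open>h\<close>, which ends in edge \<open>h - 1\<close>. The
  edge \<open>2 * h + 2\<close> joins \<open>h\<close> to \<open>0\<close> and closes it;
  \<open>h\<close>, \<open>h + 1\<close>, \<open>2 * h + 1\<close>, \<open>2 * h + 3\<close> form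
  the star.\<close>

definition sidx :: "nat \<Rightarrow> nat \<Rightarrow> nat list" where
  "sidx h i = concat (map (\<lambda>j. [j, h + 2 + j]) [i..<h - 1]) @ [h - 1]"

definition spairs :: "nat \<Rightarrow> nat \<Rightarrow> (nat \<times> nat) list" where
  "spairs h i = map (\<lambda>j. (j, h + 2 + j)) [i..<h - 1]"

lemma length_zigzag [simp]: "nedges (completed_zigzag h) = 2 * h + 4" "nverts (completed_zigzag h) = h + 2"
  by (simp_all add: completed_zigzag_def)

lemma zigzag_edge1: "i < h + 2 \<Longrightarrow> edges (completed_zigzag h) ! i = (i, (i + 1) mod (h + 2))"
  by (simp add: completed_zigzag_def nth_append del: upt_Suc)

lemma zigzag_edge2: "i < h + 2 \<Longrightarrow> edges (completed_zigzag h) ! (h + 2 + i) = (i, (i + 2) mod (h + 2))"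
  by (simp add: completed_zigzag_def nth_append del: upt_Suc)

lemma map_wedge_sidx:
  assumes "3 \<le> h" "i \<le> h - 1"
  shows "map (wedge (completed_zigzag h) w) (sidx h i) =
    strip_edges i (map (map_prod w w) (spairs h i)) (w (h - 1))"
  using assms(2)
proof (induction rule: inc_induct)
  case base
  show ?case using assms(1) by (simp add: sidx_def spairs_def ew_def zigzag_edge1)
next
  case (step j)
  have s: "[j..<h - 1] = j # [Suc j..<h - 1]" using step by (simp add: upt_conv_Cons)
  have "sidx h j = j # (h + 2 + j) # sidx h (Suc j)" "spairs h j = (j, h + 2 + j) # spairs h (Suc j)"
    unfolding sidx_def spairs_def s by simp_all
  then show ?case
    using step assms(1) zigzag_edge1[of j h] zigzag_edge2[of j h] by (simp add: ew_def)
qed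

lemma ew_star:
  assumes "3 \<le> h"
  shows "ew (completed_zigzag h) h = vsub (uv h) (uv (h + 1))"
    "ew (completed_zigzag h) (h + 1) = vsub (uv (h + 1)) (uv 0)"
    "ew (completed_zigzag h) (2 * h + 1) = vsub (uv (h - 1)) (uv (h + 1))"
    "ew (completed_zigzag h) (2 * h + 2) = vsub (uv h) (uv 0)"
    "ew (completed_zigzag h) (2 * h + 3) = vsub (uv (h + 1)) (uv 1)"
proof -
  have i: "2 * h + 1 = h + 2 + (h - 1)" "2 * h + 2 = h + 2 + h" "2 * h + 3 = h + 2 + (h + 1)" using assms by auto
  have m: "(h - 1 + 2) mod (h + 2) = h + 1" "(h + 1 + 2) mod (h + 2) = 1" "(h + 2) mod (h + 2) = 0"
    "(h + 1 + 1) mod (h + 2) = 0" "(h + 1) mod (h + 2) = h + 1"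
    using assms mod_add_self1[of "h + 2" 1] by (auto simp: add.commute)
  show "ew (completed_zigzag h) h = vsub (uv h) (uv (h + 1))"
    "ew (completed_zigzag h) (h + 1) = vsub (uv (h + 1)) (uv 0)"
    using zigzag_edge1[of h h] zigzag_edge1[of "h + 1" h] m(4,5) by (simp_all add: ew_def)
  show "ew (completed_zigzag h) (2 * h + 1) = vsub (uv (h - 1)) (uv (h + 1))"
    unfolding i ew_def using zigzag_edge2[of "h - 1" h] m by simp
  show "ew (completed_zigzag h) (2 * h + 2) = vsub (uv h) (uv 0)"
    unfolding i ew_def using zigzag_edge2[of h h] m by simp
  show "ew (completed_zigzag h) (2 * h + 3) = vsub (uv (h + 1)) (uv 1)"
    unfolding i ew_def using zigzag_edge2[of "h + 1" h] m(2) by (simp only: fst_conv snd_conv add_strict_left_mono one_less_numeral_iff semiring_norm if_True)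
qed

lemma set_sidx: "3 \<le> h \<Longrightarrow> set (sidx h 0) = {..<h} \<union> {h + 2..<2 * h + 1}"
proof -
  assume h: "3 \<le> h"
  have "{h + 2..<2 * h + 1} = (\<lambda>j. h + 2 + j) ` {0..<h - 1}"
  proof -
    have "2 * h + 1 = h + 2 + (h - 1)" using h by simp
    then show ?thesis by (simp only: image_add_atLeastLessThan image_add_atLeastLessThan' add_0_left add.commute)
  qed
  moreover have "{..<h} = insert (h - 1) {0..<h - 1}" using h by auto
  moreover have "set (concat (map (\<lambda>j. [j, h + 2 + j]) [0..<h - 1])) = {0..<h - 1} \<union> (\<lambda>j. h + 2 + j) ` {0..<h - 1}"
    by auto
  ultimately show ?thesis by (simp add: sidx_def)
qed

lemma distinct_sidx: "3 \<le> h \<Longrightarrow> distinct (sidx h 0)"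
proof -
  assume h: "3 \<le> h"
  have "length (sidx h 0) = card (set (sidx h 0))"
  proof -
    have "length (concat (map (\<lambda>j. [j, h + 2 + j]) ks)) = 2 * length ks" for ks by (induction ks) auto
    then have "length (sidx h 0) = 2 * h - 1" using h by (simp add: sidx_def)
    moreover have "card ({..<h} \<union> {h + 2..<2 * h + 1}) = card {..<h} + card {h + 2..<2 * h + 1}"
      by (rule card_Un_disjoint) auto
    ultimately show ?thesis using h by (simp add: set_sidx)
  qed
  then show ?thesis by (simp add: card_distinct)
qed

lemma bal_strip_edges: "i + length L + 2 \<le> D \<Longrightarrow> bal D (strip_edges i L c)"
  by (induction i L c rule: strip_edges.induct) (auto simp: vsub_apply sum_subtractf sum_uv)

definition zig_list :: "nat \<Rightarrow> (nat \<Rightarrow> 'a::comm_ring_1) \<Rightarrow> 'a entry list" where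
  "zig_list h w = edg (w (2 * h + 2)) (vsub (uv h) (uv 0)) #
     strip_edges 0 (map (map_prod w w) (spairs h 0)) (w (h - 1))"

definition zig_net :: "nat \<Rightarrow> (nat \<Rightarrow> 'a::comm_ring_1) \<Rightarrow> 'a net" where
  "zig_net h w = strip_close (w (2 * h + 2)) (strip (map (map_prod w w) (spairs h 0)) (w (h - 1)))"

lemma length_spairs [simp]: "length (spairs h i) = h - 1 - i"
  by (simp add: spairs_def)

lemma bal_zig_list: "3 \<le> h \<Longrightarrow> bal (h + 1) (zig_list h w)"
  by (auto simp: zig_list_def vsub_apply sum_subtractf sum_uv simp del: sum.lessThan_Suc intro: bal_strip_edges)

lemma flip_zig_list: "map flip_entry (zig_list h w) = zig_list h w"
  by (simp add: zig_list_def)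

lemma net_at_zig:
  fixes w :: "nat \<Rightarrow> 'a::idom"
  assumes "3 \<le> h"
  shows "net_at (h + 1) (uv 0) (uv 1) (uv (h - 1)) (tst (uv h) (uv h) # zig_list h w) = zig_net h w"
  unfolding zig_list_def zig_net_def
  using net_at_close[of "strip_edges 0 (map (map_prod w w) (spairs h 0)) (w (h - 1))" "h + 1" "uv 0" "uv 1" "uv (h - 1)" "uv h" "w (2 * h + 2)"]
    net_at_strip_edges[of "h + 1" 0 "map (map_prod w w) (spairs h 0)" "w (h - 1)"] assms
  by (simp add: units_def)

lemma map_wedge_zig:
  fixes w :: "nat \<Rightarrow> 'a::comm_ring_1"
  shows "3 \<le> h \<Longrightarrow> map (wedge (completed_zigzag h) w) ((2 * h + 2) # sidx h 0) = zig_list h w"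
  by (simp add: map_wedge_sidx zig_list_def ew_star(4)[of h, simplified])

text \<open>Without the deleted vertex the network is balanced, so a single test entry does nothing
  but ground it.\<close>

lemma gd_zig_one:
  fixes w :: "nat \<Rightarrow> 'a::idom"
  assumes "3 \<le> h" "i \<le> h" "j \<le> h"
  shows "gd (h + 1) (tst (uv i) (uv j) # zig_list h w) = pP (zig_net h w)"
proof -
  have "gd (h + 1) (tst (uv i) (uv j) # zig_list h w) = gd (h + 1) (tst (uv h) (uv h) # zig_list h w)"
    by (rule gd_ground) (use assms bal_zig_list[OF assms(1), of w] in \<open>auto simp: sum_uv simp del: sum.lessThan_Suc\<close>)
  then show ?thesis by (simp add: net_at_zig[OF assms(1), symmetric] net_at_def)
qed

lemma gd_zig_two:
  fixes w :: "nat \<Rightarrow> 'a::idom"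
  assumes "3 \<le> h" "i \<le> h" "j \<le> h" "i' \<le> h" "j' \<le> h"
  shows "gd (h + 1) (tst (uv i) (uv j) # tst (uv i') (uv j') # zig_list h w) =
    gd (h + 1) (tst (vsub (uv i') (uv i)) (vsub (uv j') (uv j)) # tst (uv h) (uv h) # zig_list h w)"
  by (rule gd_ground2) (use assms bal_zig_list[OF assms(1), of w] in \<open>auto simp: sum_uv simp del: sum.lessThan_Suc\<close>)

lemma gd_zig_test:
  fixes w :: "nat \<Rightarrow> 'a::idom"
  assumes "3 \<le> h"
  shows "gd (h + 1) (tst (uv 0) (uv 0) # tst (uv h) (uv h) # zig_list h w) = d1 (zig_net h w) + dm (zig_net h w)"
    "gd (h + 1) (tst (uv 0) (uv 1) # tst (uv h) (uv h) # zig_list h w) = dm (zig_net h w)"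
    "gd (h + 1) (tst (uv 1) (uv 0) # tst (uv h) (uv h) # zig_list h w) = dm (zig_net h w)"
    "gd (h + 1) (tst (uv 1) (uv 1) # tst (uv h) (uv h) # zig_list h w) = d2 (zig_net h w) + dm (zig_net h w)"
    "gd (h + 1) (tst (uv 0) (uv (h - 1)) # tst (uv h) (uv h) # zig_list h w) = t1 (zig_net h w)"
    "gd (h + 1) (tst (uv (h - 1)) (uv 0) # tst (uv h) (uv h) # zig_list h w) = t1 (zig_net h w)"
    "gd (h + 1) (tst (uv 1) (uv (h - 1)) # tst (uv h) (uv h) # zig_list h w) = t2 (zig_net h w)"
    "gd (h + 1) (tst (uv (h - 1)) (uv 1) # tst (uv h) (uv h) # zig_list h w) = t2 (zig_net h w)"
    "gd (h + 1) (tst (uv (h - 1)) (uv (h - 1)) # tst (uv h) (uv h) # zig_list h w) = om (zig_net h w)"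
proof -
  have s: "gd (h + 1) (tst R C # tst (uv h) (uv h) # zig_list h w) = gd (h + 1) (tst C R # tst (uv h) (uv h) # zig_list h w)" for R C
    by (rule gd_sym1) (simp add: flip_zig_list)
  note n = net_at_zig[OF assms, symmetric] net_at_def
  show "gd (h + 1) (tst (uv 0) (uv 0) # tst (uv h) (uv h) # zig_list h w) = d1 (zig_net h w) + dm (zig_net h w)"
    "gd (h + 1) (tst (uv 0) (uv 1) # tst (uv h) (uv h) # zig_list h w) = dm (zig_net h w)"
    "gd (h + 1) (tst (uv 1) (uv 1) # tst (uv h) (uv h) # zig_list h w) = d2 (zig_net h w) + dm (zig_net h w)"
    "gd (h + 1) (tst (uv 0) (uv (h - 1)) # tst (uv h) (uv h) # zig_list h w) = t1 (zig_net h w)"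
    "gd (h + 1) (tst (uv 1) (uv (h - 1)) # tst (uv h) (uv h) # zig_list h w) = t2 (zig_net h w)"
    "gd (h + 1) (tst (uv (h - 1)) (uv (h - 1)) # tst (uv h) (uv h) # zig_list h w) = om (zig_net h w)"
    by (simp_all add: n)
  then show "gd (h + 1) (tst (uv 1) (uv 0) # tst (uv h) (uv h) # zig_list h w) = dm (zig_net h w)"
    "gd (h + 1) (tst (uv (h - 1)) (uv 0) # tst (uv h) (uv h) # zig_list h w) = t1 (zig_net h w)"
    "gd (h + 1) (tst (uv (h - 1)) (uv 1) # tst (uv h) (uv h) # zig_list h w) = t2 (zig_net h w)"
    using s[of "uv 1" "uv 0"] s[of "uv (h - 1)" "uv 0"] s[of "uv (h - 1)" "uv 1"] by simp_all
qed

section \<open>Semilinear reducibility of the completed zigzag graphs\<close>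

lemma svars_spairs: "svars (spairs h i) c = insert c ({i..<h - 1} \<union> (\<lambda>j. h + 2 + j) ` {i..<h - 1})"
proof -
  have "svars (map (\<lambda>j. (j, h + 2 + j)) ks) c = insert c (set ks \<union> (\<lambda>j. h + 2 + j) ` set ks)" for ks
    by (induction ks) auto
  then show ?thesis by (simp add: spairs_def)
qed

lemma fresh_spairs:
  assumes "i \<le> h - 1" "3 \<le> h"
  shows "fresh (spairs h i) (h - 1)"
  using assms(1)
proof (induction rule: inc_induct)
  case base
  show ?case by (simp add: spairs_def)
next
  case (step j)
  have "spairs h j = (j, h + 2 + j) # spairs h (Suc j)"
    using step by (simp add: spairs_def upt_conv_Cons)
  then show ?case using step assms(2) by (auto simp: svars_spairs)
qed

context
  fixes h :: nat
  assumes h: "3 \<le> h"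
begin

private abbreviation "N \<equiv> vstrip (spairs h 0) (h - 1)"
private abbreviation "Z \<equiv> zig_net h Var"
private abbreviation "z \<equiv> Var (2 * h + 2)"
private abbreviation "G \<equiv> completed_zigzag h"

private lemma Z: "Z = strip_close z N"
  by (simp add: zig_net_def vstrip_eq_strip)

private lemma star_notin: "2 * h + 2 \<notin> svars (spairs h 0) (h - 1)"
  using h by (auto simp: svars_spairs)

private lemma slr_pairs:
  "slr_pair (Upair (pP Z) (dm Z))"
  "slr_pair (Upair (pP Z) (d2 Z - t2 Z + t1 Z))"
  "slr_pair (Upair (dm Z - t1 Z) (t1 Z - t2 Z))"
  "slr_pair (Upair (pP Z) (d1 Z + dm Z - t1 Z))"
  "slr_pair (Upair (pP Z) (om Z - t2 Z))"
proof -
  note f = fresh_spairs[of 0 h] h star_notin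
  have fr: "fresh (spairs h 0) (h - 1)" using f by simp
  have len: "length (spairs h 0) \<ge> 2" using h by simp
  have a: "slr_pair (Upair (z * pP N + (d1 N + dm N)) (z * dm N))"
    "slr_pair (Upair (z * pP N + (d1 N + dm N)) (z * (d2 N + (t1 N - t2 N)) + (ff N - ch N)))"
    "slr_pair (Upair (z * (dm N - t1 N)) (z * (t1 N - t2 N) - ch N))"
    using slr_pair_dm[OF fr len star_notin] slr_pair_d2S[OF fr len star_notin] slr_pair_U[OF fr len star_notin] .
  show "slr_pair (Upair (pP Z) (dm Z))" using a(1) by (simp add: Z strip_close_def)
  show "slr_pair (Upair (pP Z) (d2 Z - t2 Z + t1 Z))" using a(2) by (simp add: Z strip_close_def algebra_simps)
  show "slr_pair (Upair (dm Z - t1 Z) (t1 Z - t2 Z))" using a(3) by (simp add: Z strip_close_def algebra_simps)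
  \<comment> \<open>The last two pairs are the first two for the strip read backwards. The closing
    edge joins the two ends of the strip and therefore keeps its role.\<close>
  obtain M e where m: "mir (spairs h 0) (h - 1) = (M, e)" by fastforce
  let ?M = "vstrip M e"
  have frm: "fresh M e" "length M \<ge> 2" "2 * h + 2 \<notin> svars M e"
    using fresh_mir[OF m fr] length_mir[OF m] len svars_mir[OF m] star_notin by auto
  have b: "slr_pair (Upair (z * pP ?M + (d1 ?M + dm ?M)) (z * dm ?M))"
    "slr_pair (Upair (z * pP ?M + (d1 ?M + dm ?M)) (z * (d2 ?M + (t1 ?M - t2 ?M)) + (ff ?M - ch ?M)))"
    using slr_pair_dm[OF frm] slr_pair_d2S[OF frm] .
  have P: "pP N \<noteq> 0" using tail_net_vstrip[OF fr] by (simp add: tail_net_def)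
  note q = mir_vstrip[OF m] mir_d2[OF mir_map[OF m, of Var], folded vstrip_eq_strip]
    mir_quadratic[OF mir_map[OF m, of Var], folded vstrip_eq_strip, OF P]
  have t2: "t2 ?M = d1 N - (t1 N - t2 N)" using q(5) unfolding q(4) by (simp add: algebra_simps)
  show "slr_pair (Upair (pP Z) (d1 Z + dm Z - t1 Z))"
    using b(1) unfolding q(1,2,4) by (simp add: Z strip_close_def algebra_simps)
  show "slr_pair (Upair (pP Z) (om Z - t2 Z))"
    using b(2) unfolding q(1,2,3,4,6,7,8) t2 by (simp add: Z strip_close_def algebra_simps)
qed

lemma dodgson_zig:
  assumes "distinct (js @ ks)" "distinct (is @ ks)" "length js = length is" "set js \<inter> set is = {}"
    and "set (js @ ks) = {h, h + 1, 2 * h + 1, 2 * h + 3} - I" "set (is @ ks) = {h, h + 1, 2 * h + 1, 2 * h + 3} - J"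
    and "I \<subseteq> {h, h + 1, 2 * h + 1, 2 * h + 3}" "J \<subseteq> {h, h + 1, 2 * h + 1, 2 * h + 3}"
    and K: "K \<inter> ({..<h} \<union> {h + 2..<2 * h + 1} \<union> {2 * h + 2}) = {}"
    and g: "g = gd (h + 1) (map2 (\<lambda>j i. tst (ew G j) (ew G i)) js is @ map (redge G K) ks @ zig_list h Var)"
  shows "dodgson G I J K = g \<or> dodgson G I J K = - g"
proof -
  let ?S = "{h, h + 1, 2 * h + 1, 2 * h + 3}" and ?R = "{..<h} \<union> {h + 2..<2 * h + 1} \<union> {2 * h + 2}"
  let ?rest = "(2 * h + 2) # sidx h 0"
  have R: "set ?rest = ?R" using set_sidx[OF h] by auto
  have "distinct ?rest" using distinct_sidx[OF h] set_sidx[OF h] by auto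
  then obtain rest where rest: "rest = ?rest" "distinct rest" "set rest = ?R" using R by blast
  have SR: "?S \<inter> ?R = {}" using h by auto
  have U: "{..<nedges G} = ?S \<union> ?R" using h by auto
  have zl: "map (redge G K) rest = zig_list h Var"
    unfolding map_wedge_zig[OF h, symmetric] rest(1)
  proof (rule map_cong[OF refl])
    fix x assume "x \<in> set ?rest"
    then have "x \<in> ?R" using R by blast
    then have "x \<notin> K" using K by blast
    then show "redge G K x = wedge G Var x" by simp
  qed
  have disj: "(S - I) \<inter> R = {}" if "S \<inter> R = {}" for S I R :: "nat set"
    using that by blast
  have sub: "set (js @ ks) \<inter> set rest = {}" "set (is @ ks) \<inter> set rest = {}"
    unfolding assms(5,6) rest(3) by (rule disj[OF SR])+
  show ?thesis
  proof (rule dodgson_gd[of js "ks @ rest" "is"])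
    show "distinct (js @ ks @ rest)" "distinct (is @ ks @ rest)"
      using assms(1,2) rest(2) sub unfolding append_assoc[symmetric] distinct_append[of "_ @ _" rest] by blast+
    have XI: "X - I = (S - I) \<union> R \<and> I \<subseteq> X" if "I \<subseteq> S" "S \<inter> R = {}" "X = S \<union> R" for I X S R :: "nat set"
      using that by blast
    note X = XI[OF assms(7) SR U] XI[OF assms(8) SR U]
    show "set (js @ ks @ rest) = {..<nedges G} - I" "set (is @ ks @ rest) = {..<nedges G} - J"
      using X assms(5,6) rest(3) unfolding append_assoc[symmetric] set_append[of "_ @ _" rest] by (simp_all only:)
    show "I \<subseteq> {..<nedges G}" "J \<subseteq> {..<nedges G}" using X by blast+
  qed (use assms(3,4) g zl in simp_all)
qed

private lemma star_ends:
  assumes "e < 2 * h + 4"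
  shows "fst (edges G ! e) = h + 1 \<longleftrightarrow> e = h + 1 \<or> e = 2 * h + 3"
    "snd (edges G ! e) = h + 1 \<longleftrightarrow> e = h \<or> e = 2 * h + 1"
proof -
  have a: "(i + 1) mod (h + 2) = h + 1 \<longleftrightarrow> i = h" if "i < h + 2" for i
    using that by (cases "i = h + 1") auto
  have b: "(i + 2) mod (h + 2) = h + 1 \<longleftrightarrow> i = h - 1" if "i < h + 2" for i
  proof -
    have "i < h \<or> i = h \<or> i = h + 1" using that by linarith
    then show ?thesis using h by (elim disjE) (auto simp: mod_if)
  qed
  have "(fst (edges G ! e) = h + 1 \<longleftrightarrow> e = h + 1 \<or> e = 2 * h + 3) \<and>
    (snd (edges G ! e) = h + 1 \<longleftrightarrow> e = h \<or> e = 2 * h + 1)"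
  proof (cases "e < h + 2")
    case True
    then show ?thesis using zigzag_edge1[OF True] a[OF True] h by auto
  next
    case False
    then obtain i where i: "e = h + 2 + i" "i < h + 2"
      using assms le_Suc_ex[of "h + 2" e] by auto
    have ed: "edges G ! e = (i, (i + 2) mod (h + 2))" unfolding i(1) by (rule zigzag_edge2[OF i(2)])
    show ?thesis unfolding ed fst_conv snd_conv b[OF i(2)] using i h by auto
  qed
  then show "fst (edges G ! e) = h + 1 \<longleftrightarrow> e = h + 1 \<or> e = 2 * h + 3"
    "snd (edges G ! e) = h + 1 \<longleftrightarrow> e = h \<or> e = 2 * h + 1" by blast+
qed

private lemma star_valency: "valency G (h + 1) = 4" "incident_edges G (h + 1) = {2 * h + 3, h, 2 * h + 1, h + 1}"
proof -
  have f: "{e. e < nedges G \<and> fst (edges G ! e) = h + 1} = {h + 1, 2 * h + 3}"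
    using star_ends(1) by (auto simp del: One_nat_def)
  have s: "{e. e < nedges G \<and> snd (edges G ! e) = h + 1} = {h, 2 * h + 1}"
    using star_ends(2) by (auto simp del: One_nat_def)
  show "valency G (h + 1) = 4" unfolding valency_def f s by simp
  have "incident_edges G (h + 1) = {e. e < nedges G \<and> fst (edges G ! e) = h + 1} \<union> {e. e < nedges G \<and> snd (edges G ! e) = h + 1}"
    by (auto simp: incident_edges_def)
  then show "incident_edges G (h + 1) = {2 * h + 3, h, 2 * h + 1, h + 1}" unfolding f s by auto
qed

private lemma two: "i \<le> h \<Longrightarrow> j \<le> h \<Longrightarrow> i' \<le> h \<Longrightarrow> j' \<le> h \<Longrightarrow>
  gd (h + 1) (tst (uv i) (uv j) # tst (uv i') (uv j') # zig_list h Var) =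
    gd (h + 1) (tst (vsub (uv i') (uv i)) (vsub (uv j') (uv j)) # tst (uv h) (uv h) # zig_list h Var)"
  by (rule gd_zig_two[OF h])

private lemmas star_rules = ew_star[OF h] gd_sub gd_dup gd_outside gd_outside2
  diff_0 diff_0_right minus_zero minus_minus

private lemma le: "0 \<le> h" "1 \<le> h" "h - 1 \<le> h" "h \<le> h" using h by auto

text \<open>Only one row and one column of the star survive. They ground a balanced network, so up
  to sign the answer is \<open>pP Z\<close> for every choice of the two edges.\<close>

private lemma dodgson_one:
  assumes S: "{i, j, k, t} = {h, h + 1, 2 * h + 1, 2 * h + 3}" and d: "distinct [i, j, k, t]"
  shows "dodgson G {i, k, t} {j, k, t} {} = pP Z \<or> dodgson G {i, k, t} {j, k, t} {} = - pP Z"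
proof -
  have "dodgson G {i, k, t} {j, k, t} {} = gd (h + 1) (tst (ew G j) (ew G i) # zig_list h Var) \<or>
      dodgson G {i, k, t} {j, k, t} {} = - gd (h + 1) (tst (ew G j) (ew G i) # zig_list h Var)"
    by (rule dodgson_zig[of "[j]" "[]" "[i]", unfolded S[symmetric]]) (use d in auto)
  moreover have "gd (h + 1) (tst (ew G j) (ew G i) # zig_list h Var) = pP Z \<or>
      gd (h + 1) (tst (ew G j) (ew G i) # zig_list h Var) = - pP Z"
  proof -
    have "i \<in> {h, h + 1, 2 * h + 1, 2 * h + 3}" "j \<in> {h, h + 1, 2 * h + 1, 2 * h + 3}"
      unfolding S[symmetric] by simp_all
    then show ?thesis
      by (elim insertE emptyE) (simp_all only: star_rules gd_zig_one[OF h, where w = Var] le simp_thms)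
  qed
  ultimately show ?thesis by auto
qed

private lemma dodgson_two:
  assumes S: "{i, j, k, t} = {h, h + 1, 2 * h + 1, 2 * h + 3}" and d: "distinct [i, j, k, t]"
    and g: "gd (h + 1) (tst (ew G j) (ew G i) # tst (ew G k) (ew G k) # zig_list h Var) = p \<or>
      gd (h + 1) (tst (ew G j) (ew G i) # tst (ew G k) (ew G k) # zig_list h Var) = - p"
  shows "dodgson G {i, t} {j, t} {k} = p \<or> dodgson G {i, t} {j, t} {k} = - p"
proof -
  have "k \<in> {h, h + 1, 2 * h + 1, 2 * h + 3}" unfolding S[symmetric] by simp
  then have K: "{k} \<inter> ({..<h} \<union> {h + 2..<2 * h + 1} \<union> {2 * h + 2}) = {}" using h by auto
  have "dodgson G {i, t} {j, t} {k} = gd (h + 1) (tst (ew G j) (ew G i) # tst (ew G k) (ew G k) # zig_list h Var) \<or>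
      dodgson G {i, t} {j, t} {k} = - gd (h + 1) (tst (ew G j) (ew G i) # tst (ew G k) (ew G k) # zig_list h Var)"
    by (rule dodgson_zig[of "[j]" "[k]" "[i]", unfolded S[symmetric]]) (use d K in auto)
  with g show ?thesis by auto
qed

private lemma dodgson_four:
  assumes S: "{a, b, c, d} = {h, h + 1, 2 * h + 1, 2 * h + 3}" and d: "distinct [a, b, c, d]"
    and g: "gd (h + 1) (tst (ew G b) (ew G a) # tst (ew G d) (ew G c) # zig_list h Var) = p \<or>
      gd (h + 1) (tst (ew G b) (ew G a) # tst (ew G d) (ew G c) # zig_list h Var) = - p"
  shows "dodgson G {a, c} {b, d} {} = p \<or> dodgson G {a, c} {b, d} {} = - p"
proof -
  have "dodgson G {a, c} {b, d} {} = gd (h + 1) (tst (ew G b) (ew G a) # tst (ew G d) (ew G c) # zig_list h Var) \<or>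
      dodgson G {a, c} {b, d} {} = - gd (h + 1) (tst (ew G b) (ew G a) # tst (ew G d) (ew G c) # zig_list h Var)"
    by (rule dodgson_zig[of "[b, d]" "[]" "[a, c]", unfolded S[symmetric]]) (use d in auto)
  with g show ?thesis by auto
qed

text \<open>The first two are the Dodgson polynomials of the four-edge pair, the others those that
  are paired with \<open>pP Z\<close>. The signs reflect the orientation of the edges at
  \<open>h + 1\<close> and are discarded by \<open>slr_pair_sign\<close>.\<close>

private lemma star_values:
  "gd (h + 1) (tst (ew G h) (ew G (2 * h + 3)) # tst (ew G (h + 1)) (ew G (2 * h + 1)) # zig_list h Var) = - (dm Z - t1 Z)"
  "gd (h + 1) (tst (ew G h) (ew G (2 * h + 3)) # tst (ew G (2 * h + 1)) (ew G (h + 1)) # zig_list h Var) = t1 Z - t2 Z"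
  "gd (h + 1) (tst (ew G h) (ew G (2 * h + 3)) # tst (ew G (2 * h + 1)) (ew G (2 * h + 1)) # zig_list h Var) = - (om Z - t2 Z)"
  "gd (h + 1) (tst (ew G (2 * h + 1)) (ew G h) # tst (ew G (h + 1)) (ew G (h + 1)) # zig_list h Var) = d1 Z + dm Z - t1 Z"
  "gd (h + 1) (tst (ew G (h + 1)) (ew G (2 * h + 1)) # tst (ew G (2 * h + 3)) (ew G (2 * h + 3)) # zig_list h Var) = - (d2 Z - t2 Z + t1 Z)"
  "gd (h + 1) (tst (ew G (2 * h + 3)) (ew G (h + 1)) # tst (ew G h) (ew G h) # zig_list h Var) = dm Z"
  by (simp_all only: star_rules, simp_all only: two le, simp_all only: star_rules gd_zig_test[OF h]) simp_all

lemma semilinearly_reducible_zigzag: "semilinearly_reducible (completed_zigzag h)"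
proof -
  \<comment> \<open>The star edges in the order of their other ends \<open>1\<close>,
    \<open>h\<close>, \<open>h - 1\<close>, \<open>0\<close>. With this order the four-edge pair is
    \<open>dm - t1\<close> and \<open>t1 - t2\<close>, and neighbouring edges produce exactly the
    four pairs available from the strip.\<close>
  have d: "distinct [2 * h + 3, h, 2 * h + 1, h + 1]" using h by simp
  have A: "slr_pair (Upair (dodgson G {2 * h + 3, 2 * h + 1} {h, h + 1} {}) (dodgson G {2 * h + 3, h + 1} {h, 2 * h + 1} {}))"
    by (rule slr_pair_sign[OF slr_pairs(3)]; rule dodgson_four) (use d in \<open>auto simp: star_values simp del: One_nat_def add_Suc_right\<close>)
  have B: "slr_pair (Upair (dodgson G {i, t} {j, t} {k}) (dodgson G {i, k, t} {j, k, t} {}))"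
    if "(i, j, k, t) \<in> {(2 * h + 3, h, 2 * h + 1, h + 1), (h, 2 * h + 1, h + 1, 2 * h + 3),
      (2 * h + 1, h + 1, 2 * h + 3, h), (h + 1, 2 * h + 3, h, 2 * h + 1)}" for i j k t
  proof -
    have S: "{i, j, k, t} = {h, h + 1, 2 * h + 1, 2 * h + 3}" "distinct [i, j, k, t]"
      using that h by auto
    have "\<exists>p. slr_pair (Upair (pP Z) p) \<and>
      (gd (h + 1) (tst (ew G j) (ew G i) # tst (ew G k) (ew G k) # zig_list h Var) = p \<or>
       gd (h + 1) (tst (ew G j) (ew G i) # tst (ew G k) (ew G k) # zig_list h Var) = - p)"
      using that
      apply (elim insertE emptyE Pair_inject)
      apply (simp_all only: star_values)
      using slr_pairs(1,2,4,5) by blast+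
    then obtain p where p: "slr_pair (Upair (pP Z) p)"
      "gd (h + 1) (tst (ew G j) (ew G i) # tst (ew G k) (ew G k) # zig_list h Var) = p \<or>
       gd (h + 1) (tst (ew G j) (ew G i) # tst (ew G k) (ew G k) # zig_list h Var) = - p" by blast
    show ?thesis
      by (rule slr_pair_sym[OF slr_pair_sign[OF p(1) dodgson_one[OF S] dodgson_two[OF S p(2)]]])
  qed
  show ?thesis
    unfolding semilinearly_reducible_def
  proof (rule disjI2, intro exI conjI)
    show "h + 1 < nverts G" by simp
    show "valency G (h + 1) = 4" "incident_edges G (h + 1) = {2 * h + 3, h, 2 * h + 1, h + 1}"
      by (rule star_valency)+
    show "distinct [2 * h + 3, h, 2 * h + 1, h + 1]" by (rule d)
    show "slr_pair (Upair (dodgson G {2 * h + 3, 2 * h + 1} {h, h + 1} {}) (dodgson G {2 * h + 3, h + 1} {h, 2 * h + 1} {}))"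
      by (rule A)
    show "\<forall>(i, j, k, t) \<in> {(2 * h + 3, h, 2 * h + 1, h + 1), (h, 2 * h + 1, h + 1, 2 * h + 3),
      (2 * h + 1, h + 1, 2 * h + 3, h), (h + 1, 2 * h + 3, h, 2 * h + 1)}.
      slr_pair (Upair (dodgson G {i, t} {j, t} {k}) (dodgson G {i, k, t} {j, k, t} {}))"
      by (rule ballI) (use B in \<open>simp only: split_paired_all prod.case\<close>)
  qed
qed

end

section \<open>The graph polynomial as a bordered determinant\<close>

lemma eval_mpoly_superset:
  assumes "finite S" "Poly_Mapping.keys p \<subseteq> S"
  shows "eval_mpoly x p = (\<Sum>m\<in>S. of_int (Poly_Mapping.lookup p m) *
    (\<Prod>i\<in>Poly_Mapping.keys m. x i ^ Poly_Mapping.lookup m i))"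
  unfolding eval_mpoly_def using assms
  by (intro sum.mono_neutral_left) (auto simp: in_keys_iff)

lemma eval_mpoly_0 [simp]: "eval_mpoly x 0 = 0"
  by (simp add: eval_mpoly_def)

lemma eval_mpoly_add: "eval_mpoly x (p + q) = eval_mpoly x p + eval_mpoly x q"
proof -
  let ?S = "Poly_Mapping.keys p \<union> Poly_Mapping.keys q"
  have "Poly_Mapping.keys (p + q) \<subseteq> ?S" by (rule keys_add)
  then show ?thesis
    by (simp add: eval_mpoly_superset[of ?S] lookup_add distrib_right sum.distrib)
qed

lemma eval_mpoly_sum: "eval_mpoly x (\<Sum>i\<in>A. f i) = (\<Sum>i\<in>A. eval_mpoly x (f i))"
  by (induction A rule: infinite_finite_induct) (auto simp: eval_mpoly_add)

lemma prod_Var: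
  assumes "finite A"
  shows "(\<Prod>i\<in>A. Var i) = Poly_Mapping.single (\<Sum>i\<in>A. Poly_Mapping.single i 1) 1"
  using assms
proof induction
  case empty
  then show ?case by (simp only: prod.empty sum.empty single_one)
next
  case (insert i A)
  then show ?case by (simp add: Var_def mult_single)
qed

lemma eval_prod_Var:
  fixes x :: "nat \<Rightarrow> 'a::comm_ring_1"
  assumes A: "finite A"
  shows "eval_mpoly x (\<Prod>i\<in>A. Var i) = (\<Prod>i\<in>A. x i)"
proof -
  let ?m = "\<Sum>i\<in>A. Poly_Mapping.single i 1 :: nat \<Rightarrow>\<^sub>0 nat"
  have l: "Poly_Mapping.lookup ?m i = (if i \<in> A then 1 else 0)" for i
    using A by (simp add: lookup_sum lookup_single when_def)
  have k: "Poly_Mapping.keys ?m = A"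
    unfolding set_eq_iff in_keys_iff l by simp
  have "eval_mpoly x (Poly_Mapping.single m 1) = (\<Prod>i\<in>Poly_Mapping.keys m. x i ^ Poly_Mapping.lookup m i)" for m
    by (simp add: eval_mpoly_def)
  then show ?thesis unfolding prod_Var[OF A] by (simp only: k l) simp
qed

definition wl :: "multigraph \<Rightarrow> (nat \<Rightarrow> 'a::comm_ring_1) \<Rightarrow> nat set \<Rightarrow> 'a entry list" where
  "wl G w A = map (wedge G w) (sorted_list_of_set A)"

lemma mset_wl_insert: "finite A \<Longrightarrow> a \<notin> A \<Longrightarrow> mset (wl G w (insert a A)) = add_mset (wedge G w a) (mset (wl G w A))"
proof -
  assume a: "finite A" "a \<notin> A"
  have "mset (sorted_list_of_set (insert a A)) = add_mset a (mset (sorted_list_of_set A))"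
    using a by (simp add: sorted_list_of_set_insert mset_insort)
  then show ?thesis by (simp add: wl_def)
qed

lemma gd_wl_insert: "finite A \<Longrightarrow> a \<notin> A \<Longrightarrow> gd D (wl G w (insert a A) @ ys) = gd D (wedge G w a # wl G w A @ ys)"
  by (rule gd_perm) (simp add: mset_wl_insert)

text \<open>Iterated deletion and contraction; \<open>S\<close> is the set of contracted
  edges.\<close>

lemma gd_wl_expand:
  assumes "finite A"
  shows "gd D (wl G w A @ ys) = (\<Sum>S\<in>Pow A. (\<Prod>e\<in>A - S. w e) * gd D (wl G (\<lambda>_. 0) S @ ys))"
  using assms
proof (induction A arbitrary: ys rule: finite_induct)
  case empty
  then show ?case by (simp add: wl_def)
next
  case (insert a A)
  let ?z = "wl G (\<lambda>_. 0)" and ?e = "edg 0 (ew G a)"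
  have fin: "S \<subseteq> A \<Longrightarrow> finite S" for S using insert(1) finite_subset by blast
  have "gd D (wl G w (insert a A) @ ys) = w a * gd D (wl G w A @ ys) + gd D (?e # wl G w A @ ys)"
    unfolding gd_wl_insert[OF insert(1,2)] by (rule gd_edge)
  also have "gd D (?e # wl G w A @ ys) = gd D (wl G w A @ ?e # ys)"
    by (rule gd_perm) simp
  also have "w a * gd D (wl G w A @ ys) + \<dots> =
      (\<Sum>S\<in>Pow A. w a * ((\<Prod>e\<in>A - S. w e) * gd D (?z S @ ys))) +
      (\<Sum>S\<in>Pow A. (\<Prod>e\<in>A - S. w e) * gd D (?z S @ ?e # ys))"
    unfolding insert.IH by (simp add: sum_distrib_left)
  also have "(\<Sum>S\<in>Pow A. w a * ((\<Prod>e\<in>A - S. w e) * gd D (?z S @ ys))) =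
      (\<Sum>S\<in>Pow A. (\<Prod>e\<in>insert a A - S. w e) * gd D (?z S @ ys))"
  proof (rule sum.cong)
    fix S assume S: "S \<in> Pow A"
    then have "insert a A - S = insert a (A - S)" using insert(2) by auto
    then show "w a * ((\<Prod>e\<in>A - S. w e) * gd D (?z S @ ys)) = (\<Prod>e\<in>insert a A - S. w e) * gd D (?z S @ ys)"
      using insert(1,2) by (simp add: mult.assoc)
  qed simp
  also have "(\<Sum>S\<in>Pow A. (\<Prod>e\<in>A - S. w e) * gd D (?z S @ ?e # ys)) =
      (\<Sum>S\<in>insert a ` Pow A. (\<Prod>e\<in>insert a A - S. w e) * gd D (?z S @ ys))"
  proof (subst sum.reindex)
    show "inj_on (insert a) (Pow A)" using insert(2) by (auto simp: inj_on_def)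
    show "(\<Sum>S\<in>Pow A. (\<Prod>e\<in>A - S. w e) * gd D (?z S @ ?e # ys)) =
        sum ((\<lambda>S. (\<Prod>e\<in>insert a A - S. w e) * gd D (?z S @ ys)) \<circ> insert a) (Pow A)"
    proof (rule sum.cong)
      fix S assume S: "S \<in> Pow A"
      then have "insert a A - insert a S = A - S" using insert(2) by auto
      moreover have "gd D (?z (insert a S) @ ys) = gd D (?z S @ ?e # ys)"
        using mset_wl_insert[of S a G "\<lambda>_. 0"] S insert(2) fin by (intro gd_perm) auto
      ultimately show "(\<Prod>e\<in>A - S. w e) * gd D (?z S @ ?e # ys) =
          ((\<lambda>S. (\<Prod>e\<in>insert a A - S. w e) * gd D (?z S @ ys)) \<circ> insert a) S" by simp
    qed simp
  qed
  also have "(\<Sum>S\<in>Pow A. (\<Prod>e\<in>insert a A - S. w e) * gd D (?z S @ ys)) +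
      (\<Sum>S\<in>insert a ` Pow A. (\<Prod>e\<in>insert a A - S. w e) * gd D (?z S @ ys)) =
      (\<Sum>S\<in>Pow (insert a A). (\<Prod>e\<in>insert a A - S. w e) * gd D (?z S @ ys))"
    unfolding Pow_insert using insert(1,2) by (intro sum.union_disjoint[symmetric]) auto
  finally show ?case .
qed

context
  fixes G :: multigraph and root :: nat and ty :: "'a::idom itself"
  assumes nv: "nverts G = Suc root"
    and ends: "\<And>e. e < nedges G \<Longrightarrow> fst (edges G ! e) \<le> root \<and> snd (edges G ! e) \<le> root"
begin

private lemma adj_sym: "(u, v) \<in> (adj G T)\<^sup>* \<Longrightarrow> (v, u) \<in> (adj G T)\<^sup>*"
proof -
  have "sym (adj G T)" by (auto simp: sym_def adj_def)
  then show "(u, v) \<in> (adj G T)\<^sup>* \<Longrightarrow> (v, u) \<in> (adj G T)\<^sup>*" using sym_rtrancl by (meson symD)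
qed

text \<open>Telescoping along a path: each edge row of \<open>T\<close> may be added to the test row
  without changing the determinant, since equal rows give zero.\<close>

private lemma gd_path:
  assumes "finite T" "(u, v) \<in> (adj G T)\<^sup>*"
  shows "gd root (tst (vsub (uv u) (uv v)) C # wl G (\<lambda>_. 0 :: 'a) T @ ys) = 0"
  using assms(2)
proof (induction rule: rtrancl_induct)
  case base
  show ?case by (simp only: gd_sub_row diff_self)
next
  case (step v w)
  obtain e where e: "e \<in> T" "edges G ! e = (v, w) \<or> edges G ! e = (w, v)"
    using step(2) by (auto simp: adj_def)
  let ?r = "wl G (\<lambda>_. 0 :: 'a) (T - {e}) @ ys"
  have p: "gd root (tst R C # wl G (\<lambda>_. 0 :: 'a) T @ ys) = gd root (tst R C # tst (ew G e) (ew G e) # ?r)" for R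
  proof (rule gd_perm)
    have "T = insert e (T - {e})" using e by auto
    then have "mset (wl G (\<lambda>_. 0 :: 'a) T) = add_mset (tst (ew G e) (ew G e)) (mset (wl G (\<lambda>_. 0 :: 'a) (T - {e})))"
      using mset_wl_insert[of "T - {e}" e G "\<lambda>_. 0 :: 'a"] assms(1) by simp
    then show "mset (tst R C # wl G (\<lambda>_. 0 :: 'a) T @ ys) = mset (tst R C # tst (ew G e) (ew G e) # ?r)" by simp
  qed
  have 0: "gd root (tst (ew G e) C # tst (ew G e) (ew G e) # ?r) = 0" by (rule gd_dup_row)
  have IH: "gd root (tst (uv u) C # tst (ew G e) (ew G e) # ?r) = gd root (tst (uv v) C # tst (ew G e) (ew G e) # ?r)"
    using step.IH unfolding p by (simp only: gd_sub_row right_minus_eq)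
  have "gd root (tst (uv v) C # tst (ew G e) (ew G e) # ?r) = gd root (tst (uv w) C # tst (ew G e) (ew G e) # ?r)"
  proof -
    have *: "gd root (tst (vsub (uv x) (uv y)) C # q # ?r) = 0 \<Longrightarrow>
      gd root (tst (uv x) C # q # ?r) = gd root (tst (uv y) C # q # ?r)" for x y q
      by (simp only: gd_sub_row right_minus_eq)
    show ?thesis
    proof (cases "edges G ! e = (v, w)")
      case True
      then have "ew G e = vsub (uv v) (uv w :: nat \<Rightarrow> 'a)" by (simp add: ew_def)
      then show ?thesis using *[of v w "tst (ew G e) (ew G e)"] 0 by simp
    next
      case False
      then have "ew G e = vsub (uv w) (uv v :: nat \<Rightarrow> 'a)" using e by (simp add: ew_def)
      then show ?thesis using *[of w v "tst (ew G e) (ew G e)"] 0 by simp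
    qed
  qed
  with IH show ?case unfolding p by (simp only: gd_sub_row right_minus_eq)
qed

private lemma gd_cycle:
  assumes "finite T" "i \<in> T" "edges G ! i \<in> (adj G (T - {i}))\<^sup>*"
  shows "gd root (wl G (\<lambda>_. 0 :: 'a) T) = 0"
proof -
  have "T = insert i (T - {i})" using assms by auto
  then have "gd root (wl G (\<lambda>_. 0 :: 'a) T) = gd root (tst (ew G i) (ew G i) # wl G (\<lambda>_. 0 :: 'a) (T - {i}))"
    using gd_wl_insert[of "T - {i}" i root G "\<lambda>_. 0 :: 'a" "[]"] assms(1) by simp
  also have "\<dots> = 0"
    using gd_path[of "T - {i}" "fst (edges G ! i)" "snd (edges G ! i)" "ew G i" "[]"] assms by (simp add: ew_def)
  finally show ?thesis .
qed

text \<open>The indicator function of the vertices not joined to the root is constant along every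
  edge of \<open>T\<close> and zero at the root, hence orthogonal to all edge rows.\<close>

private lemma gd_disconnected:
  assumes T: "T \<subseteq> {..<nedges G}" and u: "u \<le> root" "(u, root) \<notin> (adj G T)\<^sup>*"
  shows "gd root (wl G (\<lambda>_. 0 :: 'a) T) = 0"
proof (rule gd_kernel[where u = "\<lambda>v. if (v, root) \<in> (adj G T)\<^sup>* then 0 else 1" and w = u])
  let ?f = "\<lambda>v. if (v, root) \<in> (adj G T)\<^sup>* then 0 else 1 :: 'a"
  have fin: "finite T" using T finite_subset by blast
  show "u < root" using u by (cases "u = root") auto
  show "?f u \<noteq> 0" using u by simp
  fix x assume "x \<in> set (wl G (\<lambda>_. 0 :: 'a) T)"
  then obtain e where e: "e \<in> T" "x = edg 0 (ew G e)" using fin by (auto simp: wl_def)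
  let ?a = "fst (edges G ! e)" and ?b = "snd (edges G ! e)"
  have ab: "?a \<le> root" "?b \<le> root" using ends[of e] e T by auto
  have "(?a, ?b) \<in> adj G T" using e by (auto simp: adj_def intro: bexI[of _ e])
  moreover have "(?b, ?a) \<in> adj G T" using e by (auto simp: adj_def intro: bexI[of _ e])
  ultimately have "(?a, root) \<in> (adj G T)\<^sup>* \<longleftrightarrow> (?b, root) \<in> (adj G T)\<^sup>*"
    by (meson converse_rtrancl_into_rtrancl)
  then have "?f ?a = ?f ?b" by (simp only:)
  moreover have s: "(\<Sum>v<root. uv i v * ?f v) = ?f i" if "i \<le> root" for i
  proof (cases "i = root")
    case True
    have "(\<Sum>v<root. uv i v * ?f v) = 0" by (rule sum.neutral) (auto simp: True uv_def)
    then show ?thesis using True by simp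
  next
    case False
    have "(\<Sum>v<root. uv i v * ?f v) = (\<Sum>v<root. if v = i then ?f i else 0)"
      by (rule sum.cong) (auto simp: uv_def)
    then show ?thesis using False that by simp
  qed
  ultimately show "(\<Sum>v<root. fst (snd x) v * ?f v) = 0"
    using ab by (simp only: e(2) fst_conv snd_conv ew_def vsub_apply left_diff_distrib sum_subtractf s diff_self)
qed

private definition ul :: "nat set \<Rightarrow> 'a entry list" where
  "ul A = map (\<lambda>v. tst (uv v) (uv v)) (sorted_list_of_set A)"

private lemma mset_ul_insert: "finite A \<Longrightarrow> a \<notin> A \<Longrightarrow> mset (ul (insert a A)) = add_mset (tst (uv a) (uv a)) (mset (ul A))"
proof -
  assume a: "finite A" "a \<notin> A"
  have "mset (sorted_list_of_set (insert a A)) = add_mset a (mset (sorted_list_of_set A))"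
    using a by (simp add: sorted_list_of_set_insert mset_insort)
  then show ?thesis by (simp add: ul_def)
qed

text \<open>
  A spanning tree is grown from the root: an edge leaving the part \<open>W\<close> reached so far replaces the
  unit entry of its new vertex, because the row of its old vertex is spanned by the edges of \<open>S\<close>.
\<close>

private lemma gd_grow:
  assumes T: "T \<subseteq> {..<nedges G}" "\<And>u. u \<le> root \<Longrightarrow> (u, root) \<in> (adj G T)\<^sup>*"
    and ac: "\<And>i. i \<in> T \<Longrightarrow> edges G ! i \<notin> (adj G (T - {i}))\<^sup>*"
    and W: "root \<in> W" "W \<subseteq> {..root}" and S: "S \<subseteq> T" "\<And>w. w \<in> W \<Longrightarrow> (w, root) \<in> (adj G S)\<^sup>*"
    and SW: "\<And>e. e \<in> S \<Longrightarrow> fst (edges G ! e) \<in> W \<and> snd (edges G ! e) \<in> W"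
    and one: "gd root (wl G (\<lambda>_. 0 :: 'a) S @ ul ({..root} - W)) = 1"
  shows "gd root (wl G (\<lambda>_. 0 :: 'a) T) = 1"
  using W S SW one
proof (induction "card ({..root} - W)" arbitrary: W S)
  case 0
  then have W: "W = {..root}" by auto
  \<comment> \<open>Once all vertices are reached, an edge of \<open>T\<close> outside
    \<open>S\<close> would close a cycle with edges of \<open>S\<close>.\<close>
  have "S = T"
  proof (rule ccontr)
    assume "S \<noteq> T"
    then obtain i where i: "i \<in> T" "i \<notin> S" using 0 by auto
    let ?a = "fst (edges G ! i)" and ?b = "snd (edges G ! i)"
    have "?a \<le> root" "?b \<le> root" using ends[of i] i T by auto
    then have "(?a, root) \<in> (adj G S)\<^sup>*" "(root, ?b) \<in> (adj G S)\<^sup>*" using 0(5) adj_sym W by auto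
    then have "(?a, ?b) \<in> (adj G S)\<^sup>*" by (meson rtrancl_trans)
    moreover have "adj G S \<subseteq> adj G (T - {i})" using i 0(4) by (auto simp: adj_def)
    ultimately have "(?a, ?b) \<in> (adj G (T - {i}))\<^sup>*" using rtrancl_mono by blast
    then show False using ac[OF i(1)] by simp
  qed
  then show ?case using 0 W by (simp add: ul_def)
next
  case (Suc n)
  have finS: "finite S" by (rule finite_subset[OF subset_trans[OF Suc(5) T(1)] finite_lessThan])
  have "{..root} - W \<noteq> {}"
  proof
    assume "{..root} - W = {}"
    with Suc(2) show False by (simp only: card.empty)
  qed
  then obtain u where u: "u \<le> root" "u \<notin> W" by auto
  have "\<exists>v w. (v, w) \<in> adj G T \<and> v \<notin> W \<and> w \<in> W"
    using T(2)[OF u(1)] u(2)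
  proof (induction rule: converse_rtrancl_induct)
    case base
    then show ?case using Suc(3) by simp
  next
    case (step y z)
    then show ?case by (cases "z \<in> W") auto
  qed
  then obtain v w e where e: "e \<in> T" "edges G ! e = (v, w) \<or> edges G ! e = (w, v)" and vw: "v \<notin> W" "w \<in> W"
    by (auto simp: adj_def)
  have v: "v \<le> root" "v \<noteq> root" using ends[of e] e T Suc(3) vw by auto
  have eS: "e \<notin> S" using Suc(7)[of e] e vw by auto
  let ?W = "insert v W" and ?S = "insert e S"
  let ?rest = "wl G (\<lambda>_. 0 :: 'a) S @ ul ({..root} - ?W)"
  have RW: "{..root} - W = insert v ({..root} - ?W)" using v vw by auto
  have one: "gd root (tst (uv v) (uv v) # ?rest) = 1"
  proof -
    have "gd root (wl G (\<lambda>_. 0 :: 'a) S @ ul ({..root} - W)) = gd root (tst (uv v) (uv v) # ?rest)"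
      unfolding RW by (rule gd_perm) (simp add: mset_ul_insert)
    then show ?thesis using Suc(8) by simp
  qed
  \<comment> \<open>\<open>S\<close> connects \<open>w\<close> with the root, which has no column,
    so the row \<open>uv w\<close> lies in the span of the rows of \<open>S\<close>. Hence replacing
    \<open>uv v\<close> by the row of the new edge changes nothing but possibly the sign, and this
    occurs in both row and column.\<close>
  have zero: "gd root (tst (uv w) C # ?rest) = 0" for C
  proof -
    have "gd root (tst (vsub (uv w) (uv root)) C # ?rest) = 0"
      by (rule gd_path[OF finS Suc(6)[OF vw(2)]])
    then show ?thesis by (simp add: gd_sub_row gd_outside)
  qed
  have zero': "gd root (tst C (uv w) # ?rest) = 0" for C
  proof -
    have "map flip_entry ?rest = ?rest" by (simp add: wl_def ul_def)
    then show ?thesis using gd_sym1[of ?rest root C "uv w"] zero[of C] by simp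
  qed
  have "gd root (tst (ew G e) (ew G e) # ?rest) = 1"
  proof (cases "edges G ! e = (v, w)")
    case True
    then have "ew G e = vsub (uv v) (uv w :: nat \<Rightarrow> 'a)" by (simp add: ew_def)
    then show ?thesis using one by (simp add: gd_sub_row gd_sub_col zero zero')
  next
    case False
    then have "ew G e = vsub (uv w) (uv v :: nat \<Rightarrow> 'a)" using e by (simp add: ew_def)
    then show ?thesis using one by (simp add: gd_sub_row gd_sub_col zero zero')
  qed
  then have one': "gd root (wl G (\<lambda>_. 0 :: 'a) ?S @ ul ({..root} - ?W)) = 1"
    by (simp add: gd_wl_insert[OF finS eS])
  have ad: "(w, v) \<in> adj G ?S" "(v, w) \<in> adj G ?S" using e by (auto simp: adj_def)
  have mono: "(adj G S)\<^sup>* \<subseteq> (adj G ?S)\<^sup>*" by (rule rtrancl_mono) (auto simp: adj_def)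
  show ?case
  proof (rule Suc(1)[of ?W ?S])
    show "n = card ({..root} - ?W)" using Suc(2) unfolding RW by simp
    show "(x, root) \<in> (adj G ?S)\<^sup>*" if "x \<in> ?W" for x
    proof (cases "x = v")
      case True
      have "(w, root) \<in> (adj G ?S)\<^sup>*" using Suc(6)[OF vw(2)] mono by blast
      then show ?thesis using ad True by (meson converse_rtrancl_into_rtrancl)
    next
      case False
      then show ?thesis using Suc(6)[of x] that mono by blast
    qed
    show "fst (edges G ! x) \<in> ?W \<and> snd (edges G ! x) \<in> ?W" if "x \<in> ?S" for x
      using Suc(7)[of x] that e vw by auto
  qed (use Suc(3,4,5) v e one' in auto)
qed

private lemma gd_spanning:
  assumes T: "T \<subseteq> {..<nedges G}"
  shows "gd root (wl G (\<lambda>_. 0 :: 'a) T) = (if spanning_tree G T then 1 else 0)"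
proof (cases "spanning_tree G T")
  case True
  have "gd root (wl G (\<lambda>_. 0 :: 'a) T) = 1"
  proof (rule gd_grow[where W = "{root}" and S = "{}"])
    show "u \<le> root \<Longrightarrow> (u, root) \<in> (adj G T)\<^sup>*" for u
      using True nv by (auto simp: spanning_tree_def)
    show "i \<in> T \<Longrightarrow> edges G ! i \<notin> (adj G (T - {i}))\<^sup>*" for i
      using True by (auto simp: spanning_tree_def)
    have "{..root} - {root} = {0..<root}" by auto
    moreover have "gd root (map (\<lambda>v. (0, uv v, uv v)) [0..<root]) = (1 :: 'a)"
      by (rule gd_units) auto
    ultimately show "gd root (wl G (\<lambda>_. 0 :: 'a) {} @ ul ({..root} - {root})) = 1"
      by (simp add: wl_def ul_def)
  qed (use T in auto)
  then show ?thesis using True by simp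
next
  case False
  have "(\<exists>i\<in>T. edges G ! i \<in> (adj G (T - {i}))\<^sup>*) \<or> (\<exists>u\<le>root. (u, root) \<notin> (adj G T)\<^sup>*)"
  proof (rule ccontr)
    assume *: "\<not> ?thesis"
    have "(u, v) \<in> (adj G T)\<^sup>*" if "u < nverts G" "v < nverts G" for u v
    proof -
      have "(u, root) \<in> (adj G T)\<^sup>*" "(v, root) \<in> (adj G T)\<^sup>*" using * that nv by auto
      then show ?thesis using adj_sym[of v root T] by (meson rtrancl_trans)
    qed
    then show False using False T * unfolding spanning_tree_def by blast
  qed
  moreover have "finite T" using T finite_subset by blast
  ultimately have "gd root (wl G (\<lambda>_. 0 :: 'a) T) = 0" using gd_cycle gd_disconnected[OF T] by blast
  then show ?thesis using False by simp
qed

text \<open>The matrix-tree theorem by expansion: the coefficient belonging to a set of contracted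
  edges is 1 for a spanning tree and 0 otherwise. Signs cannot arise, since row and column of each
  edge agree.\<close>

lemma eval_graph_poly:
  fixes x :: "nat \<Rightarrow> 'a"
  shows "eval_mpoly x (graph_poly G) = gd root (map (wedge G x) [0..<nedges G])"
proof -
  let ?N = "{..<nedges G}"
  have "gd root (map (wedge G x) [0..<nedges G]) = gd root (wl G x ?N @ [])"
    by (simp add: wl_def lessThan_atLeast0)
  also have "\<dots> = (\<Sum>S\<in>Pow ?N. (\<Prod>e\<in>?N - S. x e) * (if spanning_tree G S then 1 else 0))"
    unfolding gd_wl_expand[OF finite_lessThan] by (rule sum.cong) (auto simp: gd_spanning)
  also have "\<dots> = (\<Sum>S | spanning_tree G S. \<Prod>e\<in>?N - S. x e)"
    by (rule sum.mono_neutral_cong_right) (auto simp: spanning_tree_def)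
  finally show ?thesis
    by (simp add: graph_poly_def eval_mpoly_sum eval_prod_Var)
qed

end

section \<open>Zeros in the variables of the star\<close>

text \<open>Integer-valued, so that inclusion and exclusion with negative coefficients and
  congruences modulo powers of \<open>q\<close> can be written termwise; products count common
  zeros.\<close>

definition zc :: "'a::zero \<Rightarrow> int" where
  "zc A = of_bool (A = 0)"

lemma zc_0 [simp]: "zc 0 = 1" by (simp add: zc_def)
lemma zc_nz: "A \<noteq> 0 \<Longrightarrow> zc A = 0" by (simp add: zc_def)
lemma zc_sq [simp]: "zc A * zc A = zc A" by (simp add: zc_def)
lemma zc_mult: "zc (A * B) = zc A + zc B - zc A * zc (B :: 'a::idom)" by (simp add: zc_def)
lemma zc_minus [simp]: "zc (- A :: 'a::idom) = zc A" by (simp add: zc_def)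
lemma zc_swap: "zc (A - B :: 'a::idom) = zc (B - A)" by (auto simp: zc_def)

context
  fixes q :: int and ty :: "'F::{field,finite} itself"
  defines "q \<equiv> int CARD('F)"
begin

lemma sum_zc_lin: "(\<Sum>x\<in>UNIV. zc (u * x + v)) = 1 - zc u + q * zc u * zc (v :: 'F)"
proof (cases "u = 0")
  case True
  then show ?thesis by (simp add: zc_def q_def)
next
  case False
  have "(\<Sum>x\<in>UNIV. zc (u * x + v)) = (\<Sum>x\<in>UNIV. if x = - v / u then 1 else 0 :: int)"
    using False by (intro sum.cong) (auto simp: zc_def field_simps eq_neg_iff_add_eq_0 add.commute)
  also have "\<dots> = 1" by simp
  finally show ?thesis using False by (simp add: zc_def)
qed

lemma sum_shift: "(\<Sum>x\<in>UNIV. f (x + v :: 'F)) = (\<Sum>x\<in>UNIV. f x :: int)"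
  by (rule sum.reindex_bij_witness[where i = "\<lambda>x. x - v" and j = "\<lambda>x. x + v"]) auto

lemma sum_const: "(\<Sum>x\<in>(UNIV :: 'F set). c) = q * (c :: int)"
  by (simp add: q_def)

lemma sum_zc_only: "(\<Sum>x\<in>UNIV. zc (x - v) * f x) = (f (v :: 'F) :: int)"
proof -
  have "(\<Sum>x\<in>UNIV. zc (x - v) * f x) = (\<Sum>x\<in>UNIV. if x = v then f x else 0)"
    by (rule sum.cong) (auto simp: zc_def)
  then show ?thesis by simp
qed

lemma sum_zc_hyperbola: "(\<Sum>x\<in>UNIV. \<Sum>y\<in>UNIV. zc (x * y - c)) = q - 1 + q * zc (c :: 'F)"
proof -
  have "(\<Sum>x\<in>UNIV. \<Sum>y\<in>UNIV. zc (x * y - c)) = (\<Sum>x\<in>(UNIV :: 'F set). 1 - zc x + q * zc x * zc (- c))"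
    using sum_zc_lin[of _ "- c"] by simp
  also have "\<dots> = q - 1 + q * zc c"
    using sum_zc_lin[of 1 0] sum_zc_lin[of 1 "0::'F"]
    by (simp add: sum.distrib sum_subtractf sum_const sum_distrib_left[symmetric] sum_distrib_right[symmetric] zc_nz q_def)
  finally show ?thesis .
qed

subsection \<open>The regular case\<close>

lemma cone_count: "(\<Sum>p\<in>UNIV. \<Sum>r\<in>UNIV. \<Sum>t\<in>UNIV. zc (p * r + p * t + r * t :: 'F)) = q\<^sup>2"
proof -
  have s1: "(\<Sum>x\<in>UNIV. zc (x :: 'F)) = 1" using sum_zc_lin[of 1 0] by (simp add: zc_nz)
  have "(\<Sum>t\<in>UNIV. zc (p * r + p * t + r * t :: 'F)) = 1 - zc (p + r) + q * zc (p + r) * zc p" for p r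
  proof -
    have "(\<Sum>t\<in>UNIV. zc (p * r + p * t + r * t)) = (\<Sum>t\<in>UNIV. zc ((p + r) * t + p * r))"
      by (simp add: algebra_simps)
    also have "\<dots> = 1 - zc (p + r) + q * zc (p + r) * zc (p * r)" by (rule sum_zc_lin)
    moreover have "zc (p + r) * zc (p * r) = zc (p + r) * zc p" by (auto simp: zc_def)
    ultimately show ?thesis by (simp add: mult.assoc)
  qed
  moreover have "(\<Sum>r\<in>UNIV. zc (p + r)) = 1" for p :: 'F
    using sum_shift[of zc p] s1 by (simp add: add.commute)
  ultimately show ?thesis
    by (simp add: sum.distrib sum_subtractf sum_const sum_distrib_left[symmetric] sum_distrib_right[symmetric]
        mult.assoc mult.commute[of "zc (_ + _)"] s1 power2_eq_square q_def) (simp add: algebra_simps)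
qed

text \<open>Off the line \<open>p + r = 0\<close> the quadric determines \<open>t\<close>, and
  substituting it turns the cubic into minus a multiple of a square, whose zeros in \<open>p\<close>
  and \<open>r\<close> form a shifted hyperbola. The points with \<open>p + r = 0\<close> are
  counted apart.\<close>

lemma cone_det_count:
  fixes D E P :: 'F
  assumes P: "P \<noteq> 0"
    and A: "\<And>p r t. A p r t = P * (p * r + p * t + r * t)"
    and B: "\<And>p r t. B p r t = P * (p * r * t - p * D\<^sup>2 - r * E\<^sup>2 - t * (D - E)\<^sup>2
      + p * r * x + p * t * y + r * t * w)"
    and xyw: "x - y = - 2 * D" "x - w = - 2 * E"
  shows "(\<Sum>p\<in>UNIV. \<Sum>r\<in>UNIV. \<Sum>t\<in>UNIV. zc (A p r t) * zc (B p r t)) =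
    q * (zc D + zc E + zc (D - E) + 1 - zc D * zc E) - 2"
proof -
  have s1: "(\<Sum>x\<in>UNIV. zc (x :: 'F)) = 1" using sum_zc_lin[of 1 0] by (simp add: zc_nz)
  have inner: "(\<Sum>t\<in>UNIV. zc (A p r t) * zc (B p r t)) =
     zc ((p + E) * (r + D) - D * E) - zc (p + r) * zc ((p + E) * (r + D) - D * E)
     + zc (p + r) * zc p * (1 + (q - 1) * zc (D - E))" for p r
  proof (cases "p + r = 0")
    case True
    then have r: "r = - p" by (simp add: eq_neg_iff_add_eq_0 add.commute)
    show ?thesis
    proof (cases "p = 0")
      case p: True
      have "(\<Sum>t\<in>UNIV. zc (A p r t) * zc (B p r t)) = (\<Sum>t\<in>UNIV. zc ((D - E) * t))"
        by (rule sum.cong) (auto simp: zc_def A B p r P)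
      also have "\<dots> = 1 - zc (D - E) + q * zc (D - E)" using sum_zc_lin[of "D - E" 0] by simp
      finally show ?thesis using p r by (simp add: algebra_simps)
    next
      case False
      then show ?thesis by (simp add: A r zc_nz P algebra_simps)
    qed
  next
    case False
    let ?t = "- (p * r) / (p + r)"
    have "zc (A p r t) = zc (t - ?t)" for t
    proof -
      have "A p r t = (P * (p + r)) * (t - ?t)" using False by (simp add: A field_simps)
      then show ?thesis using False P by (simp add: zc_mult zc_nz)
    qed
    then have "(\<Sum>t\<in>UNIV. zc (A p r t) * zc (B p r t)) = zc (B p r ?t)"
      using sum_zc_only[of ?t "\<lambda>t. zc (B p r t)"] by simp
    \<comment> \<open>Here the square appears: with \<open>t * (p + r) = - p * r\<close> all terms
      containing \<open>x\<close> cancel.\<close>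
    also have "B p r ?t * (p + r) = - P * (p * r + p * D + r * E)\<^sup>2"
    proof -
      have t: "?t * (p + r) = - (p * r)" using False by simp
      have yw: "y = x + 2 * D" "w = x + 2 * E" using xyw by (simp_all add: algebra_simps)
      have gen: "B p r t * (p + r) = P * ((p * r) * (t * (p + r)) - (p * D\<^sup>2 + r * E\<^sup>2) * (p + r) - (t * (p + r)) * (D - E)\<^sup>2
          + p * r * x * (p + r) + (p * y + r * w) * (t * (p + r)))" for t
        by (simp add: B algebra_simps)
      show ?thesis unfolding gen t unfolding yw by (simp add: algebra_simps power2_eq_square)
    qed
    then have "zc (B p r ?t) = zc (p * r + p * D + r * E)"
      using False P by (auto simp: zc_def)
    also have "p * r + p * D + r * E = (p + E) * (r + D) - D * E" by (simp add: algebra_simps)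
    finally show ?thesis using False by (simp add: zc_nz)
  qed
  have h: "(\<Sum>p\<in>UNIV. \<Sum>r\<in>UNIV. zc ((p + E) * (r + D) - D * E)) = q - 1 + q * zc (D * E)"
  proof -
    have "(\<Sum>p\<in>UNIV. \<Sum>r\<in>UNIV. zc ((p + E) * (r + D) - D * E)) = (\<Sum>p\<in>UNIV. \<Sum>r\<in>UNIV. zc ((p + E) * r - D * E))"
      using sum_shift[of "\<lambda>r. zc ((_ + E) * r - D * E)" D] by simp
    also have "\<dots> = (\<Sum>p\<in>UNIV. \<Sum>r\<in>UNIV. zc (p * r - D * E))"
      by (rule sum_shift)
    finally show ?thesis by (simp add: sum_zc_hyperbola)
  qed
  have only: "(\<Sum>r\<in>UNIV. zc (p + r) * f r) = f (- p)" for p :: 'F and f :: "'F \<Rightarrow> int"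
    using sum_zc_only[of "- p" f] by (simp add: add.commute)
  have d: "(\<Sum>p\<in>UNIV. zc ((p + E) * (D - p) - D * E)) = 2 - zc (D - E)"
  proof -
    have "zc ((p + E) * (D - p) - D * E) = zc p + zc (p - (D - E)) - zc (p - (D - E)) * zc p" for p
    proof -
      have "(p + E) * (D - p) - D * E = - (p * (p - (D - E)))" by (simp add: algebra_simps)
      then show ?thesis by (simp add: zc_mult del: minus_mult_right)
    qed
    then show ?thesis
      using sum_zc_only[of "D - E" zc] sum_zc_only[of "D - E" "\<lambda>_. 1"] by (simp add: sum.distrib sum_subtractf s1)
  qed
  have "(\<Sum>p\<in>UNIV. \<Sum>r\<in>UNIV. \<Sum>t\<in>UNIV. zc (A p r t) * zc (B p r t)) =
      (q - 1 + q * zc (D * E)) - (2 - zc (D - E)) + (1 + (q - 1) * zc (D - E))"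
    unfolding inner
    using only[of _ "\<lambda>_. 1"]
    by (simp add: sum.distrib sum_subtractf h only d mult.assoc s1 sum_distrib_right[symmetric])
  then show ?thesis by (simp add: zc_mult algebra_simps)
qed

subsection \<open>All cases\<close>

text \<open>The graph polynomial of the whole graph as a function of the star variables, split as
  \<open>d * psiA + psiB\<close>; the variables \<open>a\<close>, \<open>b\<close>,
  \<open>c\<close>, \<open>d\<close> belong to the edges ending in \<open>x\<close>,
  \<open>y\<close>, \<open>w\<close> and the ground. See \<open>gd_zig_star\<close>.\<close>

definition psiA :: "'F net \<Rightarrow> 'F \<Rightarrow> 'F \<Rightarrow> 'F \<Rightarrow> 'F" where
  "psiA N a b c = pP N * (a * b + a * c + b * c)
    + a * (d2 N + dm N - 2 * t2 N + om N) + b * (d1 N + dm N - 2 * t1 N + om N) + c * (d1 N + d2 N)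
    + (ff N + x1 N + x3 N - 2 * ps N - 2 * ch N - 2 * x2 N)"

definition psiB :: "'F net \<Rightarrow> 'F \<Rightarrow> 'F \<Rightarrow> 'F \<Rightarrow> 'F" where
  "psiB N a b c = pP N * (a * b * c) + b * c * (d1 N + dm N) + a * c * (d2 N + dm N) + a * b * om N
    + c * ff N + b * x1 N + a * x3 N + f4 N"

definition star_count :: "'F net \<Rightarrow> int" where
  "star_count N = (\<Sum>a\<in>UNIV. \<Sum>b\<in>UNIV. \<Sum>c\<in>UNIV. \<Sum>d\<in>UNIV. zc (d * psiA N a b c + psiB N a b c))"

text \<open>
  For \<open>pP N \<noteq> 0\<close> this is three minus the number of distinct values among \<open>dm, t1, t2\<close>. For
  \<open>pP N = 0\<close> the summands are chosen such that each of them vanishes on a pair of polynomials to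
  which a resultant in the closing edge can be applied.
\<close>

definition star_main :: "'F net \<Rightarrow> int" where
  "star_main N = zc (dm N - t1 N) + zc (dm N - t2 N) + zc (t1 N - t2 N) - zc (dm N - t1 N) * zc (t1 N - t2 N)
    + zc (pP N) * (zc (d1 N + d2 N) + zc (d1 N + dm N) - zc (d2 N - t2 N + t1 N) - zc (t2 N)
      - zc (d1 N + dm N - t1 N) - zc (d1 N))"

text \<open>Dividing by \<open>pP\<close> turns the first-order minors into a symmetric response
  matrix, and the quadratic relations express all higher ones by it.\<close>

lemma star_regular:
  assumes lag: "net_lag N" and P: "pP N \<noteq> 0"
  shows "star_count N = q ^ 3 - 2 * q + q\<^sup>2 * star_main N"
proof -
  note r = lag[unfolded net_lag_def lag_def]
  define x y w g1 g2 g3 where g: "x = dm N / pP N" "y = t1 N / pP N" "w = t2 N / pP N"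
    "g1 = (d1 N + dm N) / pP N" "g2 = (d2 N + dm N) / pP N" "g3 = om N / pP N"
  have e: "dm N = pP N * x" "t1 N = pP N * y" "t2 N = pP N * w" "d1 N = pP N * (g1 - x)" "d2 N = pP N * (g2 - x)"
    "om N = pP N * g3" using P by (simp_all add: g right_diff_distrib)
  have canc: "u = pP N * v" if "pP N * u = pP N * (pP N * v)" for u v using that P by simp
  have f: "ff N = pP N * (g1 * g2 - x\<^sup>2)" "x1 N = pP N * (g1 * g3 - y\<^sup>2)" "x3 N = pP N * (g2 * g3 - w\<^sup>2)"
    "ch N = pP N * (g1 * w - x * y)" "ps N = pP N * (y * g2 - x * w)" "x2 N = pP N * (x * g3 - y * w)"
    by (rule canc, use r in \<open>simp add: e algebra_simps power2_eq_square\<close>)+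
  have f4: "f4 N = pP N * (g1 * (g2 * g3 - w\<^sup>2) - x * (x * g3 - y * w) - y * (y * g2 - x * w))"
    by (rule canc, use r in \<open>simp add: e f algebra_simps power2_eq_square\<close>)
  let ?D = "x - y" and ?E = "x - w"
  \<comment> \<open>The shifts are chosen to remove the linear terms of \<open>psiA\<close>; its
    constant term then disappears as well.\<close>
  define A where "A p r t = psiA N (p - (g1 + w - x - y)) (r - (g2 + y - x - w)) (t - (g3 + x - y - w))" for p r t
  define B where "B p r t = psiB N (p - (g1 + w - x - y)) (r - (g2 + y - x - w)) (t - (g3 + x - y - w))" for p r t
  have A: "A p r t = pP N * (p * r + p * t + r * t)" for p r t
    unfolding A_def psiA_def f e by (simp add: algebra_simps power2_eq_square)
  have B: "B p r t = pP N * (p * r * t - p * ?D\<^sup>2 - r * ?E\<^sup>2 - t * (?D - ?E)\<^sup>2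
      + p * r * (y + w - x) + p * t * (x + w - y) + r * t * (x + y - w))" for p r t
    unfolding B_def psiB_def f f4 e by (simp add: algebra_simps power2_eq_square)
  have sh: "(\<Sum>a\<in>UNIV. \<Sum>b\<in>UNIV. \<Sum>c\<in>UNIV. f a b c) =
      (\<Sum>p\<in>UNIV. \<Sum>r\<in>UNIV. \<Sum>t\<in>UNIV. f (p - u) (r - v) (t - z))" for f :: "'F \<Rightarrow> 'F \<Rightarrow> 'F \<Rightarrow> int" and u v z
    using sum_shift[of "\<lambda>a. \<Sum>b\<in>UNIV. \<Sum>c\<in>UNIV. f a b c" "- u"] sum_shift[of "\<lambda>b. \<Sum>c\<in>UNIV. f _ b c" "- v"]
      sum_shift[of "\<lambda>c. f _ _ c" "- z"] by simp
  have "star_count N = (\<Sum>p\<in>UNIV. \<Sum>r\<in>UNIV. \<Sum>t\<in>UNIV. 1 - zc (A p r t) + q * (zc (A p r t) * zc (B p r t)))"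
    unfolding star_count_def A_def B_def
    by (subst sh[of _ "g1 + w - x - y" "g2 + y - x - w" "g3 + x - y - w"]) (simp add: mult.commute[of _ "psiA _ _ _ _"] sum_zc_lin mult.assoc)
  also have "\<dots> = q ^ 3 - (\<Sum>p\<in>UNIV. \<Sum>r\<in>UNIV. \<Sum>t\<in>UNIV. zc (A p r t)) +
      q * (\<Sum>p\<in>UNIV. \<Sum>r\<in>UNIV. \<Sum>t\<in>UNIV. zc (A p r t) * zc (B p r t))"
    by (simp add: sum.distrib sum_subtractf sum_distrib_left[symmetric] q_def power3_eq_cube)
  also have "(\<Sum>p\<in>UNIV. \<Sum>r\<in>UNIV. \<Sum>t\<in>UNIV. zc (A p r t)) = q\<^sup>2"
    unfolding A zc_mult zc_nz[OF P] by (simp add: cone_count)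
  also have "(\<Sum>p\<in>UNIV. \<Sum>r\<in>UNIV. \<Sum>t\<in>UNIV. zc (A p r t) * zc (B p r t)) =
      q * (zc ?D + zc ?E + zc (?D - ?E) + 1 - zc ?D * zc ?E) - 2"
    by (rule cone_det_count[OF P A B]) (simp_all add: algebra_simps)
  finally have n: "star_count N = q ^ 3 - q\<^sup>2 + q * (q * (zc ?D + zc ?E + zc (?D - ?E) + 1 - zc ?D * zc ?E) - 2)" .
  have z: "zc (dm N - t1 N) = zc ?D" "zc (dm N - t2 N) = zc ?E" "zc (t1 N - t2 N) = zc (?D - ?E)"
    using P by (auto simp: zc_def e)
  have "zc ?D * zc ?E = zc ?D * zc (?D - ?E)" "zc ?D * zc (?D - ?E) = zc ?D * zc ?E" by (auto simp: zc_def)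
  then show ?thesis unfolding n star_main_def z zc_nz[OF P] by (simp add: algebra_simps power2_eq_square power3_eq_cube)
qed

definition psi :: "'F \<Rightarrow> 'F \<Rightarrow> 'F \<Rightarrow> 'F \<Rightarrow> 'F \<Rightarrow> 'F \<Rightarrow> 'F \<Rightarrow> 'F \<Rightarrow> 'F \<Rightarrow> 'F \<Rightarrow> 'F \<Rightarrow> 'F \<Rightarrow> 'F \<Rightarrow> 'F \<Rightarrow>
    'F \<Rightarrow> 'F \<Rightarrow> 'F \<Rightarrow> 'F \<Rightarrow> 'F" where
  "psi P G11 G12 G22 G13 G23 G33 F X Y X1 X2 X3 K a b c d =
    d * (P * (a * b + a * c + b * c) + a * (G22 - 2 * G23 + G33) + b * (G11 - 2 * G13 + G33) + c * (G11 - 2 * G12 + G22)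
      + (F + X1 + X3 - 2 * Y - 2 * X - 2 * X2))
    + (P * (a * b * c) + b * c * G11 + a * c * G22 + a * b * G33 + c * F + b * X1 + a * X3 + K)"

text \<open>
  A singular point with \<open>G11 \<noteq> 0\<close>: \<open>psi\<close> is a multiple of the determinant of a symmetric
  two-by-two matrix whose diagonal entries are free.
\<close>

lemma psi_pivot:
  assumes lag: "lag P G11 G12 G22 G13 G23 G33 F X Y X1 X2 X3 K" and P: "P = 0" and G: "G11 \<noteq> 0"
  shows "[(\<Sum>a\<in>UNIV. \<Sum>b\<in>UNIV. \<Sum>c\<in>UNIV. \<Sum>d\<in>UNIV. zc (psi P G11 G12 G22 G13 G23 G33 F X Y X1 X2 X3 K a b c d)) =
    - q\<^sup>2 * (zc (G12 * G13) * zc ((G12 - G11) * (G13 - G11)))] (mod q ^ 3)"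
proof -
  note r = lag[unfolded lag_def]
  \<comment> \<open>For \<open>P = 0\<close> the symmetric matrix of the \<open>G\<close>'s has rank
    one, so with the pivot \<open>G11\<close> all of it is determined by the ratios \<open>u\<close>
    and \<open>v\<close>. Likewise \<open>m\<close>, \<open>n\<close>, \<open>k\<close> determine
    the remaining minors.\<close>
  define u v m n k where g: "u = G12 / G11" "v = G13 / G11" "m = F / G11" "n = X / G11" "k = X1 / G11"
  have e: "G12 = G11 * u" "G13 = G11 * v" "F = G11 * m" "X = G11 * n" "X1 = G11 * k" using G by (simp_all add: g)
  have canc: "s = G11 * t" if "G11 * s = G11 * (G11 * t)" for s t using that G by simp
  have rr: "G11 * G22 = G12 * G12" "G11 * G33 = G13 * G13" "G11 * G23 = G12 * G13" "G11 * Y = G13 * F - G12 * X"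
    "G11 * X2 = G12 * X1 - G13 * X" "G11 * X3 = G12 * X2 + G13 * Y" "G11 * K = X1 * F - X * X"
    using r unfolding P by (simp_all add: algebra_simps)
  have h: "G22 = G11 * (u * u)" "G33 = G11 * (v * v)" "G23 = G11 * (u * v)"
    by (rule canc, simp add: rr e)+
  have h2: "Y = G11 * (v * m - u * n)" "X2 = G11 * (u * k - v * n)"
    by (rule canc, simp only: rr e, simp add: algebra_simps)+
  have h3: "X3 = G11 * (u * u * k - 2 * (u * v * n) + v * v * m)" "K = G11 * (m * k - n * n)"
    by (rule canc, simp only: rr e h2, simp add: algebra_simps)+
  let ?M = "\<lambda>a d. (u * v) * a + ((u - 1) * (v - 1) * d + n)"
  let ?p = "psi P G11 G12 G22 G13 G23 G33 F X Y X1 X2 X3 K"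
  have p: "?p a b c d = G11 * ((b + (u * u * a + (u - 1) * (u - 1) * d + m)) * (c + (v * v * a + (v - 1) * (v - 1) * d + k))
      - ?M a d * ?M a d)" for a b c d
    unfolding psi_def P h h2 h3 e by (simp add: algebra_simps)
  have bc: "(\<Sum>b\<in>UNIV. \<Sum>c\<in>UNIV. zc (?p a b c d)) = q - 1 + q * zc (?M a d)" for a d
  proof -
    have "(\<Sum>b\<in>UNIV. \<Sum>c\<in>UNIV. zc (?p a b c d)) =
      (\<Sum>b\<in>UNIV. \<Sum>c\<in>UNIV. zc ((b + (u * u * a + (u - 1) * (u - 1) * d + m)) * (c + (v * v * a + (v - 1) * (v - 1) * d + k))
        - ?M a d * ?M a d))" unfolding p zc_mult zc_nz[OF G] by simp
    also have "\<dots> = (\<Sum>b\<in>UNIV. \<Sum>c\<in>UNIV. zc (b * c - ?M a d * ?M a d))"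
      unfolding sum_shift[of "\<lambda>c. zc (_ * c - ?M a d * ?M a d)"]
      by (rule sum_shift[of "\<lambda>b. \<Sum>c\<in>UNIV. zc (b * c - ?M a d * ?M a d)"])
    also have "\<dots> = q - 1 + q * zc (?M a d * ?M a d)" by (rule sum_zc_hyperbola)
    finally show ?thesis by (simp only: zc_mult zc_sq add_diff_cancel_right')
  qed
  have sw: "(\<Sum>b\<in>UNIV. \<Sum>c\<in>UNIV. \<Sum>d\<in>UNIV. f b c d) = (\<Sum>d\<in>UNIV. \<Sum>b\<in>UNIV. \<Sum>c\<in>UNIV. f b c d)"
    for f :: "'F \<Rightarrow> 'F \<Rightarrow> 'F \<Rightarrow> int"
  proof -
    have "(\<Sum>b\<in>UNIV. \<Sum>c\<in>UNIV. \<Sum>d\<in>UNIV. f b c d) = (\<Sum>b\<in>UNIV. \<Sum>d\<in>UNIV. \<Sum>c\<in>UNIV. f b c d)"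
      by (rule sum.cong[OF refl]) (rule sum.swap)
    also have "\<dots> = (\<Sum>d\<in>UNIV. \<Sum>b\<in>UNIV. \<Sum>c\<in>UNIV. f b c d)" by (rule sum.swap)
    finally show ?thesis .
  qed
  let ?e = "zc (u * v)" and ?f = "zc ((u - 1) * (v - 1))"
  have "(\<Sum>a\<in>UNIV. \<Sum>b\<in>UNIV. \<Sum>c\<in>UNIV. \<Sum>d\<in>UNIV. zc (?p a b c d)) = (\<Sum>a\<in>(UNIV :: 'F set). \<Sum>d\<in>(UNIV :: 'F set). q - 1 + q * zc (?M a d))"
    unfolding sw bc ..
  also have "\<dots> = (\<Sum>d\<in>(UNIV :: 'F set). \<Sum>a\<in>(UNIV :: 'F set). q - 1 + q * zc (?M a d))" by (rule sum.swap)
  also have "\<dots> = (\<Sum>d\<in>(UNIV :: 'F set). q * (q - 1) + q * (1 - ?e + q * ?e * zc ((u - 1) * (v - 1) * d + n)))"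
    by (simp only: sum.distrib sum_distrib_left[symmetric] sum_zc_lin sum_const)
  also have "\<dots> = q * (q * (q - 1)) + q * (q - q * ?e + q * ?e * (1 - ?f + q * ?f * zc n))"
    by (simp only: sum.distrib sum_subtractf sum_distrib_left[symmetric] sum_zc_lin sum_const mult_1_right)
      (simp add: algebra_simps)
  also have "\<dots> = - q\<^sup>2 * (?e * ?f) + q ^ 3 * (1 + ?e * ?f * zc n)"
    by (simp add: algebra_simps power2_eq_square power3_eq_cube)
  finally have *: "(\<Sum>a\<in>UNIV. \<Sum>b\<in>UNIV. \<Sum>c\<in>UNIV. \<Sum>d\<in>UNIV. zc (?p a b c d)) = - q\<^sup>2 * (?e * ?f) + q ^ 3 * (1 + ?e * ?f * zc n)" .
  have z: "?e = zc (G12 * G13)" "?f = zc ((G12 - G11) * (G13 - G11))"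
  proof -
    have "G12 * G13 = G11 * (G11 * (u * v))" "(G12 - G11) * (G13 - G11) = G11 * (G11 * ((u - 1) * (v - 1)))"
      by (simp_all add: e algebra_simps)
    then show "?e = zc (G12 * G13)" "?f = zc ((G12 - G11) * (G13 - G11))"
      by (simp_all add: zc_mult[of G11] zc_nz[OF G] del: mult_eq_0_iff)
  qed
  show ?thesis unfolding * z by (simp add: cong_iff_dvd_diff)
qed

lemma star_count_psi: "star_count N = (\<Sum>a\<in>UNIV. \<Sum>b\<in>UNIV. \<Sum>c\<in>UNIV. \<Sum>d\<in>UNIV.
    zc (psi (pP N) (d1 N + dm N) (dm N) (d2 N + dm N) (t1 N) (t2 N) (om N) (ff N) (ch N) (ps N) (x1 N) (x2 N) (x3 N) (f4 N) a b c d))"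
  unfolding star_count_def psi_def psiA_def psiB_def by (simp add: algebra_simps)

lemma star_singular:
  assumes lag: "net_lag N" and P: "pP N = 0"
  shows "[star_count N = q\<^sup>2 * star_main N] (mod q ^ 3)"
proof -
  obtain G11 G12 G22 G13 G23 G33 F X Y X1 X2 X3 K where g: "d1 N + dm N = G11" "dm N = G12" "d2 N + dm N = G22"
    "t1 N = G13" "t2 N = G23" "om N = G33" "ff N = F" "ch N = X" "ps N = Y" "x1 N = X1" "x2 N = X2" "x3 N = X3" "f4 N = K" by blast
  have d: "d1 N = G11 - G12" "d2 N = G22 - G12" using g by auto
  have l1: "lag 0 G11 G12 G22 G13 G23 G33 F X Y X1 X2 X3 K" using lag unfolding net_lag_def P unfolding g(1,3) unfolding g .
  note r = l1[unfolded lag_def]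
  \<comment> \<open>The relations are symmetric under permutations of \<open>x\<close>,
    \<open>y\<close>, \<open>w\<close>; any vertex with nonzero diagonal entry can therefore take
    the place of the pivot.\<close>
  have l2: "lag 0 G22 G12 G11 G23 G13 G33 F Y X X3 X2 X1 K" and l3: "lag 0 G33 G23 G22 G13 G12 G11 X3 X2 Y X1 X F K"
    using r unfolding lag_def by (auto simp: algebra_simps)
  let ?n = "\<Sum>a\<in>UNIV. \<Sum>b\<in>UNIV. \<Sum>c\<in>UNIV. \<Sum>d\<in>UNIV. zc (psi 0 G11 G12 G22 G13 G23 G33 F X Y X1 X2 X3 K a b c d)"
  have n: "star_count N = ?n" unfolding star_count_psi P unfolding g(1,3) unfolding g ..
  have M: "star_main N = zc (G12 - G13) + zc (G12 - G23) + zc (G13 - G23) - zc (G12 - G13) * zc (G13 - G23)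
    + (zc (G11 - G12 + (G22 - G12)) + zc G11 - zc (G22 - G12 - G23 + G13) - zc G23 - zc (G11 - G13) - zc (G11 - G12))"
    unfolding star_main_def d using g P by simp
  have sqz: "x = 0" if "x * x = 0" for x :: 'F using that by simp
  \<comment> \<open>The first nonzero diagonal entry is the pivot. As all two-by-two minors of the
    matrix vanish, a zero on the diagonal makes its entire row zero.\<close>
  consider (1) "G11 \<noteq> 0" | (2) "G11 = 0" "G22 \<noteq> 0" | (3) "G11 = 0" "G22 = 0" "G33 \<noteq> 0" | (4) "G11 = 0" "G22 = 0" "G33 = 0" by blast
  then show ?thesis
  proof cases
    case 1
    define u v where uv: "u = G12 / G11" "v = G13 / G11"
    have e: "G12 = G11 * u" "G13 = G11 * v" using 1 by (simp_all add: uv)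
    have canc: "s = G11 * t" if "G11 * s = G11 * (G11 * t)" for s t using that 1 by simp
    have rr: "G11 * G22 = G12 * G12" "G11 * G23 = G12 * G13" using r by simp_all
    have h: "G22 = G11 * (u * u)" "G23 = G11 * (u * v)"
      by (rule canc, simp add: rr e)+
    have f: "G12 - G13 = G11 * (u - v)" "G12 - G23 = G11 * (u * (1 - v))" "G13 - G23 = G11 * (v * (1 - u))"
      "G22 - G12 - G23 + G13 = G11 * ((u - v) * (u - 1))"
      "G11 - G13 = G11 * (1 - v)" "G11 - G12 = G11 * (1 - u)" "G12 * G13 = G11 * (G11 * (u * v))"
      "(G12 - G11) * (G13 - G11) = G11 * (G11 * ((1 - u) * (1 - v)))"
      unfolding h e by (simp_all add: algebra_simps)
    have f2: "G11 * (1 - u) + (G22 - G12) = G11 * ((1 - u) * (1 - u))"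
      unfolding h e by (simp add: algebra_simps)
    \<comment> \<open>After factoring out \<open>G11\<close>, both sides depend only on which of
      \<open>u\<close>, \<open>v\<close> are 0 or 1 and on whether they coincide.\<close>
    have "star_main N = - (zc (G12 * G13) * zc ((G12 - G11) * (G13 - G11)))"
      unfolding M f unfolding f2 unfolding h zc_mult[of G11] zc_nz[OF 1] using 1
      by (cases "u = 0"; cases "v = 0"; cases "u = 1"; cases "v = 1"; cases "u = v") (simp_all add: zc_mult zc_nz)
    then show ?thesis using psi_pivot[OF l1 refl 1] unfolding n by simp
  next
    case 2
    have o: "G12 = 0" "G13 = 0" using r 2 by (auto intro: sqz)
    have "?n = (\<Sum>a\<in>UNIV. \<Sum>b\<in>UNIV. \<Sum>c\<in>UNIV. \<Sum>d\<in>UNIV. zc (psi 0 G22 G12 G11 G23 G13 G33 F Y X X3 X2 X1 K a b c d))"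
      by (subst sum.swap) (simp add: psi_def algebra_simps)
    moreover have "star_main N = - (zc (G12 * G23) * zc ((G12 - G22) * (G23 - G22)))"
      unfolding M o 2(1) using 2(2) zc_swap[of G22 G23] by (simp add: zc_mult zc_nz)
    ultimately show ?thesis using psi_pivot[OF l2 refl 2(2)] unfolding n by simp
  next
    case 3
    have o: "G12 = 0" "G13 = 0" "G23 = 0" using r 3 by (auto intro: sqz)
    have "?n = (\<Sum>c\<in>UNIV. \<Sum>b\<in>UNIV. \<Sum>a\<in>UNIV. \<Sum>d\<in>UNIV. zc (psi 0 G11 G12 G22 G13 G23 G33 F X Y X1 X2 X3 K a b c d))"
      (is "?n = ?m")
    proof -
      have "?n = (\<Sum>a\<in>UNIV. \<Sum>c\<in>UNIV. \<Sum>b\<in>UNIV. \<Sum>d\<in>UNIV. zc (psi 0 G11 G12 G22 G13 G23 G33 F X Y X1 X2 X3 K a b c d))"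
        by (rule sum.cong[OF refl]) (rule sum.swap)
      also have "\<dots> = (\<Sum>c\<in>UNIV. \<Sum>a\<in>UNIV. \<Sum>b\<in>UNIV. \<Sum>d\<in>UNIV. zc (psi 0 G11 G12 G22 G13 G23 G33 F X Y X1 X2 X3 K a b c d))"
        by (rule sum.swap)
      also have "\<dots> = ?m" by (rule sum.cong[OF refl]) (rule sum.swap)
      finally show ?thesis .
    qed
    also have "\<dots> = (\<Sum>a\<in>UNIV. \<Sum>b\<in>UNIV. \<Sum>c\<in>UNIV. \<Sum>d\<in>UNIV. zc (psi 0 G33 G23 G22 G13 G12 G11 X3 X2 Y X1 X F K a b c d))"
      by (simp add: psi_def algebra_simps)
    finally have "?n = \<dots>" .
    moreover have "star_main N = - (zc (G23 * G13) * zc ((G23 - G33) * (G13 - G33)))"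
      unfolding M o 3(1,2) using 3(3) by (simp add: zc_mult zc_nz)
    ultimately show ?thesis using psi_pivot[OF l3 refl 3(3)] unfolding n by simp
  next
    case 4
    have o: "G12 = 0" "G13 = 0" "G23 = 0" using r 4 by (auto intro: sqz)
    have "star_main N = 0" unfolding M o 4 by simp
    \<comment> \<open>With the whole matrix zero, \<open>psi\<close> is affine linear in the four
      star variables; the number of its zeros is 0, \<open>q ^ 3\<close> or
      \<open>q ^ 4\<close>.\<close>
    moreover have "q ^ 3 dvd ?n"
    proof -
      have sl: "(\<Sum>x\<in>UNIV. zc (u * x + v)) = 1 - zc u + q * zc u * zc v" for u v :: 'F by (rule sum_zc_lin)
      let ?T = "F + X1 + X3 - 2 * Y - 2 * X - 2 * X2"
      have "?n = (\<Sum>a\<in>UNIV. \<Sum>b\<in>UNIV. \<Sum>c\<in>UNIV. \<Sum>d\<in>UNIV. zc (?T * d + (F * c + (X1 * b + (X3 * a + K)))))"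
        unfolding psi_def o 4 by (simp add: algebra_simps)
      also have "\<dots> = q ^ 3 * (1 - zc ?T) + q ^ 3 * zc ?T * (1 - zc F) + q ^ 3 * zc ?T * zc F * (1 - zc X1)
          + q ^ 3 * zc ?T * zc F * zc X1 * (1 - zc X3 + q * zc X3 * zc K)"
        by (simp only: sl sum.distrib sum_subtractf sum_distrib_left[symmetric] sum_const mult_1_right mult.assoc)
          (simp add: algebra_simps power3_eq_cube)
      finally show ?thesis by (simp only: distrib_left[symmetric] mult.assoc dvd_triv_left dvd_add)
    qed
    ultimately show ?thesis unfolding n by (simp add: cong_iff_dvd_diff)
  qed
qed

theorem star_count_cong:
  assumes "net_lag N"
  shows "[star_count N = q\<^sup>2 * star_main N - 2 * q * (1 - zc (pP N))] (mod q ^ 3)"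
proof (cases "pP N = 0")
  case True
  then show ?thesis using star_singular[OF assms True] by simp
next
  case False
  then show ?thesis using star_regular[OF assms False] by (simp add: cong_iff_dvd_diff zc_nz)
qed

end

section \<open>Point counts of strips modulo \<open>q\<close>\<close>

context
  fixes q :: int and ty :: "'F::{field,finite} itself"
  defines "q \<equiv> int CARD('F)"
begin

private lemma sum_lin: "(\<Sum>x\<in>UNIV. zc (u * x + v)) = 1 - zc u + q * zc u * zc (v :: 'F)"
  unfolding q_def by (rule sum_zc_lin)

text \<open>The counting form of elimination: unless both leading coefficients vanish, a common zero
  exists exactly if the resultant vanishes, and then it is unique. If both vanish, the resultant
  does too, which the second term corrects up to a multiple of \<open>q\<close>.\<close>

lemma sum_zc_res:
  "(\<Sum>b\<in>UNIV. zc (f1 * b + f0) * zc (g1 * b + g0)) =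
    zc (f1 * g0 - f0 * g1) - zc f1 * zc g1 + q * zc f1 * zc g1 * zc f0 * zc (g0 :: 'F)"
proof (cases "f1 = 0")
  case True
  have "(\<Sum>b\<in>UNIV. zc (f1 * b + f0) * zc (g1 * b + g0)) = zc f0 * (\<Sum>b\<in>UNIV. zc (g1 * b + g0))"
    by (simp add: True sum_distrib_left)
  then show ?thesis unfolding sum_lin by (simp add: True zc_mult zc_def)
next
  case False
  have "zc (f1 * b + f0) = zc (b - (- f0 / f1))" for b
  proof -
    have "f1 * b + f0 = f1 * (b - (- f0 / f1))" using False by (simp add: algebra_simps)
    then show ?thesis by (simp only: zc_mult zc_nz[OF False])
  qed
  then have "(\<Sum>b\<in>UNIV. zc (f1 * b + f0) * zc (g1 * b + g0)) = zc (g1 * (- f0 / f1) + g0)"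
    using sum_zc_only[of "- f0 / f1" "\<lambda>b. zc (g1 * b + g0)"] by simp
  also have "f1 * (g1 * (- f0 / f1) + g0) = f1 * g0 - f0 * g1" using False by (simp add: algebra_simps)
  then have "zc (g1 * (- f0 / f1) + g0) = zc (f1 * g0 - f0 * g1)"
    using zc_mult[of f1 "g1 * (- f0 / f1) + g0"] zc_nz[OF False] by simp
  finally show ?thesis by (simp add: zc_nz[OF False])
qed

private lemma lin_cong: "[(\<Sum>x\<in>UNIV. zc (u * x + v)) = 1 - zc (u :: 'F)] (mod q)"
  unfolding sum_lin by (simp add: cong_iff_dvd_diff)

private lemma res_cong: "[(\<Sum>b\<in>UNIV. zc (f1 * b + f0) * zc (g1 * b + g0)) = zc (f1 * g0 - f0 * g1) - zc f1 * zc (g1 :: 'F)] (mod q)"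
  unfolding sum_zc_res by (simp add: cong_iff_dvd_diff)

private lemma const_cong: "[(\<Sum>x\<in>(UNIV :: 'F set). c) = 0] (mod q)"
  by (simp add: cong_iff_dvd_diff q_def)

private lemma head_sum: "(\<Sum>a\<in>UNIV. zc (a :: 'F) * f a) = f 0"
  using sum_zc_only[of 0 f] by simp

private lemmas cong_ring = cong_add cong_diff cong_mult cong_refl cong_sum

text \<open>The zero set of the first factor is the union of \<open>a = 0\<close>, where the second
  polynomial becomes \<open>b * m + n\<close>, and \<open>b * u + v = 0\<close>, where it is linear
  in \<open>a\<close>. Inclusion and exclusion leave one resultant in \<open>b\<close>.\<close>

lemma sum_product_head:
  fixes u v e g m n :: 'F
  shows "[(\<Sum>a\<in>UNIV. \<Sum>b\<in>UNIV. zc (a * (b * u + v)) * zc (a * (b * u + v) * e + a * g + b * m + n)) =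
    1 - zc m + (1 - zc u) * (1 - zc g) - (zc (u * n - v * m) - zc u * zc m)] (mod q)"
proof -
  have "zc (a * (b * u + v)) * zc (a * (b * u + v) * e + a * g + b * m + n) =
      zc a * zc (m * b + n) + zc (u * b + v) * zc (g * a + (b * m + n)) - zc a * (zc (u * b + v) * zc (m * b + n))" for a b
    by (cases "a = 0"; cases "b * u + v = 0") (auto simp: zc_def mult.commute add.assoc)
  then have "(\<Sum>a\<in>UNIV. \<Sum>b\<in>UNIV. zc (a * (b * u + v)) * zc (a * (b * u + v) * e + a * g + b * m + n)) =
      (\<Sum>a\<in>UNIV. zc (a :: 'F) * (\<Sum>b\<in>UNIV. zc (m * b + n))) +
      (\<Sum>a\<in>UNIV. \<Sum>b\<in>UNIV. zc (u * b + v) * zc (g * a + (b * m + n))) -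
      (\<Sum>a\<in>UNIV. zc (a :: 'F) * (\<Sum>b\<in>UNIV. zc (u * b + v) * zc (m * b + n)))"
    by (simp only: sum.distrib sum_subtractf sum_distrib_left)
  also have "(\<Sum>a\<in>UNIV. \<Sum>b\<in>UNIV. zc (u * b + v) * zc (g * a + (b * m + n))) =
      (\<Sum>b\<in>UNIV. zc (u * b + v) * (\<Sum>a\<in>UNIV. zc (g * a + (b * m + n))))"
    by (subst sum.swap) (simp only: sum_distrib_left)
  finally have s: "(\<Sum>a\<in>UNIV. \<Sum>b\<in>UNIV. zc (a * (b * u + v)) * zc (a * (b * u + v) * e + a * g + b * m + n)) =
      (\<Sum>b\<in>UNIV. zc (m * b + n)) + (\<Sum>b\<in>UNIV. zc (u * b + v) * (\<Sum>a\<in>UNIV. zc (g * a + (b * m + n))))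
      - (\<Sum>b\<in>UNIV. zc (u * b + v) * zc (m * b + n))"
    by (simp only: head_sum)
  have "[(\<Sum>b\<in>UNIV. zc (u * b + v) * (\<Sum>a\<in>UNIV. zc (g * a + (b * m + n)))) = (\<Sum>b\<in>UNIV. zc (u * b + v) * (1 - zc g))] (mod q)"
    by (intro cong_ring lin_cong)
  moreover have "[(\<Sum>b\<in>UNIV. zc (u * b + v) * (1 - zc g)) = (1 - zc u) * (1 - zc g)] (mod q)"
    unfolding sum_distrib_right[symmetric] by (intro cong_ring lin_cong)
  ultimately have "[(\<Sum>b\<in>UNIV. zc (u * b + v) * (\<Sum>a\<in>UNIV. zc (g * a + (b * m + n)))) = (1 - zc u) * (1 - zc g)] (mod q)"
    by (rule cong_trans)
  then show ?thesis unfolding s using res_cong[of u v m n] by (intro cong_ring lin_cong)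
qed

lemma sum_product_linear:
  fixes \<alpha>1 \<alpha>2 \<beta>1 \<beta>2 :: 'F
  shows "[(\<Sum>a\<in>UNIV. zc ((\<alpha>1 * a + \<beta>1) * (\<alpha>2 * a + \<beta>2))) =
    (1 - zc \<alpha>1) + (1 - zc \<alpha>2) - (zc (\<alpha>1 * \<beta>2 - \<beta>1 * \<alpha>2) - zc \<alpha>1 * zc \<alpha>2)] (mod q)"
  unfolding zc_mult sum.distrib sum_subtractf by (intro cong_diff cong_add lin_cong res_cong)

definition S :: "nat \<Rightarrow> ('F net \<Rightarrow> int) \<Rightarrow> int" where
  "S k \<phi> = (\<Sum>(L, c)\<in>{L. length L = k} \<times> UNIV. \<phi> (strip L c))"

lemma finite_lists [simp]: "finite {L :: ('F \<times> 'F) list. length L = k}"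
  using finite_lists_length_eq[of "UNIV :: ('F \<times> 'F) set" k] by simp

lemma S_0: "S 0 \<phi> = (\<Sum>c\<in>UNIV. \<phi> (strip_end c))"
proof -
  have "{L :: ('F \<times> 'F) list. length L = 0} \<times> (UNIV :: 'F set) = Pair [] ` UNIV" by auto
  then show ?thesis unfolding S_def by (simp only:) (simp add: sum.reindex inj_on_def)
qed

lemma S_Suc: "S (Suc k) \<phi> = S k (\<lambda>N. \<Sum>a\<in>UNIV. \<Sum>b\<in>UNIV. \<phi> (strip_step a b N))"
proof -
  let ?f = "\<lambda>(p :: 'F \<times> 'F, L, c :: 'F). (p # L, c)"
  have im: "{L. length L = Suc k} \<times> UNIV = ?f ` (UNIV \<times> {L. length L = k} \<times> UNIV)"
    by (auto simp: length_Suc_conv image_iff)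
  have inj: "inj_on ?f (UNIV \<times> {L. length L = k} \<times> UNIV)" by (auto simp: inj_on_def)
  have "S (Suc k) \<phi> = (\<Sum>p\<in>UNIV. \<Sum>x\<in>{L. length L = k} \<times> UNIV. \<phi> (strip (p # fst x) (snd x)))"
    unfolding S_def im sum.reindex[OF inj] sum.cartesian_product by (intro sum.cong) auto
  also have "\<dots> = (\<Sum>x\<in>{L. length L = k} \<times> UNIV. \<Sum>p\<in>UNIV. \<phi> (strip (p # fst x) (snd x)))"
    by (rule sum.swap)
  also have "\<dots> = (\<Sum>x\<in>{L. length L = k} \<times> UNIV. \<Sum>a\<in>UNIV. \<Sum>b\<in>UNIV. \<phi> (strip_step a b (strip (fst x) (snd x))))"
    unfolding sum.cartesian_product by (intro sum.cong) auto
  finally show ?thesis by (simp add: S_def case_prod_beta)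
qed

lemma S_cong:
  assumes "\<And>N. net_lag N \<Longrightarrow> [\<phi> N = \<psi> N] (mod m)"
  shows "[S k \<phi> = S k \<psi>] (mod m)"
  unfolding S_def by (intro cong_sum) (auto intro: assms net_lag_strip)

lemma S_add: "S k (\<lambda>N. \<phi> N + \<psi> N) = S k \<phi> + S k \<psi>"
  by (simp add: S_def case_prod_beta sum.distrib)

lemma S_diff: "S k (\<lambda>N. \<phi> N - \<psi> N) = S k \<phi> - S k \<psi>"
  by (simp add: S_def case_prod_beta sum_subtractf)

lemma S_cmult: "S k (\<lambda>N. c * \<phi> N) = c * S k \<phi>"
  by (simp add: S_def case_prod_beta sum_distrib_left)

lemma S_const: "S k (\<lambda>N. c) = c * q ^ (2 * k + 1)"
proof (induction k arbitrary: c)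
  case 0
  then show ?case by (simp add: S_0 q_def)
next
  case (Suc k)
  have "S (Suc k) (\<lambda>N. c) = S k (\<lambda>N. q * q * c)" by (simp add: S_Suc q_def mult.assoc)
  then show ?case using Suc[of "q * q * c"] by (simp add: algebra_simps)
qed

text \<open>Reversal is an involution on the values of the edge variables of strips with
  \<open>k\<close> triangles, so it only reindexes the sum.\<close>

lemma S_mir:
  assumes "\<And>L c M e. mir L c = (M, e) \<Longrightarrow> \<phi> (strip M e) = \<psi> (strip L c)"
  shows "S k \<phi> = S k \<psi>"
proof -
  have snoc: "mir (M @ [(e, b)]) a = (case mir M e of (L, c) \<Rightarrow> ((a, b) # L, c))" for M :: "('F \<times> 'F) list" and e b a
    by (induction M e rule: mir.induct) (auto split: prod.splits)
  have inv: "mir (fst (mir L c)) (snd (mir L c)) = (L, c)" for L :: "('F \<times> 'F) list" and c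
  proof (induction L c rule: mir.induct)
    case (2 a b L c)
    then show ?case by (cases "mir L c") (simp add: snoc)
  qed simp
  have len: "length (fst (mir L c)) = length L" for L :: "('F \<times> 'F) list" and c
    using length_mir[of L c] by (cases "mir L c") auto
  have m: "\<psi> (strip (fst (mir L c)) (snd (mir L c))) = \<phi> (strip L c)" for L c
    using assms[of "fst (mir L c)" "snd (mir L c)" L c] inv by simp
  show ?thesis
    unfolding S_def
    by (rule sum.reindex_bij_witness[where i = "\<lambda>(L, c). mir L c" and j = "\<lambda>(L, c). mir L c"])
      (auto simp: inv case_prod_beta len mem_Times_iff m)
qed

definition val :: "('F net \<Rightarrow> 'F) \<Rightarrow> nat \<Rightarrow> int \<Rightarrow> bool" where
  "val X k n \<longleftrightarrow> [S k (\<lambda>N. zc (X N)) = n] (mod q)"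

definition val2 :: "('F net \<Rightarrow> 'F) \<Rightarrow> ('F net \<Rightarrow> 'F) \<Rightarrow> nat \<Rightarrow> int \<Rightarrow> bool" where
  "val2 X Y k n \<longleftrightarrow> [S k (\<lambda>N. zc (X N) * zc (Y N)) = n] (mod q)"

lemma val2_same: "val X k n \<Longrightarrow> val2 X X k n"
  by (simp add: val_def val2_def)

lemma val2_sym: "val2 X Y k n \<Longrightarrow> val2 Y X k n"
  by (simp add: val2_def mult.commute)

lemma val2_zero: "val X k n \<Longrightarrow> val2 (\<lambda>N. 0) X k n"
  by (simp add: val_def val2_def)

lemma S_const_cong: "[S k (\<lambda>N. c) = 0] (mod q)"
  by (simp add: S_const cong_iff_dvd_diff)

lemma val_zero: "val (\<lambda>N. 0) k 0"
  using S_const_cong[of k 1] by (simp add: val_def)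

private lemmas S_lin = S_add S_diff S_cmult
private lemmas cong_S = cong_add cong_diff cong_mult cong_refl S_const_cong

text \<open>For a first minor that acquires the factor \<open>a\<close>, such as \<open>d1\<close>,
  \<open>nS\<close> or \<open>ch\<close>. The resultant left over by \<open>sum_product_head\<close>
  is supposed to factor as \<open>A * B\<close> up to sign, so its zeros are again counts for
  shorter strips.\<close>

lemma val2_product:
  assumes X: "\<And>N a b. net_lag N \<Longrightarrow> X (strip_step a b N) = a * (b * u N + v N)"
    and Y: "\<And>N a b. net_lag N \<Longrightarrow> Y (strip_step a b N) = a * (b * u N + v N) * e N + a * g N + b * m N + n N"
    and AB: "\<And>N. net_lag N \<Longrightarrow> u N * n N - v N * m N = A N * B N \<or> v N * m N - u N * n N = A N * B N"
    and c: "val u k cu" "val g k cg" "val m k cm" "val A k cA" "val B k cB"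
      "val2 u g k cug" "val2 A B k cAB" "val2 u m k cum"
  shows "val2 X Y (Suc k) (cug - cm - cu - cg - cA - cB + cAB + cum)"
proof -
  have "[(\<Sum>a\<in>UNIV. \<Sum>b\<in>UNIV. zc (X (strip_step a b N)) * zc (Y (strip_step a b N))) =
      2 + zc (u N) * zc (g N) - zc (m N) - zc (u N) - zc (g N) - zc (A N) - zc (B N) + zc (A N) * zc (B N) + zc (u N) * zc (m N)] (mod q)"
    if N: "net_lag N" for N
  proof -
    have "zc (u N * n N - v N * m N) = zc (A N) + zc (B N) - zc (A N) * zc (B N)"
      using AB[OF N] zc_swap[of "u N * n N" "v N * m N"] by (auto simp: zc_mult)
    then have "2 + zc (u N) * zc (g N) - zc (m N) - zc (u N) - zc (g N) - zc (A N) - zc (B N) + zc (A N) * zc (B N) + zc (u N) * zc (m N) =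
        1 - zc (m N) + (1 - zc (u N)) * (1 - zc (g N)) - (zc (u N * n N - v N * m N) - zc (u N) * zc (m N))"
      by (simp add: algebra_simps)
    then show ?thesis
      unfolding X[OF N] Y[OF N] by (simp only: sum_product_head)
  qed
  then have "[S (Suc k) (\<lambda>N. zc (X N) * zc (Y N)) =
      S k (\<lambda>N. 2 + zc (u N) * zc (g N) - zc (m N) - zc (u N) - zc (g N) - zc (A N) - zc (B N) + zc (A N) * zc (B N) + zc (u N) * zc (m N))] (mod q)"
    unfolding S_Suc by (rule S_cong)
  also have "[S k (\<lambda>N. 2 + zc (u N) * zc (g N) - zc (m N) - zc (u N) - zc (g N) - zc (A N) - zc (B N) + zc (A N) * zc (B N) + zc (u N) * zc (m N))
      = 0 + cug - cm - cu - cg - cA - cB + cAB + cum] (mod q)"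
    unfolding S_lin by (intro cong_S c[unfolded val_def val2_def])
  finally show ?thesis by (simp add: val2_def)
qed

text \<open>For two minors that are both linear in \<open>b\<close>. The indicator of vanishing
  leading coefficients is a \<open>\<kappa>\<close> without \<open>a\<close>, so summing it over
  \<open>a\<close> gives a multiple of \<open>q\<close>. The resultant is a product of two linear
  functions of \<open>a\<close>, which is counted by one more resultant.\<close>

lemma val2_resultant:
  assumes X: "\<And>N a b. net_lag N \<Longrightarrow> X (strip_step a b N) = p1 N a * b + p0 N a"
    and Y: "\<And>N a b. net_lag N \<Longrightarrow> Y (strip_step a b N) = r1 N a * b + r0 N a"
    and \<kappa>: "\<And>N a. zc (p1 N a) * zc (r1 N a) = \<kappa> N"
    and R: "\<And>N a. net_lag N \<Longrightarrow> p1 N a * r0 N a - p0 N a * r1 N a = - ((\<alpha>1 N * a + \<beta>1 N) * (\<alpha>2 N * a + \<beta>2 N))"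
    and AB: "\<And>N. net_lag N \<Longrightarrow> \<alpha>1 N * \<beta>2 N - \<beta>1 N * \<alpha>2 N = A N * B N \<or> \<beta>1 N * \<alpha>2 N - \<alpha>1 N * \<beta>2 N = A N * B N"
    and c: "val \<alpha>1 k ca" "val \<alpha>2 k cb" "val A k cA" "val B k cB" "val2 A B k cAB" "val2 \<alpha>1 \<alpha>2 k c12"
  shows "val2 X Y (Suc k) (cAB + c12 - ca - cb - cA - cB)"
proof -
  have "[(\<Sum>a\<in>UNIV. \<Sum>b\<in>UNIV. zc (X (strip_step a b N)) * zc (Y (strip_step a b N))) =
      2 + zc (A N) * zc (B N) + zc (\<alpha>1 N) * zc (\<alpha>2 N) - zc (\<alpha>1 N) - zc (\<alpha>2 N) - zc (A N) - zc (B N)] (mod q)"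
    if N: "net_lag N" for N
  proof -
    have "[(\<Sum>a\<in>UNIV. \<Sum>b\<in>UNIV. zc (X (strip_step a b N)) * zc (Y (strip_step a b N))) =
        (\<Sum>a\<in>UNIV. zc (p1 N a * r0 N a - p0 N a * r1 N a) - zc (p1 N a) * zc (r1 N a))] (mod q)"
      unfolding X[OF N] Y[OF N] by (intro cong_sum res_cong)
    also have "(\<Sum>a\<in>UNIV. zc (p1 N a * r0 N a - p0 N a * r1 N a) - zc (p1 N a) * zc (r1 N a)) =
        (\<Sum>a\<in>UNIV. zc ((\<alpha>1 N * a + \<beta>1 N) * (\<alpha>2 N * a + \<beta>2 N))) - (\<Sum>a\<in>(UNIV :: 'F set). \<kappa> N)"
      unfolding R[OF N] \<kappa> zc_minus sum_subtractf ..
    also have "[\<dots> = (1 - zc (\<alpha>1 N)) + (1 - zc (\<alpha>2 N)) - (zc (\<alpha>1 N * \<beta>2 N - \<beta>1 N * \<alpha>2 N) - zc (\<alpha>1 N) * zc (\<alpha>2 N)) - 0] (mod q)"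
      by (intro cong_diff[OF sum_product_linear const_cong])
    also have "zc (\<alpha>1 N * \<beta>2 N - \<beta>1 N * \<alpha>2 N) = zc (A N) + zc (B N) - zc (A N) * zc (B N)"
      using AB[OF N] zc_swap[of "\<alpha>1 N * \<beta>2 N" "\<beta>1 N * \<alpha>2 N"] by (auto simp: zc_mult)
    finally show ?thesis by (simp add: algebra_simps)
  qed
  then have "[S (Suc k) (\<lambda>N. zc (X N) * zc (Y N)) =
      S k (\<lambda>N. 2 + zc (A N) * zc (B N) + zc (\<alpha>1 N) * zc (\<alpha>2 N) - zc (\<alpha>1 N) - zc (\<alpha>2 N) - zc (A N) - zc (B N))] (mod q)"
    unfolding S_Suc by (rule S_cong)
  also have "[S k (\<lambda>N. 2 + zc (A N) * zc (B N) + zc (\<alpha>1 N) * zc (\<alpha>2 N) - zc (\<alpha>1 N) - zc (\<alpha>2 N) - zc (A N) - zc (B N))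
      = 0 + cAB + c12 - ca - cb - cA - cB] (mod q)"
    unfolding S_lin by (intro cong_S c[unfolded val_def val2_def])
  finally show ?thesis by (simp add: val2_def)
qed

text \<open>A variant for a first polynomial that is \<open>a\<close> times something independent of
  \<open>b\<close>: over \<open>v = 0\<close> both variables remain free, so the leading coefficient
  \<open>p\<close> of the second in both enters.\<close>

lemma val2_bilinear:
  assumes X: "\<And>N a b. net_lag N \<Longrightarrow> X (strip_step a b N) = - (a * v N)"
    and Y: "\<And>N a b. net_lag N \<Longrightarrow> Y (strip_step a b N) = (p N * a + m N) * b + (a * g N + n N)"
    and c: "val v k cv" "val m k cm" "val2 v p k cvp" "val2 v m k cvm"
  shows "val2 X Y (Suc k) (cvp + cvm - cm - 2 * cv)"
proof -
  have "[(\<Sum>a\<in>UNIV. \<Sum>b\<in>UNIV. zc (X (strip_step a b N)) * zc (Y (strip_step a b N))) =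
      1 + zc (v N) * zc (p N) + zc (v N) * zc (m N) - zc (m N) - 2 * zc (v N)] (mod q)"
    if N: "net_lag N" for N
  proof -
    let ?h = "\<lambda>a. \<Sum>b\<in>UNIV. zc ((p N * a + m N) * b + (a * g N + n N))"
    have e: "(\<Sum>a\<in>UNIV. \<Sum>b\<in>UNIV. zc (X (strip_step a b N)) * zc (Y (strip_step a b N))) =
        ?h 0 + zc (v N) * (\<Sum>a\<in>UNIV. ?h a) - zc (v N) * ?h 0"
    proof -
      have "(\<Sum>a\<in>UNIV. \<Sum>b\<in>UNIV. zc (X (strip_step a b N)) * zc (Y (strip_step a b N))) =
          (\<Sum>a\<in>UNIV. zc (a :: 'F) * ?h a) + zc (v N) * (\<Sum>a\<in>UNIV. ?h a) - zc (v N) * (\<Sum>a\<in>UNIV. zc a * ?h a)"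
        unfolding X[OF N] Y[OF N] zc_minus zc_mult[of _ "v N"] sum_distrib_left sum.distrib[symmetric] sum_subtractf[symmetric]
        by (simp add: algebra_simps)
      then show ?thesis unfolding head_sum .
    qed
    have "[?h 0 = 1 - zc (m N)] (mod q)" using lin_cong[of "m N" "n N"] by simp
    then have c1: "[?h 0 + zc (v N) * (\<Sum>a\<in>UNIV. ?h a) - zc (v N) * ?h 0 =
        (1 - zc (m N)) + zc (v N) * (\<Sum>a\<in>UNIV. 1 - zc (p N * a + m N)) - zc (v N) * (1 - zc (m N))] (mod q)"
      by (intro cong_ring lin_cong)
    have c2: "[(1 - zc (m N)) + zc (v N) * (\<Sum>a\<in>UNIV. 1 - zc (p N * a + m N)) - zc (v N) * (1 - zc (m N)) =
        (1 - zc (m N)) + zc (v N) * (0 - (1 - zc (p N))) - zc (v N) * (1 - zc (m N))] (mod q)"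
      unfolding sum_subtractf by (intro cong_add cong_diff cong_mult cong_refl lin_cong const_cong)
    show ?thesis using cong_trans[OF c1 c2] unfolding e by (simp add: algebra_simps)
  qed
  then have "[S (Suc k) (\<lambda>N. zc (X N) * zc (Y N)) =
      S k (\<lambda>N. 1 + zc (v N) * zc (p N) + zc (v N) * zc (m N) - zc (m N) - 2 * zc (v N))] (mod q)"
    unfolding S_Suc by (rule S_cong)
  also have "[S k (\<lambda>N. 1 + zc (v N) * zc (p N) + zc (v N) * zc (m N) - zc (m N) - 2 * zc (v N))
      = 0 + cvp + cvm - cm - 2 * cv] (mod q)"
    unfolding S_lin by (intro cong_S c[unfolded val_def val2_def])
  finally show ?thesis by (simp add: val2_def)
qed

lemma val_product:
  assumes X: "\<And>N a b. net_lag N \<Longrightarrow> X (strip_step a b N) = a * (b * u N + v N)" and u: "val u k cu"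
  shows "val X (Suc k) cu"
proof -
  have "val2 X (\<lambda>N. 0) (Suc k) (cu - 0 - cu - 0 - 0 - 0 + 0 + cu)"
    by (rule val2_product[where e = "\<lambda>N. 0" and g = "\<lambda>N. 0" and m = "\<lambda>N. 0" and n = "\<lambda>N. 0" and A = "\<lambda>N. 0" and B = "\<lambda>N. 0",
        OF X]) (use u val2_sym[OF val2_zero[OF u]] val2_zero[OF val_zero] in \<open>simp_all add: val_zero\<close>)
  then show ?thesis by (simp add: val_def val2_def)
qed

lemma val_linear:
  assumes X: "\<And>N a b. net_lag N \<Longrightarrow> X (strip_step a b N) = (p N * a + m N) * b + f N a" and c: "val p k cp"
  shows "val X (Suc k) cp"
proof -
  have "[(\<Sum>a\<in>UNIV. \<Sum>b\<in>UNIV. zc (X (strip_step a b N))) = zc (p N) - 1] (mod q)" if N: "net_lag N" for N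
  proof -
    have "[(\<Sum>a\<in>UNIV. \<Sum>b\<in>UNIV. zc (X (strip_step a b N))) = (\<Sum>a\<in>UNIV. 1 - zc (p N * a + m N))] (mod q)"
      unfolding X[OF N] by (intro cong_sum lin_cong)
    also have "[(\<Sum>a\<in>UNIV. 1 - zc (p N * a + m N)) = 0 - (1 - zc (p N))] (mod q)"
      unfolding sum_subtractf by (intro cong_diff lin_cong const_cong)
    finally show ?thesis by simp
  qed
  then have "[S (Suc k) (\<lambda>N. zc (X N)) = S k (\<lambda>N. zc (p N) - 1)] (mod q)"
    unfolding S_Suc by (rule S_cong)
  also have "[S k (\<lambda>N. zc (p N) - 1) = cp - 0] (mod q)"
    unfolding S_lin by (intro cong_S c[unfolded val_def])
  finally show ?thesis by (simp add: val_def)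
qed

text \<open>Every value of \<open>a + b\<close> is taken \<open>q\<close> times.\<close>

lemma S_sum_head:
  assumes "\<And>N a b. net_lag N \<Longrightarrow> \<phi> (strip_step a b N) = f N (a + b)"
  shows "[S (Suc k) \<phi> = 0] (mod q)"
proof -
  have "[(\<Sum>a\<in>UNIV. \<Sum>b\<in>UNIV. \<phi> (strip_step a b N)) = 0] (mod q)" if N: "net_lag N" for N
  proof -
    have "(\<Sum>b\<in>UNIV. f N (a + b)) = (\<Sum>b\<in>UNIV. f N b)" for a
      using sum_shift[of "f N" a] by (simp add: add.commute)
    then show ?thesis unfolding assms[OF N] by (simp add: cong_iff_dvd_diff q_def)
  qed
  then have "[S (Suc k) \<phi> = S k (\<lambda>N. 0)] (mod q)" unfolding S_Suc by (rule S_cong)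
  then show ?thesis by (simp add: S_const)
qed

end

section \<open>The counts for all pairs of minors\<close>

context
  fixes q :: int and ty :: "'F::{field,finite} itself"
  defines "q \<equiv> int CARD('F)"
begin

private abbreviation "vl X k n \<equiv> val (X :: 'F net \<Rightarrow> 'F) k n"
private abbreviation "vl2 X Y k n \<equiv> val2 (X :: 'F net \<Rightarrow> 'F) (Y :: 'F net \<Rightarrow> 'F) k n"
private abbreviation "nT N \<equiv> d1 N - (t1 N - t2 N)"
private abbreviation "nO N \<equiv> 0"

private lemma sum_zc: "(\<Sum>c\<in>UNIV. zc (c :: 'F)) = 1"
  using sum_zc_lin[of 1 0] by (simp add: zc_nz)

private lemma zc_one: "zc (1 :: 'F) = 0"
  by (simp add: zc_nz)

private lemmas base = val_def val2_def S_0 strip_end_def sum_zc zc_one cong_iff_dvd_diff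

private lemma rel:
  assumes "net_lag N"
  shows "pP N * ff N - (d1 N * d2 N + d1 N * dm N + d2 N * dm N) = (0 :: 'F)"
    "pP N * ch N - ((d1 N + dm N) * t2 N - dm N * t1 N) = 0"
    "pP N * ps N - ((d2 N + dm N) * t1 N - dm N * t2 N) = 0"
    "t1 N * ff N - ((d1 N + dm N) * ps N + dm N * ch N) = 0"
  using assms by (simp_all add: net_lag_def lag_def algebra_simps)

text \<open>The resultants from the reduction, now at points of the field, including those where
  \<open>pP\<close> vanishes. The factors are arranged as linear functions of \<open>a\<close>, some
  with leading coefficient zero, to fit \<open>val2_resultant\<close>.\<close>

private lemma ids:
  fixes N :: "'F net"
  assumes N: "net_lag N"
  shows "pP N * (a * (d2 N + dm N) + ff N) - (a * pP N + d1 N + d2 N) * (a * pP N + (d1 N + dm N)) = - ((pP N * a + d1 N) * (pP N * a + d1 N))"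
    "pP N * (a * (d2 N + nW N) + nG N) - (a * pP N + d1 N + d2 N) * (a * pP N + nV N) = - ((pP N * a + d1 N) * (pP N * a + nT N))"
    "pP N * (a * dm N + ff N) - (a * pP N + d1 N + d2 N) * (d1 N + dm N) = - ((0 * a + d1 N) * (pP N * a + d1 N))"
    "pP N * (a * nW N + nG N) - (a * pP N + d1 N + d2 N) * nV N = - ((0 * a + nT N) * (pP N * a + d1 N))"
    "pP N * (a * nU N + nG N) - (a * pP N + d1 N + d2 N) * nV N = - ((0 * a + d1 N) * (pP N * a + nT N))"
    "pP N * ff N - d2 N * (d1 N + dm N) = d1 N * dm N"
    "pP N * nG N - d2 N * nV N = d1 N * nW N"
    "t1 N * nG N - ps N * nV N = ch N * nU N"
    "pP N * ff N - (d1 N + dm N) * (d1 N + d2 N) = - (d1 N * d1 N)"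
    "pP N * (ff N - ch N) - (d1 N + dm N) * (d2 N - t2 N + t1 N) = d1 N * nU N"
    "pP N * ch N - (d1 N + dm N) * t2 N = - (dm N * t1 N)"
proof -
  note z = rel[OF N]
  have "pP N * (a * (d2 N + dm N) + ff N) - (a * pP N + d1 N + d2 N) * (a * pP N + (d1 N + dm N)) - (- ((pP N * a + d1 N) * (pP N * a + d1 N))) = (pP N * ff N - (d1 N * d2 N + d1 N * dm N + d2 N * dm N))"
    by (simp add: algebra_simps)
  then show "pP N * (a * (d2 N + dm N) + ff N) - (a * pP N + d1 N + d2 N) * (a * pP N + (d1 N + dm N)) = - ((pP N * a + d1 N) * (pP N * a + d1 N))" by (simp only: z diff_0_right right_minus_eq)
  have "pP N * (a * (d2 N + nW N) + nG N) - (a * pP N + d1 N + d2 N) * (a * pP N + nV N) - (- ((pP N * a + d1 N) * (pP N * a + nT N))) = (pP N * ff N - (d1 N * d2 N + d1 N * dm N + d2 N * dm N)) - (pP N * ch N - ((d1 N + dm N) * t2 N - dm N * t1 N)) - (pP N * ps N - ((d2 N + dm N) * t1 N - dm N * t2 N))"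
    by (simp add: algebra_simps)
  then show "pP N * (a * (d2 N + nW N) + nG N) - (a * pP N + d1 N + d2 N) * (a * pP N + nV N) = - ((pP N * a + d1 N) * (pP N * a + nT N))" by (simp only: z diff_0_right right_minus_eq)
  have "pP N * (a * dm N + ff N) - (a * pP N + d1 N + d2 N) * (d1 N + dm N) - (- ((0 * a + d1 N) * (pP N * a + d1 N))) = (pP N * ff N - (d1 N * d2 N + d1 N * dm N + d2 N * dm N))"
    by (simp add: algebra_simps)
  then show "pP N * (a * dm N + ff N) - (a * pP N + d1 N + d2 N) * (d1 N + dm N) = - ((0 * a + d1 N) * (pP N * a + d1 N))" by (simp only: z diff_0_right right_minus_eq)
  have "pP N * (a * nW N + nG N) - (a * pP N + d1 N + d2 N) * nV N - (- ((0 * a + nT N) * (pP N * a + d1 N))) = (pP N * ff N - (d1 N * d2 N + d1 N * dm N + d2 N * dm N)) - (pP N * ch N - ((d1 N + dm N) * t2 N - dm N * t1 N)) - (pP N * ps N - ((d2 N + dm N) * t1 N - dm N * t2 N))"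
    by (simp add: algebra_simps)
  then show "pP N * (a * nW N + nG N) - (a * pP N + d1 N + d2 N) * nV N = - ((0 * a + nT N) * (pP N * a + d1 N))" by (simp only: z diff_0_right right_minus_eq)
  have "pP N * (a * nU N + nG N) - (a * pP N + d1 N + d2 N) * nV N - (- ((0 * a + d1 N) * (pP N * a + nT N))) = (pP N * ff N - (d1 N * d2 N + d1 N * dm N + d2 N * dm N)) - (pP N * ch N - ((d1 N + dm N) * t2 N - dm N * t1 N)) - (pP N * ps N - ((d2 N + dm N) * t1 N - dm N * t2 N))"
    by (simp add: algebra_simps)
  then show "pP N * (a * nU N + nG N) - (a * pP N + d1 N + d2 N) * nV N = - ((0 * a + d1 N) * (pP N * a + nT N))" by (simp only: z diff_0_right right_minus_eq)
  have "pP N * ff N - d2 N * (d1 N + dm N) - (d1 N * dm N) = (pP N * ff N - (d1 N * d2 N + d1 N * dm N + d2 N * dm N))"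
    by (simp add: algebra_simps)
  then show "pP N * ff N - d2 N * (d1 N + dm N) = d1 N * dm N" by (simp only: z diff_0_right right_minus_eq)
  have "pP N * nG N - d2 N * nV N - (d1 N * nW N) = (pP N * ff N - (d1 N * d2 N + d1 N * dm N + d2 N * dm N)) - (pP N * ch N - ((d1 N + dm N) * t2 N - dm N * t1 N)) - (pP N * ps N - ((d2 N + dm N) * t1 N - dm N * t2 N))"
    by (simp add: algebra_simps)
  then show "pP N * nG N - d2 N * nV N = d1 N * nW N" by (simp only: z diff_0_right right_minus_eq)
  have "t1 N * nG N - ps N * nV N - (ch N * nU N) = (t1 N * ff N - ((d1 N + dm N) * ps N + dm N * ch N))"
    by (simp add: algebra_simps)
  then show "t1 N * nG N - ps N * nV N = ch N * nU N" by (simp only: z diff_0_right right_minus_eq)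
  have "pP N * ff N - (d1 N + dm N) * (d1 N + d2 N) - (- (d1 N * d1 N)) = (pP N * ff N - (d1 N * d2 N + d1 N * dm N + d2 N * dm N))"
    by (simp add: algebra_simps)
  then show "pP N * ff N - (d1 N + dm N) * (d1 N + d2 N) = - (d1 N * d1 N)" by (simp only: z diff_0_right right_minus_eq)
  have "pP N * (ff N - ch N) - (d1 N + dm N) * (d2 N - t2 N + t1 N) - (d1 N * nU N) = (pP N * ff N - (d1 N * d2 N + d1 N * dm N + d2 N * dm N)) - (pP N * ch N - ((d1 N + dm N) * t2 N - dm N * t1 N))"
    by (simp add: algebra_simps)
  then show "pP N * (ff N - ch N) - (d1 N + dm N) * (d2 N - t2 N + t1 N) = d1 N * nU N" by (simp only: z diff_0_right right_minus_eq)
  have "pP N * ch N - (d1 N + dm N) * t2 N - (- (dm N * t1 N)) = (pP N * ch N - ((d1 N + dm N) * t2 N - dm N * t1 N))"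
    by (simp add: algebra_simps)
  then show "pP N * ch N - (d1 N + dm N) * t2 N = - (dm N * t1 N)" by (simp only: z diff_0_right right_minus_eq)
qed

text \<open>The first two variables enter \<open>pP\<close> only through their sum; the same holds
  for \<open>t2\<close> in the next lemma.\<close>

private lemma v_P: "vl pP k 0"
proof (cases k)
  case (Suc j)
  have "[S (Suc j) (\<lambda>N :: 'F net. zc (pP N)) = 0] (mod int CARD('F))"
    by (rule S_sum_head[where f = "\<lambda>N s. zc (s * pP N + (d1 N + d2 N))"]) (simp add: strip_step_def algebra_simps)
  then show ?thesis by (simp add: val_def Suc)
qed (simp add: base)

private lemma v_P_t2: "vl2 pP t2 k 0"
proof (cases k)
  case (Suc j)
  have "[S (Suc j) (\<lambda>N :: 'F net. zc (pP N) * zc (t2 N)) = 0] (mod int CARD('F))"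
    by (rule S_sum_head[where f = "\<lambda>N s. zc (s * pP N + (d1 N + d2 N)) * zc (s * t1 N + (ch N + ps N))"])
      (simp add: strip_step_def algebra_simps)
  then show ?thesis by (simp add: val2_def Suc)
qed (simp add: base)

private lemmas st = strip_step_def algebra_simps

private lemma v_lin0: "vl dm k 0" "vl nW k 0"
proof -
  have "vl dm (Suc j) 0" for j
    by (rule val_linear[where p = nO and m = nF and f = "\<lambda>N a. a * dm N + ff N", OF _ val_zero]) (simp add: st)
  then show "vl dm k 0" by (cases k) (simp_all add: base)
  have "vl nW (Suc j) 0" for j
    by (rule val_linear[where p = nO and m = nV and f = "\<lambda>N a. a * nU N + nG N", OF _ val_zero]) (simp add: st)
  then show "vl nW k 0" by (cases k) (simp_all add: base)
qed

private lemma v_lin1: "vl t1 (Suc k) 0" "vl nU (Suc k) 0" "vl nF (Suc k) 0" "vl nV k 0"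
proof -
  show "vl t1 (Suc k) 0"
    by (rule val_linear[where p = nO and m = t1 and f = "\<lambda>N a. a * t2 N + (ch N + ps N)", OF _ val_zero]) (simp add: st)
  show "vl nU (Suc k) 0"
    by (rule val_linear[where p = nO and m = nV and f = "\<lambda>N a. a * nW N + nG N", OF _ val_zero]) (simp add: st)
  show "vl nF (Suc k) 0"
    by (rule val_linear[where p = pP and m = nF and f = "\<lambda>N a. a * (d2 N + dm N) + ff N", OF _ v_P]) (simp add: st)
  have "vl nV (Suc j) 0" for j
    by (rule val_linear[where p = pP and m = nV and f = "\<lambda>N a. a * (d2 N + nW N) + nG N", OF _ v_P]) (simp add: st)
  then show "vl nV k 0" by (cases k) (simp_all add: base)
qed

private lemma v_prod: "vl d1 (Suc k) 0" "vl nS (Suc k) 0" "vl nT k 0" "vl ch (Suc (Suc k)) 0"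
proof -
  show "vl d1 (Suc k) 0" by (rule val_product[where u = pP and v = d2, OF _ v_P]) (simp add: st)
  show "vl nS (Suc k) 0" by (rule val_product[where u = nO and v = "\<lambda>N. - nS N", OF _ val_zero]) (simp add: st)
  have "vl nT (Suc j) 0" for j
    by (rule val_product[where u = pP and v = "\<lambda>N. d2 N + nS N", OF _ v_P]) (simp add: st)
  then show "vl nT k 0" by (cases k) (simp_all add: base)
  show "vl ch (Suc (Suc k)) 0" by (rule val_product[where u = t1 and v = ps, OF _ v_lin1(1)]) (simp add: st)
qed

text \<open>For a bare edge the first five polynomials are \<open>c\<close> or \<open>- c\<close>
  and have one zero. These values deviate from the longer strips and are the source of all nonzero
  residues below.\<close>

private lemma v_base: "vl d1 0 1" "vl t1 0 1" "vl nF 0 1" "vl nU 0 1" "vl nS 0 1" "vl ch 0 0"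
  by (simp_all add: base zc_minus)

private lemma v_ch1: "vl ch (Suc 0) 1"
  by (rule val_product[where u = t1 and v = ps, OF _ v_base(2)]) (simp add: st)

private lemma P_base: "vl2 pP X 0 0"
  by (simp add: base)

private lemma PP: "vl2 pP pP k 0" by (rule val2_same[OF v_P])
private lemma zX: "vl X k n \<Longrightarrow> vl2 nO X k n" "vl X k n \<Longrightarrow> vl2 X nO k n"
  using val2_zero val2_sym by blast+

private lemma v_P_F: "vl2 pP nF k 0"
proof (cases k)
  case (Suc j)
  have "vl2 pP nF (Suc j) (0 + 0 - 0 - 0 - 0 - 0)"
    by (rule val2_resultant[where ?p1.0 = "\<lambda>N a. pP N" and ?p0.0 = "\<lambda>N a. a * pP N + d1 N + d2 N" and ?r1.0 = "\<lambda>N a. a * pP N + (d1 N + dm N)"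
        and ?r0.0 = "\<lambda>N a. a * (d2 N + dm N) + ff N" and \<kappa> = "\<lambda>N. zc (pP N) * zc (nF N)" and ?\<alpha>1.0 = pP and ?\<alpha>2.0 = pP and ?\<beta>1.0 = d1 and ?\<beta>2.0 = d1
        and A = nO and B = nO, OF _ _ _ ids(1) _ v_P v_P val_zero val_zero zX(1)[OF val_zero] PP])
      (auto simp: st zc_def)
  then show ?thesis by (simp add: Suc)
qed (simp add: P_base)

private lemma v_P_12: "vl2 (\<lambda>N. d1 N + d2 N) pP k 0"
proof (cases k)
  case (Suc j)
  have "vl2 (\<lambda>N. d1 N + d2 N) pP (Suc j) (0 - 0 - 0 - 0 - 0 - 0 + 0 + 0)"
    by (rule val2_product[where u = pP and v = "\<lambda>N. d1 N + d2 N" and e = nO and g = pP and m = pP and n = "\<lambda>N. d1 N + d2 N"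
        and A = nO and B = nO, OF _ _ _ v_P v_P v_P val_zero val_zero PP zX(1)[OF val_zero] PP]) (simp_all add: st)
  then show ?thesis by (simp add: Suc)
qed (simp add: val2_sym[OF P_base])

private lemma v_T_P: "vl2 nT pP k 0"
proof (induction k)
  case (Suc k)
  have "vl2 nT pP (Suc k) (0 - 0 - 0 - 0 - 0 - 0 + 0 + 0)"
    by (rule val2_product[where u = pP and v = "\<lambda>N. d2 N + nS N" and e = nO and g = pP and m = pP and n = "\<lambda>N. d1 N + d2 N"
        and A = pP and B = nT, OF _ _ _ v_P v_P v_P v_P v_prod(3) PP val2_sym[OF Suc] PP]) (simp_all add: st)
  then show ?case by simp
qed (simp add: val2_sym[OF P_base])

private lemma v_d2S_P: "vl2 (\<lambda>N. d2 N - t2 N + t1 N) pP k 0"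
proof (cases k)
  case (Suc j)
  have "vl2 (\<lambda>N. d2 N - t2 N + t1 N) pP (Suc j) (0 - 0 - 0 - 0 - 0 - 0 + 0 + 0)"
    by (rule val2_product[where u = nO and v = nT and e = nO and g = pP and m = pP and n = "\<lambda>N. d1 N + d2 N"
        and A = nT and B = pP, OF _ _ _ val_zero v_P v_P v_prod(3) v_P zX(1)[OF v_P] v_T_P zX(1)[OF v_P]]) (simp_all add: st)
  then show ?thesis by (simp add: Suc)
qed (simp add: val2_sym[OF P_base])

text \<open>At the bare edge \<open>nS\<close> has one zero but none in common with
  \<open>pP\<close>, which is 1 there; this makes the first value \<open>- 1\<close>, and it is
  preserved afterwards.\<close>

private lemma v_S_P: "vl2 nS pP (Suc k) (- 1)"
proof -
  have step: "vl2 nS pP (Suc k) (0 - 0 - 0 - 0 - n - 0 + m + 0)" if "vl nS k n" "vl2 nS pP k m" for k n m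
    by (rule val2_product[where u = nO and v = "\<lambda>N. - nS N" and e = nO and g = pP and m = pP and n = "\<lambda>N. d1 N + d2 N"
        and A = nS and B = pP, OF _ _ _ val_zero v_P v_P that(1) v_P zX(1)[OF v_P] that(2) zX(1)[OF v_P]]) (simp_all add: st)
  show ?thesis
  proof (induction k)
    case 0
    show ?case using step[OF v_base(5) val2_sym[OF P_base]] by simp
  next
    case (Suc k)
    then show ?case using step[OF v_prod(2) Suc] by simp
  qed
qed

private lemma v_d1_P: "vl2 d1 pP (Suc k) (- 1)"
proof -
  have step: "vl2 d1 pP (Suc k) (0 - 0 - 0 - 0 - 0 - n + m + 0)" if "vl d1 k n" "vl2 d1 pP k m" for k n m
    by (rule val2_product[where u = pP and v = d2 and e = nO and g = pP and m = pP and n = "\<lambda>N. d1 N + d2 N"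
        and A = pP and B = d1, OF _ _ _ v_P v_P v_P v_P that(1) PP val2_sym[OF that(2)] PP]) (simp_all add: st)
  show ?thesis
  proof (induction k)
    case 0
    show ?case using step[OF v_base(1) val2_sym[OF P_base]] by simp
  next
    case (Suc k)
    then show ?case using step[OF v_prod(1) Suc] by simp
  qed
qed

private lemma v_P_V: "vl2 pP nV (Suc k) (- 1)"
proof -
  have step: "vl2 pP nV (Suc k) (m + 0 - 0 - 0 - 0 - n)" if "vl nS k n" "vl2 nS pP k m" for k n m
    by (rule val2_resultant[where ?p1.0 = "\<lambda>N a. pP N" and ?p0.0 = "\<lambda>N a. a * pP N + d1 N + d2 N" and ?r1.0 = "\<lambda>N a. a * pP N + nV N"
        and ?r0.0 = "\<lambda>N a. a * (d2 N + nW N) + nG N" and \<kappa> = "\<lambda>N. zc (pP N) * zc (nV N)" and ?\<alpha>1.0 = pP and ?\<alpha>2.0 = pP and ?\<beta>1.0 = d1 and ?\<beta>2.0 = nT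
        and A = pP and B = nS, OF _ _ _ ids(2) _ v_P v_P v_P that(1) val2_sym[OF that(2)] PP])
      (auto simp: st zc_def)
  show ?thesis
  proof (cases k)
    case 0
    show ?thesis using step[OF v_base(5) val2_sym[OF P_base]] 0 by simp
  next
    case (Suc j)
    then show ?thesis using step[OF v_prod(2) v_S_P] by simp
  qed
qed

text \<open>The leading coefficient of \<open>Y\<close> in \<open>b\<close> does not contain
  \<open>a\<close>, so one of the two linear factors of the resultant is a constant
  \<open>X\<close>, and the answer depends on \<open>X\<close> alone.\<close>

private lemma P_const_resultant:
  assumes Y: "\<And>N a b. net_lag N \<Longrightarrow> Y (strip_step a b N) = r N * b + h N a"
    and R: "\<And>N a. net_lag N \<Longrightarrow> pP N * h N a - (a * pP N + d1 N + d2 N) * r N = - ((0 * a + X N) * (pP N * a + \<beta> N))"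
    and c: "vl X k n" "vl2 X pP k m"
  shows "vl2 pP Y (Suc k) (m - n)"
proof -
  have "vl2 pP Y (Suc k) (m + 0 - 0 - 0 - n - 0)"
    by (rule val2_resultant[where ?p1.0 = "\<lambda>N a. pP N" and ?p0.0 = "\<lambda>N a. a * pP N + d1 N + d2 N" and ?r1.0 = "\<lambda>N a. r N"
        and ?r0.0 = h and \<kappa> = "\<lambda>N. zc (pP N) * zc (r N)" and ?\<alpha>1.0 = nO and ?\<alpha>2.0 = pP and ?\<beta>1.0 = X and ?\<beta>2.0 = \<beta>
        and A = X and B = pP, OF _ Y _ R _ val_zero v_P c(1) v_P c(2) zX(1)[OF v_P]])
      (auto simp: st)
  then show ?thesis by simp
qed

private lemma v_P_pairs: "vl2 pP dm (Suc k) (- 1)" "vl2 pP nU (Suc k) 0" "vl2 pP nW (Suc k) (- 1)"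
proof -
  have d: "\<exists>n m. vl d1 k n \<and> vl2 d1 pP k m \<and> m - n = - 1"
  proof (cases k)
    case 0
    then show ?thesis using v_base(1) val2_sym[OF P_base] by force
  next
    case (Suc j)
    then show ?thesis using v_prod(1) v_d1_P by force
  qed
  then obtain n m where d: "vl d1 k n" "vl2 d1 pP k m" "m - n = - 1" by blast
  show "vl2 pP dm (Suc k) (- 1)"
    using P_const_resultant[where Y = dm and r = nF and h = "\<lambda>N a. a * dm N + ff N", OF _ ids(3) d(1,2)] d(3)
    by (simp add: st)
  show "vl2 pP nW (Suc k) (- 1)"
    using P_const_resultant[where Y = nW and r = nV and h = "\<lambda>N a. a * nU N + nG N", OF _ ids(5) d(1,2)] d(3)
    by (simp add: st)
  show "vl2 pP nU (Suc k) 0"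
    using P_const_resultant[where Y = nU and r = nV and h = "\<lambda>N a. a * nW N + nG N", OF _ ids(4) v_prod(3) v_T_P]
    by (simp add: st)
qed

text \<open>Each triangle adds the common zeros of \<open>pP\<close> and \<open>dm\<close> of the
  tail, which count as \<open>- 1\<close>; hence linear growth in the length.\<close>

private lemma v_d1_dm: "vl2 d1 dm (Suc k) (- int (Suc k))"
proof -
  have step: "vl2 d1 dm (Suc k) (pd - f - 0 - 0 - d - 0 + dd + 0)"
    if "vl2 pP dm k pd" "vl nF k f" "vl d1 k d" "vl2 d1 dm k dd" for k pd f d dd
    by (rule val2_product[where u = pP and v = d2 and e = nO and g = dm and m = nF and n = ff and A = d1 and B = dm,
        OF _ _ disjI1[OF ids(6)] v_P v_lin0(1) that(2,3) v_lin0(1) that(1,4) v_P_F]) (simp_all add: st)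
  show ?thesis
  proof (induction k)
    case 0
    have "vl2 d1 dm 0 1" by (simp add: base)
    from step[OF P_base v_base(3,1) this] show ?case by simp
  next
    case (Suc k)
    from step[OF v_P_pairs(1) v_lin1(3) v_prod(1) Suc] show ?case by simp
  qed
qed

private lemma v_d1_W: "vl2 d1 nW (Suc k) (- int (Suc k))"
proof -
  have step: "vl2 d1 nW (Suc k) (pu - 0 - 0 - u - d - 0 + dd + pv)"
    if "vl2 pP nU k pu" "vl nU k u" "vl d1 k d" "vl2 d1 nW k dd" "vl2 pP nV k pv" for k pu u d dd pv
    by (rule val2_product[where u = pP and v = d2 and e = nO and g = nU and m = nV and n = nG and A = d1 and B = nW,
        OF _ _ disjI1[OF ids(7)] v_P that(2) v_lin1(4) that(3) v_lin0(2) that(1,4,5)]) (simp_all add: st)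
  show ?thesis
  proof (induction k)
    case 0
    have "vl2 d1 nW 0 1" by (simp add: base)
    from step[OF P_base v_base(4,1) this P_base] show ?case by simp
  next
    case (Suc k)
    from step[OF v_P_pairs(2) v_lin1(2) v_prod(1) Suc v_P_V] show ?case by simp
  qed
qed

private lemma v_d1_U: "vl2 d1 nU (Suc (Suc k)) (- int (k + 3))"
proof -
  have "vl2 d1 nU (Suc (Suc k)) (- 1 - 0 - 0 - 0 - 0 - 0 + - int (Suc k) + - 1)"
    by (rule val2_product[where u = pP and v = d2 and e = nO and g = nW and m = nV and n = nG and A = d1 and B = nW,
        OF _ _ disjI1[OF ids(7)] v_P v_lin0(2) v_lin1(4) v_prod(1) v_lin0(2) v_P_pairs(3) v_d1_W v_P_V]) (simp_all add: st)
  moreover have "(- 1 - 0 - 0 - 0 - 0 - 0 + - int (Suc k) + - 1 :: int) = - int (k + 3)" by simp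
  ultimately show ?thesis by (simp only:)
qed

private lemma v_S_V: "vl2 nS nV (Suc k) (- int (Suc k))"
proof -
  have step: "vl2 nS nV (Suc k) (p + m - 0 - 2 * n)" if "vl nS k n" "vl2 nS pP k p" "vl2 nS nV k m" for k n p m
    by (rule val2_bilinear[where v = nS and p = pP and m = nV and g = "\<lambda>N. d2 N + nW N" and n = nG,
        OF _ _ that(1) v_lin1(4) that(2,3)]) (simp_all add: st)
  show ?thesis
  proof (induction k)
    case 0
    have "vl2 nS nV 0 1" by (simp add: base)
    from step[OF v_base(5) val2_sym[OF P_base] this] show ?case by simp
  next
    case (Suc k)
    from step[OF v_prod(2) v_S_P Suc] show ?case by simp
  qed
qed

private lemma v_S_U: "vl2 nS nU (Suc (Suc k)) (- int (Suc k))"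
proof -
  have "vl2 nS nU (Suc (Suc k)) (0 - 0 - 0 - 0 - 0 - 0 + - int (Suc k) + 0)"
    by (rule val2_product[where u = nO and v = "\<lambda>N. - nS N" and e = nO and g = nW and m = nV and n = nG and A = nS and B = nV,
        OF _ _ _ val_zero v_lin0(2) v_lin1(4) v_prod(2) v_lin1(4) zX(1)[OF v_lin0(2)] v_S_V zX(1)[OF v_lin1(4)]]) (simp_all add: st)
  then show ?thesis by simp
qed

text \<open>By reversal, and by replacing a polynomial modulo the other one of its pair:
  \<open>nV\<close> equals \<open>nU\<close> where \<open>d1\<close> vanishes, and \<open>nF\<close>
  equals \<open>t1\<close> where \<open>nV\<close> vanishes.\<close>

private lemma v_mir: "vl2 t1 nW (Suc k) (- int (Suc k))" "vl2 t1 nV (Suc k) (- int (Suc k))"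
  "vl2 dm t1 (Suc (Suc k)) (- int (k + 3))" "vl2 nF nV (Suc k) (- int (Suc k))"
proof -
  have "S (Suc k) (\<lambda>N :: 'F net. zc (d1 N) * zc (nW N)) = S (Suc k) (\<lambda>N :: 'F net. zc (t1 N) * zc (nW N))"
    by (rule S_mir) (simp only: mir_strip(2,5))
  then show "vl2 t1 nW (Suc k) (- int (Suc k))" using v_d1_W[of k] by (simp only: val2_def)
  have "S (Suc k) (\<lambda>N :: 'F net. zc (d1 N) * zc (dm N)) = S (Suc k) (\<lambda>N :: 'F net. zc (t1 N) * zc (nV N))"
    by (rule S_mir) (simp only: mir_strip(2,4))
  then show tV: "vl2 t1 nV (Suc k) (- int (Suc k))" using v_d1_dm[of k] by (simp only: val2_def)
  have "S (Suc (Suc k)) (\<lambda>N :: 'F net. zc (dm N) * zc (t1 N)) = S (Suc (Suc k)) (\<lambda>N :: 'F net. zc (nV N) * zc (d1 N))"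
    by (rule S_mir) (simp only: mir_strip(3,4))
  moreover have "zc (nV N) * zc (d1 N) = zc (d1 N) * zc (nU N)" for N :: "'F net"
    by (auto simp: zc_def)
  ultimately show "vl2 dm t1 (Suc (Suc k)) (- int (k + 3))" using v_d1_U[of k] by (simp only: val2_def)
  have "zc (t1 N) * zc (nV N) = zc (nF N) * zc (nV N)" for N :: "'F net"
    by (auto simp: zc_def)
  then show "vl2 nF nV (Suc k) (- int (Suc k))" using tV by (simp only: val2_def)
qed

text \<open>The increments are the two linearly growing counts of \<open>t1\<close> with
  \<open>nW\<close> and with \<open>nV\<close>, so this is the place where a quadratic polynomial in
  the length arises.\<close>

private lemma v_ch_U: "vl2 ch nU (Suc (Suc k)) (- int ((k + 2) * (k + 1)))"
proof -
  have step: "vl2 ch nU (Suc k) (tw - 0 - t - 0 - c - u + cu + tv)"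
    if "vl2 t1 nW k tw" "vl t1 k t" "vl ch k c" "vl nU k u" "vl2 ch nU k cu" "vl2 t1 nV k tv" for k tw t c u cu tv
    by (rule val2_product[where u = t1 and v = ps and e = nO and g = nW and m = nV and n = nG and A = ch and B = nU,
        OF _ _ disjI1[OF ids(8)] that(2) v_lin0(2) v_lin1(4) that(3,4,1,5,6)]) (simp_all add: st)
  have 1: "vl2 ch nU (Suc 0) 1"
  proof -
    have "vl2 t1 nW 0 1" "vl2 ch nU 0 1" "vl2 t1 nV 0 1" by (simp_all add: base)
    from step[OF this(1) v_base(2,6,4) this(2,3)] show ?thesis by simp
  qed
  show ?thesis
  proof (induction k)
    case 0
    from step[OF v_mir(1) v_lin1(1) v_ch1 v_lin1(2) 1 v_mir(2)] show ?case by simp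
  next
    case (Suc k)
    from step[OF v_mir(1) v_lin1(1) v_prod(4) v_lin1(2) Suc v_mir(2)] show ?case by (simp add: algebra_simps)
  qed
qed

subsection \<open>Summation over the closing edge\<close>

private lemma close_lin: "[(\<Sum>z\<in>UNIV. zc (u * z + v)) = 1 - zc (u :: 'F)] (mod q)"
  unfolding sum_zc_lin q_def by (simp add: cong_iff_dvd_diff)

private lemma close_res:
  "f1 * g0 - f0 * g1 = r \<or> f1 * g0 - f0 * g1 = - r \<Longrightarrow>
    [(\<Sum>z\<in>UNIV. zc (f1 * z + f0) * zc (g1 * z + g0)) = zc r - zc f1 * zc (g1 :: 'F)] (mod q)"
  unfolding sum_zc_res q_def by (auto simp: cong_iff_dvd_diff)

text \<open>What summation over the closing edge leaves of \<open>star_main\<close>: each product of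
  two indicators becomes the indicator of a resultant, written in factored form, minus the product
  of the indicators of the leading coefficients.\<close>

private definition close_main :: "'F net \<Rightarrow> int" where
  "close_main N = (1 - zc (nU N)) + (1 - zc (nW N)) + (1 - zc (nS N)) - (zc (ch N * nU N) - zc (nS N) * zc (nU N))
    + ((zc (d1 N * d1 N) - zc (d1 N + d2 N) * zc (pP N)) + (zc (nF N * nF N) - zc (pP N) * zc (nF N))
      - (zc (d1 N * nU N) - zc (d2 N - t2 N + t1 N) * zc (pP N)) - (zc (dm N * t1 N) - zc (pP N) * zc (t2 N))
      - (zc (nF N * nV N) - zc (pP N) * zc (nV N)) - (zc (nF N * d1 N) - zc (d1 N) * zc (pP N)))"

private lemma close_main_cong:
  assumes N: "net_lag N"
  shows "[(\<Sum>z\<in>UNIV. star_main (strip_close z N)) = close_main N] (mod q)"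
proof -
  have e: "star_main (strip_close z N) = zc (nU N * z + 0) + zc (nW N * z + (- ch N)) + zc (nS N * z + (- ch N))
      - zc (nS N * z + (- ch N)) * zc (nU N * z + 0)
      + (zc ((d1 N + d2 N) * z + ff N) * zc (pP N * z + nF N) + zc (pP N * z + nF N) * zc (nF N * z + 0)
       - zc ((d2 N - t2 N + t1 N) * z + (ff N - ch N)) * zc (pP N * z + nF N) - zc (pP N * z + nF N) * zc (t2 N * z + ch N)
       - zc (pP N * z + nF N) * zc (nV N * z + 0) - zc (d1 N * z + 0) * zc (pP N * z + nF N))" for z
    unfolding star_main_def by (simp add: strip_close_def algebra_simps)
  show ?thesis
    unfolding e close_main_def sum.distrib sum_subtractf
    using ids(9-11)[OF N] by (intro cong_add cong_diff close_lin close_res) (auto simp: algebra_simps)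
qed

private lemma S_split: "S k (\<lambda>N :: 'F net. \<phi> N + \<psi> N) = S k \<phi> + S k \<psi>" "S k (\<lambda>N :: 'F net. \<phi> N - \<psi> N) = S k \<phi> - S k \<psi>"
  by (rule S_add S_diff)+

private lemma S_close_main:
  "[S (Suc (Suc k)) (\<lambda>N. \<Sum>z\<in>UNIV. star_main (strip_close z N :: 'F net)) = - int ((k + 3) * (k + 5))] (mod q)"
proof -
  let ?k = "Suc (Suc k)"
  have F_d1: "vl2 nF d1 ?k (- int ?k)"
  proof -
    have "zc (d1 N) * zc (dm N) = zc (nF N) * zc (d1 N)" for N :: "'F net" by (auto simp: zc_def)
    then show ?thesis using v_d1_dm[of "Suc k"] by (simp only: val2_def)
  qed
  note c = v_lin1(2)[of "Suc k"] v_lin0(2)[of ?k] v_prod(2)[of "Suc k"] v_prod(4)[of k] v_ch_U[of k] v_S_U[of k]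
    v_prod(1)[of "Suc k"] v_P_12[of ?k] v_lin1(3)[of "Suc k"] v_P_F[of ?k] v_d1_U[of k] v_d2S_P[of ?k] v_lin0(1)[of ?k]
    v_lin1(1)[of "Suc k"] v_mir(3)[of k] v_P_t2[of ?k] v_lin1(4)[of ?k] v_mir(4)[of "Suc k"] v_P_V[of "Suc k"] F_d1 v_d1_P[of "Suc k"]
  note c = c[unfolded val_def val2_def, folded q_def]
  have 1: "[S ?k (\<lambda>N :: 'F net. 1 :: int) = 0] (mod q)" unfolding q_def by (rule S_const_cong)
  have a: "[S ?k (\<lambda>N. \<Sum>z\<in>UNIV. star_main (strip_close z N :: 'F net)) = S ?k close_main] (mod q)"
    by (rule S_cong) (rule close_main_cong)
  \<comment> \<open>The term with \<open>ch * nU\<close>, together with \<open>nS\<close> and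
    \<open>nU\<close>, contributes \<open>- (k + 1) * (k + 3)\<close>; the last four resultants
    contribute \<open>- (k + 3)\<close> each.\<close>
  have b: "[S ?k close_main = (0 - 0) + (0 - 0) + (0 - 0) - (0 + 0 - (- int ((k + 2) * (k + 1))) - (- int (Suc k)))
    + ((0 + 0 - 0 - 0) + (0 + 0 - 0 - 0) - (0 + 0 - (- int (k + 3)) - 0) - (0 + 0 - (- int (k + 3)) - 0)
      - (0 + 0 - (- int ?k) - (- 1)) - (0 + 0 - (- int ?k) - (- 1)))] (mod q)"
    unfolding close_main_def zc_mult zc_sq S_split
    by (intro cong_add cong_diff c 1)
  show ?thesis using cong_trans[OF a b] unfolding cong_iff_dvd_diff by (simp add: algebra_simps)
qed

text \<open>This sum is multiplied by \<open>2 * q\<close> in \<open>star_count_cong\<close>, so it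
  has to vanish modulo the square of \<open>q\<close>, one power more than the counts above
  provide.\<close>

private lemma S_regular: "[S (Suc (Suc k)) (\<lambda>N. \<Sum>z\<in>UNIV. 1 - zc (pP (strip_close z N :: 'F net))) = 0] (mod q\<^sup>2)"
proof -
  let ?k = "Suc (Suc k)"
  have q: "q dvd S j (\<lambda>N :: 'F net. zc (pP N))" "q dvd S j (\<lambda>N :: 'F net. zc (pP N) * zc (nF N))" for j
    using v_P[of j] v_P_F[of j] by (simp_all add: val_def val2_def cong_0_iff q_def)
  have c: "q\<^sup>2 dvd S (Suc j) (\<lambda>N :: 'F net. c)" for j c
    by (simp add: S_const q_def power2_eq_square)
  \<comment> \<open>The additional power comes from \<open>pP\<close> depending only on
    \<open>a + b\<close>.\<close>
  have "(\<Sum>a\<in>UNIV. \<Sum>b\<in>UNIV. zc (pP (strip_step a b N))) = q * (1 - zc (pP N)) + q\<^sup>2 * (zc (pP N) * zc (d1 N + d2 N))" for N :: "'F net"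
  proof -
    have h: "(\<Sum>b\<in>UNIV. zc (pP (strip_step a b N))) = 1 - zc (pP N) + q * zc (pP N) * zc (d1 N + d2 N)" for a
    proof -
      have "pP (strip_step a b N) = pP N * (b + a) + (d1 N + d2 N)" for b by (simp add: st)
      then show ?thesis using sum_shift[of "\<lambda>b. zc (pP N * b + (d1 N + d2 N))" a] sum_zc_lin[of "pP N" "d1 N + d2 N"]
        by (simp add: q_def)
    qed
    show ?thesis unfolding h by (simp add: q_def algebra_simps power2_eq_square)
  qed
  then have "S ?k (\<lambda>N :: 'F net. zc (pP N)) = q * (S (Suc k) (\<lambda>N :: 'F net. 1) - S (Suc k) (\<lambda>N :: 'F net. zc (pP N))) +
      q\<^sup>2 * S (Suc k) (\<lambda>N :: 'F net. zc (pP N) * zc (d1 N + d2 N))"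
    by (simp add: S_Suc[of "Suc k"] S_add S_diff S_cmult)
  moreover have "q dvd S (Suc k) (\<lambda>N :: 'F net. 1)" using c[of k 1] by (rule dvd_trans[rotated]) simp
  then have "q\<^sup>2 dvd q * (S (Suc k) (\<lambda>N :: 'F net. 1) - S (Suc k) (\<lambda>N :: 'F net. zc (pP N)))"
    unfolding power2_eq_square using q(1) by (intro mult_dvd_mono dvd_diff) auto
  ultimately have P: "q\<^sup>2 dvd S ?k (\<lambda>N :: 'F net. zc (pP N))" by simp
  have "(\<Sum>z\<in>UNIV. 1 - zc (pP (strip_close z N))) = (q - 1) + zc (pP N) - q * (zc (pP N) * zc (nF N))" for N :: "'F net"
  proof -
    have "pP (strip_close z N) = pP N * z + nF N" for z by (simp add: strip_close_def algebra_simps)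
    then show ?thesis using sum_zc_lin[of "pP N" "nF N"] by (simp add: sum_subtractf q_def algebra_simps)
  qed
  then have "S ?k (\<lambda>N. \<Sum>z\<in>UNIV. 1 - zc (pP (strip_close z N :: 'F net))) =
      S ?k (\<lambda>N :: 'F net. q - 1) + S ?k (\<lambda>N :: 'F net. zc (pP N)) - q * S ?k (\<lambda>N :: 'F net. zc (pP N) * zc (nF N))"
    by (simp only: S_add S_diff S_cmult)
  moreover have "q\<^sup>2 dvd q * S ?k (\<lambda>N :: 'F net. zc (pP N) * zc (nF N))"
    unfolding power2_eq_square using q(2) by (intro mult_dvd_mono) auto
  ultimately show ?thesis using P c[of "Suc k" "q - 1"] by (simp add: cong_0_iff)
qed

lemma S_star_count:
  "[S (Suc (Suc k)) (\<lambda>N. \<Sum>z\<in>UNIV. star_count (strip_close z N :: 'F net)) = - (q\<^sup>2 * int ((k + 3) * (k + 5)))] (mod q ^ 3)"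
proof -
  let ?k = "Suc (Suc k)"
  have a: "[S ?k (\<lambda>N. \<Sum>z\<in>UNIV. star_count (strip_close z N :: 'F net)) =
      S ?k (\<lambda>N. \<Sum>z\<in>UNIV. q\<^sup>2 * star_main (strip_close z N :: 'F net) - 2 * q * (1 - zc (pP (strip_close z N))))] (mod q ^ 3)"
    unfolding q_def by (intro S_cong cong_sum star_count_cong net_lag_close)
  have e: "S ?k (\<lambda>N. \<Sum>z\<in>UNIV. q\<^sup>2 * star_main (strip_close z N :: 'F net) - 2 * q * (1 - zc (pP (strip_close z N)))) =
      q\<^sup>2 * S ?k (\<lambda>N. \<Sum>z\<in>UNIV. star_main (strip_close z N :: 'F net)) - 2 * q * S ?k (\<lambda>N. \<Sum>z\<in>UNIV. 1 - zc (pP (strip_close z N :: 'F net)))"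
    unfolding sum_subtractf[of "\<lambda>z. q\<^sup>2 * _ z"] sum_distrib_left[symmetric] S_diff S_cmult ..
  have d: "u dvd x - y \<Longrightarrow> v * u dvd v * x - v * y" for u v x y :: int
    by (metis mult_dvd_mono dvd_refl right_diff_distrib)
  have "q ^ 3 dvd q\<^sup>2 * S ?k (\<lambda>N. \<Sum>z\<in>UNIV. star_main (strip_close z N :: 'F net)) - q\<^sup>2 * (- int ((k + 3) * (k + 5)))"
    using d[OF S_close_main[of k, unfolded cong_iff_dvd_diff], of "q\<^sup>2"] by (simp add: power3_eq_cube power2_eq_square mult.assoc)
  moreover have "q ^ 3 dvd 2 * q * S ?k (\<lambda>N. \<Sum>z\<in>UNIV. 1 - zc (pP (strip_close z N :: 'F net)))"
  proof -
    have "q * q\<^sup>2 dvd q * S ?k (\<lambda>N. \<Sum>z\<in>UNIV. 1 - zc (pP (strip_close z N :: 'F net)))"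
      using S_regular[of k] by (intro mult_dvd_mono) (simp_all add: cong_0_iff)
    then show ?thesis by (simp add: power3_eq_cube power2_eq_square mult.assoc)
  qed
  ultimately have "q ^ 3 dvd (q\<^sup>2 * S ?k (\<lambda>N. \<Sum>z\<in>UNIV. star_main (strip_close z N :: 'F net)) - q\<^sup>2 * (- int ((k + 3) * (k + 5)))) -
      2 * q * S ?k (\<lambda>N. \<Sum>z\<in>UNIV. 1 - zc (pP (strip_close z N :: 'F net)))" by (rule dvd_diff)
  then have "[S ?k (\<lambda>N. \<Sum>z\<in>UNIV. q\<^sup>2 * star_main (strip_close z N :: 'F net) - 2 * q * (1 - zc (pP (strip_close z N)))) =
      - (q\<^sup>2 * int ((k + 3) * (k + 5)))] (mod q ^ 3)"
    unfolding e cong_iff_dvd_diff by (simp add: algebra_simps)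
  with a show ?thesis by (rule cong_trans)
qed

end

section \<open>The count for the completed zigzag graph\<close>

context
  fixes h :: nat and w :: "nat \<Rightarrow> 'a::idom"
  assumes h: "3 \<le> h"
begin

private abbreviation "D \<equiv> h + 1"
private abbreviation "W \<equiv> zig_net h w"
private abbreviation "xs \<equiv> zig_list h w"
private abbreviation "x \<equiv> uv 0 :: nat \<Rightarrow> 'a"
private abbreviation "y \<equiv> uv 1 :: nat \<Rightarrow> 'a"
private abbreviation "r \<equiv> uv (h - 1) :: nat \<Rightarrow> 'a"
private abbreviation "\<rho> \<equiv> uv h :: nat \<Rightarrow> 'a"

private lemma net: "net_at D x y r (tst \<rho> \<rho> # xs) = W"
  by (rule net_at_zig[OF h])

private lemma fields:
  "gd D (tst \<rho> \<rho> # xs) = pP W"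
  "gd D (tst x x # tst y y # tst \<rho> \<rho> # xs) = ff W" "gd D (tst x x # tst r r # tst \<rho> \<rho> # xs) = x1 W"
  "gd D (tst y y # tst r r # tst \<rho> \<rho> # xs) = x3 W" "gd D (tst x x # tst y r # tst \<rho> \<rho> # xs) = ch W"
  "gd D (tst x r # tst y y # tst \<rho> \<rho> # xs) = ps W" "gd D (tst x y # tst r r # tst \<rho> \<rho> # xs) = x2 W"
  "gd D (tst x x # tst y y # tst r r # tst \<rho> \<rho> # xs) = f4 W"
  unfolding net[symmetric] net_at_def by simp_all

private lemma mixed:
  "gd D (tst y y # tst r x # tst \<rho> \<rho> # xs) = ps W" "gd D (tst y x # tst r r # tst \<rho> \<rho> # xs) = x2 W"
  "gd D (tst y y # tst x r # tst \<rho> \<rho> # xs) = ps W" "gd D (tst y y # tst x x # tst \<rho> \<rho> # xs) = ff W"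
  "gd D (tst y x # tst x r # tst \<rho> \<rho> # xs) = - ch W" "gd D (tst x y # tst r x # tst \<rho> \<rho> # xs) = - ch W"
proof -
  have f: "gd D (tst R C # tst R' C' # tst \<rho> \<rho> # xs) = gd D (tst C R # tst C' R' # tst \<rho> \<rho> # xs)" for R C R' C'
    using gd_flip[of D "tst R C # tst R' C' # tst \<rho> \<rho> # xs"] by (simp add: flip_zig_list)
  show 1: "gd D (tst y y # tst x r # tst \<rho> \<rho> # xs) = ps W" using fields(6) gd_swap[of D "tst x r"] by metis
  show "gd D (tst y y # tst r x # tst \<rho> \<rho> # xs) = ps W" using f[of y y r x] 1 by simp
  show "gd D (tst y x # tst r r # tst \<rho> \<rho> # xs) = x2 W" using f[of y x r r] fields(7) by simp
  show "gd D (tst y y # tst x x # tst \<rho> \<rho> # xs) = ff W" using fields(2) gd_swap[of D "tst x x"] by metis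
  show 2: "gd D (tst y x # tst x r # tst \<rho> \<rho> # xs) = - ch W"
    unfolding gd_swap_row[of D y] fields(5) ..
  show "gd D (tst x y # tst r x # tst \<rho> \<rho> # xs) = - ch W" using f[of x y r x] 2 by simp
qed

text \<open>All four star edges deleted: the vertex \<open>h + 1\<close> is isolated and there is no
  spanning tree.\<close>

private lemma zero: "gd D xs = 0"
  by (rule gd_sum_zero_row) (use bal_zig_list[OF h, of w] in \<open>auto simp: bal_def\<close>)

private lemma vertex_le: "0 \<le> h" "1 \<le> h" "h - 1 \<le> h" "h \<le> h" using h by auto

private lemma one: "gd D (tst x x # xs) = pP W" "gd D (tst y y # xs) = pP W" "gd D (tst r r # xs) = pP W"
  by (rule gd_zig_one[OF h vertex_le(1) vertex_le(1)], rule gd_zig_one[OF h vertex_le(2) vertex_le(2)], rule gd_zig_one[OF h vertex_le(3) vertex_le(3)])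

private lemma pair_values:
  "gd D (tst y y # tst x x # xs) = d1 W + d2 W"
  "gd D (tst r r # tst x x # xs) = d1 W + dm W - 2 * t1 W + om W"
  "gd D (tst r r # tst y y # xs) = d2 W + dm W - 2 * t2 W + om W"
proof -
  have t: "gd D (tst (uv i) (uv i) # tst (uv j) (uv j) # xs) =
      gd D (tst (vsub (uv j) (uv i)) (vsub (uv j) (uv i)) # tst \<rho> \<rho> # xs)" if "i \<le> h" "j \<le> h" for i j
    using gd_zig_two[OF h, of i i j j w] that by simp
  note z = gd_sub gd_dup gd_zig_test[OF h]
  show "gd D (tst y y # tst x x # xs) = d1 W + d2 W"
    unfolding t[OF vertex_le(2,1)] by (simp only: z) simp
  show "gd D (tst r r # tst x x # xs) = d1 W + dm W - 2 * t1 W + om W"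
    unfolding t[OF vertex_le(3,1)] by (simp only: z) simp
  show "gd D (tst r r # tst y y # xs) = d2 W + dm W - 2 * t2 W + om W"
    unfolding t[OF vertex_le(3,2)] by (simp only: z) simp
qed

text \<open>One of the three contracted star edges serves as the ground and the other two become
  differences of vertices.\<close>

private lemma three:
  "gd D (tst r r # tst y y # tst x x # xs) = ff W + x1 W + x3 W - 2 * ps W - 2 * ch W - 2 * x2 W"
proof -
  let ?Y = "vsub y x" and ?R = "vsub r x"
  have "gd D (tst r r # tst y y # tst x x # xs) = gd D (tst y y # tst x x # tst r r # xs)" by (rule gd_perm) simp
  also have "\<dots> = gd D (tst y y # tst x x # tst ?R ?R # xs)" by (rule gd_clear2)
  also have "\<dots> = gd D (tst ?R ?R # tst x x # tst y y # xs)" by (rule gd_perm) simp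
  also have "\<dots> = gd D (tst ?R ?R # tst x x # tst ?Y ?Y # xs)" by (rule gd_clear2)
  also have "\<dots> = gd D (tst x x # tst ?Y ?Y # tst ?R ?R # xs)" by (rule gd_perm) simp
  also have "\<dots> = gd D (tst \<rho> \<rho> # tst ?Y ?Y # tst ?R ?R # xs)"
    by (rule gd_ground) (use h in \<open>auto simp: vsub_apply sum_subtractf sum_uv bal_zig_list[OF h, of w, simplified] simp del: sum.lessThan_Suc\<close>)
  also have "\<dots> = gd D (tst ?Y ?Y # tst ?R ?R # tst \<rho> \<rho> # xs)" by (rule gd_perm) simp
  also have "\<dots> = ff W + x1 W + x3 W - 2 * ps W - 2 * ch W - 2 * x2 W"
    by (simp only: gd_sub gd_dup fields mixed) simp
  finally show ?thesis .
qed

private lemma ground: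
  "gd D (tst \<rho> \<rho> # tst x x # xs) = d1 W + dm W" "gd D (tst \<rho> \<rho> # tst y y # xs) = d2 W + dm W" "gd D (tst \<rho> \<rho> # tst r r # xs) = om W"
  "gd D (tst \<rho> \<rho> # tst y y # tst x x # xs) = ff W" "gd D (tst \<rho> \<rho> # tst r r # tst x x # xs) = x1 W"
  "gd D (tst \<rho> \<rho> # tst r r # tst y y # xs) = x3 W" "gd D (tst \<rho> \<rho> # tst r r # tst y y # tst x x # xs) = f4 W"
proof -
  have 2: "gd D (tst \<rho> \<rho> # s # xs) = gd D (s # tst \<rho> \<rho> # xs)" for s by (rule gd_perm) simp
  have 3: "gd D (tst \<rho> \<rho> # s # t # xs) = gd D (t # s # tst \<rho> \<rho> # xs)" for s t by (rule gd_perm) simp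
  have 4: "gd D (tst \<rho> \<rho> # s # t # u # xs) = gd D (u # t # s # tst \<rho> \<rho> # xs)" for s t u by (rule gd_perm) simp
  show "gd D (tst \<rho> \<rho> # tst x x # xs) = d1 W + dm W" "gd D (tst \<rho> \<rho> # tst y y # xs) = d2 W + dm W" "gd D (tst \<rho> \<rho> # tst r r # xs) = om W"
    unfolding 2 by (rule gd_zig_test[OF h])+
  show "gd D (tst \<rho> \<rho> # tst y y # tst x x # xs) = ff W" "gd D (tst \<rho> \<rho> # tst r r # tst x x # xs) = x1 W"
    "gd D (tst \<rho> \<rho> # tst r r # tst y y # xs) = x3 W" unfolding 3 by (rule fields)+
  show "gd D (tst \<rho> \<rho> # tst r r # tst y y # tst x x # xs) = f4 W" unfolding 4 by (rule fields)
qed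

text \<open>Sixteen terms from deletion and contraction of the four star edges. The terms with the
  ground edge contracted are minors of the grounded network; the others are brought to that form by
  \<open>gd_ground\<close>.\<close>

lemma gd_zig_star:
  "gd (h + 1) (edg a (uv 0) # edg b (uv 1) # edg c (uv (h - 1)) # edg d (uv h) # zig_list h w) =
    d * (pP W * (a * b + a * c + b * c)
      + a * (d2 W + dm W - 2 * t2 W + om W) + b * (d1 W + dm W - 2 * t1 W + om W) + c * (d1 W + d2 W)
      + (ff W + x1 W + x3 W - 2 * ps W - 2 * ch W - 2 * x2 W))
    + (pP W * (a * b * c) + b * c * (d1 W + dm W) + a * c * (d2 W + dm W) + a * b * om W
      + c * ff W + b * x1 W + a * x3 W + f4 W)"
proof -
  have ea: "gd D (edg a x # ys) = a * gd D ys + gd D (tst x x # ys)" for ys by (rule gd_edge)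
  have eb: "gd D (edg b y # ys) = b * gd D ys + gd D (tst y y # ys)" for ys by (rule gd_edge)
  have ec: "gd D (edg c r # ys) = c * gd D ys + gd D (tst r r # ys)" for ys by (rule gd_edge)
  have ed: "gd D (edg d \<rho> # ys) = d * gd D ys + gd D (tst \<rho> \<rho> # ys)" for ys by (rule gd_edge)
  have mb: "gd D (tst x x # edg b y # ys) = gd D (edg b y # tst x x # ys)" for ys by (rule gd_swap)
  have mc: "gd D (tst u u # edg c r # ys) = gd D (edg c r # tst u u # ys)"
    "gd D (tst u u # tst v v # edg c r # ys) = gd D (edg c r # tst u u # tst v v # ys)" for u v ys by (rule gd_perm, simp)+
  have md: "gd D (tst u u # edg d \<rho> # xs) = gd D (edg d \<rho> # tst u u # xs)"
    "gd D (tst u u # tst v v # edg d \<rho> # xs) = gd D (edg d \<rho> # tst u u # tst v v # xs)"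
    "gd D (tst u u # tst v v # tst t t # edg d \<rho> # xs) = gd D (edg d \<rho> # tst u u # tst v v # tst t t # xs)" for u v t
    by (rule gd_perm, simp)+
  show ?thesis
    unfolding ea unfolding mb unfolding eb unfolding mc unfolding ec unfolding md unfolding ed
      zero one pair_values three ground fields(1)
    by (simp add: algebra_simps)
qed

text \<open>In a star edge the vertex \<open>h + 1\<close> has no column, and the orientation sign
  of the other end occurs in row and column and cancels.\<close>

lemma eval_zigzag:
  "eval_mpoly w (graph_poly (completed_zigzag h)) =
    gd (h + 1) (edg (w (h + 1)) (uv 0) # edg (w (2 * h + 3)) (uv 1) # edg (w (2 * h + 1)) (uv (h - 1)) # edg (w h) (uv h) # zig_list h w)"
proof -
  let ?G = "completed_zigzag h"
  have ends: "fst (edges ?G ! e) \<le> h + 1 \<and> snd (edges ?G ! e) \<le> h + 1" if "e < nedges ?G" for e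
  proof (cases "e < h + 2")
    case True
    then show ?thesis by (simp add: zigzag_edge1 less_Suc_eq_le[symmetric])
  next
    case False
    then obtain i where e: "e = h + 2 + i" by (metis le_Suc_ex not_less)
    with that have i: "e = h + 2 + i" "i < h + 2" by simp_all
    have ed: "edges ?G ! e = (i, (i + 2) mod (h + 2))" unfolding i(1) by (rule zigzag_edge2[OF i(2)])
    have "(i + 2) mod (h + 2) < h + 2" by simp
    then show ?thesis unfolding ed fst_conv snd_conv using i(2) by linarith
  qed
  have R: "set ((2 * h + 2) # sidx h 0) = {..<h} \<union> {h + 2..<2 * h + 1} \<union> {2 * h + 2}"
    using set_sidx[OF h] by auto
  have "distinct ([h + 1, 2 * h + 3, 2 * h + 1, h] @ (2 * h + 2) # sidx h 0)"
    using distinct_sidx[OF h] set_sidx[OF h] h by auto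
  moreover have "set ([h + 1, 2 * h + 3, 2 * h + 1, h] @ (2 * h + 2) # sidx h 0) = set [0..<2 * h + 4]"
    unfolding set_append R set_upt using h by auto
  ultimately have m: "mset [0..<2 * h + 4] = mset ([h + 1, 2 * h + 3, 2 * h + 1, h] @ (2 * h + 2) # sidx h 0)"
    using set_eq_iff_mset_eq_distinct[of "[0..<2 * h + 4]" "[h + 1, 2 * h + 3, 2 * h + 1, h] @ (2 * h + 2) # sidx h 0"]
      distinct_upt by metis
  have "eval_mpoly w (graph_poly ?G) = gd (h + 1) (map (wedge ?G w) [0..<nedges ?G])"
    by (rule eval_graph_poly) (use ends in auto)
  also have "\<dots> = gd (h + 1) (map (wedge ?G w) ([h + 1, 2 * h + 3, 2 * h + 1, h] @ (2 * h + 2) # sidx h 0))"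
    by (rule gd_perm) (simp only: mset_map m length_zigzag)
  also have "\<dots> = gd (h + 1) (wedge ?G w (h + 1) # wedge ?G w (2 * h + 3) # wedge ?G w (2 * h + 1) # wedge ?G w h # zig_list h w)"
    unfolding map_append map_wedge_zig[OF h] by (simp only: list.map append.simps)
  also have "\<dots> = gd (h + 1) (edg (w (h + 1)) (uv 0) # edg (w (2 * h + 3)) (uv 1) # edg (w (2 * h + 1)) (uv (h - 1)) # edg (w h) (uv h) # zig_list h w)"
  proof -
    have p: "gd D (edg \<alpha> (vsub u (uv (h + 1))) # ys) = gd D (edg \<alpha> u # ys)" for \<alpha> :: 'a and u ys
      unfolding gd_edge[of D \<alpha>] by (simp only: gd_sub gd_outside diff_0_right)
    have n: "gd D (edg \<alpha> (vsub (uv (h + 1)) u) # ys) = gd D (edg \<alpha> u # ys)" for \<alpha> :: 'a and u ys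
      unfolding gd_edge[of D \<alpha>] by (simp only: gd_sub gd_outside diff_0_right diff_0 minus_minus)
    have n2: "gd D (e # edg \<alpha> (vsub (uv (h + 1)) u) # ys) = gd D (e # edg \<alpha> u # ys)" for \<alpha> :: 'a and e u ys
      unfolding gd_swap[of D e] by (rule n)
    have p3: "gd D (e # e' # edg \<alpha> (vsub u (uv (h + 1))) # ys) = gd D (e # e' # edg \<alpha> u # ys)" for \<alpha> :: 'a and e e' u ys
      unfolding gd_rot3[of D e e'] by (rule p)
    have p4: "gd D (e # e' # e'' # edg \<alpha> (vsub u (uv (h + 1))) # ys) = gd D (e # e' # e'' # edg \<alpha> u # ys)" for \<alpha> :: 'a and e e' e'' u ys
    proof -
      have m: "gd D (e # e' # e'' # t # ys) = gd D (t # e # e' # e'' # ys)" for t by (rule gd_perm) simp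
      show ?thesis unfolding m by (rule p)
    qed
    show ?thesis
      unfolding ew_star[OF h] n n2 p3 p4 ..
  qed
  finally show ?thesis .
qed

end

context
  fixes q :: int and ty :: "'F::{field,finite} itself"
  defines "q \<equiv> int CARD('F)"
begin

lemma num_zeros_zigzag:
  assumes h: "3 \<le> h"
  shows "int (num_zeros TYPE('F) (2 * h + 4) (graph_poly (completed_zigzag h))) =
    S (h - 1) (\<lambda>N :: 'F net. \<Sum>z\<in>UNIV. star_count (strip_close z N))"
proof -
  let ?A = "{..<2 * h + 4} \<rightarrow>\<^sub>E (UNIV :: 'F set)"
  let ?B = "({L :: ('F \<times> 'F) list. length L = h - 1} \<times> (UNIV :: 'F set)) \<times> (UNIV :: ('F \<times> 'F \<times> 'F \<times> 'F \<times> 'F) set)"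
  let ?j = "\<lambda>x :: nat \<Rightarrow> 'F. ((map (\<lambda>k. (x k, x (h + 2 + k))) [0..<h - 1], x (h - 1)), x (2 * h + 2),
    x (h + 1), x (2 * h + 3), x (2 * h + 1), x h)"
  \<comment> \<open>The inverse assignment follows the numbering of the edges: strip pairs at
    \<open>k\<close> and \<open>h + 2 + k\<close>, last strip edge \<open>h - 1\<close>, star edges
    \<open>h\<close>, \<open>h + 1\<close>, \<open>2 * h + 1\<close>, \<open>2 * h + 3\<close>,
    closing edge \<open>2 * h + 2\<close>.\<close>
  let ?i = "\<lambda>((L, e), z, a, b, c, d). restrict (\<lambda>k. if k < h - 1 then fst (L ! k) else if k = h - 1 then e
    else if k = h then d else if k = h + 1 then a else if k < 2 * h + 1 then snd (L ! (k - (h + 2)))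
    else if k = 2 * h + 1 then c else if k = 2 * h + 2 then z else b) {..<2 * h + 4}"
  let ?f = "\<lambda>((L, e), z, a, b, c, d). zc (d * psiA (strip_close z (strip L e)) a b c + psiB (strip_close z (strip L e)) a b c) :: int"
  have "int (num_zeros TYPE('F) (2 * h + 4) (graph_poly (completed_zigzag h))) =
      (\<Sum>x\<in>?A. zc (eval_mpoly x (graph_poly (completed_zigzag h))))"
    unfolding num_zeros_def zc_def by (subst sum_of_bool_eq) (auto intro!: finite_PiE arg_cong[of _ _ card])
  also have "\<dots> = (\<Sum>t\<in>?B. ?f t)"
  proof (rule sum.reindex_bij_witness[where i = ?i and j = ?j])
    fix x assume x: "x \<in> ?A"
    show "?i (?j x) = x"
    proof
      fix k
      have e: "2 \<le> k \<Longrightarrow> Suc (Suc (k - 2)) = k" by simp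
      consider "k < h - 1" | "k = h - 1" | "k = h" | "k = h + 1" | "h + 2 \<le> k" "k < 2 * h + 1" | "k = 2 * h + 1"
        | "k = 2 * h + 2" | "k = 2 * h + 3" | "2 * h + 4 \<le> k" by linarith
      then show "?i (?j x) k = x k"
        using h PiE_arb[OF x, of k] e by cases auto
    qed
    show "?j x \<in> ?B" by simp
    have "map (map_prod x x) (spairs h 0) = map (\<lambda>k. (x k, x (h + 2 + k))) [0..<h - 1]"
      by (simp add: spairs_def)
    then show "?f (?j x) = zc (eval_mpoly x (graph_poly (completed_zigzag h)))"
      unfolding eval_zigzag[OF h] gd_zig_star[OF h] zig_net_def by (simp add: psiA_def psiB_def)
  next
    fix t assume t: "t \<in> ?B"
    obtain L e z a b c d where te: "t = ((L, e), z, a, b, c, d)" by (metis surj_pair)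
    have L: "length L = h - 1" using t te by simp
    have L': "map (\<lambda>k. (?i t k, ?i t (h + 2 + k))) [0..<h - 1] = L"
      by (rule nth_equalityI) (use h L te in auto)
    have "?i t (h - 1) = e" "?i t (2 * h + 2) = z" "?i t (h + 1) = a" "?i t (2 * h + 3) = b" "?i t (2 * h + 1) = c" "?i t h = d"
      using h by (auto simp: te)
    then have "?j (?i t) = ((L, e), z, a, b, c, d)" by (simp only: L')
    then show "?j (?i t) = t" by (simp only: te)
    show "?i t \<in> ?A" by (simp add: te)
  qed
  also have "\<dots> = (\<Sum>(L, e)\<in>{L :: ('F \<times> 'F) list. length L = h - 1} \<times> UNIV. \<Sum>z\<in>UNIV. star_count (strip_close z (strip L e)))"
    unfolding star_count_def sum.cartesian_product by (simp add: case_prod_beta, subst sum.cartesian_product', simp)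
  finally show ?thesis by (simp only: S_def)
qed

lemma c2_zigzag:
  assumes h: "3 \<le> h"
  shows "[int (c2 TYPE('F) (completed_zigzag h)) = - int (h * (h + 2))] (mod int CARD('F))"
proof -
  define Z where "Z = num_zeros TYPE('F) (2 * h + 4) (graph_poly (completed_zigzag h))"
  \<comment> \<open>The strip has \<open>h - 1 = k + 2\<close> triangles, whence
    \<open>h * (h + 2) = (k + 3) * (k + 5)\<close>.\<close>
  obtain k where k: "h = k + 3" using h le_Suc_ex[of 3 h] by (auto simp: add.commute)
  have "[int Z = - (q\<^sup>2 * int (h * (h + 2)))] (mod q ^ 3)"
  proof -
    have "[S (Suc (Suc k)) (\<lambda>N :: 'F net. \<Sum>z\<in>UNIV. star_count (strip_close z N)) =
        - ((int CARD('F))\<^sup>2 * int ((k + 3) * (k + 5)))] (mod int CARD('F) ^ 3)"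
      by (rule S_star_count)
    moreover have "h - 1 = Suc (Suc k)" "h * (h + 2) = (k + 3) * (k + 5)" using k by simp_all
    ultimately show ?thesis using num_zeros_zigzag[OF h] by (simp only: Z_def q_def)
  qed
  then obtain t where "int Z - - (q\<^sup>2 * int (h * (h + 2))) = q ^ 3 * t"
    unfolding cong_iff_dvd_diff by (elim dvdE)
  then have "int Z = q\<^sup>2 * (q * t - int (h * (h + 2)))"
    by (simp add: algebra_simps power3_eq_cube power2_eq_square)
  moreover have "q > 0" by (simp add: q_def)
  ultimately have "int Z div q\<^sup>2 = q * t - int (h * (h + 2))" by simp
  then have "int (c2 TYPE('F) (completed_zigzag h)) = (q * t - int (h * (h + 2))) mod q"
    unfolding c2_def length_zigzag Z_def[symmetric] q_def by (simp add: zdiv_int zmod_int)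
  then show ?thesis unfolding q_def[symmetric] by (simp only: cong_mod_left) (simp add: cong_iff_dvd_diff)
qed

end

theorem proposition26:
  fixes h :: nat
  assumes "3 \<le> h" and "h \<le> 8"
  shows "semilinearly_reducible (completed_zigzag h) \<and>
         [int (c2 TYPE('F::{field,finite}) (completed_zigzag h)) = - int (h * (h + 2))]
           (mod int CARD('F))"
  using semilinearly_reducible_zigzag[OF assms(1)] c2_zigzag[OF assms(1)] by (rule conjI)

end
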